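(* Let $n\in\{2,3\}$, let $X^{2n}$ be a compact complex manifold of complex dimension $n$ with complex structure $J$, Kähler form $\omega$ and holomorphic volume form $\Omega$, and put $K=2^{n/3}$. Let $\widetilde\omega_t$, $t\in[0,\infty)$, be the smooth solution of the (rescaled) Kähler–Ricci flow $$\frac{d\widetilde\omega_t}{dt}=-2K\,\mathrm{Ric}(\widetilde\omega_t,J),\qquad\widetilde\omega_0=\omega,$$ on $X^{2n}$, with associated Riemannian metrics $\widetilde h_t$, and let $\Theta_t:X^{2n}\to X^{2n}$ be the family of diffeomorphisms defined by $$\frac{d}{dt}\Theta_t(p)=Y_t(\Theta_t(p)),\quad\Theta_0=\mathrm{id},\qquad Y_t=K\,\nabla_{\widetilde h_t}\big(\log|\Omega|_{\widetilde\omega_t}\big).$$ Then the $G_2$-structures $$\varphi_t=-\Theta_t^*(|\Omega|_{\widetilde\omega_t})\,dr^1\wedge dr^2\wedge dr^3+dr^1\wedge\Theta_t^*(|\Omega|_{\widetilde\omega_t}\widetilde\omega_t)+dr^2\wedge\operatorname{Re}\Big(\Theta_t^*\Big[\tfrac{1}{|\Omega|_{\widetilde\omega_t}}\Omega\Big]\Big)+dr^3\wedge\operatorname{Im}\Big(\Theta_t^*\Big[\tfrac{1}{|\Omega|_{\widetilde\omega_t}}\Omega\Big]\Big)$$ on $M^7=T^3\times X^4$ if $n=2$, and $$\varphi_t=\operatorname{Re}\Big(\Theta_t^*\Big[\tfrac{1}{|\Omega|_{\widetilde\omega_t}}\Omega\Big]\Big)-dr\wedge\Theta_t^*(|\Omega|_{\widetilde\omega_t}\widetilde\omega_t)$$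 on $M^7=S^1\times X^6$ if $n=3$, solve the $G_2$-Laplacian coflow $\frac{d\psi_t}{dt}=\Delta_{d_t}\psi_t$, $\psi_t=\star_t\varphi_t$, for all $t\in[0,\infty)$, with initial data $$\varphi_0=-|\Omega|_\omega dr^1\wedge dr^2\wedge dr^3+dr^1\wedge|\Omega|_\omega\omega+dr^2\wedge\operatorname{Re}\big(\tfrac1{|\Omega|_\omega}\Omega\big)+dr^3\wedge\operatorname{Im}\big(\tfrac1{|\Omega|_\omega}\Omega\big),$$ respectively $\varphi_0=\operatorname{Re}\big(\tfrac1{|\Omega|_\omega}\Omega\big)-dr\wedge|\Omega|_\omega\omega$.
   Context: A holomorphic volume form is a nowhere vanishing holomorphic $(n,0)$-form. In local holomorphic coordinates write $\omega=i\,h_{p\bar q}dz^p\wedge d\bar z^q$ and $\Omega=f\,dz^1\wedge\dots\wedge dz^n$; then $|\Omega|_\omega^2=|f|^2/\det(h_{p\bar q})$ and the Ricci form is $\mathrm{Ric}(\omega,J)=-i\partial\bar\partial\log\det(h_{p\bar q})$. The Riemannian metric $h$ of a Kähler form is given by $\omega(\cdot,\cdot)=h(J\cdot,\cdot)$. $\nabla_h$ is the Riemannian gradient. It is known (Cao) that the Kähler–Ricci flow above has a unique smooth solution for all $t\in[0,\infty)$. $r^1,r^2,r^3$ are the angle coordinates on $T^3$, $r$ is the angle coordinate on $S^1$; forms on the factors are pulled back to $M^7$. A $G_2$-structure on a 7-manifold is a smooth 3-form $\varphi$ that is positive, i.e. $(Y\lrcorner\varphi)\wedge(Y\lrcorner\varphi)\wedge\varphi\neq0$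 for every nonzero tangent vector $Y$. It induces a unique Riemannian metric $g$ and volume form $\mathrm{vol}$ (the Riemannian volume form of $g$, fixing the orientation) by $-\frac16(Y\lrcorner\varphi)\wedge(Z\lrcorner\varphi)\wedge\varphi=g(Y,Z)\,\mathrm{vol}$, hence a Hodge star $\star$ and dual 4-form $\psi=\star\varphi$. $\Delta_{d_t}=dd_t^*+d_t^*d$ is the Hodge Laplacian of the metric induced by $\varphi_t$. *)

theory Defs
  imports "HOL-Analysis.Analysis"
begin

section \<open>Smooth functions and manifolds\<close>

text \<open>
  Derivatives are taken within \<open>S\<close>, so that the definition covers open sets as well as sets such as
  \<open>[0, \<infinity>) \<times> U\<close> with \<open>U\<close> open (one-sided derivatives at time \<open>0\<close>); on both kinds of sets the
  derivative is unique.
\<close>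

primrec Ck_on :: "nat \<Rightarrow> 'a::real_normed_vector set \<Rightarrow> ('a \<Rightarrow> 'b::real_normed_vector) \<Rightarrow> bool" where
  "Ck_on 0 S f = continuous_on S f"
| "Ck_on (Suc k) S f =
     (\<exists>f'. (\<forall>x\<in>S. (f has_derivative f' x) (at x within S)) \<and> (\<forall>v. Ck_on k S (\<lambda>x. f' x v)))"

definition smooth_on :: "'a::real_normed_vector set \<Rightarrow> ('a \<Rightarrow> 'b::real_normed_vector) \<Rightarrow> bool" where
  "smooth_on S f \<longleftrightarrow> (\<forall>k. Ck_on k S f)"

text \<open>A chart is a domain together with a coordinate map, of which only the values on the domain matter.\<close>

type_synonym ('m, 'e) chart = "'m set \<times> ('m \<Rightarrow> 'e)"

definition cdom :: "('m, 'e) chart \<Rightarrow> 'm set" where "cdom c = fst c"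
definition cmap :: "('m, 'e) chart \<Rightarrow> 'm \<Rightarrow> 'e" where "cmap c = snd c"
definition cimg :: "('m, 'e) chart \<Rightarrow> 'e set" where "cimg c = cmap c ` cdom c"
definition cinv :: "('m, 'e) chart \<Rightarrow> 'e \<Rightarrow> 'm" where "cinv c = inv_into (cdom c) (cmap c)"

definition coord_rep :: "('m, 'e) chart \<Rightarrow> ('k, 'f) chart \<Rightarrow> ('m \<Rightarrow> 'k) \<Rightarrow> 'e \<Rightarrow> 'f" where
  "coord_rep c d f = cmap d \<circ> f \<circ> cinv c"

definition transition :: "('m, 'e) chart \<Rightarrow> ('m, 'e) chart \<Rightarrow> 'e \<Rightarrow> 'e" where
  "transition c d = coord_rep c d id"

definition smooth_atlas :: "('m::topological_space, 'e::euclidean_space) chart set \<Rightarrow> bool" where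
  "smooth_atlas A \<longleftrightarrow>
     (\<forall>c\<in>A. open (cdom c) \<and> open (cimg c) \<and> homeomorphism (cdom c) (cimg c) (cmap c) (cinv c)) \<and>
     (\<Union>c\<in>A. cdom c) = UNIV \<and>
     (\<forall>c\<in>A. \<forall>d\<in>A. smooth_on (cmap c ` (cdom c \<inter> cdom d)) (transition c d))"

text \<open>Complex charts take values in \<open>complex^'n\<close>, where \<open>J\<close> is multiplication by \<open>\<i>\<close>; a smooth map is
  holomorphic if its real derivative commutes with \<open>J\<close>.\<close>

definition complex_atlas :: "('m::topological_space, complex^'n) chart set \<Rightarrow> bool" where
  "complex_atlas A \<longleftrightarrow> smooth_atlas A \<and>
     (\<forall>c\<in>A. \<forall>d\<in>A. \<forall>x\<in>cmap c ` (cdom c \<inter> cdom d). \<forall>v.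
        frechet_derivative (transition c d) (at x) (\<i> *s v) =
        \<i> *s frechet_derivative (transition c d) (at x) v)"

definition smooth_map ::
  "('m::topological_space, 'e::euclidean_space) chart set \<Rightarrow>
   ('k::topological_space, 'f::euclidean_space) chart set \<Rightarrow> ('m \<Rightarrow> 'k) \<Rightarrow> bool" where
  "smooth_map A B f \<longleftrightarrow> continuous_on UNIV f \<and>
     (\<forall>c\<in>A. \<forall>d\<in>B. smooth_on (cmap c ` (cdom c \<inter> f -` cdom d)) (coord_rep c d f))"

definition diffeomorphism :: "('m::topological_space, 'e::euclidean_space) chart set \<Rightarrow> ('m \<Rightarrow> 'm) \<Rightarrow> bool" where
  "diffeomorphism A f \<longleftrightarrow> bij f \<and> smooth_map A A f \<and> smooth_map A A (inv f)"

text \<open>Smoothness of \<open>(t, p) \<mapsto> f\<^sub>t(p)\<close> on \<open>[0, \<infinity>) \<times> M\<close>.\<close>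

definition smooth_family :: "('m::topological_space, 'e::euclidean_space) chart set \<Rightarrow> (real \<Rightarrow> 'm \<Rightarrow> 'm) \<Rightarrow> bool" where
  "smooth_family A f \<longleftrightarrow> continuous_on ({0..} \<times> UNIV) (\<lambda>(t, p). f t p) \<and>
     (\<forall>c\<in>A. \<forall>d\<in>A. smooth_on {(t, x). 0 \<le> t \<and> x \<in> cimg c \<and> f t (cinv c x) \<in> cdom d}
                       (\<lambda>(t, x). coord_rep c d (f t) x))"

definition product_atlas ::
  "('m, 'e) chart set \<Rightarrow> ('k, 'f) chart set \<Rightarrow> ('m \<times> 'k, 'e \<times> 'f) chart set" where
  "product_atlas A B = {(cdom c \<times> cdom d, map_prod (cmap c) (cmap d)) | c d. c \<in> A \<and> d \<in> B}"

section \<open>Multilinear algebra\<close>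

text \<open>An alternating \<open>k\<close>-linear form is a function on lists of vectors, extended by \<open>0\<close> to lists whose
  length is not \<open>k\<close>.\<close>

definition alt_form :: "nat \<Rightarrow> ('e::real_vector list \<Rightarrow> 'b::real_vector) \<Rightarrow> bool" where
  "alt_form k \<alpha> \<longleftrightarrow>
     (\<forall>vs. length vs \<noteq> k \<longrightarrow> \<alpha> vs = 0) \<and>
     (\<forall>vs i. length vs = k \<and> i < k \<longrightarrow> linear (\<lambda>u. \<alpha> (vs[i := u]))) \<and>
     (\<forall>vs i j. length vs = k \<and> i < j \<and> j < k \<and> vs ! i = vs ! j \<longrightarrow> \<alpha> vs = 0)"

text \<open>Normalised so that \<open>(\<alpha> \<and> \<beta>)(u, v) = \<alpha>(u) \<beta>(v) - \<alpha>(v) \<beta>(u)\<close> for one-forms.\<close>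

definition wedge :: "nat \<Rightarrow> nat \<Rightarrow> ('e list \<Rightarrow> real) \<Rightarrow> ('e list \<Rightarrow> real) \<Rightarrow> 'e list \<Rightarrow> real" where
  "wedge k l \<alpha> \<beta> vs =
     (if length vs = k + l
      then (\<Sum>\<sigma> | \<sigma> permutes {..<k + l}. of_int (sign \<sigma>) *
              \<alpha> (map (\<lambda>i. vs ! \<sigma> i) [0..<k]) * \<beta> (map (\<lambda>i. vs ! \<sigma> i) [k..<k + l])) / (fact k * fact l)
      else 0)"

definition interior_product :: "'e \<Rightarrow> ('e list \<Rightarrow> real) \<Rightarrow> 'e list \<Rightarrow> real" where
  "interior_product Y \<alpha> = (\<lambda>vs. \<alpha> (Y # vs))"

definition inner_product :: "('e::real_vector \<Rightarrow> 'e \<Rightarrow> real) \<Rightarrow> bool" where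
  "inner_product g \<longleftrightarrow> (\<forall>u v. g u v = g v u) \<and> (\<forall>u. linear (g u)) \<and> (\<forall>u. u \<noteq> 0 \<longrightarrow> g u u > 0)"

definition sharp :: "('e \<Rightarrow> 'e \<Rightarrow> real) \<Rightarrow> ('e \<Rightarrow> real) \<Rightarrow> 'e" where
  "sharp g \<xi> = (THE v. \<forall>w. g v w = \<xi> w)"

text \<open>A top degree form is a Riemannian volume form of \<open>g\<close> (for one of the two orientations) if it is
  \<open>\<plusminus>1\<close> on \<open>g\<close>-orthonormal bases.\<close>

definition volume_form_of :: "('e::euclidean_space \<Rightarrow> 'e \<Rightarrow> real) \<Rightarrow> ('e list \<Rightarrow> real) \<Rightarrow> bool" where
  "volume_form_of g v \<longleftrightarrow> alt_form DIM('e) v \<and>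
     (\<forall>es. length es = DIM('e) \<and>
           (\<forall>i<DIM('e). \<forall>j<DIM('e). g (es ! i) (es ! j) = (if i = j then 1 else 0)) \<longrightarrow> \<bar>v es\<bar> = 1)"

text \<open>The Hodge star of a \<open>k\<close>-form, normalised by \<open>\<alpha> \<and> \<star>\<beta> = \<langle>\<alpha>, \<beta>\<rangle> vol\<close>: in coordinates,
  \<open>(\<star>\<beta>)(vs) = (1/k!) \<Sum> g\<^sup>i\<^sup>1\<^sup>j\<^sup>1 \<dots> g\<^sup>i\<^sup>k\<^sup>j\<^sup>k \<beta>(b\<^sub>i\<^sub>1, \<dots>, b\<^sub>i\<^sub>k) vol(b\<^sub>j\<^sub>1, \<dots>, b\<^sub>j\<^sub>k, vs)\<close>,
  where \<open>sharp g (\<lambda>w. w \<bullet> b\<^sub>i) = \<Sum>\<^sub>j g\<^sup>i\<^sup>j b\<^sub>j\<close>.\<close>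

definition hodge ::
  "nat \<Rightarrow> ('e::euclidean_space \<Rightarrow> 'e \<Rightarrow> real) \<Rightarrow> ('e list \<Rightarrow> real) \<Rightarrow> ('e list \<Rightarrow> real) \<Rightarrow> 'e list \<Rightarrow> real" where
  "hodge k g vol \<beta> vs =
     (if k \<le> DIM('e) \<and> length vs = DIM('e) - k
      then (\<Sum>bs | set bs \<subseteq> Basis \<and> length bs = k.
              \<beta> bs * vol (map (\<lambda>b. sharp g (\<lambda>w. w \<bullet> b)) bs @ vs)) / fact k
      else 0)"

section \<open>Differential forms on an open subset of the model space\<close>

definition ext_deriv :: "nat \<Rightarrow> ('e::euclidean_space \<Rightarrow> 'e list \<Rightarrow> real) \<Rightarrow> 'e \<Rightarrow> 'e list \<Rightarrow> real" where
  "ext_deriv k \<alpha> x vs =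
     (if length vs = Suc k
      then (\<Sum>i\<le>k. (- 1) ^ i * frechet_derivative (\<lambda>y. \<alpha> y (take i vs @ drop (Suc i) vs)) (at x) (vs ! i))
      else 0)"

text \<open>Here \<open>g\<close> and \<open>vol\<close> are a metric and its volume form in coordinates; the codifferential and the Laplacian
  do not depend on the orientation.\<close>

definition codiff ::
  "nat \<Rightarrow> ('e::euclidean_space \<Rightarrow> 'e \<Rightarrow> 'e \<Rightarrow> real) \<Rightarrow> ('e \<Rightarrow> 'e list \<Rightarrow> real) \<Rightarrow>
   ('e \<Rightarrow> 'e list \<Rightarrow> real) \<Rightarrow> 'e \<Rightarrow> 'e list \<Rightarrow> real" where
  "codiff k g vol \<alpha> x vs =
     (- 1) ^ (DIM('e) * (k + 1) + 1) *
     hodge (DIM('e) - k + 1) (g x) (vol x)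
       (ext_deriv (DIM('e) - k) (\<lambda>y. hodge k (g y) (vol y) (\<alpha> y)) x) vs"

definition hodge_laplacian ::
  "nat \<Rightarrow> ('e::euclidean_space \<Rightarrow> 'e \<Rightarrow> 'e \<Rightarrow> real) \<Rightarrow> ('e \<Rightarrow> 'e list \<Rightarrow> real) \<Rightarrow>
   ('e \<Rightarrow> 'e list \<Rightarrow> real) \<Rightarrow> 'e \<Rightarrow> 'e list \<Rightarrow> real" where
  "hodge_laplacian k g vol \<alpha> x vs =
     ext_deriv (k - 1) (codiff k g vol \<alpha>) x vs + codiff (k + 1) g vol (ext_deriv k \<alpha>) x vs"

section \<open>Differential forms on manifolds\<close>

text \<open>A differential form is given by its local representatives: \<open>\<alpha> c x\<close> is the form in the chart \<open>c\<close>
  at the coordinate point \<open>x \<in> cimg c\<close>. The representatives must match under the transition maps.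
  Functions are \<open>0\<close>-forms. Real and complex valued forms are covered by the parameter \<open>'b\<close>.\<close>

type_synonym ('m, 'e, 'b) form = "('m, 'e) chart \<Rightarrow> 'e \<Rightarrow> 'e list \<Rightarrow> 'b"

definition smooth_form ::
  "('m::topological_space, 'e::euclidean_space) chart set \<Rightarrow> nat \<Rightarrow> ('m, 'e, 'b::real_normed_vector) form \<Rightarrow> bool" where
  "smooth_form A k \<alpha> \<longleftrightarrow>
     (\<forall>c\<in>A. (\<forall>x\<in>cimg c. alt_form k (\<alpha> c x)) \<and> (\<forall>vs. smooth_on (cimg c) (\<lambda>x. \<alpha> c x vs))) \<and>
     (\<forall>c\<in>A. \<forall>d\<in>A. \<forall>x\<in>cmap c ` (cdom c \<inter> cdom d). \<forall>vs.
        \<alpha> c x vs = \<alpha> d (transition c d x) (map (frechet_derivative (transition c d) (at x)) vs))"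

definition form_eq :: "('m, 'e) chart set \<Rightarrow> ('m, 'e, 'b) form \<Rightarrow> ('m, 'e, 'b) form \<Rightarrow> bool" where
  "form_eq A \<alpha> \<beta> \<longleftrightarrow> (\<forall>c\<in>A. \<forall>x\<in>cimg c. \<alpha> c x = \<beta> c x)"

text \<open>For a form \<open>\<beta>\<close> on the target, the choice of the chart \<open>d\<close> around \<open>f(p)\<close> is immaterial.\<close>

definition pullback ::
  "('k, 'f) chart set \<Rightarrow> ('m \<Rightarrow> 'k) \<Rightarrow> ('k, 'f::euclidean_space, 'b) form \<Rightarrow> ('m, 'e::euclidean_space, 'b) form" where
  "pullback B f \<beta> c x vs =
     (let d = (SOME d. d \<in> B \<and> f (cinv c x) \<in> cdom d)
      in \<beta> d (coord_rep c d f x) (map (frechet_derivative (coord_rep c d f) (at x)) vs))"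

definition wedge_form ::
  "nat \<Rightarrow> nat \<Rightarrow> ('m, 'e, real) form \<Rightarrow> ('m, 'e, real) form \<Rightarrow> ('m, 'e, real) form" where
  "wedge_form k l \<alpha> \<beta> = (\<lambda>c x. wedge k l (\<alpha> c x) (\<beta> c x))"

definition fun_times :: "('m, 'e, real) form \<Rightarrow> ('m, 'e, 'b::real_vector) form \<Rightarrow> ('m, 'e, 'b) form" where
  "fun_times F \<alpha> = (\<lambda>c x vs. F c x [] *\<^sub>R \<alpha> c x vs)"

definition fun_divide :: "('m, 'e, 'b::real_vector) form \<Rightarrow> ('m, 'e, real) form \<Rightarrow> ('m, 'e, 'b) form" where
  "fun_divide \<alpha> F = (\<lambda>c x vs. (1 / F c x []) *\<^sub>R \<alpha> c x vs)"

definition Re_form :: "('m, 'e, complex) form \<Rightarrow> ('m, 'e, real) form" where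
  "Re_form \<alpha> = (\<lambda>c x vs. Re (\<alpha> c x vs))"

definition Im_form :: "('m, 'e, complex) form \<Rightarrow> ('m, 'e, real) form" where
  "Im_form \<alpha> = (\<lambda>c x vs. Im (\<alpha> c x vs))"

section \<open>Kaehler geometry\<close>

definition kaehler_form :: "('m::topological_space, complex^'n) chart set \<Rightarrow> ('m, complex^'n, real) form \<Rightarrow> bool" where
  "kaehler_form A \<omega> \<longleftrightarrow> smooth_form A 2 \<omega> \<and>
     (\<forall>c\<in>A. \<forall>x\<in>cimg c.
        (\<forall>u v. \<omega> c x [\<i> *s u, \<i> *s v] = \<omega> c x [u, v]) \<and>
        (\<forall>v. v \<noteq> 0 \<longrightarrow> \<omega> c x [v, \<i> *s v] > 0) \<and>
        (\<forall>vs. ext_deriv 2 (\<omega> c) x vs = 0))"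

text \<open>The metric \<open>h\<close> with \<open>\<omega>(u, v) = h(J u, v)\<close>.\<close>

definition kaehler_metric :: "((complex^'n) list \<Rightarrow> real) \<Rightarrow> complex^'n \<Rightarrow> complex^'n \<Rightarrow> real" where
  "kaehler_metric \<sigma> u v = \<sigma> [- (\<i> *s u), v]"

text \<open>The matrix \<open>h\<^sub>p\<^sub>q\<close> with \<open>\<omega> = \<i> \<Sum> h\<^sub>p\<^sub>q dz\<^sup>p \<and> d\<bar>z\<^sup>q\<close>, obtained by evaluating \<open>\<omega>\<close> on
  \<open>\<partial>/\<partial>x\<^sup>p = axis p 1\<close> and \<open>\<partial>/\<partial>y\<^sup>p = axis p \<i>\<close>; see the lemma \<open>herm_matrix\<close> below.\<close>

definition herm_matrix :: "((complex^'n) list \<Rightarrow> real) \<Rightarrow> complex^'n^'n" where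
  "herm_matrix \<sigma> = (\<chi> p q. (of_real (\<sigma> [axis p 1, axis q \<i>]) - \<i> * of_real (\<sigma> [axis p 1, axis q 1])) / 2)"

definition herm_det :: "((complex^'n) list \<Rightarrow> real) \<Rightarrow> real" where
  "herm_det \<sigma> = Re (det (herm_matrix \<sigma>))"

text \<open>The Wirtinger derivatives \<open>\<partial>/\<partial>z\<^sup>p\<close> and \<open>\<partial>/\<partial>\<bar>z\<^sup>p\<close>.\<close>

definition wirtinger :: "'n \<Rightarrow> (complex^'n \<Rightarrow> complex) \<Rightarrow> complex^'n \<Rightarrow> complex" where
  "wirtinger p f x =
     (frechet_derivative f (at x) (axis p 1) - \<i> * frechet_derivative f (at x) (axis p \<i>)) / 2"

definition wirtinger_bar :: "'n \<Rightarrow> (complex^'n \<Rightarrow> complex) \<Rightarrow> complex^'n \<Rightarrow> complex" where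
  "wirtinger_bar p f x =
     (frechet_derivative f (at x) (axis p 1) + \<i> * frechet_derivative f (at x) (axis p \<i>)) / 2"

text \<open>The real two-form \<open>\<i> \<partial>\<bar>\<partial>f = \<i> \<Sum> (\<partial>\<^sup>2f / \<partial>z\<^sup>p \<partial>\<bar>z\<^sup>q) dz\<^sup>p \<and> d\<bar>z\<^sup>q\<close> of a real function.\<close>

definition i_del_delbar :: "(complex^'n \<Rightarrow> real) \<Rightarrow> complex^'n \<Rightarrow> (complex^'n) list \<Rightarrow> real" where
  "i_del_delbar f x vs =
     (if length vs = 2
      then Re (\<i> * (\<Sum>p\<in>UNIV. \<Sum>q\<in>UNIV. wirtinger p (wirtinger_bar q (\<lambda>y. of_real (f y))) x *
             (vs ! 0 $ p * cnj (vs ! 1 $ q) - vs ! 1 $ p * cnj (vs ! 0 $ q))))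
      else 0)"

definition ricci_form :: "('m, complex^'n, real) form \<Rightarrow> ('m, complex^'n, real) form" where
  "ricci_form \<omega> = (\<lambda>c x vs. - i_del_delbar (\<lambda>y. ln (herm_det (\<omega> c y))) x vs)"

text \<open>A form of type \<open>(n, 0)\<close> is one that is complex multilinear.\<close>

definition holomorphic_volume_form ::
  "('m::topological_space, complex^'n) chart set \<Rightarrow> ('m, complex^'n, complex) form \<Rightarrow> bool" where
  "holomorphic_volume_form A \<Omega> \<longleftrightarrow> smooth_form A CARD('n) \<Omega> \<and>
     (\<forall>c\<in>A. \<forall>x\<in>cimg c.
        (\<forall>vs i. length vs = CARD('n) \<and> i < CARD('n) \<longrightarrow>
           \<Omega> c x (vs[i := \<i> *s (vs ! i)]) = \<i> * \<Omega> c x vs) \<and>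
        (\<forall>vs u. frechet_derivative (\<lambda>y. \<Omega> c y vs) (at x) (\<i> *s u) =
                \<i> * frechet_derivative (\<lambda>y. \<Omega> c y vs) (at x) u) \<and>
        (\<exists>vs. \<Omega> c x vs \<noteq> 0))"

text \<open>The coefficient \<open>f = \<Omega>(\<partial>/\<partial>z\<^sup>1, \<dots>, \<partial>/\<partial>z\<^sup>n)\<close> for some ordering of the coordinates,
  which affects only its sign.\<close>

definition vol_coeff :: "((complex^'n) list \<Rightarrow> complex) \<Rightarrow> complex" where
  "vol_coeff \<Upsilon> = \<Upsilon> (map (\<lambda>p. axis p 1) (SOME ps. distinct ps \<and> set ps = (UNIV :: 'n set)))"

definition vol_norm :: "('m, complex^'n, complex) form \<Rightarrow> ('m, complex^'n, real) form \<Rightarrow> ('m, complex^'n, real) form" where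
  "vol_norm \<Omega> \<omega> =
     (\<lambda>c x vs. if vs = [] then sqrt ((cmod (vol_coeff (\<Omega> c x)))\<^sup>2 / herm_det (\<omega> c x)) else 0)"

text \<open>Smooth solutions on \<open>[0, \<infinity>)\<close> of \<open>d\<omega>\<^sub>t/dt = -2 K Ric(\<omega>\<^sub>t, J)\<close>, \<open>\<omega>\<^sub>0 = \<omega>\<close>.\<close>

definition kaehler_ricci_flow ::
  "('m::topological_space, complex^'n) chart set \<Rightarrow> real \<Rightarrow> ('m, complex^'n, real) form \<Rightarrow>
   (real \<Rightarrow> ('m, complex^'n, real) form) \<Rightarrow> bool" where
  "kaehler_ricci_flow A K \<omega> \<omega>t \<longleftrightarrow>
     (\<forall>t\<ge>0. kaehler_form A (\<omega>t t)) \<and>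
     (\<forall>c\<in>A. \<forall>vs. smooth_on ({0..} \<times> cimg c) (\<lambda>(t, x). \<omega>t t c x vs)) \<and>
     form_eq A (\<omega>t 0) \<omega> \<and>
     (\<forall>t\<ge>0. \<forall>c\<in>A. \<forall>x\<in>cimg c. \<forall>vs.
        ((\<lambda>s. \<omega>t s c x vs) has_real_derivative - 2 * K * ricci_form (\<omega>t t) c x vs) (at t within {0..}))"

text \<open>The vector field \<open>Y = K \<nabla>\<^sub>h log |\<Omega>|\<^sub>\<omega>\<close> in a chart.\<close>

definition log_norm_gradient ::
  "real \<Rightarrow> ('m, complex^'n, complex) form \<Rightarrow> ('m, complex^'n, real) form \<Rightarrow>
   ('m, complex^'n) chart \<Rightarrow> complex^'n \<Rightarrow> complex^'n" where
  "log_norm_gradient K \<Omega> \<omega> c x =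
     K *\<^sub>R sharp (kaehler_metric (\<omega> c x)) (frechet_derivative (\<lambda>y. ln (vol_norm \<Omega> \<omega> c y [])) (at x))"

definition gradient_flow ::
  "('m::topological_space, complex^'n) chart set \<Rightarrow> real \<Rightarrow> ('m, complex^'n, complex) form \<Rightarrow>
   (real \<Rightarrow> ('m, complex^'n, real) form) \<Rightarrow> (real \<Rightarrow> 'm \<Rightarrow> 'm) \<Rightarrow> bool" where
  "gradient_flow A K \<Omega> \<omega>t \<Theta> \<longleftrightarrow>
     smooth_family A \<Theta> \<and> (\<forall>t\<ge>0. diffeomorphism A (\<Theta> t)) \<and> \<Theta> 0 = id \<and>
     (\<forall>t\<ge>0. \<forall>p. \<forall>c\<in>A. \<Theta> t p \<in> cdom c \<longrightarrow>
        ((\<lambda>s. cmap c (\<Theta> s p)) has_vector_derivative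
           log_norm_gradient K \<Omega> (\<omega>t t) c (cmap c (\<Theta> t p))) (at t within {0..}))"

section \<open>The circle and the angle coordinate\<close>

typedef circle = "{z :: complex. norm z = 1}"
  by (rule exI[of _ 1]) simp

instantiation circle :: metric_space
begin

definition dist_circle :: "circle \<Rightarrow> circle \<Rightarrow> real" where
  "dist_circle x y = dist (Rep_circle x) (Rep_circle y)"

definition uniformity_circle :: "(circle \<times> circle) filter" where
  "uniformity_circle = (INF e\<in>{0<..}. principal {(x, y). dist x y < e})"

definition open_circle :: "circle set \<Rightarrow> bool" where
  "open_circle U \<longleftrightarrow> (\<forall>x\<in>U. \<forall>\<^sub>F (x', y) in uniformity. x' = x \<longrightarrow> y \<in> U)"

instance
  by standard
     (auto simp: dist_circle_def uniformity_circle_def open_circle_def Rep_circle_inject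
           intro: dist_triangle2)

end

text \<open>The chart with coordinate \<open>r \<in> (a, a + 2\<pi>)\<close> for the point \<open>exp(\<i> r)\<close>.\<close>

definition angle_chart :: "real \<Rightarrow> (circle, real) chart" where
  "angle_chart a = ({z. Rep_circle z \<noteq> cis a},
                    \<lambda>z. THE r. a < r \<and> r < a + 2 * pi \<and> Rep_circle z = cis r)"

definition circle_atlas :: "(circle, real) chart set" where
  "circle_atlas = range angle_chart"

text \<open>The one-form \<open>dr\<close>: every chart of the atlas is a branch of \<open>r\<close>.\<close>

definition dr :: "(circle, real, real) form" where
  "dr = (\<lambda>c x vs. if length vs = 1 then vs ! 0 else 0)"

section \<open>\<open>G\<^sub>2\<close>-structures and the Laplacian coflow\<close>

definition g2_structure :: "('m::topological_space, 'e::euclidean_space) chart set \<Rightarrow> ('m, 'e, real) form \<Rightarrow> bool" where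
  "g2_structure A \<phi> \<longleftrightarrow> DIM('e) = 7 \<and> smooth_form A 3 \<phi> \<and>
     (\<forall>c\<in>A. \<forall>x\<in>cimg c. \<forall>Y. Y \<noteq> 0 \<longrightarrow>
        (\<exists>vs. wedge 4 3 (wedge 2 2 (interior_product Y (\<phi> c x)) (interior_product Y (\<phi> c x))) (\<phi> c x) vs \<noteq> 0))"

definition g2_induces ::
  "('e::euclidean_space list \<Rightarrow> real) \<Rightarrow> ('e \<Rightarrow> 'e \<Rightarrow> real) \<Rightarrow> ('e list \<Rightarrow> real) \<Rightarrow> bool" where
  "g2_induces \<phi> g v \<longleftrightarrow> inner_product g \<and> volume_form_of g v \<and>
     (\<forall>Y Z vs. - (1 / 6) * wedge 4 3 (wedge 2 2 (interior_product Y \<phi>) (interior_product Z \<phi>)) \<phi> vs =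
               g Y Z * v vs)"

definition g2_metric :: "('e::euclidean_space list \<Rightarrow> real) \<Rightarrow> 'e \<Rightarrow> 'e \<Rightarrow> real" where
  "g2_metric \<phi> = (THE g. \<exists>v. g2_induces \<phi> g v)"

definition g2_vol :: "('e::euclidean_space list \<Rightarrow> real) \<Rightarrow> 'e list \<Rightarrow> real" where
  "g2_vol \<phi> = (THE v. \<exists>g. g2_induces \<phi> g v)"

definition g2_dual :: "('m, 'e::euclidean_space, real) form \<Rightarrow> ('m, 'e, real) form" where
  "g2_dual \<phi> = (\<lambda>c x. hodge 3 (g2_metric (\<phi> c x)) (g2_vol (\<phi> c x)) (\<phi> c x))"

definition g2_laplacian ::
  "nat \<Rightarrow> ('m, 'e::euclidean_space, real) form \<Rightarrow> ('m, 'e, real) form \<Rightarrow> ('m, 'e, real) form" where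
  "g2_laplacian k \<phi> \<alpha> =
     (\<lambda>c. hodge_laplacian k (\<lambda>y. g2_metric (\<phi> c y)) (\<lambda>y. g2_vol (\<phi> c y)) (\<alpha> c))"

definition g2_laplacian_coflow ::
  "('m::topological_space, 'e::euclidean_space) chart set \<Rightarrow> (real \<Rightarrow> ('m, 'e, real) form) \<Rightarrow> bool" where
  "g2_laplacian_coflow A \<phi> \<longleftrightarrow>
     (\<forall>t\<ge>0. g2_structure A (\<phi> t)) \<and>
     (\<forall>t\<ge>0. \<forall>c\<in>A. \<forall>x\<in>cimg c. \<forall>vs.
        ((\<lambda>s. g2_dual (\<phi> s) c x vs) has_real_derivative
           g2_laplacian 4 (\<phi> t) (g2_dual (\<phi> t)) c x vs) (at t within {0..}))"

section \<open>The two product manifolds\<close>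

definition T3_times :: "('x, 'e) chart set \<Rightarrow> (circle \<times> circle \<times> circle \<times> 'x, real \<times> real \<times> real \<times> 'e) chart set" where
  "T3_times A = product_atlas circle_atlas (product_atlas circle_atlas (product_atlas circle_atlas A))"

definition S1_times :: "('x, 'e) chart set \<Rightarrow> (circle \<times> 'x, real \<times> 'e) chart set" where
  "S1_times A = product_atlas circle_atlas A"

text \<open>For a function \<open>F\<close>, a real two-form \<open>\<sigma>\<close> and a complex two-form \<open>\<Upsilon>\<close> on \<open>X\<close>:
  \<open>- F dr\<^sup>1 \<and> dr\<^sup>2 \<and> dr\<^sup>3 + dr\<^sup>1 \<and> \<sigma> + dr\<^sup>2 \<and> Re \<Upsilon> + dr\<^sup>3 \<and> Im \<Upsilon>\<close> on \<open>T\<^sup>3 \<times> X\<close>.\<close>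

definition T3_form ::
  "('x, 'e) chart set \<Rightarrow> ('x, 'e::euclidean_space, real) form \<Rightarrow> ('x, 'e, real) form \<Rightarrow> ('x, 'e, complex) form \<Rightarrow>
   (circle \<times> circle \<times> circle \<times> 'x, real \<times> real \<times> real \<times> 'e, real) form" where
  "T3_form A F \<sigma> \<Upsilon> =
     (let dr1 = pullback circle_atlas (\<lambda>(r1, r2, r3, p). r1) dr;
          dr2 = pullback circle_atlas (\<lambda>(r1, r2, r3, p). r2) dr;
          dr3 = pullback circle_atlas (\<lambda>(r1, r2, r3, p). r3) dr;
          pr = (\<lambda>(r1, r2, r3, p). p)
      in (\<lambda>c x vs.
            - fun_times (pullback A pr F) (wedge_form 1 2 dr1 (wedge_form 1 1 dr2 dr3)) c x vs
            + wedge_form 1 2 dr1 (pullback A pr \<sigma>) c x vs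
            + wedge_form 1 2 dr2 (pullback A pr (Re_form \<Upsilon>)) c x vs
            + wedge_form 1 2 dr3 (pullback A pr (Im_form \<Upsilon>)) c x vs))"

text \<open>For a real two-form \<open>\<sigma>\<close> and a complex three-form \<open>\<Upsilon>\<close> on \<open>X\<close>: \<open>Re \<Upsilon> - dr \<and> \<sigma>\<close> on \<open>S\<^sup>1 \<times> X\<close>.\<close>

definition S1_form ::
  "('x, 'e) chart set \<Rightarrow> ('x, 'e::euclidean_space, real) form \<Rightarrow> ('x, 'e, complex) form \<Rightarrow>
   (circle \<times> 'x, real \<times> 'e, real) form" where
  "S1_form A \<sigma> \<Upsilon> =
     (\<lambda>c x vs. pullback A snd (Re_form \<Upsilon>) c x vs
             - wedge_form 1 2 (pullback circle_atlas fst dr) (pullback A snd \<sigma>) c x vs)"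

section \<open>Consistency checks\<close>

lemma alt_form_2:
  assumes "alt_form 2 (\<sigma> :: 'e::real_vector list \<Rightarrow> real)"
  shows "linear (\<lambda>u. \<sigma> [u, v])" "linear (\<lambda>v. \<sigma> [u, v])" "\<sigma> [u, u] = 0"
proof -
  have lin: "\<And>vs i. length vs = 2 \<Longrightarrow> i < 2 \<Longrightarrow> linear (\<lambda>u. \<sigma> (vs[i := u]))"
    and alt: "\<And>vs i j. length vs = 2 \<Longrightarrow> i < j \<Longrightarrow> j < 2 \<Longrightarrow> vs ! i = vs ! j \<Longrightarrow> \<sigma> vs = 0"
    using assms unfolding alt_form_def by blast+
  show "linear (\<lambda>u. \<sigma> [u, v])" using lin[of "[v, v]" 0] by simp
  show "linear (\<lambda>v. \<sigma> [u, v])" using lin[of "[u, u]" 1] by simp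
  show "\<sigma> [u, u] = 0" using alt[of "[u, u]" 0 1] by simp
qed

lemma herm_matrix:
  fixes \<sigma> :: "(complex^'n) list \<Rightarrow> real"
  assumes alt: "alt_form 2 \<sigma>" and J: "\<And>u v. \<sigma> [\<i> *s u, \<i> *s v] = \<sigma> [u, v]"
  shows "of_real (\<sigma> [u, v]) =
         \<i> * (\<Sum>p\<in>UNIV. \<Sum>q\<in>UNIV. herm_matrix \<sigma> $ p $ q * (u $ p * cnj (v $ q) - v $ p * cnj (u $ q)))"
proof -
  define S where "S p q = \<sigma> [axis p 1, axis q 1]" for p q
  define T where "T p q = \<sigma> [axis p 1, axis q \<i>]" for p q
  have l1: "linear (\<lambda>u. \<sigma> [u, v])" and l2: "linear (\<lambda>v. \<sigma> [u, v])" and d: "\<sigma> [u, u] = 0" for u v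
    using alt_form_2[OF alt] by blast+
  have anti: "\<sigma> [u, v] = - \<sigma> [v, u]" for u v
  proof -
    have "\<sigma> [u + v, u + v] = \<sigma> [u, u] + \<sigma> [u, v] + (\<sigma> [v, u] + \<sigma> [v, v])"
      by (simp add: linear_add[OF l1] linear_add[OF l2])
    then show ?thesis by (simp add: d)
  qed
  have ax: "\<i> *s axis p 1 = (axis p \<i> :: complex^'n)" "\<i> *s axis p \<i> = - (axis p 1 :: complex^'n)" for p
    by (auto simp: vec_eq_iff axis_def)
  have neg: "\<sigma> [u, - v] = - \<sigma> [u, v]" for u v by (rule linear_neg[OF l2])
  have s11: "\<sigma> [axis p \<i>, axis q \<i>] = S p q" for p q
    using J[of "axis p 1" "axis q 1"] by (simp add: ax S_def)
  have s10: "\<sigma> [axis p \<i>, axis q 1] = - T p q" for p q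
    using J[of "axis p 1" "axis q \<i>"] by (simp add: ax neg T_def)
  have Ssym: "S q p = - S p q" for p q unfolding S_def by (rule anti)
  have Tsym: "T q p = T p q" for p q
    using s10[of p q] anti[of "axis p \<i>" "axis q 1"] by (simp add: T_def)
  have dec: "u = (\<Sum>p\<in>UNIV. Re (u $ p) *\<^sub>R axis p 1 + Im (u $ p) *\<^sub>R axis p \<i>)" for u :: "complex^'n"
  proof -
    have "(\<Sum>p\<in>UNIV. Re (u $ p) *\<^sub>R axis p 1 + Im (u $ p) *\<^sub>R axis p \<i>) $ q = u $ q" for q
    proof -
      have "(Re (u $ p) *\<^sub>R axis p 1 + Im (u $ p) *\<^sub>R axis p \<i>) $ q = (if p = q then u $ q else 0)" for p
        by (auto simp: axis_def complex_eq_iff)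
      then show ?thesis by (simp add: sum_component)
    qed
    then show ?thesis by (simp add: vec_eq_iff)
  qed
  have e1: "\<sigma> [u, w] = (\<Sum>p\<in>UNIV. Re (u $ p) * \<sigma> [axis p 1, w] + Im (u $ p) * \<sigma> [axis p \<i>, w])" for w
    by (subst dec[of u]) (simp add: linear_sum[OF l1] linear_add[OF l1] linear_cmul[OF l1])
  have e2: "\<sigma> [w, v] = (\<Sum>q\<in>UNIV. Re (v $ q) * \<sigma> [w, axis q 1] + Im (v $ q) * \<sigma> [w, axis q \<i>])" for w
    by (subst dec[of v]) (simp add: linear_sum[OF l2] linear_add[OF l2] linear_cmul[OF l2])
  define z where "z p q = u $ p * cnj (v $ q)" for p q
  have L: "\<sigma> [u, v] = (\<Sum>p\<in>UNIV. \<Sum>q\<in>UNIV. S p q * Re (z p q) - T p q * Im (z p q))"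
    unfolding e1[of v] e2[of "axis _ 1"] e2[of "axis _ \<i>"] s11 s10 S_def[symmetric] T_def[symmetric] z_def
    by (simp add: sum_distrib_left sum.distrib[symmetric] algebra_simps)
  have h: "herm_matrix \<sigma> $ p $ q = (of_real (T p q) - \<i> * of_real (S p q)) / 2" for p q
    by (simp add: herm_matrix_def S_def T_def)
  have "(\<Sum>p\<in>UNIV. \<Sum>q\<in>UNIV. herm_matrix \<sigma> $ p $ q * (v $ p * cnj (u $ q))) =
        (\<Sum>q\<in>UNIV. \<Sum>p\<in>UNIV. herm_matrix \<sigma> $ p $ q * (v $ p * cnj (u $ q)))"
    by (rule sum.swap)
  also have "\<dots> = (\<Sum>p\<in>UNIV. \<Sum>q\<in>UNIV. herm_matrix \<sigma> $ q $ p * cnj (z p q))"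
    by (simp add: z_def mult.commute)
  finally have sw: "(\<Sum>p\<in>UNIV. \<Sum>q\<in>UNIV. herm_matrix \<sigma> $ p $ q * (v $ p * cnj (u $ q))) =
      (\<Sum>p\<in>UNIV. \<Sum>q\<in>UNIV. herm_matrix \<sigma> $ q $ p * cnj (z p q))" .
  have "\<i> * (\<Sum>p\<in>UNIV. \<Sum>q\<in>UNIV. herm_matrix \<sigma> $ p $ q * (u $ p * cnj (v $ q) - v $ p * cnj (u $ q))) =
        \<i> * ((\<Sum>p\<in>UNIV. \<Sum>q\<in>UNIV. herm_matrix \<sigma> $ p $ q * z p q) -
             (\<Sum>p\<in>UNIV. \<Sum>q\<in>UNIV. herm_matrix \<sigma> $ q $ p * cnj (z p q)))"
    unfolding sw[symmetric] by (simp add: z_def right_diff_distrib sum_subtractf)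
  also have "\<dots> = (\<Sum>p\<in>UNIV. \<Sum>q\<in>UNIV. \<i> * (herm_matrix \<sigma> $ p $ q * z p q - herm_matrix \<sigma> $ q $ p * cnj (z p q)))"
    by (simp add: sum_subtractf[symmetric] sum_distrib_left)
  also have "\<dots> = (\<Sum>p\<in>UNIV. \<Sum>q\<in>UNIV. of_real (S p q * Re (z p q) - T p q * Im (z p q)))"
  proof (intro sum.cong refl)
    fix p q
    show "\<i> * (herm_matrix \<sigma> $ p $ q * z p q - herm_matrix \<sigma> $ q $ p * cnj (z p q)) =
          of_real (S p q * Re (z p q) - T p q * Im (z p q))"
      unfolding h Ssym[of q p] Tsym[of q p] by (simp add: complex_eq_iff field_simps Ssym[of q p] Tsym[of q p])
  qed
  also have "\<dots> = of_real (\<sigma> [u, v])" unfolding L by simp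
  finally show ?thesis by simp
qed

end

theory Submission
  imports Defs "HOL-Combinatorics.Multiset_Permutations"
begin

text \<open>
  On the product, \<open>\<phi>\<^sub>t = P / F + F Q\<close>, where \<open>F\<close> is the pullback of \<open>|\<Omega>|\<close> under \<open>\<Theta>\<^sub>t\<close> and \<open>P\<close>, \<open>Q\<close> are closed forms
  built from the pullbacks of \<open>\<omega>\<^sub>t\<close> and \<open>\<Omega>\<close>. The dual form is \<open>\<psi>\<^sub>t = A + B\<close> with \<open>A\<close>, \<open>B\<close> closed and free of \<open>F\<close>:
  \<open>A\<close> is linear in \<open>\<Omega>\<close>, while \<open>B\<close> is built from \<open>\<omega>\<^sub>t\<close> alone. In an adapted orthonormal frame one finds
  \<open>\<Delta> \<psi>\<^sub>t = d (Y \<lrcorner> (A - B))\<close>, where \<open>Y\<close> is the gradient of \<open>log F\<close>. This is the velocity of the flow: the pullback of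
  the closed form \<open>\<Omega>\<close> changes by its Lie derivative \<open>d (Y \<lrcorner> \<Omega>)\<close>, and so does that of \<open>\<omega>\<^sub>t\<close>, except that the
  Kaehler--Ricci flow adds \<open>- 2 K Ric = - 2 d (Y \<lrcorner> \<omega>\<^sub>t)\<close>, which reverses the sign.
\<close>

text \<open>The constant K is forced by the frame. On a frame that is unitary for the Kaehler metric
  h, \<Omega> has modulus |\<Omega>| / 2^(n/2). For n = 3 the model needs \<Omega> / F to take the
  value 1, so the frame is stretched by k with k^3 = 2^(3/2), and K = k^2 = 2. For n = 2 the three
  torus vectors have free lengths a1, a2, a3; the terms of the three-form require a1 F k^2 = 1, a2
  k^2 = a3 k^2 = 2 and F a1 a2 a3 = 1, hence k^3 = 2 and again K = k^2. As the stretched frame is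
  orthonormal for the induced metric, that metric restricts to h / K on X, and the gradient of log F
  is K times the gradient for h: this is the K in the vector field Y.

  The obstacle is the initial time, where only one-sided derivatives exist. The flow is therefore
  treated as a single map on a half-space of space-time. Its second derivatives are still symmetric
  there, so pullback commutes with d, and the time component of that identity is Cartan's formula.
  The induced metric, given by a definite description, is reached only through frames, where every
  star is a finite table of signs.\<close>

abbreviation (input) fd :: "('a::real_normed_vector \<Rightarrow> 'b::real_normed_vector) \<Rightarrow> 'a \<Rightarrow> 'a \<Rightarrow> 'b" where
  "fd f x \<equiv> frechet_derivative f (at x)"

section \<open>Alternating forms as functions on lists: slots, swaps, basic constructions\<close>

lemma alt_form_linear:
  assumes "alt_form k \<alpha>" "length vs = k" "i < k"
  shows "linear (\<lambda>u. \<alpha> (vs[i := u]))"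
  using assms unfolding alt_form_def by blast

lemma alt_form_length: "alt_form k \<alpha> \<Longrightarrow> length vs \<noteq> k \<Longrightarrow> \<alpha> vs = 0"
  unfolding alt_form_def by blast

lemma alt_form_eq_0:
  "alt_form k \<alpha> \<Longrightarrow> i < j \<Longrightarrow> j < length vs \<Longrightarrow> vs ! i = vs ! j \<Longrightarrow> \<alpha> vs = 0"
  unfolding alt_form_def by metis

lemma alt_form_linear_mid:
  assumes "alt_form k \<alpha>" "length xs + length ys + 1 = k"
  shows "linear (\<lambda>u. \<alpha> (xs @ u # ys))"
  using alt_form_linear[OF assms(1), of "xs @ 0 # ys" "length xs"] assms(2) by simp

lemma alt_form_linear_hd: "alt_form k \<alpha> \<Longrightarrow> Suc (length ys) = k \<Longrightarrow> linear (\<lambda>u. \<alpha> (u # ys))"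
  using alt_form_linear_mid[of k \<alpha> "[]" ys] by simp

lemma alt_form_swap:
  assumes a: "alt_form k \<alpha>"
  shows "\<alpha> (xs @ a # b # ys) = - \<alpha> (xs @ b # a # ys)"
proof (cases "length xs + length ys + 2 = k")
  case True
  have l1: "linear (\<lambda>u. \<alpha> (xs @ u # v # ys))" for v
    using alt_form_linear_mid[OF a, of xs "v # ys"] True by simp
  have l2: "linear (\<lambda>v. \<alpha> (xs @ u # v # ys))" for u
    using alt_form_linear_mid[OF a, of "xs @ [u]" ys] True by simp
  have d: "\<alpha> (xs @ u # u # ys) = 0" for u
    by (rule alt_form_eq_0[OF a, of "length xs" "Suc (length xs)"]) (auto simp: nth_append)
  have "0 = \<alpha> (xs @ (a + b) # (a + b) # ys)" by (simp add: d)
  also have "\<dots> = \<alpha> (xs @ a # a # ys) + \<alpha> (xs @ a # b # ys) + (\<alpha> (xs @ b # a # ys) + \<alpha> (xs @ b # b # ys))"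
    by (simp add: linear_add[OF l1] linear_add[OF l2])
  finally show ?thesis by (simp add: d eq_neg_iff_add_eq_0)
qed (auto simp: alt_form_length[OF a])

lemma alt_form_front:
  assumes a: "alt_form k \<alpha>"
  shows "\<alpha> (xs @ a # ys) = (- 1) ^ length xs *\<^sub>R \<alpha> (a # xs @ ys)"
proof (induction xs arbitrary: ys rule: rev_induct)
  case (snoc x xs)
  have "\<alpha> ((xs @ [x]) @ a # ys) = - \<alpha> (xs @ a # x # ys)"
    using alt_form_swap[OF a, of xs x a ys] by simp
  also have "\<dots> = - ((- 1) ^ length xs *\<^sub>R \<alpha> (a # xs @ x # ys))" by (subst snoc.IH) simp
  finally show ?case by simp
qed simp

lemma alt_form_Cons:
  assumes a: "alt_form (Suc k) \<alpha>"
  shows "alt_form k (\<lambda>vs. \<alpha> (v # vs))"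
  unfolding alt_form_def
proof (intro conjI allI impI)
  fix vs :: "'a list" and i assume "length vs = k \<and> i < k"
  then show "linear (\<lambda>u. \<alpha> (v # vs[i := u]))"
    using alt_form_linear[OF a, of "v # vs" "Suc i"] by simp
next
  fix vs :: "'a list" and i j assume "length vs = k \<and> i < j \<and> j < k \<and> vs ! i = vs ! j"
  then show "\<alpha> (v # vs) = 0"
    by (intro alt_form_eq_0[OF a, of "Suc i" "Suc j"]) auto
qed (use alt_form_length[OF a] in auto)

lemma alt_form_append:
  assumes a: "alt_form k \<alpha>" "k = l + length ws"
  shows "alt_form l (\<lambda>vs. \<alpha> (vs @ ws))"
  unfolding alt_form_def
proof (intro conjI allI impI)
  fix vs :: "'a list" and i assume "length vs = l \<and> i < l"
  then show "linear (\<lambda>u. \<alpha> (vs[i := u] @ ws))"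
    using alt_form_linear[OF a(1), of "vs @ ws" "i"] a(2) by (simp add: list_update_append)
next
  fix vs :: "'a list" and i j assume "length vs = l \<and> i < j \<and> j < l \<and> vs ! i = vs ! j"
  then show "\<alpha> (vs @ ws) = 0"
    by (intro alt_form_eq_0[OF a(1), of "i" "j"]) (auto simp: nth_append)
qed (use alt_form_length[OF a(1)] a(2) in auto)

lemma alt_form_interior_product: "alt_form (Suc k) \<alpha> \<Longrightarrow> alt_form k (interior_product Y \<alpha>)"
  unfolding interior_product_def by (rule alt_form_Cons)

lemma alt_form_add: "alt_form k \<alpha> \<Longrightarrow> alt_form k \<beta> \<Longrightarrow> alt_form k (\<lambda>vs. \<alpha> vs + \<beta> vs)"
  unfolding alt_form_def by (auto intro: linear_compose_add)

lemma alt_form_scaleR: "alt_form k \<alpha> \<Longrightarrow> alt_form k (\<lambda>vs. c *\<^sub>R \<alpha> vs)"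
  unfolding alt_form_def by (auto intro: linear_compose_scale_right)

lemma alt_form_mult: "alt_form k \<alpha> \<Longrightarrow> alt_form k (\<lambda>vs. c * \<alpha> vs :: real)"
  using alt_form_scaleR[of k \<alpha> c] by simp

lemma alt_form_diff: "alt_form k \<alpha> \<Longrightarrow> alt_form k \<beta> \<Longrightarrow> alt_form k (\<lambda>vs. \<alpha> vs - \<beta> vs)"
  using alt_form_add[of k \<alpha> "\<lambda>vs. (-1) *\<^sub>R \<beta> vs"] alt_form_scaleR[of k \<beta> "-1"] by simp

lemma alt_form_uminus: "alt_form k \<alpha> \<Longrightarrow> alt_form k (\<lambda>vs. - \<alpha> vs)"
  using alt_form_scaleR[of k \<alpha> "-1"] by simp

lemma alt_form_compose:
  assumes a: "alt_form k \<alpha>" and L: "linear L"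
  shows "alt_form k (\<lambda>vs. \<alpha> (map L vs))"
  unfolding alt_form_def
proof (intro conjI allI impI)
  fix vs :: "'c list" and i assume "length vs = k \<and> i < k"
  then show "linear (\<lambda>u. \<alpha> (map L (vs[i := u])))"
    using linear_compose[OF L alt_form_linear[OF a, of "map L vs" "i"]] by (simp add: map_update o_def)
next
  fix vs :: "'c list" and i j assume "length vs = k \<and> i < j \<and> j < k \<and> vs ! i = vs ! j"
  then show "\<alpha> (map L vs) = 0"
    by (intro alt_form_eq_0[OF a, of "i" "j"]) auto
qed (use alt_form_length[OF a] in auto)

lemma alt_form_linear_comp:
  assumes a: "alt_form k \<alpha>" and L: "linear L"
  shows "alt_form k (\<lambda>vs. L (\<alpha> vs))"
  unfolding alt_form_def
proof (intro conjI allI impI)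
  fix vs :: "'a list" and i assume "length vs = k \<and> i < k"
  then show "linear (\<lambda>u. L (\<alpha> (vs[i := u])))"
    using linear_compose[OF alt_form_linear[OF a, of vs i] L] by (simp add: o_def)
qed (use alt_form_length[OF a] alt_form_eq_0[OF a] linear_0[OF L] in auto)

section \<open>Sorting the arguments of an alternating form\<close>

text \<open>Its parity is the sign of the permutation that sorts the list; this recursive count can
  be evaluated on concrete index lists.\<close>

primrec inversions :: "nat list \<Rightarrow> nat" where
  "inversions [] = 0"
| "inversions (x # xs) = length (filter (\<lambda>y. y < x) xs) + inversions xs"

text \<open>Each smaller entry that \<open>x\<close> has to pass costs one swap. The prefix grows
  during the induction; the suffix stays untouched, so that a block inside a longer argument list
  can be sorted.\<close>

lemma alt_form_insort:
  assumes a: "alt_form k \<alpha>" and "sorted ys"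
  shows "\<alpha> (map f (pre @ x # ys @ suf)) =
         (- 1) ^ length (filter (\<lambda>y. y < x) ys) *\<^sub>R \<alpha> (map f (pre @ insort x ys @ suf))"
  using assms(2)
proof (induction ys arbitrary: pre)
  case (Cons y ys)
  show ?case
  proof (cases "x \<le> y")
    case True
    then have "filter (\<lambda>z. z < x) (y # ys) = []" using Cons.prems by (auto simp: filter_empty_conv)
    with True show ?thesis by simp
  next
    case False
    have "\<alpha> (map f (pre @ x # (y # ys) @ suf)) = - \<alpha> (map f ((pre @ [y]) @ x # ys @ suf))"
      using alt_form_swap[OF a, of "map f pre" "f x" "f y" "map f (ys @ suf)"] by simp
    also have "\<dots> = - ((- 1) ^ length (filter (\<lambda>y. y < x) ys) *\<^sub>R \<alpha> (map f ((pre @ [y]) @ insort x ys @ suf)))"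
      by (subst Cons.IH) (use Cons.prems in auto)
    finally show ?thesis using False by auto
  qed
qed simp

lemma alt_form_sort:
  assumes a: "alt_form k \<alpha>"
  shows "\<alpha> (map f (pre @ xs @ suf)) = (- 1) ^ inversions xs *\<^sub>R \<alpha> (map f (pre @ sort xs @ suf))"
proof (induction xs arbitrary: pre)
  case (Cons x xs)
  have m: "length (filter (\<lambda>y. y < x) (sort xs)) = length (filter (\<lambda>y. y < x) xs)"
    by (metis mset_filter mset_sort size_mset)
  have "\<alpha> (map f (pre @ (x # xs) @ suf)) = \<alpha> (map f ((pre @ [x]) @ xs @ suf))" by simp
  also have "\<dots> = (- 1) ^ inversions xs *\<^sub>R \<alpha> (map f (pre @ x # sort xs @ suf))"
    by (subst Cons.IH) simp
  also have "\<alpha> (map f (pre @ x # sort xs @ suf)) =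
      (- 1) ^ length (filter (\<lambda>y. y < x) (sort xs)) *\<^sub>R \<alpha> (map f (pre @ insort x (sort xs) @ suf))"
    by (rule alt_form_insort[OF a]) simp
  finally show ?case by (simp add: m power_add mult.commute)
qed simp

section \<open>The wedge product\<close>

text \<open>The numerator of \<open>wedge\<close> for an arbitrary function of lists. Without the
  factorials and the split into two factors it can be expanded by the slot that the first vector
  occupies.\<close>

definition alternate :: "nat \<Rightarrow> ('e list \<Rightarrow> real) \<Rightarrow> 'e list \<Rightarrow> real" where
  "alternate n G vs = (\<Sum>\<sigma> | \<sigma> permutes {..<n}. of_int (sign \<sigma>) * G (map (\<lambda>i. vs ! \<sigma> i) [0..<n]))"

lemma wedge_alternate:
  "wedge k l \<alpha> \<beta> vs = (if length vs = k + l
     then alternate (k + l) (\<lambda>ws. \<alpha> (take k ws) * \<beta> (drop k ws)) vs / (fact k * fact l) else 0)"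
proof -
  have "take k (map f [0..<k+l]) = map f [0..<k]" "drop k (map f [0..<k+l]) = map f [k..<k+l]"
    for f :: "nat \<Rightarrow> 'a" by (simp_all add: take_map drop_map)
  then show ?thesis unfolding wedge_def alternate_def by (simp add: mult.assoc)
qed

text \<open>Every permutation of n + 1 points is uniquely \<open>lift_perm q \<circ> cyc j\<close>:
  here \<open>j\<close> is the point sent to 0, and \<open>q\<close> acts on the remaining
  points.\<close>

definition cyc :: "nat \<Rightarrow> nat \<Rightarrow> nat" where
  "cyc j i = (if i < j then Suc i else if i = j then 0 else i)"

definition lift_perm :: "(nat \<Rightarrow> nat) \<Rightarrow> nat \<Rightarrow> nat" where
  "lift_perm q i = (case i of 0 \<Rightarrow> 0 | Suc m \<Rightarrow> Suc (q m))"

lemma lift_perm_simps: "lift_perm q 0 = 0" "lift_perm q (Suc m) = Suc (q m)"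
  by (simp_all add: lift_perm_def)

lemma linear_cmult: "linear f \<Longrightarrow> linear (\<lambda>x. c * f x :: real)"
  using linear_compose_scale_right[of f c] by simp

lemma cyc_Suc: "cyc (Suc j) = cyc j \<circ> Transposition.transpose j (Suc j)"
  by (auto simp: fun_eq_iff cyc_def Transposition.transpose_def)

lemma cyc_permutes: "j \<le> n \<Longrightarrow> cyc j permutes {..<Suc n} \<and> sign (cyc j) = (- 1) ^ j"
proof (induction j)
  case 0
  have "cyc 0 = id" by (auto simp: cyc_def)
  then show ?case using permutes_id[of "{..<Suc n}"] by (simp del: id_apply)
next
  case (Suc j)
  have t: "Transposition.transpose j (Suc j) permutes {..<Suc n}" using Suc.prems by (intro permutes_swap_id) auto
  have c: "cyc j permutes {..<Suc n}" "sign (cyc j) = (- 1) ^ j" using Suc by auto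
  have "sign (cyc j \<circ> Transposition.transpose j (Suc j)) = sign (cyc j) * sign (Transposition.transpose j (Suc j))"
    by (rule sign_compose) (use c t in \<open>auto intro: permutes_imp_permutation[OF finite_lessThan]\<close>)
  then show ?case unfolding cyc_Suc
    by (intro conjI permutes_compose[OF t c(1)]) (simp only: c(2) sign_swap_id power_Suc2, simp)
qed

lemma lift_perm_permutes:
  assumes "q permutes {..<n}"
  shows "lift_perm q permutes {..<Suc n}"
proof (rule bij_imp_permutes)
  have inj: "inj q" using permutes_inj[OF assms] .
  have "inj (lift_perm q)"
  proof (rule injI)
    fix x y assume "lift_perm q x = lift_perm q y"
    then show "x = y" by (cases x; cases y) (auto simp: lift_perm_simps inj_eq[OF inj])
  qed
  moreover have "lift_perm q ` {..<Suc n} \<subseteq> {..<Suc n}"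
  proof (intro image_subsetI)
    fix x assume "x \<in> {..<Suc n}"
    then show "lift_perm q x \<in> {..<Suc n}"
      using permutes_in_image[OF assms, of "x - 1"] by (cases x) (simp_all add: lift_perm_simps)
  qed
  ultimately show "bij_betw (lift_perm q) {..<Suc n} {..<Suc n}"
    by (metis bij_betw_def endo_inj_surj finite_lessThan inj_on_subset subset_UNIV)
  show "lift_perm q x = x" if "x \<notin> {..<Suc n}" for x
    using that permutes_not_in[OF assms] by (auto simp: lift_perm_def split: nat.splits)
qed

lemma sign_lift_perm:
  assumes "q permutes {..<n}"
  shows "sign (lift_perm q) = sign q"
  using assms finite_lessThan[of n]
proof (induction rule: permutes_induct)
  case id
  have "lift_perm id = id" by (auto simp: lift_perm_def split: nat.splits)
  then show ?case by (simp only:)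
next
  case (swap a b p)
  have e: "lift_perm (Transposition.transpose a b \<circ> p) = Transposition.transpose (Suc a) (Suc b) \<circ> lift_perm p"
    by (auto simp: fun_eq_iff lift_perm_def Transposition.transpose_def split: nat.splits)
  have "permutation p" "permutation (lift_perm p)"
    using swap lift_perm_permutes[of p n] by (auto intro: permutes_imp_permutation[OF finite_lessThan])
  then have "sign (Transposition.transpose (Suc a) (Suc b) \<circ> lift_perm p) = - sign (lift_perm p)"
    "sign (Transposition.transpose a b \<circ> p) = - sign p"
    using swap(3) by (simp_all only: sign_compose permutation_swap_id sign_swap_id) auto
  then show ?case unfolding e using swap by (simp only:)
qed

text \<open>The permutations are grouped by the slot \<open>j\<close> that receives
  \<open>v\<close>. Moving \<open>v\<close> there is the cycle \<open>cyc j\<close> of sign (-1)^j,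
  and \<open>q\<close> permutes the other vectors.\<close>

lemma alternate_Cons:
  "alternate (Suc n) G (v # vs) =
     (\<Sum>j\<le>n. (- 1) ^ j * alternate n (\<lambda>ws. G (take j ws @ v # drop j ws)) vs)"
proof -
  let ?h = "\<lambda>\<sigma>. of_int (sign \<sigma>) * G (map (\<lambda>i. (v # vs) ! \<sigma> i) [0..<Suc n])"
  have perm: "lift_perm q \<circ> cyc j permutes {..<Suc n}" "sign (lift_perm q \<circ> cyc j) = (- 1) ^ j * sign q"
    if "j \<le> n" "q permutes {..<n}" for j q
    using that cyc_permutes[OF that(1)] lift_perm_permutes[OF that(2)] sign_lift_perm[OF that(2)]
      sign_compose[of "lift_perm q" "cyc j"] permutes_imp_permutation[OF finite_lessThan]
    by (auto intro: permutes_compose simp: mult.commute)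
  have ls: "map (\<lambda>i. (v # vs) ! (lift_perm q \<circ> cyc j) i) [0..<Suc n] =
     take j (map (\<lambda>i. vs ! q i) [0..<n]) @ v # drop j (map (\<lambda>i. vs ! q i) [0..<n])" if "j \<le> n" for j q
    by (rule nth_equalityI)
       (use that in \<open>auto simp: cyc_def lift_perm_def nth_append min_def nth_Cons' split: nat.splits simp del: upt_Suc\<close>)
  define S where "S = {..n} \<times> {q. q permutes {..<n}}"
  have inj: "inj_on (\<lambda>(j, q). lift_perm q \<circ> cyc j) S"
  proof (rule inj_onI, clarsimp simp: S_def)
    fix j q j' q'
    assume *: "j \<le> n" "q permutes {..<n}" "j' \<le> n" "q' permutes {..<n}"
      and e: "lift_perm q \<circ> cyc j = lift_perm q' \<circ> cyc j'"
    have "(lift_perm q \<circ> cyc j) j = 0" by (simp add: cyc_def lift_perm_def)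
    then have "(lift_perm q' \<circ> cyc j') j = 0" using e by simp
    then have jj: "j = j'" by (auto simp: cyc_def lift_perm_def split: if_splits nat.splits)
    have "surj (cyc j)" using cyc_permutes[OF *(1)] permutes_surj by blast
    then have "lift_perm q = lift_perm q'" using e unfolding jj
      by (metis fun.inj_map_strong surj_iff o_assoc o_id)
    then have "q m = q' m" for m
      by (metis lift_perm_simps(2) nat.inject)
    then show "j = j' \<and> q = q'" using jj by auto
  qed
  \<comment> \<open>Injectivity together with (n + 1) * n! = (n + 1)! gives surjectivity onto the
    permutations.\<close>
  have "card ((\<lambda>(j, q). lift_perm q \<circ> cyc j) ` S) = card {\<sigma>. \<sigma> permutes {..<Suc n}}"
    unfolding card_image[OF inj] by (simp add: S_def card_cartesian_product card_permutations)
  then have im: "(\<lambda>(j, q). lift_perm q \<circ> cyc j) ` S = {\<sigma>. \<sigma> permutes {..<Suc n}}"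
    by (intro card_subset_eq) (auto simp: S_def finite_permutations intro!: perm(1))
  have "alternate (Suc n) G (v # vs) = sum ?h {\<sigma>. \<sigma> permutes {..<Suc n}}"
    unfolding alternate_def ..
  also have "\<dots> = (\<Sum>(j, q)\<in>S. ?h (lift_perm q \<circ> cyc j))"
    unfolding im[symmetric] by (subst sum.reindex[OF inj]) (simp add: o_def case_prod_beta)
  also have "\<dots> = (\<Sum>(j, q)\<in>S. (- 1) ^ j * (of_int (sign q) *
       G (take j (map (\<lambda>i. vs ! q i) [0..<n]) @ v # drop j (map (\<lambda>i. vs ! q i) [0..<n]))))"
    by (intro sum.cong refl) (clarsimp simp: S_def perm ls simp del: upt_Suc comp_apply cong del: sign_on_cong)
  also have "\<dots> = (\<Sum>j\<le>n. (- 1) ^ j * alternate n (\<lambda>ws. G (take j ws @ v # drop j ws)) vs)"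
    unfolding S_def alternate_def sum_distrib_left by (rule sum.cartesian_product[symmetric])
  finally show ?thesis .
qed

lemma alternate_cong:
  "(\<And>ws. length ws = n \<Longrightarrow> G ws = H ws) \<Longrightarrow> alternate n G vs = alternate n H vs"
  unfolding alternate_def by (intro sum.cong refl) simp

lemma alternate_mult: "alternate n (\<lambda>ws. c * G ws) vs = c * alternate n G vs"
  unfolding alternate_def sum_distrib_left by (intro sum.cong refl) simp

text \<open>All n + 1 slots for the first vector contribute equally: the sign of the slot cancels
  the sign of moving the vector back to the front.\<close>

lemma alternate_alt_form:
  "alt_form n \<alpha> \<Longrightarrow> length vs = n \<Longrightarrow> alternate n \<alpha> vs = fact n * \<alpha> vs"
proof (induction n arbitrary: \<alpha> vs)
  case 0
  have "{\<sigma> :: nat \<Rightarrow> nat. \<sigma> permutes {..<0}} = {id}" by auto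
  with 0 show ?case by (simp add: alternate_def)
next
  case (Suc n)
  then obtain w ws where vs: "vs = w # ws" and l: "length ws = n" by (metis length_Suc_conv)
  have "alternate (Suc n) \<alpha> vs = (\<Sum>j\<le>n. (- 1) ^ j * alternate n (\<lambda>us. \<alpha> (take j us @ w # drop j us)) ws)"
    unfolding vs by (rule alternate_Cons)
  also have "\<dots> = (\<Sum>j\<le>n. (- 1) ^ j * ((- 1) ^ j * alternate n (\<lambda>us. \<alpha> (w # us)) ws))"
    unfolding alternate_mult[symmetric]
    by (intro sum.cong refl arg_cong2[where f = times] alternate_cong)
       (subst alt_form_front[OF Suc.prems(1)], auto simp: min_def)
  also have "\<dots> = (\<Sum>j\<le>n. fact n * \<alpha> (w # ws))"
    using Suc.IH[OF alt_form_Cons[OF Suc.prems(1)] l]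
    by (intro sum.cong refl) (simp flip: mult.assoc power_mult_distrib)
  finally show ?case by (simp add: vs)
qed

lemma wedge_0_left: "alt_form l \<beta> \<Longrightarrow> wedge 0 l \<alpha> \<beta> vs = \<alpha> [] * \<beta> vs"
  by (auto simp: wedge_alternate alternate_mult alternate_alt_form alt_form_length)

lemma wedge_0_right:
  assumes "alt_form k \<alpha>" shows "wedge k 0 \<alpha> \<beta> vs = \<alpha> vs * \<beta> []"
proof (cases "length vs = k")
  case True
  have "alternate k (\<lambda>ws. \<alpha> (take k ws) * \<beta> (drop k ws)) vs = alternate k (\<lambda>ws. \<beta> [] * \<alpha> ws) vs"
    by (rule alternate_cong) simp
  with True show ?thesis by (simp add: wedge_alternate alternate_mult alternate_alt_form[OF assms])
qed (simp add: wedge_alternate alt_form_length[OF assms])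

text \<open>Contraction is an antiderivation. In the expansion by the slot of \<open>v\<close>, the
  k + 1 slots of the first factor all give \<open>A1\<close>, and the l + 1 slots of the second all
  give \<open>A2\<close> with the sign of passing the first factor. The multiplicities k + 1 and l +
  1 turn one factorial of the normalisation into the next lower one.\<close>

lemma wedge_Cons:
  assumes a: "alt_form (Suc k) \<alpha>" and b: "alt_form (Suc l) \<beta>"
  shows "wedge (Suc k) (Suc l) \<alpha> \<beta> (v # vs) =
     wedge k (Suc l) (\<lambda>ws. \<alpha> (v # ws)) \<beta> vs + (- 1) ^ Suc k * wedge (Suc k) l \<alpha> (\<lambda>ws. \<beta> (v # ws)) vs"
proof (cases "length vs = Suc (k + l)")
  case True
  let ?n = "Suc (k + l)"
  define A1 where "A1 = alternate ?n (\<lambda>ws. \<alpha> (v # take k ws) * \<beta> (drop k ws)) vs"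
  define A2 where "A2 = alternate ?n (\<lambda>ws. \<alpha> (take (Suc k) ws) * \<beta> (v # drop (Suc k) ws)) vs"
  have eq1: "(- 1) ^ j * alternate ?n (\<lambda>ws. \<alpha> (take (Suc k) (take j ws @ v # drop j ws)) *
      \<beta> (drop (Suc k) (take j ws @ v # drop j ws))) vs = A1" if "j \<le> k" for j
  proof -
    have "\<alpha> (take (Suc k) (take j ws @ v # drop j ws)) * \<beta> (drop (Suc k) (take j ws @ v # drop j ws)) =
          (- 1) ^ j * (\<alpha> (v # take k ws) * \<beta> (drop k ws))" if "length ws = ?n" for ws
    proof -
      have 1: "take (Suc k) (take j ws @ v # drop j ws) = take j ws @ v # take (k - j) (drop j ws)"
        using \<open>j \<le> k\<close> that by (simp add: min_def Suc_diff_le)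
      have 2: "drop (Suc k) (take j ws @ v # drop j ws) = drop k ws"
        using \<open>j \<le> k\<close> that by (simp add: min_def Suc_diff_le)
      have 3: "take j ws @ take (k - j) (drop j ws) = take k ws"
        using \<open>j \<le> k\<close> by (metis le_add_diff_inverse take_add)
      show ?thesis unfolding 1 2 by (subst alt_form_front[OF a]) (use \<open>j \<le> k\<close> that 3 in \<open>simp add: min_def\<close>)
    qed
    then have "alternate ?n (\<lambda>ws. \<alpha> (take (Suc k) (take j ws @ v # drop j ws)) *
      \<beta> (drop (Suc k) (take j ws @ v # drop j ws))) vs = (- 1) ^ j * A1"
      unfolding A1_def alternate_mult[symmetric] by (rule alternate_cong)
    then show ?thesis by (simp flip: mult.assoc power_mult_distrib)
  qed
  have eq2: "(- 1) ^ j * alternate ?n (\<lambda>ws. \<alpha> (take (Suc k) (take j ws @ v # drop j ws)) *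
      \<beta> (drop (Suc k) (take j ws @ v # drop j ws))) vs = (- 1) ^ Suc k * A2" if "k < j" "j \<le> ?n" for j
  proof -
    obtain i where i: "j = Suc k + i" using \<open>k < j\<close> by (metis less_iff_Suc_add add_Suc)
    have "\<alpha> (take (Suc k) (take j ws @ v # drop j ws)) * \<beta> (drop (Suc k) (take j ws @ v # drop j ws)) =
          (- 1) ^ i * (\<alpha> (take (Suc k) ws) * \<beta> (v # drop (Suc k) ws))" if "length ws = ?n" for ws
    proof -
      have 1: "take (Suc k) (take j ws @ v # drop j ws) = take (Suc k) ws"
        using i that \<open>j \<le> ?n\<close> by (simp add: min_def)
      have 2: "drop (Suc k) (take j ws @ v # drop j ws) = take i (drop (Suc k) ws) @ v # drop i (drop (Suc k) ws)"
        using i that \<open>j \<le> ?n\<close> by (simp add: min_def drop_take add.commute)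
      show ?thesis unfolding 1 2 by (subst alt_form_front[OF b]) (use i that \<open>j \<le> ?n\<close> in \<open>simp add: min_def del: drop_drop\<close>)
    qed
    then have "alternate ?n (\<lambda>ws. \<alpha> (take (Suc k) (take j ws @ v # drop j ws)) *
      \<beta> (drop (Suc k) (take j ws @ v # drop j ws))) vs = (- 1) ^ i * A2"
      unfolding A2_def alternate_mult[symmetric] by (rule alternate_cong)
    then show ?thesis by (simp add: i power_add flip: mult.assoc power_mult_distrib)
  qed
  have "alternate (Suc ?n) (\<lambda>ws. \<alpha> (take (Suc k) ws) * \<beta> (drop (Suc k) ws)) (v # vs) =
    (\<Sum>j\<le>?n. if j \<le> k then A1 else (- 1) ^ Suc k * A2)"
    unfolding alternate_Cons by (intro sum.cong refl) (use eq1 eq2 in auto)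
  also have "\<dots> = (\<Sum>j\<in>{..k}. A1) + (\<Sum>j\<in>{Suc k..?n}. (- 1) ^ Suc k * A2)"
  proof -
    have "{..?n} = {..k} \<union> {Suc k..?n}" by auto
    then show ?thesis by (simp only:) (subst sum.union_disjoint, auto intro!: sum.cong arg_cong2[where f = "(+)"])
  qed
  also have "\<dots> = Suc k * A1 + Suc l * ((- 1) ^ Suc k * A2)" by simp
  finally have *: "alternate (Suc ?n) (\<lambda>ws. \<alpha> (take (Suc k) ws) * \<beta> (drop (Suc k) ws)) (v # vs) =
     Suc k * A1 + Suc l * ((- 1) ^ Suc k * A2)" .
  have "wedge (Suc k) (Suc l) \<alpha> \<beta> (v # vs) =
      (Suc k * A1 + Suc l * ((- 1) ^ Suc k * A2)) / (fact (Suc k) * fact (Suc l))"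
    using True * by (simp add: wedge_alternate)
  also have "\<dots> = A1 / (fact k * fact (Suc l)) + (- 1) ^ Suc k * (A2 / (fact (Suc k) * fact l))"
    by (simp add: divide_simps add_nonneg_eq_0_iff del: power_Suc of_nat_Suc)
  also have "A1 / (fact k * fact (Suc l)) = wedge k (Suc l) (\<lambda>ws. \<alpha> (v # ws)) \<beta> vs"
    using True by (simp add: wedge_alternate A1_def)
  also have "A2 / (fact (Suc k) * fact l) = wedge (Suc k) l \<alpha> (\<lambda>ws. \<beta> (v # ws)) vs"
    using True by (simp add: wedge_alternate A2_def)
  finally show ?thesis .
qed (simp add: wedge_def)

lemma alt_form_wedge:
  assumes a: "alt_form k \<alpha>" and b: "alt_form l \<beta>"
  shows "alt_form (k + l) (wedge k l \<alpha> \<beta>)"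
  unfolding alt_form_def
proof (intro conjI allI impI)
  let ?G = "\<lambda>ws. \<alpha> (take k ws) * \<beta> (drop k ws)"
  have G: "linear (\<lambda>u. ?G (ws[p := u]))" if "length ws = k + l" "p < k + l" for ws p
  proof (cases "p < k")
    case True
    then have eq: "(\<lambda>u. ?G (ws[p := u])) = (\<lambda>u. \<beta> (drop k ws) *\<^sub>R \<alpha> ((take k ws)[p := u]))"
      by (auto simp: take_update_swap)
    show ?thesis unfolding eq
      by (intro linear_compose_scale_right alt_form_linear[OF a]) (use that True in auto)
  next
    case False
    then have eq: "(\<lambda>u. ?G (ws[p := u])) = (\<lambda>u. \<alpha> (take k ws) *\<^sub>R \<beta> ((drop k ws)[p - k := u]))"
      by (auto simp: drop_update_swap)
    show ?thesis unfolding eq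
      by (intro linear_compose_scale_right alt_form_linear[OF b]) (use that False in auto)
  qed
  { fix vs :: "'a list" and i assume vs: "length vs = k + l \<and> i < k + l"
    have "linear (\<lambda>u. of_int (sign \<sigma>) * ?G (map (\<lambda>m. vs[i := u] ! \<sigma> m) [0..<k + l]))"
      if s: "\<sigma> permutes {..<k + l}" for \<sigma>
    proof -
      \<comment> \<open>Slot \<open>i\<close> of \<open>vs\<close> is read at position
        \<open>inv \<sigma> i\<close> of the permuted list, so each summand is linear in it.\<close>
      have p: "inv \<sigma> i < k + l" using permutes_in_image[OF permutes_inv[OF s], of i] vs by simp
      have "map (\<lambda>m. vs[i := u] ! \<sigma> m) [0..<k + l] = (map (\<lambda>m. vs ! \<sigma> m) [0..<k + l])[inv \<sigma> i := u]" for u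
      proof (rule nth_equalityI)
        fix m assume "m < length (map (\<lambda>m. vs[i := u] ! \<sigma> m) [0..<k + l])"
        moreover have "\<sigma> m = i \<longleftrightarrow> m = inv \<sigma> i" by (metis permutes_inverses s)
        ultimately show "map (\<lambda>m. vs[i := u] ! \<sigma> m) [0..<k + l] ! m = (map (\<lambda>m. vs ! \<sigma> m) [0..<k + l])[inv \<sigma> i := u] ! m"
          using permutes_in_image[OF s, of m] vs by (auto simp: nth_list_update)
      qed simp
      then show ?thesis
        using G[of "map (\<lambda>m. vs ! \<sigma> m) [0..<k + l]", OF _ p]
        by (simp add: linear_cmult)
    qed
    then have "linear (\<lambda>u. alternate (k + l) ?G (vs[i := u]))"
      unfolding alternate_def by (intro linear_compose_sum) auto
    from linear_compose_scale_right[OF this, of "1 / (fact k * fact l)"]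
    show "linear (\<lambda>u. wedge k l \<alpha> \<beta> (vs[i := u]))" using vs by (simp add: wedge_alternate) }
  { fix vs :: "'a list" and i j assume vs: "length vs = k + l \<and> i < j \<and> j < k + l \<and> vs ! i = vs ! j"
    \<comment> \<open>Composition with the transposition of the two equal slots pairs each
      permutation with one of opposite sign and the same value, so the sum equals its own
      negative.\<close>
    let ?t = "Transposition.transpose i j"
    have t: "?t permutes {..<k + l}" using vs by (intro permutes_swap_id) auto
    have "alternate (k + l) ?G vs = (\<Sum>\<sigma> | \<sigma> permutes {..<k + l}.
       of_int (sign (?t \<circ> \<sigma>)) * ?G (map (\<lambda>m. vs ! (?t \<circ> \<sigma>) m) [0..<k + l]))"
      unfolding alternate_def
    proof (rule sum.reindex_bij_witness[where i = "\<lambda>\<sigma>. ?t \<circ> \<sigma>" and j = "\<lambda>\<sigma>. ?t \<circ> \<sigma>"])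
      show inv: "?t \<circ> (?t \<circ> \<sigma>) = \<sigma>" for \<sigma> by (auto simp: fun_eq_iff)
      then show "?t \<circ> (?t \<circ> \<sigma>) = \<sigma>" for \<sigma> .
      show "of_int (sign (?t \<circ> (?t \<circ> \<sigma>))) * ?G (map (\<lambda>m. vs ! (?t \<circ> (?t \<circ> \<sigma>)) m) [0..<k + l]) =
         of_int (sign \<sigma>) * ?G (map (\<lambda>m. vs ! \<sigma> m) [0..<k + l])" for \<sigma>
        unfolding inv ..
    qed (auto dest: permutes_compose[OF _ t])
    also have "\<dots> = (\<Sum>\<sigma> | \<sigma> permutes {..<k + l}. - (of_int (sign \<sigma>) * ?G (map (\<lambda>m. vs ! \<sigma> m) [0..<k + l])))"
    proof (intro sum.cong refl)
      fix \<sigma> assume "\<sigma> \<in> {\<sigma>. \<sigma> permutes {..<k + l}}"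
      then have "sign (?t \<circ> \<sigma>) = - sign \<sigma>"
        using vs t by (subst sign_compose) (auto simp: sign_swap_id permutation_permutes)
      moreover have "vs ! (?t \<circ> \<sigma>) m = vs ! \<sigma> m" for m using vs by (auto simp: Transposition.transpose_def)
      ultimately show "of_int (sign (?t \<circ> \<sigma>)) * ?G (map (\<lambda>m. vs ! (?t \<circ> \<sigma>) m) [0..<k + l]) =
         - (of_int (sign \<sigma>) * ?G (map (\<lambda>m. vs ! \<sigma> m) [0..<k + l]))" by simp
    qed
    finally have "alternate (k + l) ?G vs = 0" by (simp add: alternate_def sum_negf)
    then show "wedge k l \<alpha> \<beta> vs = 0" by (simp add: wedge_alternate) }
qed (simp add: wedge_def)

section \<open>Shuffle formulas in low degrees, by contracting until a factor has degree 0\<close>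

lemma wedge_Cons_interior:
  assumes "alt_form (Suc k) \<alpha>" "alt_form (Suc l) \<beta>"
  shows "wedge (Suc k) (Suc l) \<alpha> \<beta> (v # vs) =
     wedge k (Suc l) (interior_product v \<alpha>) \<beta> vs + (- 1) ^ Suc k * wedge (Suc k) l \<alpha> (interior_product v \<beta>) vs"
  using wedge_Cons[OF assms] by (simp only: interior_product_def)

lemma wedge_1_1:
  assumes "alt_form 1 \<alpha>" "alt_form 1 \<beta>"
  shows "wedge 1 1 \<alpha> \<beta> [a0, a1] =
     \<alpha> [a0] * \<beta> [a1] - \<alpha> [a1] * \<beta> [a0]"
  using assms
  by (simp add: numeral_eq_Suc wedge_Cons_interior alt_form_interior_product wedge_0_left wedge_0_right)
     (simp add: interior_product_def)

lemma wedge_1_2: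
  assumes "alt_form 1 \<alpha>" "alt_form 2 \<beta>"
  shows "wedge 1 2 \<alpha> \<beta> [a0, a1, a2] =
     \<alpha> [a0] * \<beta> [a1, a2] - \<alpha> [a1] * \<beta> [a0, a2] + \<alpha> [a2] * \<beta> [a0, a1]"
  using assms
  by (simp add: numeral_eq_Suc wedge_Cons_interior alt_form_interior_product wedge_0_left wedge_0_right)
     (simp add: interior_product_def)

lemma wedge_2_2:
  assumes "alt_form 2 \<alpha>" "alt_form 2 \<beta>"
  shows "wedge 2 2 \<alpha> \<beta> [a0, a1, a2, a3] =
     \<alpha> [a0, a1] * \<beta> [a2, a3] - \<alpha> [a0, a2] * \<beta> [a1, a3] + \<alpha> [a0, a3] * \<beta> [a1, a2]
     + \<alpha> [a1, a2] * \<beta> [a0, a3] - \<alpha> [a1, a3] * \<beta> [a0, a2] + \<alpha> [a2, a3] * \<beta> [a0, a1]"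
  using assms
  by (simp add: numeral_eq_Suc wedge_Cons_interior alt_form_interior_product wedge_0_left wedge_0_right)
     (simp add: interior_product_def)

lemma wedge_4_3:
  assumes "alt_form 4 \<alpha>" "alt_form 3 \<beta>"
  shows "wedge 4 3 \<alpha> \<beta> [a0, a1, a2, a3, a4, a5, a6] =
     \<alpha> [a0, a1, a2, a3] * \<beta> [a4, a5, a6] - \<alpha> [a0, a1, a2, a4] * \<beta> [a3, a5, a6] + \<alpha> [a0, a1, a2, a5] * \<beta> [a3, a4, a6]
     - \<alpha> [a0, a1, a2, a6] * \<beta> [a3, a4, a5] + \<alpha> [a0, a1, a3, a4] * \<beta> [a2, a5, a6] - \<alpha> [a0, a1, a3, a5] * \<beta> [a2, a4, a6]
     + \<alpha> [a0, a1, a3, a6] * \<beta> [a2, a4, a5] + \<alpha> [a0, a1, a4, a5] * \<beta> [a2, a3, a6] - \<alpha> [a0, a1, a4, a6] * \<beta> [a2, a3, a5]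
     + \<alpha> [a0, a1, a5, a6] * \<beta> [a2, a3, a4] - \<alpha> [a0, a2, a3, a4] * \<beta> [a1, a5, a6] + \<alpha> [a0, a2, a3, a5] * \<beta> [a1, a4, a6]
     - \<alpha> [a0, a2, a3, a6] * \<beta> [a1, a4, a5] - \<alpha> [a0, a2, a4, a5] * \<beta> [a1, a3, a6] + \<alpha> [a0, a2, a4, a6] * \<beta> [a1, a3, a5]
     - \<alpha> [a0, a2, a5, a6] * \<beta> [a1, a3, a4] + \<alpha> [a0, a3, a4, a5] * \<beta> [a1, a2, a6] - \<alpha> [a0, a3, a4, a6] * \<beta> [a1, a2, a5]
     + \<alpha> [a0, a3, a5, a6] * \<beta> [a1, a2, a4] - \<alpha> [a0, a4, a5, a6] * \<beta> [a1, a2, a3] + \<alpha> [a1, a2, a3, a4] * \<beta> [a0, a5, a6]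
     - \<alpha> [a1, a2, a3, a5] * \<beta> [a0, a4, a6] + \<alpha> [a1, a2, a3, a6] * \<beta> [a0, a4, a5] + \<alpha> [a1, a2, a4, a5] * \<beta> [a0, a3, a6]
     - \<alpha> [a1, a2, a4, a6] * \<beta> [a0, a3, a5] + \<alpha> [a1, a2, a5, a6] * \<beta> [a0, a3, a4] - \<alpha> [a1, a3, a4, a5] * \<beta> [a0, a2, a6]
     + \<alpha> [a1, a3, a4, a6] * \<beta> [a0, a2, a5] - \<alpha> [a1, a3, a5, a6] * \<beta> [a0, a2, a4] + \<alpha> [a1, a4, a5, a6] * \<beta> [a0, a2, a3]
     + \<alpha> [a2, a3, a4, a5] * \<beta> [a0, a1, a6] - \<alpha> [a2, a3, a4, a6] * \<beta> [a0, a1, a5] + \<alpha> [a2, a3, a5, a6] * \<beta> [a0, a1, a4]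
     - \<alpha> [a2, a4, a5, a6] * \<beta> [a0, a1, a3] + \<alpha> [a3, a4, a5, a6] * \<beta> [a0, a1, a2]"
  using assms
  by (simp add: numeral_eq_Suc wedge_Cons_interior alt_form_interior_product wedge_0_left wedge_0_right)
     (simp add: interior_product_def)


section \<open>Strictly increasing index lists\<close>

text \<open>An enumeration by lists, so that a claim about all increasing index lists can be decided
  by evaluation.\<close>

primrec incs :: "nat \<Rightarrow> nat \<Rightarrow> nat \<Rightarrow> nat list list" where
  "incs 0 l n = [[]]"
| "incs (Suc k) l n = concat (map (\<lambda>i. map ((#) i) (incs k (Suc i) n)) [l..<n])"

lemma incs_complete:
  "sorted is \<Longrightarrow> distinct is \<Longrightarrow> set is \<subseteq> {l..<n} \<Longrightarrow> length is = k \<Longrightarrow> is \<in> set (incs k l n)"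
proof (induction k arbitrary: "is" l)
  case (Suc k)
  then obtain i js where i: "is = i # js" by (metis length_Suc_conv)
  have "set js \<subseteq> {Suc i..<n}"
  proof
    fix j assume "j \<in> set js"
    then have "i \<le> j" "i \<noteq> j" "j < n" using Suc.prems i by auto
    then show "j \<in> {Suc i..<n}" by auto
  qed
  then have "js \<in> set (incs k (Suc i) n)" using Suc.prems i by (intro Suc.IH) auto
  then show ?case using Suc.prems i by auto
qed simp

lemma incs_sound: "is \<in> set (incs k l n) \<Longrightarrow> sorted is \<and> distinct is \<and> set is \<subseteq> {l..<n} \<and> length is = k"
proof (induction k arbitrary: "is" l)
  case (Suc k)
  then obtain i js where i: "is = i # js" "l \<le> i" "i < n" "js \<in> set (incs k (Suc i) n)" by auto
  from Suc.IH[OF i(4)] have js: "sorted js" "distinct js" "set js \<subseteq> {Suc i..<n}" "length js = k" by auto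
  have "\<forall>j\<in>set js. i < j \<and> j < n \<and> l \<le> j" using js(3) i by fastforce
  then show ?case using i js by (auto simp: less_imp_le)
qed simp

definition spanning :: "'e::real_vector list \<Rightarrow> bool" where
  "spanning es \<longleftrightarrow> (\<forall>v. \<exists>c. v = (\<Sum>i<length es. c i *\<^sub>R es ! i))"

lemma alt_form_not_distinct:
  assumes "alt_form k \<alpha>" "\<not> distinct is"
  shows "\<alpha> (map f is) = 0"
proof -
  obtain i j where "i < length is" "j < length is" "i \<noteq> j" "is ! i = is ! j"
    using assms(2) by (auto simp: distinct_conv_nth)
  then show ?thesis
    using alt_form_eq_0[OF assms(1), of i j "map f is"] alt_form_eq_0[OF assms(1), of j i "map f is"]
    by (cases "i < j") auto
qed

lemma alt_form_zero_spanning: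
  assumes "spanning es"
  shows "alt_form k \<alpha> \<Longrightarrow> (\<And>is. length is = k \<Longrightarrow> set is \<subseteq> {..<length es} \<Longrightarrow> \<alpha> (map ((!) es) is) = 0) \<Longrightarrow> \<alpha> vs = 0"
proof (induction k arbitrary: \<alpha> vs)
  case 0
  then show ?case using 0(2)[of "[]"] by (cases vs) (auto simp: alt_form_length)
next
  case (Suc k)
  show ?case
  proof (cases "length vs = Suc k")
    case True
    then obtain w ws where vs: "vs = w # ws" "length ws = k" by (metis length_Suc_conv)
    obtain c where w: "w = (\<Sum>i<length es. c i *\<^sub>R es ! i)" using assms unfolding spanning_def by blast
    have z: "\<alpha> (es ! i # ws) = 0" if "i < length es" for i
    proof (rule Suc.IH[OF alt_form_Cons[OF Suc.prems(1)]])
      fix js assume "length js = k" "set js \<subseteq> {..<length es}"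
      then show "\<alpha> (es ! i # map ((!) es) js) = 0" using Suc.prems(2)[of "i # js"] that by simp
    qed
    interpret l: linear "\<lambda>u. \<alpha> (u # ws)" by (rule alt_form_linear_hd[OF Suc.prems(1)]) (simp add: vs)
    show ?thesis unfolding vs(1) w by (simp add: l.sum l.scale z)
  qed (simp add: alt_form_length[OF Suc.prems(1)])
qed

text \<open>Repeated indices give 0 on both sides and sorting costs both sides the same sign, so
  finitely many increasing lists decide the equality. All star computations rest on this
  reduction.\<close>

lemma alt_form_eq_spanning:
  assumes s: "spanning es" and a: "alt_form k \<alpha>" and b: "alt_form k \<beta>"
    and e: "\<And>is. is \<in> set (incs k 0 (length es)) \<Longrightarrow> \<alpha> (map ((!) es) is) = \<beta> (map ((!) es) is)"
  shows "\<alpha> = \<beta>"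
proof
  fix vs
  have d: "alt_form k (\<lambda>vs. \<alpha> vs - \<beta> vs)"
    using alt_form_add[OF a alt_form_scaleR[OF b, of "-1"]] by simp
  have "\<alpha> vs - \<beta> vs = 0"
  proof (rule alt_form_zero_spanning[OF s d])
    fix js assume js: "length js = k" "set js \<subseteq> {..<length es}"
    show "\<alpha> (map ((!) es) js) - \<beta> (map ((!) es) js) = 0"
    proof (cases "distinct js")
      case True
      then have "sort js \<in> set (incs k 0 (length es))" using js by (intro incs_complete) auto
      from e[OF this] show ?thesis
        using alt_form_sort[OF a, of "(!) es" "[]" js "[]"] alt_form_sort[OF b, of "(!) es" "[]" js "[]"] by simp
    qed (simp add: alt_form_not_distinct[OF a] alt_form_not_distinct[OF b])
  qed
  then show "\<alpha> vs = \<beta> vs" by simp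
qed

section \<open>The Hodge star in an orthonormal frame\<close>

definition frame :: "('e::euclidean_space \<Rightarrow> 'e \<Rightarrow> real) \<Rightarrow> 'e list \<Rightarrow> bool" where
  "frame g es \<longleftrightarrow> inner_product g \<and> length es = DIM('e) \<and>
     (\<forall>i<DIM('e). \<forall>j<DIM('e). g (es ! i) (es ! j) = (if i = j then 1 else 0))"

lemma inner_product_linear_left: "inner_product g \<Longrightarrow> linear (\<lambda>u. g u v)"
proof -
  assume g: "inner_product g"
  then have "(\<lambda>u. g u v) = g v" by (auto simp: inner_product_def)
  then show ?thesis using g by (simp add: inner_product_def)
qed

lemma frame_expand:
  fixes g :: "'e::euclidean_space \<Rightarrow> 'e \<Rightarrow> real"
  assumes "frame g es"
  shows "v = (\<Sum>i<DIM('e). g v (es ! i) *\<^sub>R es ! i)"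
proof -
  have g: "inner_product g" and l: "length es = DIM('e)"
    and o: "\<And>i j. i < DIM('e) \<Longrightarrow> j < DIM('e) \<Longrightarrow> g (es ! i) (es ! j) = (if i = j then 1 else 0)"
    using assms unfolding frame_def by auto
  have lin: "linear (\<lambda>u. g u v)" for v by (rule inner_product_linear_left[OF g])
  have inj: "inj_on ((!) es) {..<DIM('e)}"
    by (rule inj_onI) (metis lessThan_iff o zero_neq_one)
  have ses: "set es = (!) es ` {..<DIM('e)}" using l by (auto simp: set_conv_nth)
  have ind: "independent (set es)"
  proof (rule independent_if_scalars_zero)
    fix f x assume s: "(\<Sum>x\<in>set es. f x *\<^sub>R x) = 0" and "x \<in> set es"
    then obtain j where j: "j < DIM('e)" "x = es ! j" using ses by auto
    have "0 = g (\<Sum>x\<in>set es. f x *\<^sub>R x) (es ! j)" unfolding s by (simp add: linear_0[OF lin])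
    also have "\<dots> = (\<Sum>i<DIM('e). f (es ! i) * g (es ! i) (es ! j))"
      unfolding ses sum.reindex[OF inj] by (simp add: linear_sum[OF lin] linear_cmul[OF lin])
    also have "\<dots> = (\<Sum>i<DIM('e). if i = j then f (es ! j) else 0)"
      using j by (intro sum.cong refl) (auto simp: o)
    finally show "f x = 0" using j by simp
  qed simp
  have "card (set es) = DIM('e)" unfolding ses card_image[OF inj] by simp
  then have span: "span (set es) = UNIV"
    using card_eq_dim[of "set es" UNIV] ind by auto
  let ?h = "\<lambda>v. \<Sum>i<DIM('e). g v (es ! i) *\<^sub>R es ! i"
  have lh: "linear ?h"
    by (rule linearI) (simp_all add: linear_add[OF lin] linear_cmul[OF lin] scaleR_add_left sum.distrib scaleR_sum_right)
  have "id v = ?h v"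
  proof (rule linear_eq_on_span[OF linear_id lh, of "set es"])
    fix x assume "x \<in> set es"
    then obtain j where j: "j < DIM('e)" "x = es ! j" using ses by auto
    have "?h x = (\<Sum>i<DIM('e). if i = j then es ! j else 0)"
      using j by (intro sum.cong refl) (auto simp: o)
    then show "id x = ?h x" using j by simp
  qed (simp add: span)
  then show ?thesis by simp
qed

lemma frame_spanning: "frame g es \<Longrightarrow> spanning es"
  unfolding spanning_def using frame_expand frame_def by metis

lemma sharp_frame:
  fixes g :: "'e::euclidean_space \<Rightarrow> 'e \<Rightarrow> real"
  assumes f: "frame g es" and x: "linear \<xi>"
  shows "sharp g \<xi> = (\<Sum>i<DIM('e). \<xi> (es ! i) *\<^sub>R es ! i)"
proof -
  let ?v = "\<Sum>i<DIM('e). \<xi> (es ! i) *\<^sub>R es ! i"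
  have g: "inner_product g" using f by (simp add: frame_def)
  have lin: "linear (\<lambda>u. g u v)" for v by (rule inner_product_linear_left[OF g])
  have sym: "g u v = g v u" for u v using g by (simp add: inner_product_def)
  have 1: "g ?v w = \<xi> w" for w
  proof -
    have "g ?v w = (\<Sum>i<DIM('e). \<xi> (g w (es ! i) *\<^sub>R es ! i))"
      unfolding linear_sum[OF lin] linear_cmul[OF lin] linear_cmul[OF x] sym[of "es ! _" w] by (simp add: mult.commute)
    also have "\<dots> = \<xi> w" by (subst (2) frame_expand[OF f, of w]) (simp add: linear_sum[OF x])
    finally show ?thesis .
  qed
  show ?thesis unfolding sharp_def
  proof (rule the_equality)
    show "\<forall>w. g ?v w = \<xi> w" using 1 by blast
    fix u assume u: "\<forall>w. g u w = \<xi> w"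
    then have "g (u - ?v) (u - ?v) = 0" by (simp add: linear_diff[OF lin] 1)
    then have "u - ?v = 0"
    proof -
      have pos: "w \<noteq> 0 \<Longrightarrow> 0 < g w w" for w using g by (simp add: inner_product_def)
      assume "g (u - ?v) (u - ?v) = 0"
      with pos[of "u - ?v"] show "u - ?v = 0" by linarith
    qed
    then show "u = ?v" by simp
  qed
qed

lemma sum_lists_Suc:
  assumes "finite A"
  shows "(\<Sum>bs | set bs \<subseteq> A \<and> length bs = Suc k. f bs) =
         (\<Sum>b\<in>A. \<Sum>bs | set bs \<subseteq> A \<and> length bs = k. f (b # bs))"
proof -
  let ?L = "{bs. set bs \<subseteq> A \<and> length bs = k}"
  have "{bs. set bs \<subseteq> A \<and> length bs = Suc k} = (\<lambda>x. fst x # snd x) ` (A \<times> ?L)"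
    by (auto simp: length_Suc_conv image_iff) 
  moreover have "inj_on (\<lambda>x. fst x # snd x) (A \<times> ?L)" by (auto simp: inj_on_def)
  ultimately show ?thesis by (simp add: sum.reindex sum.cartesian_product case_prod_beta o_def)
qed

text \<open>Hypothesis \<open>c\<close> says that the tensors \<Sum> a_i \<otimes> a'_i and \<Sum>
  b_j \<otimes> b'_j agree, so one may be exchanged for the other in each slot in turn. It is used
  both to pass from \<open>Basis\<close> to an orthonormal frame and to compare two such
  frames.\<close>

lemma contraction_change:
  fixes \<alpha> \<beta> :: "'e::real_vector list \<Rightarrow> real"
  assumes fin: "finite I" "finite J"
    and c: "\<And>p q. linear p \<Longrightarrow> linear q \<Longrightarrow> (\<Sum>i\<in>I. p (a i) * q (a' i)) = (\<Sum>j\<in>J. p (b j) * q (b' j) :: real)"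
  shows "alt_form k \<alpha> \<Longrightarrow> alt_form k \<beta> \<Longrightarrow>
    (\<Sum>is | set is \<subseteq> I \<and> length is = k. \<alpha> (map a is) * \<beta> (map a' is)) =
    (\<Sum>js | set js \<subseteq> J \<and> length js = k. \<alpha> (map b js) * \<beta> (map b' js))"
proof (induction k arbitrary: \<alpha> \<beta>)
  case 0
  have e: "{is. set is \<subseteq> A \<and> length is = 0} = {[]}" for A :: "'z set" by auto
  show ?case by (simp only: e) simp
next
  case (Suc k)
  let ?L = "{js. set js \<subseteq> J \<and> length js = k}"
  have "(\<Sum>is | set is \<subseteq> I \<and> length is = Suc k. \<alpha> (map a is) * \<beta> (map a' is)) =
    (\<Sum>i\<in>I. \<Sum>is | set is \<subseteq> I \<and> length is = k. \<alpha> (a i # map a is) * \<beta> (a' i # map a' is))"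
    by (simp add: sum_lists_Suc fin)
  also have "\<dots> = (\<Sum>i\<in>I. \<Sum>js\<in>?L. \<alpha> (a i # map b js) * \<beta> (a' i # map b' js))"
    by (intro sum.cong refl Suc.IH alt_form_Cons Suc.prems)
  also have "\<dots> = (\<Sum>js\<in>?L. \<Sum>i\<in>I. \<alpha> (a i # map b js) * \<beta> (a' i # map b' js))" by (rule sum.swap)
  also have "\<dots> = (\<Sum>js\<in>?L. \<Sum>i\<in>J. \<alpha> (b i # map b js) * \<beta> (b' i # map b' js))"
    by (intro sum.cong refl c alt_form_linear_hd[OF Suc.prems(1)] alt_form_linear_hd[OF Suc.prems(2)]) auto
  also have "\<dots> = (\<Sum>i\<in>J. \<Sum>js\<in>?L. \<alpha> (b i # map b js) * \<beta> (b' i # map b' js))" by (rule sum.swap)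
  finally show ?case by (simp add: sum_lists_Suc fin)
qed

lemma alt_form_prepend: "alt_form (length us + k) v \<Longrightarrow> alt_form k (\<lambda>vs. v (us @ vs))"
proof (induction us arbitrary: v)
  case (Cons u us)
  from Cons.IH[OF alt_form_Cons[of "length us + k" v u]] Cons.prems show ?case by simp
qed simp

lemma alt_form_cong: "(\<And>vs. length vs = k \<Longrightarrow> \<alpha> vs = \<beta> vs) \<Longrightarrow> (\<And>vs. length vs \<noteq> k \<Longrightarrow> \<beta> vs = 0) \<Longrightarrow>
  alt_form k \<alpha> \<Longrightarrow> alt_form k \<beta>"
  unfolding alt_form_def by simp

lemma alt_form_sum: "(\<And>i. i \<in> I \<Longrightarrow> alt_form k (\<alpha> i)) \<Longrightarrow> alt_form k (\<lambda>vs. \<Sum>i\<in>I. \<alpha> i vs)"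
proof (induction I rule: infinite_finite_induct)
  case (insert x F)
  then show ?case by (simp add: alt_form_add)
qed (auto simp: alt_form_def intro: linear_zero)

lemma alt_form_hodge:
  fixes v :: "'e::euclidean_space list \<Rightarrow> real"
  assumes v: "alt_form DIM('e) v" and k: "k \<le> DIM('e)"
  shows "alt_form (DIM('e) - k) (hodge k g v \<beta>)"
proof (rule alt_form_cong)
  let ?f = "\<lambda>vs. \<Sum>bs | set bs \<subseteq> Basis \<and> length bs = k. (\<beta> bs / fact k) * v (map (\<lambda>b. sharp g (\<lambda>w. w \<bullet> b)) bs @ vs)"
  show "alt_form (DIM('e) - k) ?f"
    by (intro alt_form_sum alt_form_mult alt_form_prepend) (use v k in auto)
  show "?f vs = hodge k g v \<beta> vs" if "length vs = DIM('e) - k" for vs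
    using that k by (simp add: hodge_def sum_divide_distrib)
qed (simp add: hodge_def)

text \<open>The sum of b \<otimes> sharp b over \<open>Basis\<close> and the sum of e_i \<otimes>
  e_i over an orthonormal frame are both the inverse metric tensor, so the contraction in
  \<open>hodge\<close> may be taken over the frame.\<close>

lemma hodge_frame_sum:
  fixes v :: "'e::euclidean_space list \<Rightarrow> real"
  assumes f: "frame g es" and v: "alt_form DIM('e) v" and b: "alt_form k \<beta>" and k: "k \<le> DIM('e)" "length ws = DIM('e) - k"
  shows "hodge k g v \<beta> ws =
    (\<Sum>is | set is \<subseteq> {..<DIM('e)} \<and> length is = k. \<beta> (map ((!) es) is) * v (map ((!) es) is @ ws)) / fact k"
proof -
  have c: "(\<Sum>b\<in>Basis. p b * q (sharp g (\<lambda>w. w \<bullet> b))) = (\<Sum>i<DIM('e). p (es ! i) * q (es ! i))"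
    if p: "linear p" and q: "linear q" for p q :: "'e \<Rightarrow> real"
  proof -
    have "(\<Sum>b\<in>Basis. p b * q (sharp g (\<lambda>w. w \<bullet> b))) = (\<Sum>b\<in>Basis. \<Sum>i<DIM('e). p ((es ! i \<bullet> b) *\<^sub>R b) * q (es ! i))"
    proof (intro sum.cong refl)
      fix b :: 'e
      have "linear (\<lambda>w. w \<bullet> b)" by (simp add: bounded_linear.linear bounded_linear_inner_left)
      then show "p b * q (sharp g (\<lambda>w. w \<bullet> b)) = (\<Sum>i<DIM('e). p ((es ! i \<bullet> b) *\<^sub>R b) * q (es ! i))"
        by (simp add: sharp_frame[OF f] linear_sum[OF q] linear_cmul[OF q] linear_cmul[OF p] sum_distrib_left mult.left_commute mult.assoc)
    qed
    also have "\<dots> = (\<Sum>i<DIM('e). (\<Sum>b\<in>Basis. p ((es ! i \<bullet> b) *\<^sub>R b)) * q (es ! i))"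
      by (subst sum.swap) (simp add: sum_distrib_right)
    also have "\<dots> = (\<Sum>i<DIM('e). p (es ! i) * q (es ! i))"
      by (simp add: linear_sum[OF p, symmetric] euclidean_representation)
    finally show ?thesis .
  qed
  have a: "alt_form k (\<lambda>vs. v (vs @ ws))" by (rule alt_form_append[OF v]) (use k in simp)
  have "(\<Sum>bs | set bs \<subseteq> Basis \<and> length bs = k. \<beta> (map (\<lambda>b. b) bs) * v (map (\<lambda>b. sharp g (\<lambda>w. w \<bullet> b)) bs @ ws)) =
    (\<Sum>is | set is \<subseteq> {..<DIM('e)} \<and> length is = k. \<beta> (map ((!) es) is) * v (map ((!) es) is @ ws))"
    by (rule contraction_change[OF finite_Basis finite_lessThan c b a])
  then show ?thesis using k by (simp add: hodge_def)
qed

text \<open>A list with a repetition is killed by \<beta>; one that leaves \<open>I\<close> meets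
  \<open>J\<close> and is killed by the top form. The k! rearrangements of \<open>I\<close> that
  remain contribute equally, because the sorting sign occurs once in each factor.\<close>

lemma contraction_complement:
  assumes b: "alt_form k \<beta>" and v: "alt_form n v"
    and I: "sorted I" "length I = k" "distinct (I @ J)" "set (I @ J) = {..<n}"
  shows "(\<Sum>is | set is \<subseteq> {..<n} \<and> length is = k. \<beta> (map e is) * v (map e is @ map e J)) =
     fact k * (\<beta> (map e I) * v (map e (I @ J)) :: real)"
proof -
  let ?S = "{is. set is \<subseteq> {..<n} \<and> length is = k}"
  let ?T = "permutations_of_set (set I) :: nat list set"
  have sub: "?T \<subseteq> ?S"
  proof
    fix "is" assume "is \<in> ?T"
    then have "set is = set I" "distinct is" by (auto simp: permutations_of_set_def)
    then show "is \<in> ?S" using I distinct_card[of "is"] distinct_card[of I] by auto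
  qed
  have "(\<Sum>is\<in>?S. \<beta> (map e is) * v (map e is @ map e J)) = (\<Sum>is\<in>?T. \<beta> (map e is) * v (map e is @ map e J))"
  proof (rule sum.mono_neutral_right[OF _ sub], goal_cases)
    case 1 then show ?case by (rule finite_lists_length_eq) simp
  next
    case 2
    show ?case
    proof
      fix "is" assume "is \<in> ?S - ?T"
      then have is': "set is \<subseteq> {..<n}" "length is = k" "distinct is \<longrightarrow> set is \<noteq> set I"
        by (auto simp: permutations_of_set_def)
      show "\<beta> (map e is) * v (map e is @ map e J) = 0"
      proof (cases "distinct is")
        case True
        have "card (set is) = card (set I)" using True I is' by (simp add: distinct_card)
        then have "\<not> set is \<subseteq> set I" using is'(3) True card_subset_eq by blast
        then have "\<not> distinct (is @ J)" using is'(1) I(4) by auto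
        then have "v (map e (is @ J)) = 0" by (rule alt_form_not_distinct[OF v])
        then show ?thesis by simp
      qed (simp add: alt_form_not_distinct[OF b])
    qed
  qed
  also have "\<dots> = (\<Sum>is\<in>?T. \<beta> (map e I) * v (map e (I @ J)))"
  proof (intro sum.cong refl)
    fix "is" assume "is \<in> ?T"
    then have "sort is = I" using I sorted_distinct_set_unique[of "sort is" I]
      by (auto simp: permutations_of_set_def)
    then show "\<beta> (map e is) * v (map e is @ map e J) = \<beta> (map e I) * v (map e (I @ J))"
      using alt_form_sort[OF b, of e "[]" "is" "[]"] alt_form_sort[OF v, of e "[]" "is" J]
      by (simp add: mult.assoc mult.left_commute flip: power_mult_distrib)
  qed
  also have "\<dots> = fact k * (\<beta> (map e I) * v (map e (I @ J)))"
    using I by (simp add: distinct_card)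
  finally show ?thesis .
qed

lemma hodge_frame_value:
  fixes v :: "'e::euclidean_space list \<Rightarrow> real"
  assumes f: "frame g es" and v: "alt_form DIM('e) v" and b: "alt_form k \<beta>"
    and I: "sorted I" "length I = k" "distinct (I @ J)" "set (I @ J) = {..<DIM('e)}"
  shows "hodge k g v \<beta> (map ((!) es) J) = \<beta> (map ((!) es) I) * v (map ((!) es) (I @ J))"
proof -
  have "length (I @ J) = DIM('e)" using I(3,4) by (metis card_lessThan distinct_card)
  then have "k \<le> DIM('e)" "length (map ((!) es) J) = DIM('e) - k" using I(2) by auto
  from hodge_frame_sum[OF f v b this] show ?thesis
    by (subst (asm) contraction_complement[OF b v I]) simp
qed

text \<open>The contraction of \<open>v\<close> with itself over an orthonormal frame is n! times
  the square of its value there, and this contraction does not depend on the frame. One frame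
  therefore decides the normalisation on all of them.\<close>

lemma volume_form_of_frame:
  fixes v :: "'e::euclidean_space list \<Rightarrow> real"
  assumes f: "frame g es" and v: "alt_form DIM('e) v" and 1: "\<bar>v es\<bar> = 1"
  shows "volume_form_of g v"
proof -
  have sq: "(\<Sum>is | set is \<subseteq> {..<DIM('e)} \<and> length is = DIM('e). v (map ((!) us) is) * v (map ((!) us) is)) = fact DIM('e) * (v us)\<^sup>2"
    if "length us = DIM('e)" for us
    using contraction_complement[OF v v, of "[0..<DIM('e)]" "[]" "(!) us"] that map_nth[of us]
    by (simp add: atLeast0LessThan power2_eq_square)
  have "\<bar>v us\<bar> = 1" if u: "length us = DIM('e)" "\<forall>i<DIM('e). \<forall>j<DIM('e). g (us ! i) (us ! j) = (if i = j then 1 else 0)" for us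
  proof -
    have fu: "frame g us" using f u by (simp add: frame_def)
    have c: "(\<Sum>i<DIM('e). p (us ! i) * q (us ! i)) = (\<Sum>i<DIM('e). p (es ! i) * q (es ! i))"
      if p: "linear p" and q: "linear q" for p q :: "'e \<Rightarrow> real"
    proof -
      have sym: "g x y = g y x" for x y using f by (simp add: frame_def inner_product_def)
      have "(\<Sum>i<DIM('e). p (us ! i) * q (us ! i)) =
            (\<Sum>i<DIM('e). \<Sum>j<DIM('e). g (us ! i) (es ! j) * p (es ! j) * q (us ! i))"
        by (subst frame_expand[OF f, of "us ! _"]) (simp add: linear_sum[OF p] linear_cmul[OF p] sum_distrib_right)
      also have "\<dots> = (\<Sum>j<DIM('e). p (es ! j) * (\<Sum>i<DIM('e). g (es ! j) (us ! i) * q (us ! i)))"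
        by (subst sum.swap) (simp add: sum_distrib_left sym[of "us ! _"] mult_ac)
      also have "\<dots> = (\<Sum>j<DIM('e). p (es ! j) * q (\<Sum>i<DIM('e). g (es ! j) (us ! i) *\<^sub>R us ! i))"
        by (simp add: linear_sum[OF q] linear_cmul[OF q])
      also have "\<dots> = (\<Sum>j<DIM('e). p (es ! j) * q (es ! j))" by (simp flip: frame_expand[OF fu])
      finally show ?thesis .
    qed
    have "(\<Sum>is | set is \<subseteq> {..<DIM('e)} \<and> length is = DIM('e). v (map ((!) us) is) * v (map ((!) us) is)) =
      (\<Sum>is | set is \<subseteq> {..<DIM('e)} \<and> length is = DIM('e). v (map ((!) es) is) * v (map ((!) es) is))"
      by (rule contraction_change[OF finite_lessThan finite_lessThan c v v])
    moreover have "length es = DIM('e)" using f by (simp add: frame_def)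
    ultimately have "(v us)\<^sup>2 = (v es)\<^sup>2" by (simp only: sq u(1)) simp
    then have "v us = v es \<or> v us = - v es" by (simp add: power2_eq_iff)
    then show ?thesis using 1 by (elim disjE) simp_all
  qed
  then show ?thesis using v unfolding volume_form_of_def by blast
qed

section \<open>The model \<open>G\<^sub>2\<close>-structure\<close>

text \<open>Values on increasing index lists of \<open>Re \<Omega>\<close>, \<open>- dr \<and> \<omega>\<close>, \<open>- dr \<and> Im \<Omega>\<close> and \<open>- \<omega>\<^sup>2 / 2\<close> for the
  standard structures of \<open>\<real> \<times> \<complex>\<^sup>3\<close>, in the basis \<open>\<partial>\<^sub>r\<close>, \<open>\<partial>\<^bsub>x1\<^esub>\<close>, \<open>\<partial>\<^bsub>y1\<^esub>\<close>, \<open>\<partial>\<^bsub>x2\<^esub>\<close>, \<open>\<partial>\<^bsub>y2\<^esub>\<close>, \<open>\<partial>\<^bsub>x3\<^esub>\<close>, \<open>\<partial>\<^bsub>y3\<^esub>\<close>.\<close>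

definition tabP :: "nat list \<Rightarrow> int" where
  "tabP is = (if is = [1,3,5] then 1 else if is = [1,4,6] \<or> is = [2,3,6] \<or> is = [2,4,5] then - 1 else 0)"

definition tabQ :: "nat list \<Rightarrow> int" where
  "tabQ is = (if is = [0,1,2] \<or> is = [0,3,4] \<or> is = [0,5,6] then - 1 else 0)"

definition tabA :: "nat list \<Rightarrow> int" where
  "tabA is = (if is = [0,2,4,6] then 1 else if is = [0,1,3,6] \<or> is = [0,1,4,5] \<or> is = [0,2,3,5] then - 1 else 0)"

definition tabB :: "nat list \<Rightarrow> int" where
  "tabB is = (if is = [1,2,3,4] \<or> is = [1,2,5,6] \<or> is = [3,4,5,6] then - 1 else 0)"

definition has_table :: "'e list \<Rightarrow> nat \<Rightarrow> ('e::real_vector list \<Rightarrow> real) \<Rightarrow> (nat list \<Rightarrow> int) \<Rightarrow> bool" where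
  "has_table es k \<alpha> t \<longleftrightarrow> alt_form k \<alpha> \<and> (\<forall>is\<in>set (incs k 0 (length es)). \<alpha> (map ((!) es) is) = of_int (t is))"

text \<open>No metric is mentioned: the basis \<open>es\<close> turns out to be orthonormal for the
  metric induced by \<open>P + Q\<close>, and \<open>A\<close>, \<open>B\<close> are then the stars
  of \<open>P\<close>, \<open>Q\<close>.\<close>

definition g2_std ::
  "'e::real_vector list \<Rightarrow> ('e list \<Rightarrow> real) \<Rightarrow> ('e list \<Rightarrow> real) \<Rightarrow> ('e list \<Rightarrow> real) \<Rightarrow> ('e list \<Rightarrow> real) \<Rightarrow> bool" where
  "g2_std es P Q A B \<longleftrightarrow> length es = 7 \<and> spanning es \<and>
     has_table es 3 P tabP \<and> has_table es 3 Q tabQ \<and> has_table es 4 A tabA \<and> has_table es 4 B tabB"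

text \<open>The value that alternation forces on an index list in arbitrary order, given a table on
  increasing lists.\<close>

definition alt_ext :: "(nat list \<Rightarrow> int) \<Rightarrow> nat list \<Rightarrow> int" where
  "alt_ext t is = (if distinct is then (- 1) ^ inversions is * t (sort is) else 0)"

lemma has_table_value:
  assumes "has_table es k \<alpha> t" "length is = k" "set is \<subseteq> {..<length es}"
  shows "\<alpha> (map ((!) es) is) = of_int (alt_ext t is)"
proof (cases "distinct is")
  case True
  have a: "alt_form k \<alpha>" using assms by (simp add: has_table_def)
  have "sort is \<in> set (incs k 0 (length es))" using assms True by (intro incs_complete) auto
  then have "\<alpha> (map ((!) es) (sort is)) = of_int (t (sort is))" using assms(1) by (simp add: has_table_def)
  then show ?thesis using alt_form_sort[OF a, of "(!) es" "[]" "is" "[]"] True by (simp add: alt_ext_def)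
next
  case False
  then show ?thesis using assms(1) alt_form_not_distinct[of k \<alpha> "is" "(!) es"] by (simp add: alt_ext_def has_table_def)
qed

definition complement :: "nat list \<Rightarrow> nat list" where
  "complement J = filter (\<lambda>i. i \<notin> set J) [0..<7]"

text \<open>On an oriented orthonormal frame the star replaces \<open>J\<close> by its complement,
  up to the sign of the permutation \<open>complement J @ J\<close>. What remains of the star is
  hypothesis \<open>c\<close>, a finite comparison of signs.\<close>

lemma hodge_table:
  fixes v :: "'e::euclidean_space list \<Rightarrow> real"
  assumes d: "DIM('e) = 7" and f: "frame g es" and v: "alt_form 7 v" "v es = 1" and kl: "k + l = 7"
    and a: "has_table es k \<alpha> s" and b: "has_table es l \<beta> t"
    and c: "\<forall>J\<in>set (incs l 0 7). s (complement J) * (- 1) ^ inversions (complement J @ J) = t J"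
  shows "hodge k g v \<alpha> = \<beta>"
proof (rule alt_form_eq_spanning[OF frame_spanning[OF f]])
  have len: "length es = 7" using f d by (simp add: frame_def)
  have al: "alt_form k \<alpha>" using a by (simp add: has_table_def)
  have "DIM('e) - k = l" "k \<le> DIM('e)" "alt_form DIM('e) v" using d kl v(1) by simp_all
  then show "alt_form l (hodge k g v \<alpha>)" using alt_form_hodge[of v k g \<alpha>] by (simp only:)
  show "alt_form l \<beta>" using b by (simp add: has_table_def)
  fix J assume J: "J \<in> set (incs l 0 (length es))"
  then have J': "sorted J" "distinct J" "set J \<subseteq> {0..<7}" "length J = l" using incs_sound len by metis+
  let ?I = "complement J"
  have I: "sorted ?I" "distinct (?I @ J)" "set (?I @ J) = {..<7}"
    using J' by (auto simp: complement_def sorted_wrt_filter)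
  have "length (?I @ J) = 7" using I(2,3) by (metis card_lessThan distinct_card)
  then have I4: "length ?I = k" using J' kl by simp
  have "sort (?I @ J) = [0..<7]" using I by (intro sorted_distinct_set_unique) auto
  then have "v (map ((!) es) (?I @ J)) = (- 1) ^ inversions (?I @ J) * v (map ((!) es) [0..<7])"
    using alt_form_sort[OF v(1), of "(!) es" "[]" "?I @ J" "[]"] by simp
  also have "map ((!) es) [0..<7] = es" using map_nth[of es] len by simp
  finally have vv: "v (map ((!) es) (?I @ J)) = (- 1) ^ inversions (?I @ J)" using v by simp
  have "?I \<in> set (incs k 0 (length es))" using I J' I4 len by (intro incs_complete) auto
  then have "\<alpha> (map ((!) es) ?I) = of_int (s ?I)" using a by (simp add: has_table_def)
  then have "hodge k g v \<alpha> (map ((!) es) J) = of_int (s ?I * (- 1) ^ inversions (?I @ J))"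
    using hodge_frame_value[OF f _ al I(1) I4 I(2)] I(3) v vv d by simp
  also have "\<dots> = of_int (t J)" using c J len by simp
  finally show "hodge k g v \<alpha> (map ((!) es) J) = \<beta> (map ((!) es) J)"
    using b J by (simp add: has_table_def)
qed

text \<open>The star squares to +1 in dimension seven, which is why the last two tables invert the
  first two without a sign.\<close>

lemma table_PA: "\<forall>J\<in>set (incs 4 0 7). tabP (complement J) * (- 1) ^ inversions (complement J @ J) = tabA J"
  and table_QB: "\<forall>J\<in>set (incs 4 0 7). tabQ (complement J) * (- 1) ^ inversions (complement J @ J) = tabB J"
  and table_AP: "\<forall>J\<in>set (incs 3 0 7). tabA (complement J) * (- 1) ^ inversions (complement J @ J) = tabP J"
  and table_BQ: "\<forall>J\<in>set (incs 3 0 7). tabB (complement J) * (- 1) ^ inversions (complement J @ J) = tabQ J"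
  by code_simp+

lemma alt_form_scale:
  "alt_form k \<alpha> \<Longrightarrow> length vs = k \<Longrightarrow> \<alpha> (map (\<lambda>v. c *\<^sub>R v) vs) = c ^ k *\<^sub>R \<alpha> vs"
proof (induction k arbitrary: \<alpha> vs)
  case (Suc k)
  then obtain w ws where vs: "vs = w # ws" "length ws = k" by (metis length_Suc_conv)
  interpret l: linear "\<lambda>u. \<alpha> (u # map (\<lambda>v. c *\<^sub>R v) ws)"
    by (rule alt_form_linear_hd[OF Suc.prems(1)]) (simp add: vs)
  have "\<alpha> (map (\<lambda>v. c *\<^sub>R v) vs) = c *\<^sub>R \<alpha> (w # map (\<lambda>v. c *\<^sub>R v) ws)"
    using l.scale[of c w] by (simp add: vs)
  then show ?case using Suc.IH[OF alt_form_Cons[OF Suc.prems(1)] vs(2)] by (simp add: vs)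
qed simp

lemma incs_7: "is \<in> set (incs 7 0 7) \<Longrightarrow> is = [0..<7]"
proof -
  assume "is \<in> set (incs 7 0 7)"
  then have i: "sorted is" "distinct is" "set is \<subseteq> {0..<7}" "length is = 7" using incs_sound by metis+
  then have "card (set is) = 7" by (simp add: distinct_card)
  then have "set is = {0..<7}" using i by (intro card_subset_eq) auto
  then show ?thesis using i by (intro sorted_distinct_set_unique) auto
qed

text \<open>The defining equation fixes only the product of metric and volume form, so g = a g' and
  v' = a v with a = v' es, and a > 0 by positivity. The frame stretched by r = sqrt a is orthonormal
  for g', so v' has absolute value 1 on it: r^7 * r^2 = 1, hence r = 1.\<close>

lemma g2_induces_unique:
  fixes \<phi> :: "'e::euclidean_space list \<Rightarrow> real"
  assumes d: "DIM('e) = 7" and 1: "g2_induces \<phi> g v" "frame g es" "v es = 1" and 2: "g2_induces \<phi> g' v'"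
  shows "g' = g \<and> v' = v"
proof -
  have len: "length es = 7" using 1 d by (simp add: frame_def)
  have v: "alt_form 7 v" "alt_form 7 v'" using 1 2 d by (auto simp: g2_induces_def volume_form_of_def)
  have g': "inner_product g'" using 2 by (simp add: g2_induces_def)
  have eq: "g Y Z * v vs = g' Y Z * v' vs" for Y Z vs
    using 1(1) 2 unfolding g2_induces_def by metis
  define a where "a = v' es"
  have ga: "g Y Z = g' Y Z * a" for Y Z using eq[of Y Z es] 1(3) by (simp add: a_def)
  have g00: "g (es ! 0) (es ! 0) = 1" using 1(2) d by (simp add: frame_def)
  then have "es ! 0 \<noteq> 0" using ga[of "es ! 0" "es ! 0"] inner_product_linear_left[OF g', THEN linear_0] by force
  then have "g' (es ! 0) (es ! 0) > 0" using g' by (simp add: inner_product_def)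
  with g00 ga[of "es ! 0" "es ! 0"] have a: "a > 0" by (metis zero_less_mult_pos zero_less_one)
  let ?us = "map (\<lambda>x. sqrt a *\<^sub>R x) es"
  have lin: "linear (\<lambda>u. g' u w)" "linear (g' w)" for w
    using g' inner_product_linear_left by (auto simp: inner_product_def)
  have "g' (?us ! i) (?us ! j) = (if i = j then 1 else 0)" if "i < 7" "j < 7" for i j
  proof -
    have "g' (?us ! i) (?us ! j) = a * g' (es ! i) (es ! j)"
      using that len a by (simp add: linear_cmul[OF lin(1)] linear_cmul[OF lin(2)] flip: mult.assoc)
    also have "\<dots> = g (es ! i) (es ! j)" by (simp add: ga mult.commute)
    finally show ?thesis using 1(2) that d by (simp add: frame_def)
  qed
  then have "\<bar>v' ?us\<bar> = 1" using 2 len d unfolding g2_induces_def volume_form_of_def by simp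
  moreover define r where "r = sqrt a"
  have r: "r > 0" "a = r * r" using a by (simp_all add: r_def)
  have "v' ?us = r ^ 7 * (r * r)"
    using alt_form_scale[OF v(2) len, of r] by (simp only: a_def[symmetric] r_def[symmetric] real_scaleR_def r(2)[symmetric])
  ultimately have "\<bar>r ^ 7 * (r * r)\<bar> = 1" by (simp only:)
  then have "r ^ 9 = 1" using r(1) by (simp add: eval_nat_numeral)
  then have "r = 1" using power_eq_1_iff[of r 9] r(1) by auto
  with r(2) have a1: "a = 1" by simp
  have "v' = v"
    by (rule alt_form_eq_spanning[OF frame_spanning[OF 1(2)] v(2,1)])
       (use len 1(3) a1 map_nth[of es] in \<open>auto dest!: incs_7 simp: a_def\<close>)
  moreover have "g' = g" using ga a1 by (intro ext) simp
  ultimately show ?thesis by simp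
qed

lemma alt_form_3_hd:
  assumes "alt_form 3 \<phi>"
  shows "\<phi> [x + y, a, b] = \<phi> [x, a, b] + \<phi> [y, a, b]" "\<phi> [c *\<^sub>R x, a, b] = c *\<^sub>R \<phi> [x, a, b]"
proof -
  interpret l: linear "\<lambda>u. \<phi> [u, a, b]" by (rule alt_form_linear_hd[OF assms]) simp
  show "\<phi> [x + y, a, b] = \<phi> [x, a, b] + \<phi> [y, a, b]" by (rule l.add)
  show "\<phi> [c *\<^sub>R x, a, b] = c *\<^sub>R \<phi> [x, a, b]" by (rule l.scale)
qed

text \<open>The antisymmetric coefficients of the model three-form \<open>P + Q\<close>, written out
  for direct lookup.\<close>

definition phi_int :: "nat \<Rightarrow> nat \<Rightarrow> nat \<Rightarrow> int" where
  "phi_int i j k =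
    [[[0,0,0,0,0,0,0], [0,0,- 1,0,0,0,0], [0,1,0,0,0,0,0], [0,0,0,0,- 1,0,0], [0,0,0,1,0,0,0], [0,0,0,0,0,0,- 1], [0,0,0,0,0,1,0]],
     [[0,0,1,0,0,0,0], [0,0,0,0,0,0,0], [- 1,0,0,0,0,0,0], [0,0,0,0,0,1,0], [0,0,0,0,0,0,- 1], [0,0,0,- 1,0,0,0], [0,0,0,0,1,0,0]],
     [[0,- 1,0,0,0,0,0], [1,0,0,0,0,0,0], [0,0,0,0,0,0,0], [0,0,0,0,0,0,- 1], [0,0,0,0,0,- 1,0], [0,0,0,0,1,0,0], [0,0,0,1,0,0,0]],
     [[0,0,0,0,1,0,0], [0,0,0,0,0,- 1,0], [0,0,0,0,0,0,1], [0,0,0,0,0,0,0], [- 1,0,0,0,0,0,0], [0,1,0,0,0,0,0], [0,0,- 1,0,0,0,0]],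
     [[0,0,0,- 1,0,0,0], [0,0,0,0,0,0,1], [0,0,0,0,0,1,0], [1,0,0,0,0,0,0], [0,0,0,0,0,0,0], [0,0,- 1,0,0,0,0], [0,- 1,0,0,0,0,0]],
     [[0,0,0,0,0,0,1], [0,0,0,1,0,0,0], [0,0,0,0,- 1,0,0], [0,- 1,0,0,0,0,0], [0,0,1,0,0,0,0], [0,0,0,0,0,0,0], [- 1,0,0,0,0,0,0]],
     [[0,0,0,0,0,- 1,0], [0,0,0,0,- 1,0,0], [0,0,0,- 1,0,0,0], [0,0,1,0,0,0,0], [0,1,0,0,0,0,0], [1,0,0,0,0,0,0], [0,0,0,0,0,0,0]]] ! i ! j ! k"

lemma phi_int: "\<forall>i\<in>set [0..<7]. \<forall>j\<in>set [0..<7]. \<forall>k\<in>set [0..<7].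
    alt_ext (\<lambda>is. tabP is + tabQ is) [i, j, k] = phi_int i j k"
  by code_simp

definition wedge_int :: "nat \<Rightarrow> nat \<Rightarrow> nat \<Rightarrow> nat \<Rightarrow> nat \<Rightarrow> nat \<Rightarrow> int" where
  "wedge_int i j a b c d = phi_int i a b * phi_int j c d - phi_int i a c * phi_int j b d + phi_int i a d * phi_int j b c
     + phi_int i b c * phi_int j a d - phi_int i b d * phi_int j a c + phi_int i c d * phi_int j a b"

text \<open>The seven quadruples are the complements of the seven triples on which the model
  three-form is nonzero. The signs combine the value on the triple, the shuffle sign and the minus
  sign in the definition of the induced metric; the factor 1/6 is left out, hence the diagonal value
  6.\<close>

definition bform_int :: "nat \<Rightarrow> nat \<Rightarrow> int" where
  "bform_int i j = (let w = wedge_int i j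
     in w 3 4 5 6 + w 1 2 5 6 + w 1 2 3 4 - w 0 2 4 6 + w 0 2 3 5 + w 0 1 4 5 + w 0 1 3 6)"

lemma bform_int_values: "\<forall>i\<in>set [0..<7]. \<forall>j\<in>set [0..<7]. bform_int i j = (if i = j then 6 else 0)"
  by code_simp

context
  fixes es :: "'e::euclidean_space list" and P Q A B \<phi>
  assumes dim: "DIM('e) = 7" and std: "g2_std es P Q A B"
  defines "\<phi> \<equiv> \<lambda>vs. P vs + Q vs"
begin

lemma std_len: "length es = 7" and std_span: "spanning es"
  and std_tables: "has_table es 3 P tabP" "has_table es 3 Q tabQ" "has_table es 4 A tabA" "has_table es 4 B tabB"
  using std by (auto simp: g2_std_def)

lemma phi_table: "has_table es 3 \<phi> (\<lambda>is. tabP is + tabQ is)"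
  using std_tables(1,2) by (auto simp: has_table_def \<phi>_def alt_form_add)

lemma phi_alt: "alt_form 3 \<phi>"
  using phi_table by (simp add: has_table_def)

lemma phi_value:
  "a < 7 \<Longrightarrow> b < 7 \<Longrightarrow> c < 7 \<Longrightarrow> \<phi> [es ! a, es ! b, es ! c] = of_int (phi_int a b c)"
  using has_table_value[OF phi_table, of "[a, b, c]"] std_len phi_int by simp

definition bform :: "'e \<Rightarrow> 'e \<Rightarrow> 'e list \<Rightarrow> real" where
  "bform Y Z vs = - (1 / 6) * wedge 4 3 (wedge 2 2 (interior_product Y \<phi>) (interior_product Z \<phi>)) \<phi> vs"

lemma alt_interior: "alt_form 2 (interior_product Y \<phi>)"
  using alt_form_interior_product[of 2 \<phi> Y] phi_alt by simp

lemma alt_wedge22: "alt_form 4 (wedge 2 2 (interior_product Y \<phi>) (interior_product Z \<phi>))"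
  using alt_form_wedge[OF alt_interior alt_interior] by simp

lemma alt_bform: "alt_form 7 (bform Y Z)"
  unfolding bform_def[abs_def] by (rule alt_form_mult) (use alt_form_wedge[OF alt_wedge22 phi_alt] in simp)

lemma es_list: "es = [es ! 0, es ! 1, es ! 2, es ! 3, es ! 4, es ! 5, es ! 6]"
  by (rule nth_equalityI) (auto simp: std_len less_Suc_eq numeral_eq_Suc)

lemma bform_es:
  "bform Y Z es = (let w = (\<lambda>a b c d. wedge 2 2 (interior_product Y \<phi>) (interior_product Z \<phi>) [es ! a, es ! b, es ! c, es ! d])
     in (w 3 4 5 6 + w 1 2 5 6 + w 1 2 3 4 - w 0 2 4 6 + w 0 2 3 5 + w 0 1 4 5 + w 0 1 3 6) / 6)"
proof -
  show ?thesis
    apply (subst es_list)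
    apply (simp only: bform_def wedge_4_3[OF alt_wedge22 phi_alt])
    apply (simp add: phi_value phi_int_def Let_def del: One_nat_def)
    apply (simp add: field_simps)
    done
qed

lemma bform_bilinear:
  "bform (x + y) Z es = bform x Z es + bform y Z es" "bform (c *\<^sub>R x) Z es = c * bform x Z es"
  "bform Z (x + y) es = bform Z x es + bform Z y es" "bform Z (c *\<^sub>R x) es = c * bform Z x es"
  by (simp_all only: bform_es Let_def wedge_2_2[OF alt_interior alt_interior])
     (simp_all only: interior_product_def alt_form_3_hd[OF phi_alt], simp_all add: field_simps)

lemma bform_values: "i < 7 \<Longrightarrow> j < 7 \<Longrightarrow> bform (es ! i) (es ! j) es = (if i = j then 1 else 0)"
proof -
  assume ij: "i < 7" "j < 7"
  have "bform (es ! i) (es ! j) es = of_int (bform_int i j) / 6"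
    by (simp only: bform_es Let_def wedge_2_2[OF alt_interior alt_interior])
       (simp add: interior_product_def phi_value ij bform_int_def wedge_int_def Let_def del: One_nat_def)
  then show ?thesis using bform_int_values[rule_format, of i j] ij by (cases "i = j") simp_all
qed

text \<open>For fixed \<open>Y\<close>, \<open>Z\<close> the form \<open>bform Y Z\<close> has top
  degree, so it is its value on \<open>es\<close> times the top form \<open>v\<close> with
  \<open>v es = 1\<close>. That value, as a function of \<open>Y\<close> and \<open>Z\<close>, is
  the metric, and the table makes \<open>es\<close> orthonormal for it.\<close>

lemma g2_std_induces:
  obtains g v where "frame g es" "alt_form 7 v" "v es = 1" "g2_induces \<phi> g v"
proof -
  define g where "g Y Z = bform Y Z es" for Y Z
  define v where "v = bform (es ! 0) (es ! 0)"
  have lin: "linear (\<lambda>u. g u w)" "linear (g w)" for w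
    unfolding g_def by (auto intro!: linearI simp: bform_bilinear)
  have val: "g (es ! i) (es ! j) = (if i = j then 1 else 0)" if "i < 7" "j < 7" for i j
    using bform_values[OF that] by (simp add: g_def)
  have coord: "\<exists>c. u = (\<Sum>i<7. c i *\<^sub>R es ! i)" for u
    using std_span std_len by (simp add: spanning_def)
  have sum: "g (\<Sum>i<7. c i *\<^sub>R es ! i) (\<Sum>i<7. d i *\<^sub>R es ! i) = (\<Sum>i<7. c i * d i)" for c d
  proof -
    have "g (\<Sum>i<7. c i *\<^sub>R es ! i) (\<Sum>i<7. d i *\<^sub>R es ! i) = (\<Sum>i<7. c i * (\<Sum>j<7. d j * g (es ! i) (es ! j)))"
      by (simp only: linear_sum[OF lin(1)] linear_cmul[OF lin(1)])
         (simp add: linear_sum[OF lin(2)] linear_cmul[OF lin(2)])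
    also have "\<dots> = (\<Sum>i<7. c i * (\<Sum>j<7. if i = j then d i else 0))"
      by (intro sum.cong refl arg_cong2[where f = times]) (auto simp: val)
    finally show ?thesis by simp
  qed
  have ip: "inner_product g"
    unfolding inner_product_def
  proof (intro conjI allI impI lin(2))
    fix u w
    obtain c d where "u = (\<Sum>i<7. c i *\<^sub>R es ! i)" "w = (\<Sum>i<7. d i *\<^sub>R es ! i)" using coord by meson
    then show "g u w = g w u" by (simp only: sum) (simp add: mult.commute)
  next
    fix u :: 'e assume "u \<noteq> 0"
    obtain c where u: "u = (\<Sum>i<7. c i *\<^sub>R es ! i)" using coord by meson
    with \<open>u \<noteq> 0\<close> obtain i where i: "i < 7" "c i \<noteq> 0" by (metis (no_types, lifting) lessThan_iff scaleR_zero_left sum.neutral)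
    have "0 < (\<Sum>i<7. c i * c i)" by (rule sum_pos2[of _ i]) (use i in \<open>auto simp: zero_less_mult_iff\<close>)
    then show "0 < g u u" unfolding u sum .
  qed
  then have f: "frame g es" unfolding frame_def dim using std_len val by simp
  have v: "alt_form 7 v" "v es = 1" using alt_bform bform_values[of 0 0] by (simp_all add: v_def)
  have "g2_induces \<phi> g v"
    unfolding g2_induces_def
  proof (intro conjI allI ip volume_form_of_frame[OF f])
    fix Y Z vs
    have "bform Y Z = (\<lambda>vs. g Y Z * v vs)"
      by (rule alt_form_eq_spanning[OF std_span alt_bform alt_form_mult[OF v(1)]])
         (use std_len v(2) map_nth[of es] in \<open>auto dest!: incs_7 simp: g_def\<close>)
    then show "- (1 / 6) * wedge 4 3 (wedge 2 2 (interior_product Y \<phi>) (interior_product Z \<phi>)) \<phi> vs = g Y Z * v vs"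
      unfolding bform_def by meson
  qed (use v dim in simp_all)
  with f v that show ?thesis by blast
qed

lemma g2_std_hodge:
  obtains g v where "frame g es" "alt_form 7 v" "g2_induces \<phi> g v" "g2_metric \<phi> = g" "g2_vol \<phi> = v"
    "hodge 3 g v P = A" "hodge 3 g v Q = B" "hodge 4 g v A = P" "hodge 4 g v B = Q"
proof -
  obtain g v where gv: "frame g es" "alt_form 7 v" "v es = 1" "g2_induces \<phi> g v" by (rule g2_std_induces)
  have "g2_metric \<phi> = g" "g2_vol \<phi> = v"
    unfolding g2_metric_def g2_vol_def
    by (rule the_equality; use g2_induces_unique[OF dim gv(4,1,3)] gv(4) in blast)+
  moreover have "hodge 3 g v P = A" "hodge 3 g v Q = B"
    by (rule hodge_table[OF dim gv(1-3) _ std_tables(1,3) table_PA], simp)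
       (rule hodge_table[OF dim gv(1-3) _ std_tables(2,4) table_QB], simp)
  moreover have "hodge 4 g v A = P" "hodge 4 g v B = Q"
    by (rule hodge_table[OF dim gv(1-3) _ std_tables(3,1) table_AP], simp)
       (rule hodge_table[OF dim gv(1-3) _ std_tables(4,2) table_BQ], simp)
  ultimately show ?thesis using that gv by blast
qed

end

section \<open>The star of a product with a one-form\<close>

lemma hodge_add:
  "hodge k g v (\<lambda>vs. \<alpha> vs + \<beta> vs) ws = hodge k g v \<alpha> ws + hodge k g v \<beta> ws"
  by (simp add: hodge_def algebra_simps sum.distrib add_divide_distrib)

lemma hodge_diff:
  "hodge k g v (\<lambda>vs. \<alpha> vs - \<beta> vs) ws = hodge k g v \<alpha> ws - hodge k g v \<beta> ws"
  by (simp add: hodge_def algebra_simps sum_subtractf diff_divide_distrib)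

text \<open>The product \<xi> \<and> \<beta> with \<xi> as a function of vectors, expanded along the
  slot fed to \<xi>. Its shape is that of \<open>ext_deriv\<close>, which turns the Leibniz rules
  below into term-by-term identities.\<close>

definition one_wedge :: "nat \<Rightarrow> ('e \<Rightarrow> real) \<Rightarrow> ('e list \<Rightarrow> real) \<Rightarrow> 'e list \<Rightarrow> real" where
  "one_wedge k \<xi> \<beta> vs = (if length vs = Suc k then
      (\<Sum>i\<le>k. (- 1) ^ i * (\<xi> (vs ! i) * \<beta> (take i vs @ drop (Suc i) vs))) else 0)"

lemma one_wedge_simps:
  "one_wedge 2 \<xi> \<beta> [a, b, c] = \<xi> a * \<beta> [b, c] - \<xi> b * \<beta> [a, c] + \<xi> c * \<beta> [a, b]"
  "one_wedge 3 \<xi> \<beta> [a, b, c, d] = \<xi> a * \<beta> [b, c, d] - \<xi> b * \<beta> [a, c, d] + \<xi> c * \<beta> [a, b, d] - \<xi> d * \<beta> [a, b, c]"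
  by (simp_all add: one_wedge_def numeral_eq_Suc)

lemma sum_lists_3:
  "finite A \<Longrightarrow> (\<Sum>bs | set bs \<subseteq> A \<and> length bs = 3. f bs) = (\<Sum>a\<in>A. \<Sum>b\<in>A. \<Sum>c\<in>A. f [a, b, c])"
proof -
  assume A: "finite A"
  have e: "{bs. set bs \<subseteq> A \<and> length bs = 0} = {[]}" by auto
  show ?thesis unfolding numeral_3_eq_3 sum_lists_Suc[OF A] e by simp
qed

lemma sum_lists_4:
  "finite A \<Longrightarrow> (\<Sum>bs | set bs \<subseteq> A \<and> length bs = 4. f bs) = (\<Sum>a\<in>A. \<Sum>b\<in>A. \<Sum>c\<in>A. \<Sum>d\<in>A. f [a, b, c, d])"
proof -
  assume A: "finite A"
  have "(4::nat) = Suc 3" by simp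
  show ?thesis unfolding \<open>4 = Suc 3\<close> sum_lists_Suc[OF A] sum_lists_3[OF A] ..
qed

text \<open>\<open>\<star>(\<xi> \<and> \<beta>) = - \<xi>\<^sup>\<sharp> \<lrcorner> \<star>\<beta>\<close> for a three-form in dimension seven.\<close>

lemma hodge_one_wedge:
  fixes v :: "'e::euclidean_space list \<Rightarrow> real"
  assumes d: "DIM('e) = 7" and f: "frame g es" and v: "alt_form 7 v" and b: "alt_form 3 \<beta>" and x: "linear \<xi>"
    and ow: "alt_form 4 (one_wedge 3 \<xi> \<beta>)" and ws: "length ws = 3"
  shows "hodge 4 g v (one_wedge 3 \<xi> \<beta>) ws = - hodge 3 g v \<beta> ((\<Sum>i<7. \<xi> (es ! i) *\<^sub>R es ! i) # ws)"
proof -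
  let ?e = "(!) es" and ?S = "\<lambda>f. \<Sum>a<7. \<Sum>b<7. \<Sum>c<7. \<Sum>d<7. f a b c d :: real"
  let ?F = "\<lambda>a b c d. \<xi> (?e d) * (\<beta> [?e a, ?e b, ?e c] * v ([?e a, ?e b, ?e c, ?e d] @ ws))"
  \<comment> \<open>Rotations that bring the index paired with \<xi> to the last of the four slots,
    so that all four terms of the expansion become the same sum after renaming.\<close>
  have sw: "v ([a, b, c, d] @ ws) = - v ([b, c, d, a] @ ws)"
      "v ([a, b, c, d] @ ws) = v ([a, c, d, b] @ ws)" "v ([a, b, c, d] @ ws) = - v ([a, b, d, c] @ ws)" for a b c d
    using alt_form_swap[OF v, of "[]" a b "[c, d] @ ws"] alt_form_swap[OF v, of "[b]" a c "[d] @ ws"]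
      alt_form_swap[OF v, of "[b, c]" a d "ws"] alt_form_swap[OF v, of "[a]" b c "[d] @ ws"]
      alt_form_swap[OF v, of "[a, c]" b d "ws"] alt_form_swap[OF v, of "[a, b]" c d "ws"] by auto
  have T: "hodge 3 g v \<beta> ((\<Sum>i<7. \<xi> (es ! i) *\<^sub>R es ! i) # ws) = ?S ?F / 6"
  proof -
    have l: "v ([a, b, c] @ (\<Sum>i<7. \<xi> (es ! i) *\<^sub>R es ! i) # ws) = (\<Sum>i<7. \<xi> (es ! i) * v ([a, b, c, ?e i] @ ws))" for a b c
    proof -
      interpret l: linear "\<lambda>u. v ([a, b, c] @ u # ws)" by (rule alt_form_linear_mid[OF v]) (simp add: ws)
      show ?thesis using l.sum[of "\<lambda>i. \<xi> (es ! i) *\<^sub>R es ! i" "{..<7}"] l.scale by simp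
    qed
    have "hodge 3 g v \<beta> ((\<Sum>i<7. \<xi> (es ! i) *\<^sub>R es ! i) # ws) =
      (\<Sum>a<7. \<Sum>b<7. \<Sum>c<7. \<beta> [?e a, ?e b, ?e c] * v ([?e a, ?e b, ?e c] @ (\<Sum>i<7. \<xi> (es ! i) *\<^sub>R es ! i) # ws)) / fact 3"
      using hodge_frame_sum[OF f _ b, of v] v d ws by (simp add: sum_lists_3)
    also have "\<dots> = ?S ?F / 6"
      by (simp only: l sum_distrib_left) (simp add: fact_numeral mult.left_commute)
    finally show ?thesis .
  qed
  have r1: "?S (\<lambda>a b c d. \<xi> (?e a) * \<beta> [?e b, ?e c, ?e d] * v ([?e a, ?e b, ?e c, ?e d] @ ws)) = - ?S ?F"
  proof -
    have "?S (\<lambda>a b c d. \<xi> (?e a) * \<beta> [?e b, ?e c, ?e d] * v ([?e a, ?e b, ?e c, ?e d] @ ws)) = ?S (\<lambda>a b c d. - ?F b c d a)"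
      by (intro sum.cong refl) (subst sw(1), simp)
    also have "\<dots> = (\<Sum>b<7. \<Sum>a<7. \<Sum>c<7. \<Sum>d<7. - ?F b c d a)" by (rule sum.swap)
    also have "\<dots> = (\<Sum>b<7. \<Sum>c<7. \<Sum>a<7. \<Sum>d<7. - ?F b c d a)" by (rule sum.cong[OF refl], rule sum.swap)
    also have "\<dots> = (\<Sum>b<7. \<Sum>c<7. \<Sum>d<7. \<Sum>a<7. - ?F b c d a)" by (rule sum.cong[OF refl], rule sum.cong[OF refl], rule sum.swap)
    finally show ?thesis by (simp only: sum_negf)
  qed
  have r2: "?S (\<lambda>a b c d. \<xi> (?e b) * \<beta> [?e a, ?e c, ?e d] * v ([?e a, ?e b, ?e c, ?e d] @ ws)) = ?S ?F"
  proof -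
    have "?S (\<lambda>a b c d. \<xi> (?e b) * \<beta> [?e a, ?e c, ?e d] * v ([?e a, ?e b, ?e c, ?e d] @ ws)) = ?S (\<lambda>a b c d. ?F a c d b)"
      by (intro sum.cong refl) (subst sw(2), simp)
    also have "\<dots> = (\<Sum>a<7. \<Sum>c<7. \<Sum>b<7. \<Sum>d<7. ?F a c d b)" by (rule sum.cong[OF refl], rule sum.swap)
    also have "\<dots> = (\<Sum>a<7. \<Sum>c<7. \<Sum>d<7. \<Sum>b<7. ?F a c d b)" by (rule sum.cong[OF refl], rule sum.cong[OF refl], rule sum.swap)
    finally show ?thesis .
  qed
  have r3: "?S (\<lambda>a b c d. \<xi> (?e c) * \<beta> [?e a, ?e b, ?e d] * v ([?e a, ?e b, ?e c, ?e d] @ ws)) = - ?S ?F"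
  proof -
    have "?S (\<lambda>a b c d. \<xi> (?e c) * \<beta> [?e a, ?e b, ?e d] * v ([?e a, ?e b, ?e c, ?e d] @ ws)) = ?S (\<lambda>a b c d. - ?F a b d c)"
      by (intro sum.cong refl) (subst sw(3), simp)
    also have "\<dots> = (\<Sum>a<7. \<Sum>b<7. \<Sum>d<7. \<Sum>c<7. - ?F a b d c)" by (rule sum.cong[OF refl], rule sum.cong[OF refl], rule sum.swap)
    finally show ?thesis by (simp only: sum_negf)
  qed
  have r4: "?S (\<lambda>a b c d. \<xi> (?e d) * \<beta> [?e a, ?e b, ?e c] * v ([?e a, ?e b, ?e c, ?e d] @ ws)) = ?S ?F"
    by (simp only: mult.assoc)
  have "hodge 4 g v (one_wedge 3 \<xi> \<beta>) ws =
    ?S (\<lambda>a b c d. one_wedge 3 \<xi> \<beta> [?e a, ?e b, ?e c, ?e d] * v ([?e a, ?e b, ?e c, ?e d] @ ws)) / fact 4"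
    using hodge_frame_sum[OF f _ ow, of v] v d ws by (simp add: sum_lists_4)
  also have "?S (\<lambda>a b c d. one_wedge 3 \<xi> \<beta> [?e a, ?e b, ?e c, ?e d] * v ([?e a, ?e b, ?e c, ?e d] @ ws)) =
      ?S (\<lambda>a b c d. \<xi> (?e a) * \<beta> [?e b, ?e c, ?e d] * v ([?e a, ?e b, ?e c, ?e d] @ ws))
    - ?S (\<lambda>a b c d. \<xi> (?e b) * \<beta> [?e a, ?e c, ?e d] * v ([?e a, ?e b, ?e c, ?e d] @ ws))
    + ?S (\<lambda>a b c d. \<xi> (?e c) * \<beta> [?e a, ?e b, ?e d] * v ([?e a, ?e b, ?e c, ?e d] @ ws))
    - ?S (\<lambda>a b c d. \<xi> (?e d) * \<beta> [?e a, ?e b, ?e c] * v ([?e a, ?e b, ?e c, ?e d] @ ws))"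
    by (simp only: one_wedge_simps sum.distrib sum_subtractf left_diff_distrib distrib_right)
  \<comment> \<open>The four equal contributions reconcile the normalisations: 4 / 4! = 1 /
    3!.\<close>
  also have "\<dots> = - 4 * ?S ?F" unfolding r1 r2 r3 r4 by simp
  finally show ?thesis unfolding T by (simp add: fact_numeral)
qed

section \<open>Functions of class \<open>C\<^sup>k\<close>\<close>

lemma Ck_on_SucI:
  "(\<And>x. x \<in> S \<Longrightarrow> (f has_derivative f' x) (at x within S)) \<Longrightarrow> (\<And>v. Ck_on k S (\<lambda>x. f' x v)) \<Longrightarrow> Ck_on (Suc k) S f"
  by auto

lemma Ck_on_SucE:
  assumes "Ck_on (Suc k) S f"
  obtains f' where "\<And>x. x \<in> S \<Longrightarrow> (f has_derivative f' x) (at x within S)" "\<And>v. Ck_on k S (\<lambda>x. f' x v)"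
  using assms by auto

lemma Ck_on_lower: "Ck_on (Suc k) S f \<Longrightarrow> Ck_on k S f"
proof (induction k arbitrary: f)
  case 0
  then show ?case by (auto simp: continuous_on_eq_continuous_within intro: has_derivative_continuous)
next
  case (Suc k)
  then show ?case by (elim Ck_on_SucE) (rule Ck_on_SucI, auto)
qed

lemma Ck_on_mono: "Ck_on k S f \<Longrightarrow> l \<le> k \<Longrightarrow> Ck_on l S f"
  by (induction k) (auto simp: le_Suc_eq dest: Ck_on_lower simp del: Ck_on.simps(2))

lemma Ck_on_continuous: "Ck_on k S f \<Longrightarrow> continuous_on S f"
  using Ck_on_mono[of k S f 0] by simp

lemma Ck_on_cong:
  assumes "\<And>x. x \<in> S \<Longrightarrow> f x = g x" "Ck_on k S f" shows "Ck_on k S g"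
proof (cases k)
  case 0
  with assms show ?thesis by (simp cong: continuous_on_cong)
next
  case (Suc l)
  with assms(2) obtain f' where f': "\<And>x. x \<in> S \<Longrightarrow> (f has_derivative f' x) (at x within S)"
    "\<And>v. Ck_on l S (\<lambda>x. f' x v)" by (auto elim: Ck_on_SucE)
  have "(g has_derivative f' x) (at x within S)" if "x \<in> S" for x
    by (rule has_derivative_transform[OF that _ f'(1)[OF that]]) (simp add: assms(1))
  from this f'(2) show ?thesis unfolding Suc by (rule Ck_on_SucI)
qed

lemma Ck_on_subset: "Ck_on k S f \<Longrightarrow> T \<subseteq> S \<Longrightarrow> Ck_on k T f"
proof (induction k arbitrary: f)
  case (Suc k)
  then show ?case by (elim Ck_on_SucE) (rule Ck_on_SucI, auto intro: has_derivative_subset)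
qed (auto intro: continuous_on_subset)

lemma Ck_on_const: "Ck_on k S (\<lambda>_. c)"
proof (induction k arbitrary: c)
  case (Suc k)
  then show ?case by (intro Ck_on_SucI[where f' = "\<lambda>_ _. 0"] has_derivative_const)
qed simp

lemma Ck_on_bounded_linear:
  assumes L: "bounded_linear L" shows "Ck_on k S f \<Longrightarrow> Ck_on k S (\<lambda>x. L (f x))"
proof (induction k arbitrary: f)
  case 0 then show ?case using bounded_linear.continuous_on[OF L] by simp
next
  case (Suc k)
  then show ?case
    by (elim Ck_on_SucE) (rule Ck_on_SucI, auto intro: bounded_linear.has_derivative[OF L])
qed

lemma Ck_on_linear: "bounded_linear L \<Longrightarrow> Ck_on k S L"
  by (cases k) (auto intro!: Ck_on_SucI Ck_on_const bounded_linear_imp_has_derivative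
     linear_continuous_on simp del: Ck_on.simps(2))

lemma Ck_on_add: "Ck_on k S f \<Longrightarrow> Ck_on k S g \<Longrightarrow> Ck_on k S (\<lambda>x. f x + g x)"
proof (induction k arbitrary: f g)
  case 0 then show ?case by (simp add: continuous_on_add)
next
  case (Suc k)
  from Suc.prems obtain f' g' where
    "\<And>x. x \<in> S \<Longrightarrow> (f has_derivative f' x) (at x within S)" "\<And>v. Ck_on k S (\<lambda>x. f' x v)"
    "\<And>x. x \<in> S \<Longrightarrow> (g has_derivative g' x) (at x within S)" "\<And>v. Ck_on k S (\<lambda>x. g' x v)"
    by (elim Ck_on_SucE) blast
  then show ?case
    by (intro Ck_on_SucI[where f' = "\<lambda>x v. f' x v + g' x v"] has_derivative_add Suc.IH)
qed

lemma Ck_on_bilinear: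
  assumes p: "bounded_bilinear p"
  shows "Ck_on k S f \<Longrightarrow> Ck_on k S g \<Longrightarrow> Ck_on k S (\<lambda>x. p (f x) (g x))"
proof (induction k arbitrary: f g)
  case 0 then show ?case by (simp add: bounded_bilinear.continuous_on[OF p])
next
  case (Suc k)
  from Suc.prems obtain f' g' where d:
    "\<And>x. x \<in> S \<Longrightarrow> (f has_derivative f' x) (at x within S)" "\<And>v. Ck_on k S (\<lambda>x. f' x v)"
    "\<And>x. x \<in> S \<Longrightarrow> (g has_derivative g' x) (at x within S)" "\<And>v. Ck_on k S (\<lambda>x. g' x v)"
    by (elim Ck_on_SucE) blast
  show ?case
  proof (rule Ck_on_SucI[where f' = "\<lambda>x v. p (f x) (g' x v) + p (f' x v) (g x)"])
    show "Ck_on k S (\<lambda>x. p (f x) (g' x v) + p (f' x v) (g x))" for v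
      using Suc.prems[THEN Ck_on_lower] by (intro Ck_on_add Suc.IH d)
  qed (intro bounded_bilinear.FDERIV[OF p] d)
qed

lemmas Ck_on_mult = Ck_on_bilinear[OF bounded_bilinear_mult]
lemmas Ck_on_scaleR = Ck_on_bilinear[OF bounded_bilinear_scaleR]

lemma Ck_on_minus: "Ck_on k S f \<Longrightarrow> Ck_on k S (\<lambda>x. - f x)"
  by (rule Ck_on_bounded_linear[OF bounded_linear_minus[OF bounded_linear_ident]])

lemma Ck_on_diff: "Ck_on k S f \<Longrightarrow> Ck_on k S g \<Longrightarrow> Ck_on k S (\<lambda>x. f x - g x)"
  using Ck_on_add[OF _ Ck_on_minus, of k S f g] by simp

lemma Ck_on_sum: "(\<And>i. i \<in> I \<Longrightarrow> Ck_on k S (f i)) \<Longrightarrow> Ck_on k S (\<lambda>x. \<Sum>i\<in>I. f i x)"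
  by (induction I rule: infinite_finite_induct) (auto intro: Ck_on_const Ck_on_add)

lemma Ck_on_prod:
  fixes f :: "'i \<Rightarrow> 'a::real_normed_vector \<Rightarrow> 'b::{real_normed_algebra_1, comm_monoid_mult}"
  shows "(\<And>i. i \<in> I \<Longrightarrow> Ck_on k S (f i)) \<Longrightarrow> Ck_on k S (\<lambda>x. \<Prod>i\<in>I. f i x)"
  by (induction I rule: infinite_finite_induct) (auto intro: Ck_on_const Ck_on_mult)

lemma Ck_on_Pair: "Ck_on k S f \<Longrightarrow> Ck_on k S g \<Longrightarrow> Ck_on k S (\<lambda>x. (f x, g x))"
proof -
  assume "Ck_on k S f" "Ck_on k S g"
  moreover have "bounded_linear (\<lambda>a :: 'b. (a, 0 :: 'c))" "bounded_linear (\<lambda>b :: 'c. (0 :: 'b, b))"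
    by (auto intro: bounded_linear_Pair bounded_linear_ident bounded_linear_zero)
  ultimately have "Ck_on k S (\<lambda>x. (f x, 0) + (0, g x))"
    by (intro Ck_on_add) (auto intro: Ck_on_bounded_linear)
  then show ?thesis by simp
qed

text \<open>The derivative g'(f x)(f' x v) depends on x both through the base point and through the
  direction. Expanding the direction in \<open>Basis\<close> separates the two into a sum of
  products, to which the induction hypothesis applies.\<close>

lemma Ck_on_compose:
  fixes f :: "'a::real_normed_vector \<Rightarrow> 'b::euclidean_space" and g :: "'b \<Rightarrow> 'c::real_normed_vector"
  shows "Ck_on k T g \<Longrightarrow> Ck_on k S f \<Longrightarrow> f ` S \<subseteq> T \<Longrightarrow> Ck_on k S (\<lambda>x. g (f x))"
proof (induction k arbitrary: g)
  case 0 then show ?case by (simp add: continuous_on_compose2)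
next
  case (Suc k)
  from Suc.prems obtain f' g' where d:
    "\<And>x. x \<in> S \<Longrightarrow> (f has_derivative f' x) (at x within S)" "\<And>v. Ck_on k S (\<lambda>x. f' x v)"
    "\<And>x. x \<in> T \<Longrightarrow> (g has_derivative g' x) (at x within T)" "\<And>v. Ck_on k T (\<lambda>x. g' x v)"
    by (elim Ck_on_SucE) blast
  show ?case
  proof (rule Ck_on_SucI)
    fix x assume x: "x \<in> S"
    have fx: "f x \<in> T" using x Suc.prems by auto
    have "((\<lambda>x. g (f x)) has_derivative (\<lambda>v. g' (f x) (f' x v))) (at x within S)"
      by (rule has_derivative_in_compose2[OF d(3) Suc.prems(3) x d(1)[OF x]])
    moreover have "g' (f x) w = (\<Sum>b\<in>Basis. (w \<bullet> b) *\<^sub>R g' (f x) b)" for w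
    proof -
      interpret l: linear "g' (f x)" using d(3)[OF fx] has_derivative_linear by blast
      have "g' (f x) w = g' (f x) (\<Sum>b\<in>Basis. (w \<bullet> b) *\<^sub>R b)" by (simp add: euclidean_representation)
      then show ?thesis by (simp only: l.sum l.scale)
    qed
    then have "(\<lambda>v. g' (f x) (f' x v)) = (\<lambda>v. \<Sum>b\<in>Basis. (f' x v \<bullet> b) *\<^sub>R g' (f x) b)" by (intro ext)
    ultimately show "((\<lambda>x. g (f x)) has_derivative (\<lambda>v. \<Sum>b\<in>Basis. (f' x v \<bullet> b) *\<^sub>R g' (f x) b)) (at x within S)"
      by (simp only:)
  next
    fix v
    show "Ck_on k S (\<lambda>x. \<Sum>b\<in>Basis. (f' x v \<bullet> b) *\<^sub>R g' (f x) b)"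
      by (intro Ck_on_sum Ck_on_scaleR Suc.IH[OF d(4)] Ck_on_bounded_linear[OF bounded_linear_inner_left] d(2)
           Ck_on_lower[OF Suc.prems(2)] Suc.prems(3))
  qed
qed

lemma Ck_on_inverse: "Ck_on k {x::real. x \<noteq> 0} inverse"
proof (induction k)
  case 0 then show ?case by (auto intro!: continuous_intros)
next
  case (Suc k)
  show ?case
    by (rule Ck_on_SucI[where f' = "\<lambda>x v. - (inverse x * v * inverse x)"])
       (auto intro!: has_derivative_inverse' Ck_on_minus Ck_on_mult Suc.IH Ck_on_const)
qed

lemma Ck_on_ln: "Ck_on k {0<..} (ln :: real \<Rightarrow> real)"
proof (cases k)
  case 0 then show ?thesis by (auto intro!: continuous_at_imp_continuous_on DERIV_isCont[OF DERIV_ln])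
next
  case (Suc l)
  have "Ck_on l {0<..} (inverse :: real \<Rightarrow> real)" by (rule Ck_on_subset[OF Ck_on_inverse]) auto
  then have "Ck_on l {0<..} (\<lambda>x :: real. v * inverse x)" for v by (intro Ck_on_mult Ck_on_const)
  then show ?thesis unfolding Suc
    by (intro Ck_on_SucI[where f' = "\<lambda>x v. v * inverse x"])
       (auto intro!: derivative_eq_intros simp: divide_inverse)
qed

lemma Ck_on_sqrt: "Ck_on k {0<..} sqrt"
proof (induction k)
  case 0 then show ?case by (auto intro!: continuous_intros)
next
  case (Suc k)
  have "Ck_on k {0<..} (\<lambda>x. inverse (sqrt x))"
    by (rule Ck_on_compose[OF Ck_on_inverse Suc.IH]) auto
  then have "Ck_on k {0<..} (\<lambda>x. inverse (sqrt x) / 2 * v)" for v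
    using Ck_on_mult[OF _ Ck_on_const[of k "{0<..}" "v / 2"]] by simp
  moreover have "(sqrt has_derivative (\<lambda>v. inverse (sqrt x) / 2 * v)) (at x within {0<..})" if "x \<in> {0<..}" for x
    by (rule has_field_derivative_at_within[OF DERIV_real_sqrt, unfolded has_field_derivative_def])
       (use that in simp)
  ultimately show ?case by (intro Ck_on_SucI[where f' = "\<lambda>x v. inverse (sqrt x) / 2 * v"])
qed

lemma Ck_on_frechet:
  assumes "open S" "Ck_on (Suc k) S f"
  shows "x \<in> S \<Longrightarrow> (f has_derivative fd f x) (at x)"
    and "Ck_on k S (\<lambda>x. fd f x v)"
proof -
  obtain f' where d: "\<And>x. x \<in> S \<Longrightarrow> (f has_derivative f' x) (at x within S)" "\<And>v. Ck_on k S (\<lambda>x. f' x v)"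
    using assms(2) by (elim Ck_on_SucE) blast
  have e: "(f has_derivative f' x) (at x)" if "x \<in> S" for x
    using d(1)[OF that] at_within_open[OF that assms(1)] by simp
  then have f: "fd f x = f' x" if "x \<in> S" for x
    using that by (metis frechet_derivative_at)
  show "x \<in> S \<Longrightarrow> (f has_derivative fd f x) (at x)" using e f by simp
  show "Ck_on k S (\<lambda>x. fd f x v)"
    by (rule Ck_on_cong[OF _ d(2)[of v]]) (simp add: f)
qed

lemma Ck_on_local:
  assumes "\<And>x. x \<in> S \<Longrightarrow> \<exists>U. open U \<and> x \<in> U \<and> U \<subseteq> S \<and> Ck_on k U f"
  shows "Ck_on k S f"
  using assms
proof (induction k arbitrary: f)
  case 0
  have "isCont f x" if "x \<in> S" for x
    using 0[OF that] by (auto simp: continuous_on_eq_continuous_at)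
  then show ?case by (simp add: continuous_at_imp_continuous_on)
next
  case (Suc k)
  have d: "(f has_derivative fd f x) (at x)" if x: "x \<in> S" for x
    using Suc.prems[OF x] Ck_on_frechet(1) by blast
  show ?case
  proof (rule Ck_on_SucI[where f' = "\<lambda>x. fd f x"])
    show "(f has_derivative fd f x) (at x within S)" if x: "x \<in> S" for x
      using d[OF that] has_derivative_at_withinI by blast
    show "Ck_on k S (\<lambda>x. fd f x v)" for v
    proof (rule Suc.IH)
      fix x assume "x \<in> S"
      then obtain U where "open U" "x \<in> U" "U \<subseteq> S" "Ck_on (Suc k) U f" using Suc.prems by blast
      with Ck_on_frechet(2)[OF this(1,4)]
      show "\<exists>U. open U \<and> x \<in> U \<and> U \<subseteq> S \<and> Ck_on k U (\<lambda>x. fd f x v)" by blast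
    qed
  qed
qed

lemma smooth_on_imp_Ck: "smooth_on S f \<Longrightarrow> Ck_on k S f"
  by (simp add: smooth_on_def)

lemma smooth_on_frechet:
  assumes "open S" "smooth_on S f"
  shows "x \<in> S \<Longrightarrow> (f has_derivative fd f x) (at x)"
    and "smooth_on S (\<lambda>x. fd f x v)"
  using Ck_on_frechet(1)[OF assms(1), of 0 f] Ck_on_frechet(2)[OF assms(1), of _ f] assms(2)
  unfolding smooth_on_def by (simp_all del: Ck_on.simps)

lemma smooth_on_local:
  assumes "\<And>x. x \<in> S \<Longrightarrow> \<exists>U. open U \<and> x \<in> U \<and> U \<subseteq> S \<and> smooth_on U f"
  shows "smooth_on S f"
  unfolding smooth_on_def
proof (intro allI, rule Ck_on_local)
  fix k x assume "x \<in> S"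
  with assms show "\<exists>U. open U \<and> x \<in> U \<and> U \<subseteq> S \<and> Ck_on k U f"
    unfolding smooth_on_def by meson
qed

lemma smooth_on_cong: "(\<And>x. x \<in> S \<Longrightarrow> f x = g x) \<Longrightarrow> smooth_on S f \<Longrightarrow> smooth_on S g"
  unfolding smooth_on_def by (intro allI) (rule Ck_on_cong; auto)

lemma smooth_on_compose:
  fixes f :: "'a::real_normed_vector \<Rightarrow> 'b::euclidean_space" and g :: "'b \<Rightarrow> 'c::real_normed_vector"
  shows "smooth_on T g \<Longrightarrow> smooth_on S f \<Longrightarrow> f ` S \<subseteq> T \<Longrightarrow> smooth_on S (\<lambda>x. g (f x))"
  unfolding smooth_on_def by (intro allI) (rule Ck_on_compose; auto)

lemma smooth_on_const: "smooth_on S (\<lambda>_. c)"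
  unfolding smooth_on_def by (intro allI) (rule Ck_on_const; auto)

lemma smooth_on_add: "smooth_on S f \<Longrightarrow> smooth_on S g \<Longrightarrow> smooth_on S (\<lambda>x. f x + g x)"
  and smooth_on_diff: "smooth_on S f \<Longrightarrow> smooth_on S g \<Longrightarrow> smooth_on S (\<lambda>x. f x - g x)"
  and smooth_on_minus: "smooth_on S f \<Longrightarrow> smooth_on S (\<lambda>x. - f x)"
  and smooth_on_Pair: "smooth_on S f \<Longrightarrow> smooth_on S h \<Longrightarrow> smooth_on S (\<lambda>x. (f x, h x))"
  unfolding smooth_on_def by (simp_all add: Ck_on_add Ck_on_diff Ck_on_minus Ck_on_Pair del: Ck_on.simps)

lemma smooth_on_mult:
  fixes f g :: "'a::real_normed_vector \<Rightarrow> 'b::real_normed_algebra"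
  shows "smooth_on S f \<Longrightarrow> smooth_on S g \<Longrightarrow> smooth_on S (\<lambda>x. f x * g x)"
  unfolding smooth_on_def by (intro allI) (rule Ck_on_mult; auto)

lemma smooth_on_scaleR: "smooth_on S f \<Longrightarrow> smooth_on S g \<Longrightarrow> smooth_on S (\<lambda>x. f x *\<^sub>R g x)"
  unfolding smooth_on_def by (intro allI) (rule Ck_on_scaleR; auto)

lemma smooth_on_bounded_linear: "bounded_linear L \<Longrightarrow> smooth_on S f \<Longrightarrow> smooth_on S (\<lambda>x. L (f x))"
  unfolding smooth_on_def by (intro allI) (rule Ck_on_bounded_linear; auto)

lemma smooth_on_linear: "bounded_linear L \<Longrightarrow> smooth_on S L"
  unfolding smooth_on_def by (intro allI) (rule Ck_on_linear; auto)

lemma smooth_on_sum: "(\<And>i. i \<in> I \<Longrightarrow> smooth_on S (f i)) \<Longrightarrow> smooth_on S (\<lambda>x. \<Sum>i\<in>I. f i x)"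
  unfolding smooth_on_def by (intro allI) (rule Ck_on_sum; auto)

lemma smooth_on_prod:
  fixes f :: "'i \<Rightarrow> 'a::real_normed_vector \<Rightarrow> 'b::{real_normed_algebra_1, comm_monoid_mult}"
  shows "(\<And>i. i \<in> I \<Longrightarrow> smooth_on S (f i)) \<Longrightarrow> smooth_on S (\<lambda>x. \<Prod>i\<in>I. f i x)"
  unfolding smooth_on_def by (intro allI) (rule Ck_on_prod; auto)

lemma smooth_on_inverse: "smooth_on S f \<Longrightarrow> (\<And>x. x \<in> S \<Longrightarrow> f x \<noteq> 0) \<Longrightarrow> smooth_on S (\<lambda>x. inverse (f x :: real))"
  by (rule smooth_on_compose[of "{x. x \<noteq> 0}" inverse]) (auto simp: smooth_on_def Ck_on_inverse)

lemma smooth_on_ln: "smooth_on S f \<Longrightarrow> (\<And>x. x \<in> S \<Longrightarrow> f x > 0) \<Longrightarrow> smooth_on S (\<lambda>x. ln (f x :: real))"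
  by (rule smooth_on_compose[of "{0<..}" ln]) (auto simp: smooth_on_def Ck_on_ln)

lemma smooth_on_sqrt: "smooth_on S f \<Longrightarrow> (\<And>x. x \<in> S \<Longrightarrow> f x > 0) \<Longrightarrow> smooth_on S (\<lambda>x. sqrt (f x))"
  by (rule smooth_on_compose[of "{0<..}" sqrt]) (auto simp: smooth_on_def Ck_on_sqrt)

section \<open>Symmetry of second derivatives\<close>

text \<open>The mean value theorem is applied along \<open>h\<close> and then along
  \<open>k\<close>. Only the closed parallelogram at \<open>z0\<close> has to lie in
  \<open>S\<close>, so \<open>z0\<close> may be a boundary point such as one at time 0.\<close>

lemma second_difference:
  fixes f :: "'a::real_normed_vector \<Rightarrow> real"
  assumes d1: "\<And>z. z \<in> S \<Longrightarrow> (f has_derivative f' z) (at z within S)"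
    and d2: "\<And>z. z \<in> S \<Longrightarrow> ((\<lambda>z. f' z h) has_derivative fh z) (at z within S)"
    and S: "\<And>a b. 0 \<le> a \<Longrightarrow> a \<le> s \<Longrightarrow> 0 \<le> b \<Longrightarrow> b \<le> s \<Longrightarrow> z0 + a *\<^sub>R h + b *\<^sub>R k \<in> S"
    and s: "s > 0"
  shows "\<exists>a b. 0 < a \<and> a < s \<and> 0 < b \<and> b < s \<and>
    f (z0 + s *\<^sub>R h + s *\<^sub>R k) - f (z0 + s *\<^sub>R h) - f (z0 + s *\<^sub>R k) + f z0 = s * (s * fh (z0 + a *\<^sub>R h + b *\<^sub>R k) k)"
proof -
  have lin1: "linear (f' z)" if "z \<in> S" for z using d1[OF that] has_derivative_linear by blast
  have lin2: "linear (fh z)" if "z \<in> S" for z using d2[OF that] has_derivative_linear by blast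
  let ?p = "\<lambda>a b. z0 + a *\<^sub>R h + b *\<^sub>R k"
  have du: "((\<lambda>a. f (?p a b)) has_derivative (\<lambda>t. f' (?p a b) (t *\<^sub>R h))) (at a within {0..s})"
    if "0 \<le> a" "a \<le> s" "0 \<le> b" "b \<le> s" for a b
    by (rule has_derivative_in_compose2[where t = S and g' = f' and f = "\<lambda>a. ?p a b" and f' = "\<lambda>t. t *\<^sub>R h"])
       (use that S d1 in \<open>auto intro!: derivative_eq_intros\<close>)
  have "\<exists>a\<in>{0<..<s}. (f (?p s s) - f (?p s 0)) - (f (?p 0 s) - f (?p 0 0)) =
     f' (?p a s) ((s - 0) *\<^sub>R h) - f' (?p a 0) ((s - 0) *\<^sub>R h)"
  proof (rule mvt_simple[OF s])
    fix a assume "0 \<le> a" "a \<le> s"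
    then show "((\<lambda>a. f (?p a s) - f (?p a 0)) has_derivative (\<lambda>t. f' (?p a s) (t *\<^sub>R h) - f' (?p a 0) (t *\<^sub>R h))) (at a within {0..s})"
      using s by (intro has_derivative_diff du) simp_all
  qed
  then obtain a where a: "0 < a" "a < s" and 1: "(f (?p s s) - f (?p s 0)) - (f (?p 0 s) - f (?p 0 0)) =
     f' (?p a s) (s *\<^sub>R h) - f' (?p a 0) (s *\<^sub>R h)" by auto
  have dv: "((\<lambda>b. f' (?p a b) h) has_derivative (\<lambda>t. fh (?p a b) (t *\<^sub>R k))) (at b within {0..s})"
    if "0 \<le> b" "b \<le> s" for b
    by (rule has_derivative_in_compose2[where t = S and g' = fh and f = "\<lambda>b. ?p a b" and f' = "\<lambda>t. t *\<^sub>R k" and g = "\<lambda>z. f' z h"])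
       (use that S d2 a in \<open>auto intro!: derivative_eq_intros\<close>)
  have "\<exists>b\<in>{0<..<s}. f' (?p a s) h - f' (?p a 0) h = fh (?p a b) ((s - 0) *\<^sub>R k)"
    by (rule mvt_simple[OF s]) (use s in \<open>auto intro!: dv\<close>)
  then obtain b where b: "0 < b" "b < s" and 2: "f' (?p a s) h - f' (?p a 0) h = fh (?p a b) (s *\<^sub>R k)" by auto
  have in_S: "?p a s \<in> S" "?p a 0 \<in> S" "?p a b \<in> S" using a b s by (auto intro!: S simp del: scaleR_zero_left)
  have "f (?p s s) - f (?p s 0) - f (?p 0 s) + f (?p 0 0) = s * (f' (?p a s) h - f' (?p a 0) h)"
    using 1 linear_cmul[OF lin1[OF in_S(1)], of s h] linear_cmul[OF lin1[OF in_S(2)], of s h]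
    by (simp add: algebra_simps)
  also have "\<dots> = s * (s * fh (?p a b) k)" using 2 linear_cmul[OF lin2[OF in_S(3)], of s k] by simp
  finally show ?thesis using a b by auto
qed

text \<open>The second difference divided by s^2 is a mixed second derivative at a nearby point, in
  either order of differentiation. As s tends to 0, continuity brings both to
  \<open>z0\<close>.\<close>

lemma second_derivative_symmetric:
  fixes f :: "'a::real_normed_vector \<Rightarrow> real"
  assumes d1: "\<And>z. z \<in> S \<Longrightarrow> (f has_derivative f' z) (at z within S)"
    and dh: "\<And>z. z \<in> S \<Longrightarrow> ((\<lambda>z. f' z h) has_derivative fh z) (at z within S)"
    and dk: "\<And>z. z \<in> S \<Longrightarrow> ((\<lambda>z. f' z k) has_derivative fk z) (at z within S)"
    and ch: "continuous_on S (\<lambda>z. fh z k)" and ck: "continuous_on S (\<lambda>z. fk z h)"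
    and S: "\<And>a b. 0 \<le> a \<Longrightarrow> a \<le> e \<Longrightarrow> 0 \<le> b \<Longrightarrow> b \<le> e \<Longrightarrow> z0 + a *\<^sub>R h + b *\<^sub>R k \<in> S"
    and e: "e > 0"
  shows "fh z0 k = fk z0 h"
proof -
  define s where "s n = e / real (Suc n)" for n
  have s: "s n > 0" "s n \<le> e" for n using e by (auto simp: s_def field_simps)
  have s0: "s \<longlonglongrightarrow> 0" unfolding s_def using LIMSEQ_Suc[OF lim_const_over_n[of e]] by simp
  have z0: "z0 \<in> S" using S[of 0 0] e by simp
  let ?D = "\<lambda>n. f (z0 + s n *\<^sub>R h + s n *\<^sub>R k) - f (z0 + s n *\<^sub>R h) - f (z0 + s n *\<^sub>R k) + f z0"
  have "\<exists>a b. 0 < a \<and> a < s n \<and> 0 < b \<and> b < s n \<and> ?D n = s n * (s n * fh (z0 + a *\<^sub>R h + b *\<^sub>R k) k)" for n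
    by (rule second_difference[OF d1 dh]) (use s[of n] in \<open>auto intro!: S elim: order_trans\<close>)
  then obtain a b where ab: "\<And>n. 0 < a n \<and> a n < s n \<and> 0 < b n \<and> b n < s n \<and>
    ?D n = s n * (s n * fh (z0 + a n *\<^sub>R h + b n *\<^sub>R k) k)" by metis
  have "\<exists>a b. 0 < a \<and> a < s n \<and> 0 < b \<and> b < s n \<and>
     f (z0 + s n *\<^sub>R k + s n *\<^sub>R h) - f (z0 + s n *\<^sub>R k) - f (z0 + s n *\<^sub>R h) + f z0 = s n * (s n * fk (z0 + a *\<^sub>R k + b *\<^sub>R h) h)" for n
  proof (rule second_difference[OF d1 dk])
    fix a b :: real assume "0 \<le> a" "a \<le> s n" "0 \<le> b" "b \<le> s n"
    then have "z0 + b *\<^sub>R h + a *\<^sub>R k \<in> S" using s(2)[of n] by (intro S) auto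
    then show "z0 + a *\<^sub>R k + b *\<^sub>R h \<in> S" by (simp add: add_ac)
  qed (use s in auto)
  then obtain c d where cd: "\<And>n. 0 < c n \<and> c n < s n \<and> 0 < d n \<and> d n < s n \<and>
    f (z0 + s n *\<^sub>R k + s n *\<^sub>R h) - f (z0 + s n *\<^sub>R k) - f (z0 + s n *\<^sub>R h) + f z0 = s n * (s n * fk (z0 + c n *\<^sub>R k + d n *\<^sub>R h) h)" by metis
  have lim0: "u \<longlonglongrightarrow> 0" if "\<And>n. 0 < u n \<and> u n < s n" for u :: "nat \<Rightarrow> real"
    by (rule tendsto_sandwich[OF _ _ tendsto_const s0]) (use that in \<open>auto intro!: always_eventually less_imp_le\<close>)
  have "(\<lambda>n. fh (z0 + a n *\<^sub>R h + b n *\<^sub>R k) k) \<longlonglongrightarrow> fh z0 k"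
  proof (rule continuous_on_tendsto_compose[OF ch _ z0])
    have "(\<lambda>n. z0 + a n *\<^sub>R h + b n *\<^sub>R k) \<longlonglongrightarrow> z0 + 0 *\<^sub>R h + 0 *\<^sub>R k"
      by (intro tendsto_intros lim0) (use ab in auto)
    then show "(\<lambda>n. z0 + a n *\<^sub>R h + b n *\<^sub>R k) \<longlonglongrightarrow> z0" by simp
    show "\<forall>\<^sub>F n in sequentially. z0 + a n *\<^sub>R h + b n *\<^sub>R k \<in> S"
      by (intro always_eventually allI S) (use ab s in \<open>meson less_imp_le less_le_trans\<close>)+
  qed
  moreover have "(\<lambda>n. fk (z0 + c n *\<^sub>R k + d n *\<^sub>R h) h) \<longlonglongrightarrow> fk z0 h"
  proof (rule continuous_on_tendsto_compose[OF ck _ z0])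
    have "(\<lambda>n. z0 + c n *\<^sub>R k + d n *\<^sub>R h) \<longlonglongrightarrow> z0 + 0 *\<^sub>R k + 0 *\<^sub>R h"
      by (intro tendsto_intros lim0) (use cd in auto)
    then show "(\<lambda>n. z0 + c n *\<^sub>R k + d n *\<^sub>R h) \<longlonglongrightarrow> z0" by simp
    have "z0 + d n *\<^sub>R h + c n *\<^sub>R k \<in> S" for n
      by (intro S) (use cd s in \<open>meson less_imp_le less_le_trans\<close>)+
    then show "\<forall>\<^sub>F n in sequentially. z0 + c n *\<^sub>R k + d n *\<^sub>R h \<in> S"
      by (intro always_eventually allI) (simp add: add_ac)
  qed
  moreover have "fh (z0 + a n *\<^sub>R h + b n *\<^sub>R k) k = fk (z0 + c n *\<^sub>R k + d n *\<^sub>R h) h" for n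
  proof -
    have "s n * (s n * fh (z0 + a n *\<^sub>R h + b n *\<^sub>R k) k) = s n * (s n * fk (z0 + c n *\<^sub>R k + d n *\<^sub>R h) h)"
    proof -
      have e: "z0 + s n *\<^sub>R k + s n *\<^sub>R h = z0 + s n *\<^sub>R h + s n *\<^sub>R k" by (simp add: add_ac)
      show ?thesis using ab[of n] cd[of n] unfolding e by linarith
    qed
    then show ?thesis using s(1)[of n] by simp
  qed
  ultimately show ?thesis using LIMSEQ_unique by simp
qed

lemma second_derivative_symmetric_euclidean:
  fixes f :: "'a::real_normed_vector \<Rightarrow> 'b::euclidean_space"
  assumes d1: "\<And>z. z \<in> S \<Longrightarrow> (f has_derivative f' z) (at z within S)"
    and d2: "\<And>z h. z \<in> S \<Longrightarrow> ((\<lambda>z. f' z h) has_derivative f'' h z) (at z within S)"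
    and c: "\<And>h k. continuous_on S (\<lambda>z. f'' h z k)"
    and S: "\<And>a b. 0 \<le> a \<Longrightarrow> a \<le> e \<Longrightarrow> 0 \<le> b \<Longrightarrow> b \<le> e \<Longrightarrow> z0 + a *\<^sub>R h + b *\<^sub>R k \<in> S"
    and e: "e > 0"
  shows "f'' h z0 k = f'' k z0 h"
proof (rule euclidean_eqI)
  fix b :: 'b
  show "f'' h z0 k \<bullet> b = f'' k z0 h \<bullet> b"
    by (rule second_derivative_symmetric[where f = "\<lambda>z. f z \<bullet> b" and f' = "\<lambda>z h. f' z h \<bullet> b" and S = S, OF _ _ _ _ _ S e])
       (auto intro!: has_derivative_inner_left d1 d2 continuous_on_inner c continuous_on_const)
qed

section \<open>Differentiating an alternating form along with its arguments\<close>

text \<open>The product rule for a multilinear expression in which the form and all its arguments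
  move. The first argument is expanded in \<open>Basis\<close>, so that the induction meets forms
  whose first argument is constant.\<close>

lemma has_derivative_alt_form_apply:
  fixes m :: "'z::real_normed_vector \<Rightarrow> 'e::euclidean_space list \<Rightarrow> real" and W :: "'i \<Rightarrow> 'z \<Rightarrow> 'e"
  assumes z0: "z0 \<in> S"
  shows "(\<And>z. z \<in> S \<Longrightarrow> alt_form (length js) (m z)) \<Longrightarrow>
    (\<And>j. j \<in> set js \<Longrightarrow> (W j has_derivative W' j) (at z0 within S)) \<Longrightarrow>
    (\<And>vs. ((\<lambda>z. m z vs) has_derivative m' vs) (at z0 within S)) \<Longrightarrow>
    (\<And>h. alt_form (length js) (\<lambda>vs. m' vs h)) \<Longrightarrow>
    ((\<lambda>z. m z (map (\<lambda>j. W j z) js)) has_derivative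
      (\<lambda>h. m' (map (\<lambda>j. W j z0) js) h +
        (\<Sum>i<length js. m z0 ((map (\<lambda>j. W j z0) js)[i := W' (js ! i) h])))) (at z0 within S)"
proof (induction js arbitrary: m m')
  case (Cons j js)
  let ?r = "\<lambda>z. map (\<lambda>j. W j z) js"
  have a: "alt_form (Suc (length js)) (m z)" if "z \<in> S" for z using Cons.prems(1)[OF that] by simp
  have a': "alt_form (Suc (length js)) (\<lambda>vs. m' vs h)" for h using Cons.prems(4) by simp
  let ?G = "\<lambda>b h. m' (b # ?r z0) h + (\<Sum>i<length js. m z0 (b # (?r z0)[i := W' (js ! i) h]))"
  have IH: "((\<lambda>z. m z (b # ?r z)) has_derivative ?G b) (at z0 within S)" for b
    by (rule Cons.IH[where m = "\<lambda>z vs. m z (b # vs)" and m' = "\<lambda>vs. m' (b # vs)"])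
       (use Cons.prems in \<open>auto intro: alt_form_Cons a a'\<close>)
  have expand: "\<alpha> (v # vs) = (\<Sum>b\<in>Basis. (v \<bullet> b) * \<alpha> (b # vs))"
    if "alt_form (Suc (length js)) \<alpha>" "length vs = length js" for \<alpha> :: "'e list \<Rightarrow> real" and v vs
  proof -
    interpret l: linear "\<lambda>u. \<alpha> (u # vs)" by (rule alt_form_linear_hd[OF that(1)]) (simp add: that)
    have "\<alpha> (v # vs) = \<alpha> ((\<Sum>b\<in>Basis. (v \<bullet> b) *\<^sub>R b) # vs)" by (simp add: euclidean_representation)
    then show ?thesis by (simp only: l.sum l.scale real_scaleR_def)
  qed
  have "((\<lambda>z. \<Sum>b\<in>Basis. (W j z \<bullet> b) * m z (b # ?r z)) has_derivative
      (\<lambda>h. \<Sum>b\<in>Basis. (W j z0 \<bullet> b) * ?G b h + (W' j h \<bullet> b) * m z0 (b # ?r z0))) (at z0 within S)"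
    by (intro has_derivative_sum has_derivative_mult has_derivative_inner_left IH Cons.prems(2)) simp
  moreover have "(\<Sum>b\<in>Basis. (W j z0 \<bullet> b) * ?G b h + (W' j h \<bullet> b) * m z0 (b # ?r z0)) =
     m' (W j z0 # ?r z0) h + (\<Sum>i<Suc (length js). m z0 ((W j z0 # ?r z0)[i := W' ((j # js) ! i) h]))" for h
  proof -
    have "(\<Sum>b\<in>Basis. (W j z0 \<bullet> b) * ?G b h + (W' j h \<bullet> b) * m z0 (b # ?r z0)) =
      (\<Sum>b\<in>Basis. (W j z0 \<bullet> b) * m' (b # ?r z0) h) +
      (\<Sum>i<length js. \<Sum>b\<in>Basis. (W j z0 \<bullet> b) * m z0 (b # (?r z0)[i := W' (js ! i) h])) +
      (\<Sum>b\<in>Basis. (W' j h \<bullet> b) * m z0 (b # ?r z0))"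
      by (simp add: sum.distrib distrib_left sum_distrib_left) (rule sum.swap)
    also have "\<dots> = m' (W j z0 # ?r z0) h + (\<Sum>i<length js. m z0 (W j z0 # (?r z0)[i := W' (js ! i) h])) +
      m z0 (W' j h # ?r z0)"
      by (simp add: expand[OF a'] expand[OF a[OF z0]])
    finally show ?thesis by (simp only: sum.lessThan_Suc_shift) simp
  qed
  ultimately have "((\<lambda>z. \<Sum>b\<in>Basis. (W j z \<bullet> b) * m z (b # ?r z)) has_derivative
     (\<lambda>h. m' (map (\<lambda>j. W j z0) (j # js)) h +
        (\<Sum>i<length (j # js). m z0 ((map (\<lambda>j. W j z0) (j # js))[i := W' ((j # js) ! i) h])))) (at z0 within S)"
    by simp
  then show ?case
    by (rule has_derivative_transform[OF z0, rotated]) (simp add: expand[OF a])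
next
  case Nil
  then show ?case by simp
qed

section \<open>Local properties of the exterior derivative\<close>

lemma frechet_derivative_cong_open:
  assumes "open U" "x \<in> U" "\<And>y. y \<in> U \<Longrightarrow> f y = g y"
  shows "fd f x = fd g x"
proof -
  have "(f has_derivative D) (at x) \<longleftrightarrow> (g has_derivative D) (at x)" for D
    using has_derivative_transform_within_open[of f D x UNIV U g]
      has_derivative_transform_within_open[of g D x UNIV U f] assms by auto
  then show ?thesis unfolding frechet_derivative_def by simp
qed

lemma ext_deriv_cong_open:
  assumes "open U" "x \<in> U" "\<And>y vs. y \<in> U \<Longrightarrow> \<alpha> y vs = \<beta> y vs"
  shows "ext_deriv k \<alpha> x vs = ext_deriv k \<beta> x vs"
  unfolding ext_deriv_def
  by (intro if_cong refl sum.cong arg_cong2[where f = "(*)"] fun_cong[OF frechet_derivative_cong_open[OF assms(1,2)]] assms(3))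

lemma ext_deriv_length: "length vs \<noteq> Suc k \<Longrightarrow> ext_deriv k \<alpha> x vs = 0"
  by (simp add: ext_deriv_def)

lemma ext_deriv_simps:
  "ext_deriv 1 \<alpha> x [a, b] = fd (\<lambda>y. \<alpha> y [b]) x a - fd (\<lambda>y. \<alpha> y [a]) x b"
  "ext_deriv 2 \<alpha> x [a, b, c] = fd (\<lambda>y. \<alpha> y [b, c]) x a -
     fd (\<lambda>y. \<alpha> y [a, c]) x b + fd (\<lambda>y. \<alpha> y [a, b]) x c"
  "ext_deriv 3 \<alpha> x [a, b, c, d] = fd (\<lambda>y. \<alpha> y [b, c, d]) x a -
     fd (\<lambda>y. \<alpha> y [a, c, d]) x b + fd (\<lambda>y. \<alpha> y [a, b, d]) x c -
     fd (\<lambda>y. \<alpha> y [a, b, c]) x d"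
  "ext_deriv 4 \<alpha> x [a, b, c, d, e] = fd (\<lambda>y. \<alpha> y [b, c, d, e]) x a -
     fd (\<lambda>y. \<alpha> y [a, c, d, e]) x b + fd (\<lambda>y. \<alpha> y [a, b, d, e]) x c -
     fd (\<lambda>y. \<alpha> y [a, b, c, e]) x d + fd (\<lambda>y. \<alpha> y [a, b, c, d]) x e"
  by (simp_all add: ext_deriv_def numeral_eq_Suc)

lemma frechet_eq: "(f has_derivative D) (at x) \<Longrightarrow> fd f x = D"
  using frechet_derivative_at by metis

lemma alt_form_frechet:
  fixes \<alpha> :: "'e::euclidean_space \<Rightarrow> 'f::real_vector list \<Rightarrow> real"
  assumes U: "open U" "x \<in> U" and a: "\<And>y. y \<in> U \<Longrightarrow> alt_form k (\<alpha> y)"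
    and d: "\<And>vs. (\<lambda>y. \<alpha> y vs) differentiable at x"
  shows "alt_form k (\<lambda>vs. fd (\<lambda>y. \<alpha> y vs) x h)"
proof -
  have D: "((\<lambda>y. \<alpha> y vs) has_derivative fd (\<lambda>y. \<alpha> y vs) x) (at x)" for vs
    using d frechet_derivative_works by blast
  have z: "fd (\<lambda>y. \<alpha> y vs) x h = 0" if "\<And>y. y \<in> U \<Longrightarrow> \<alpha> y vs = 0" for vs
    using frechet_derivative_cong_open[OF U that] frechet_eq[OF has_derivative_const[of 0]] by simp
  show ?thesis
    unfolding alt_form_def
  proof (intro conjI allI impI)
    fix vs :: "'f list" and i assume vs: "length vs = k \<and> i < k"
    have lin: "linear (\<lambda>u. \<alpha> y (vs[i := u]))" if "y \<in> U" for y
      using alt_form_linear[OF a[OF that], of vs i] vs by simp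
    show "linear (\<lambda>u. fd (\<lambda>y. \<alpha> y (vs[i := u])) x h)"
    proof (rule linearI)
      fix u w c
      show "fd (\<lambda>y. \<alpha> y (vs[i := u + w])) x h =
        fd (\<lambda>y. \<alpha> y (vs[i := u])) x h + fd (\<lambda>y. \<alpha> y (vs[i := w])) x h"
        using frechet_eq[OF has_derivative_add[OF D[of "vs[i := u]"] D[of "vs[i := w]"]]]
          frechet_derivative_cong_open[OF U, of "\<lambda>y. \<alpha> y (vs[i := u + w])" "\<lambda>y. \<alpha> y (vs[i := u]) + \<alpha> y (vs[i := w])"]
          linear_add[OF lin] by simp
      show "fd (\<lambda>y. \<alpha> y (vs[i := c *\<^sub>R u])) x h =
        c *\<^sub>R fd (\<lambda>y. \<alpha> y (vs[i := u])) x h"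
        using frechet_eq[OF has_derivative_scaleR_right[OF D[of "vs[i := u]"], of c]]
          frechet_derivative_cong_open[OF U, of "\<lambda>y. \<alpha> y (vs[i := c *\<^sub>R u])" "\<lambda>y. c *\<^sub>R \<alpha> y (vs[i := u])"]
          linear_cmul[OF lin] by simp
    qed
  next
    fix vs :: "'f list" assume "length vs \<noteq> k"
    then show "fd (\<lambda>y. \<alpha> y vs) x h = 0" using alt_form_length[OF a] by (intro z) auto
  next
    fix vs :: "'f list" and i j assume "length vs = k \<and> i < j \<and> j < k \<and> vs ! i = vs ! j"
    then show "fd (\<lambda>y. \<alpha> y vs) x h = 0" using alt_form_eq_0[OF a, of _ i j vs] by (intro z) auto
  qed
qed

section \<open>Pullbacks and the exterior derivative\<close>

text \<open>The derivative in direction \<open>h\<close> of a component of the pullback: the chain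
  rule at the base point, and for each argument a term with the second derivative \<open>D2\<close>
  of the map. First and second derivative are parameters because at time 0 they exist only within
  the half-space.\<close>

definition pull_deriv ::
  "('e::euclidean_space \<Rightarrow> 'e list \<Rightarrow> real) \<Rightarrow> 'e \<Rightarrow> ('z \<Rightarrow> 'e) \<Rightarrow> ('z \<Rightarrow> 'z \<Rightarrow> 'e) \<Rightarrow> 'z list \<Rightarrow> 'z \<Rightarrow> real" where
  "pull_deriv \<alpha> p L D2 hs h = fd (\<lambda>q. \<alpha> q (map L hs)) p (L h) +
     (\<Sum>i<length hs. \<alpha> p ((map L hs)[i := D2 (hs ! i) h]))"

lemma has_derivative_pull:
  fixes \<theta> :: "'z::real_normed_vector \<Rightarrow> 'e::euclidean_space"
  assumes z0: "z0 \<in> S" and V: "open V" "\<And>z. z \<in> S \<Longrightarrow> \<theta> z \<in> V"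
    and t: "(\<theta> has_derivative \<theta>' z0) (at z0 within S)"
    and t2: "\<And>h. h \<in> set hs \<Longrightarrow> ((\<lambda>z. \<theta>' z h) has_derivative D2 h) (at z0 within S)"
    and a: "\<And>p. p \<in> V \<Longrightarrow> alt_form (length hs) (\<alpha> p)"
    and d: "\<And>vs. (\<lambda>p. \<alpha> p vs) differentiable (at (\<theta> z0))"
  shows "((\<lambda>z. \<alpha> (\<theta> z) (map (\<theta>' z) hs)) has_derivative pull_deriv \<alpha> (\<theta> z0) (\<theta>' z0) D2 hs) (at z0 within S)"
proof -
  have D: "((\<lambda>p. \<alpha> p vs) has_derivative fd (\<lambda>p. \<alpha> p vs) (\<theta> z0)) (at (\<theta> z0))" for vs
    using d frechet_derivative_works by blast
  have "((\<lambda>z. \<alpha> (\<theta> z) (map (\<lambda>j. \<theta>' z j) hs)) has_derivative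
     (\<lambda>h. fd (\<lambda>p. \<alpha> p (map (\<lambda>j. \<theta>' z0 j) hs)) (\<theta> z0) (\<theta>' z0 h) +
        (\<Sum>i<length hs. \<alpha> (\<theta> z0) ((map (\<lambda>j. \<theta>' z0 j) hs)[i := D2 (hs ! i) h])))) (at z0 within S)"
    by (rule has_derivative_alt_form_apply[where m = "\<lambda>z. \<alpha> (\<theta> z)" and W = "\<lambda>h z. \<theta>' z h" and W' = D2
          and m' = "\<lambda>vs h. fd (\<lambda>p. \<alpha> p vs) (\<theta> z0) (\<theta>' z0 h)", OF z0])
       (use V z0 in \<open>auto intro!: a t2 alt_form_frechet[OF V(1) _ a d] has_derivative_compose[OF t D, unfolded o_def]\<close>)
  then show ?thesis unfolding pull_deriv_def .
qed

text \<open>The terms with second derivatives cancel by symmetry, which gives \<open>d \<theta>\<^sup>* \<alpha> = \<theta>\<^sup>* d \<alpha>\<close>. It will be applied to maps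
  defined on space-time, where the component in the time direction is Cartan's formula.\<close>

lemma pull_deriv_ext_deriv:
  fixes \<alpha> :: "'e::euclidean_space \<Rightarrow> 'e list \<Rightarrow> real"
  assumes sym: "\<And>h k. D2 h k = D2 k h"
  shows "alt_form 1 (\<alpha> p) \<Longrightarrow>
      pull_deriv \<alpha> p L D2 [b] a - pull_deriv \<alpha> p L D2 [a] b = ext_deriv 1 \<alpha> p (map L [a, b])"
    and "alt_form 2 (\<alpha> p) \<Longrightarrow>
      pull_deriv \<alpha> p L D2 [b, c] a - pull_deriv \<alpha> p L D2 [a, c] b + pull_deriv \<alpha> p L D2 [a, b] c = ext_deriv 2 \<alpha> p (map L [a, b, c])"
    and "alt_form 3 (\<alpha> p) \<Longrightarrow>
      pull_deriv \<alpha> p L D2 [b, c, d] a - pull_deriv \<alpha> p L D2 [a, c, d] b + pull_deriv \<alpha> p L D2 [a, b, d] c -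
      pull_deriv \<alpha> p L D2 [a, b, c] d = ext_deriv 3 \<alpha> p (map L [a, b, c, d])"
proof -
  show "pull_deriv \<alpha> p L D2 [b] a - pull_deriv \<alpha> p L D2 [a] b = ext_deriv 1 \<alpha> p (map L [a, b])"
    by (simp add: pull_deriv_def ext_deriv_simps(1)[unfolded One_nat_def] sym[of a b])
next
  assume a: "alt_form 2 (\<alpha> p)"
  have sw: "\<alpha> p [x, y] = - \<alpha> p [y, x]" for x y using alt_form_swap[OF a, of "[]" x y "[]"] by simp
  show "pull_deriv \<alpha> p L D2 [b, c] a - pull_deriv \<alpha> p L D2 [a, c] b + pull_deriv \<alpha> p L D2 [a, b] c = ext_deriv 2 \<alpha> p (map L [a, b, c])"
    by (simp add: pull_deriv_def ext_deriv_simps sym[of a b] sym[of a c] sym[of b c]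
        sw[of "L a" "D2 b c"] sw[of "L a" "D2 c b"] sw[of "L b" "D2 c a"] lessThan_Suc)
next
  assume a: "alt_form 3 (\<alpha> p)"
  have sw: "\<alpha> p [x, y, z] = - \<alpha> p [y, x, z]" "\<alpha> p [x, y, z] = \<alpha> p [z, x, y]" for x y z
    using alt_form_swap[OF a, of "[]" x y "[z]"] alt_form_swap[OF a, of "[x]" y z "[]"]
      alt_form_swap[OF a, of "[]" x z "[y]"] by auto
  show "pull_deriv \<alpha> p L D2 [b, c, d] a - pull_deriv \<alpha> p L D2 [a, c, d] b + pull_deriv \<alpha> p L D2 [a, b, d] c -
      pull_deriv \<alpha> p L D2 [a, b, c] d = ext_deriv 3 \<alpha> p (map L [a, b, c, d])"
    by (simp add: pull_deriv_def ext_deriv_simps sym[of a] sym[of b c] sym[of b d] sym[of c d] lessThan_Suc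
        sw(1)[of _ "D2 _ _"] sw(2)[of _ _ "D2 _ _"])
qed

lemma wedge_1_3:
  assumes "alt_form 1 \<alpha>" "alt_form 3 \<beta>"
  shows "wedge 1 3 \<alpha> \<beta> [a0, a1, a2, a3] =
     \<alpha> [a0] * \<beta> [a1, a2, a3] - \<alpha> [a1] * \<beta> [a0, a2, a3] + \<alpha> [a2] * \<beta> [a0, a1, a3]
     - \<alpha> [a3] * \<beta> [a0, a1, a2]"
  using assms
  by (simp add: numeral_eq_Suc wedge_Cons_interior alt_form_interior_product wedge_0_left wedge_0_right)
     (simp add: interior_product_def)

section \<open>Products with one-forms\<close>

definition one_form :: "('e \<Rightarrow> real) \<Rightarrow> 'e list \<Rightarrow> real" where
  "one_form \<xi> vs = (if length vs = 1 then \<xi> (vs ! 0) else 0)"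

lemma one_form_simp: "one_form \<xi> [v] = \<xi> v"
  by (simp add: one_form_def)

lemma wedge_length: "length vs \<noteq> k + l \<Longrightarrow> wedge k l \<alpha> \<beta> vs = 0"
  by (simp add: wedge_def)

lemma alt_form_one_form: "linear \<xi> \<Longrightarrow> alt_form 1 (one_form \<xi>)"
  unfolding alt_form_def one_form_def by (auto simp: length_Suc_conv)

lemma length_2D: "length vs = 2 \<Longrightarrow> \<exists>a b. vs = [a, b]"
  and length_3D: "length vs = 3 \<Longrightarrow> \<exists>a b c. vs = [a, b, c]"
  and length_4D: "length vs = 4 \<Longrightarrow> \<exists>a b c d. vs = [a, b, c, d]"
  and length_5D: "length vs = 5 \<Longrightarrow> \<exists>a b c d e. vs = [a, b, c, d, e]"
  by (auto simp: numeral_eq_Suc length_Suc_conv)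

lemma one_wedge_1: "one_wedge 1 \<xi> \<beta> [a, b] = \<xi> a * \<beta> [b] - \<xi> b * \<beta> [a]"
  by (simp add: one_wedge_def)

lemma one_wedge_4:
  "one_wedge 4 \<xi> \<beta> [a, b, c, d, e] = \<xi> a * \<beta> [b, c, d, e] - \<xi> b * \<beta> [a, c, d, e] + \<xi> c * \<beta> [a, b, d, e]
    - \<xi> d * \<beta> [a, b, c, e] + \<xi> e * \<beta> [a, b, c, d]"
  by (simp add: one_wedge_def numeral_eq_Suc)

lemma one_wedge_length: "length vs \<noteq> Suc k \<Longrightarrow> one_wedge k \<xi> \<beta> vs = 0"
  by (simp add: one_wedge_def)

lemma wedge_one_form:
  assumes x: "linear \<xi>"
  shows "alt_form 1 \<beta> \<Longrightarrow> wedge 1 1 (one_form \<xi>) \<beta> = one_wedge 1 \<xi> \<beta>"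
    and "alt_form 2 \<beta> \<Longrightarrow> wedge 1 2 (one_form \<xi>) \<beta> = one_wedge 2 \<xi> \<beta>"
    and "alt_form 3 \<beta> \<Longrightarrow> wedge 1 3 (one_form \<xi>) \<beta> = one_wedge 3 \<xi> \<beta>"
proof -
  note o = alt_form_one_form[OF x]
  show "wedge 1 1 (one_form \<xi>) \<beta> = one_wedge 1 \<xi> \<beta>" if b: "alt_form 1 \<beta>"
  proof
    fix vs show "wedge 1 1 (one_form \<xi>) \<beta> vs = one_wedge 1 \<xi> \<beta> vs"
      using length_2D[of vs]
      by (cases "length vs = 2") (auto simp: one_form_simp wedge_length one_wedge_length wedge_1_1[OF o b, unfolded One_nat_def] one_wedge_1[unfolded One_nat_def])
  qed
  show "wedge 1 2 (one_form \<xi>) \<beta> = one_wedge 2 \<xi> \<beta>" if b: "alt_form 2 \<beta>"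
  proof
    fix vs show "wedge 1 2 (one_form \<xi>) \<beta> vs = one_wedge 2 \<xi> \<beta> vs"
      using length_3D[of vs]
      by (cases "length vs = 3") (auto simp: one_form_simp wedge_length one_wedge_length wedge_1_2[OF o b, unfolded One_nat_def] one_wedge_simps)
  qed
  show "wedge 1 3 (one_form \<xi>) \<beta> = one_wedge 3 \<xi> \<beta>" if b: "alt_form 3 \<beta>"
  proof
    fix vs show "wedge 1 3 (one_form \<xi>) \<beta> vs = one_wedge 3 \<xi> \<beta> vs"
      using length_4D[of vs]
      by (cases "length vs = 4") (auto simp: one_form_simp wedge_length one_wedge_length wedge_1_3[OF o b, unfolded One_nat_def] one_wedge_simps)
  qed
qed

lemma alt_form_one_wedge:
  assumes x: "linear \<xi>"
  shows "alt_form 1 \<beta> \<Longrightarrow> alt_form 2 (one_wedge 1 \<xi> \<beta>)"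
    and "alt_form 2 \<beta> \<Longrightarrow> alt_form 3 (one_wedge 2 \<xi> \<beta>)"
    and "alt_form 3 \<beta> \<Longrightarrow> alt_form 4 (one_wedge 3 \<xi> \<beta>)"
  using alt_form_wedge[OF alt_form_one_form[OF x], of 1 \<beta>] alt_form_wedge[OF alt_form_one_form[OF x], of 2 \<beta>]
    alt_form_wedge[OF alt_form_one_form[OF x], of 3 \<beta>] wedge_one_form[OF x]
  by (simp_all add: numeral_eq_Suc)

section \<open>The Laplacian of the dual four-form\<close>

lemma hodge_zero: "hodge k g v (\<lambda>_. 0) = (\<lambda>_. 0)"
  by (simp add: hodge_def fun_eq_iff)

lemma ext_deriv_zero_open:
  assumes "open U" "x \<in> U" "\<And>y vs. y \<in> U \<Longrightarrow> \<alpha> y vs = 0"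
  shows "ext_deriv k \<alpha> x = (\<lambda>_. 0)"
proof
  fix vs
  have "ext_deriv k \<alpha> x vs = ext_deriv k (\<lambda>_ _. 0) x vs" by (rule ext_deriv_cong_open[OF assms(1,2)]) (simp add: assms)
  also have "\<dots> = 0" by (simp add: ext_deriv_def)
  finally show "ext_deriv k \<alpha> x vs = 0" .
qed

text \<open>For closed \<open>P\<close> and \<open>Q\<close> only the scalar factors are
  differentiated. As d(1/F) = - (1/F) d log F and dF = F d log F, the two parts acquire opposite
  signs.\<close>

lemma ext_deriv_scaled_pair:
  fixes F :: "'e::euclidean_space \<Rightarrow> real"
  assumes F: "F differentiable at y" "F y \<noteq> 0"
    and P: "\<And>vs. (\<lambda>y. P y vs) differentiable at y" and Q: "\<And>vs. (\<lambda>y. Q y vs) differentiable at y"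
    and cP: "\<And>vs. ext_deriv 3 P y vs = 0" and cQ: "\<And>vs. ext_deriv 3 Q y vs = 0"
  shows "ext_deriv 3 (\<lambda>y vs. P y vs / F y + F y * Q y vs) y =
     one_wedge 3 (\<lambda>h. fd F y h / F y) (\<lambda>vs. F y * Q y vs - P y vs / F y)"
proof
  fix vs
  have D: "fd (\<lambda>y. P y ws / F y + F y * Q y ws) y h =
     fd (\<lambda>y. P y ws) y h / F y + F y * fd (\<lambda>y. Q y ws) y h +
     fd F y h / F y * (F y * Q y ws - P y ws / F y)" for ws h
  proof -
    have D: "((\<lambda>y. P y ws / F y + F y * Q y ws) has_derivative
      (\<lambda>h. (- P y ws * (inverse (F y) * fd F y h * inverse (F y)) + fd (\<lambda>y. P y ws) y h / F y)
       + (F y * fd (\<lambda>y. Q y ws) y h + fd F y h * Q y ws))) (at y)"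
      by (intro has_derivative_add has_derivative_divide has_derivative_mult)
         (use F P Q frechet_derivative_works in blast)+
    show ?thesis unfolding fun_cong[OF frechet_eq[OF D], of h] using F(2) by (simp add: field_simps)
  qed
  show "ext_deriv 3 (\<lambda>y vs. P y vs / F y + F y * Q y vs) y vs =
     one_wedge 3 (\<lambda>h. fd F y h / F y) (\<lambda>vs. F y * Q y vs - P y vs / F y) vs"
  proof (cases "length vs = 4")
    case True
    then obtain a b c d where vs: "vs = [a, b, c, d]" using length_4D by blast
    have "ext_deriv 3 (\<lambda>y vs. P y vs / F y + F y * Q y vs) y vs =
      ext_deriv 3 P y vs / F y + F y * ext_deriv 3 Q y vs +
      one_wedge 3 (\<lambda>h. fd F y h / F y) (\<lambda>vs. F y * Q y vs - P y vs / F y) vs"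
      unfolding vs ext_deriv_simps one_wedge_simps D by (simp only: add_divide_distrib diff_divide_distrib) (simp add: algebra_simps)
    then show ?thesis by (simp add: cP cQ)
  qed (simp add: ext_deriv_length one_wedge_length)
qed

text \<open>Since \<psi> is closed, its Laplacian is d of the codifferential. The star of \<psi> is
  \<phi>, whose derivative is d log F \<and> (F Q - P / F), and the star turns the factor d log F
  into contraction with its dual vector \<open>Y\<close>. The relative sign of \<open>A\<close> and
  \<open>B\<close> is that of 1/F against F.\<close>

lemma g2_laplacian_dual:
  fixes P Q A B \<phi> :: "'e::euclidean_space \<Rightarrow> 'e list \<Rightarrow> real"
  assumes d: "DIM('e) = 7" and U: "open U" "x \<in> U"
    and \<phi>: "\<And>y. y \<in> U \<Longrightarrow> \<phi> y = (\<lambda>vs. P y vs / F y + F y * Q y vs)"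
    and std: "\<And>y. y \<in> U \<Longrightarrow> \<exists>es. g2_std es (\<lambda>vs. P y vs / F y) (\<lambda>vs. F y * Q y vs) (A y) (B y) \<and>
       Y y = (\<Sum>i<7. (fd F y (es ! i) / F y) *\<^sub>R es ! i)"
    and F: "\<And>y. y \<in> U \<Longrightarrow> F differentiable at y" "\<And>y. y \<in> U \<Longrightarrow> F y \<noteq> 0"
    and P: "\<And>y vs. y \<in> U \<Longrightarrow> (\<lambda>y. P y vs) differentiable at y" and Q: "\<And>y vs. y \<in> U \<Longrightarrow> (\<lambda>y. Q y vs) differentiable at y"
    and cP: "\<And>y vs. y \<in> U \<Longrightarrow> ext_deriv 3 P y vs = 0" and cQ: "\<And>y vs. y \<in> U \<Longrightarrow> ext_deriv 3 Q y vs = 0"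
    and cAB: "\<And>y vs. y \<in> U \<Longrightarrow> ext_deriv 4 (\<lambda>y vs. A y vs + B y vs) y vs = 0"
  defines "\<psi> \<equiv> \<lambda>y. hodge 3 (g2_metric (\<phi> y)) (g2_vol (\<phi> y)) (\<phi> y)"
  shows "hodge_laplacian 4 (\<lambda>y. g2_metric (\<phi> y)) (\<lambda>y. g2_vol (\<phi> y)) \<psi> x vs =
      ext_deriv 3 (\<lambda>y ws. A y (Y y # ws) - B y (Y y # ws)) x vs"
    and "\<psi> x = (\<lambda>vs. A x vs + B x vs)"
proof -
  let ?g = "\<lambda>y. g2_metric (\<phi> y)" and ?v = "\<lambda>y. g2_vol (\<phi> y)"
  have main: "\<psi> y = (\<lambda>vs. A y vs + B y vs) \<and> hodge 4 (?g y) (?v y) (\<psi> y) = \<phi> y \<and>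
     (\<forall>ws. hodge 4 (?g y) (?v y) (one_wedge 3 (\<lambda>h. fd F y h / F y) (\<lambda>vs. F y * Q y vs - P y vs / F y)) ws =
       A y (Y y # ws) - B y (Y y # ws))" if y: "y \<in> U" for y
  proof -
    obtain es where s: "g2_std es (\<lambda>vs. P y vs / F y) (\<lambda>vs. F y * Q y vs) (A y) (B y)"
       and Y: "Y y = (\<Sum>i<7. (fd F y (es ! i) / F y) *\<^sub>R es ! i)" using std[OF y] by blast
    obtain g v where gv0: "frame g es" "alt_form 7 v"
      "g2_metric (\<lambda>vs. P y vs / F y + F y * Q y vs) = g" "g2_vol (\<lambda>vs. P y vs / F y + F y * Q y vs) = v"
      "hodge 3 g v (\<lambda>vs. P y vs / F y) = A y" "hodge 3 g v (\<lambda>vs. F y * Q y vs) = B y"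
      "hodge 4 g v (A y) = (\<lambda>vs. P y vs / F y)" "hodge 4 g v (B y) = (\<lambda>vs. F y * Q y vs)"
      by (rule g2_std_hodge[OF d s])
    note gv = gv0(1,2) gv0(3,4)[folded \<phi>[OF y]] gv0(5-)
    have 1: "\<psi> y = (\<lambda>vs. A y vs + B y vs)"
      unfolding \<psi>_def gv(3,4) by (simp add: \<phi>[OF y] fun_eq_iff hodge_add gv(5,6))
    have 2: "hodge 4 (?g y) (?v y) (\<psi> y) = \<phi> y"
      unfolding 1 gv(3,4) by (simp add: \<phi>[OF y] fun_eq_iff hodge_add gv(7,8))
    have alts: "alt_form 3 (\<lambda>vs. P y vs / F y)" "alt_form 3 (\<lambda>vs. F y * Q y vs)" "alt_form 4 (A y)" "alt_form 4 (B y)"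
      using s by (auto simp: g2_std_def has_table_def)
    let ?\<xi> = "\<lambda>h. fd F y h / F y" and ?\<beta> = "\<lambda>vs. F y * Q y vs - P y vs / F y"
    have "linear (fd F y)" using F(1)[OF y] frechet_derivative_works has_derivative_linear by blast
    then have lx: "linear ?\<xi>" using linear_cmul[of "\<lambda>h. fd F y h" "inverse (F y)"]
      by (simp add: divide_inverse mult.commute linear_cmult)
    have ab: "alt_form 3 ?\<beta>" using alt_form_diff[OF alts(2,1)] .
    have "hodge 4 g v (one_wedge 3 ?\<xi> ?\<beta>) ws = A y (Y y # ws) - B y (Y y # ws)" for ws
    proof (cases "length ws = 3")
      case True
      have "hodge 4 g v (one_wedge 3 ?\<xi> ?\<beta>) ws = - hodge 3 g v ?\<beta> (Y y # ws)"
        unfolding Y by (rule hodge_one_wedge[OF d gv(1,2) ab lx alt_form_one_wedge(3)[OF lx ab] True])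
      then show ?thesis by (simp add: hodge_diff gv(5,6))
    next
      case False
      then show ?thesis using alt_form_length[OF alts(3)] alt_form_length[OF alts(4)] by (simp add: hodge_def d)
    qed
    with 1 2 show ?thesis unfolding gv(3,4) by blast
  qed
  show "\<psi> x = (\<lambda>vs. A x vs + B x vs)" using main[OF U(2)] by blast
  have cod4: "codiff 4 ?g ?v \<psi> y ws = A y (Y y # ws) - B y (Y y # ws)" if y: "y \<in> U" for y ws
  proof -
    have "ext_deriv 3 (\<lambda>z. hodge 4 (?g z) (?v z) (\<psi> z)) y = ext_deriv 3 (\<lambda>y vs. P y vs / F y + F y * Q y vs) y"
    proof (rule ext, rule ext_deriv_cong_open[OF U(1) y])
      fix z vs assume z: "z \<in> U"
      have "hodge 4 (?g z) (?v z) (\<psi> z) = \<phi> z" using main[OF z] by blast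
      then show "hodge 4 (?g z) (?v z) (\<psi> z) vs = P z vs / F z + F z * Q z vs" by (simp only: \<phi>[OF z])
    qed
    also have "\<dots> = one_wedge 3 (\<lambda>h. fd F y h / F y) (\<lambda>vs. F y * Q y vs - P y vs / F y)"
      by (rule ext_deriv_scaled_pair[OF F[OF y] P[OF y] Q[OF y] cP[OF y] cQ[OF y]])
    \<comment> \<open>The sign of the codifferential is (-1)^(7 * 5 + 1) = 1.\<close>
    finally show ?thesis using main[OF y] by (simp add: codiff_def d)
  qed
  have z: "ext_deriv 4 \<psi> y = (\<lambda>_. 0)" if y: "y \<in> U" for y
  proof
    fix ws
    have "ext_deriv 4 \<psi> y ws = ext_deriv 4 (\<lambda>y vs. A y vs + B y vs) y ws"
      by (rule ext_deriv_cong_open[OF U(1) y]) (use main in simp)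
    then show "ext_deriv 4 \<psi> y ws = 0" using cAB[OF y] by simp
  qed
  have "ext_deriv 2 (\<lambda>y. hodge 5 (?g y) (?v y) (ext_deriv 4 \<psi> y)) x = (\<lambda>_. 0)"
    by (rule ext_deriv_zero_open[OF U]) (simp add: z hodge_zero)
  then have "codiff 5 ?g ?v (ext_deriv 4 \<psi>) x vs = 0" by (simp add: codiff_def d hodge_zero)
  moreover have "ext_deriv 3 (codiff 4 ?g ?v \<psi>) x vs = ext_deriv 3 (\<lambda>y ws. A y (Y y # ws) - B y (Y y # ws)) x vs"
    by (rule ext_deriv_cong_open[OF U cod4])
  ultimately show "hodge_laplacian 4 ?g ?v \<psi> x vs = ext_deriv 3 (\<lambda>y ws. A y (Y y # ws) - B y (Y y # ws)) x vs"
    by (simp add: hodge_laplacian_def)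
qed

section \<open>Leibniz rules\<close>

lemma differentiable_frechet: "f differentiable at x \<Longrightarrow> (f has_derivative fd f x) (at x)"
  using frechet_derivative_works by blast

lemma frechet_lin:
  fixes f g :: "'e::real_normed_vector \<Rightarrow> real"
  assumes "f differentiable at x" "g differentiable at x"
  shows "fd (\<lambda>y. f y + g y) x h = fd f x h + fd g x h"
    "fd (\<lambda>y. f y - g y) x h = fd f x h - fd g x h"
    "fd (\<lambda>y. f y * g y) x h = f x * fd g x h + fd f x h * g x"
  using fun_cong[OF frechet_eq[OF has_derivative_add[OF assms[THEN differentiable_frechet]]]]
    fun_cong[OF frechet_eq[OF has_derivative_diff[OF assms[THEN differentiable_frechet]]]]
    fun_cong[OF frechet_eq[OF has_derivative_mult[OF assms[THEN differentiable_frechet]]]] by auto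

lemma frechet_cmult:
  fixes f :: "'e::real_normed_vector \<Rightarrow> real"
  assumes "f differentiable at x"
  shows "fd (\<lambda>y. c * f y) x h = c * fd f x h"
    "fd (\<lambda>y. - f y) x h = - fd f x h"
  using fun_cong[OF frechet_eq[OF has_derivative_mult_right[OF differentiable_frechet[OF assms]]]]
    fun_cong[OF frechet_eq[OF has_derivative_minus[OF differentiable_frechet[OF assms]]]] by auto

lemma ext_deriv_add:
  assumes "\<And>vs. (\<lambda>y. \<alpha> y vs) differentiable at x" "\<And>vs. (\<lambda>y. \<beta> y vs) differentiable at x"
  shows "ext_deriv k (\<lambda>y vs. \<alpha> y vs + \<beta> y vs) x vs = ext_deriv k \<alpha> x vs + ext_deriv k \<beta> x vs"
  by (simp add: ext_deriv_def frechet_lin assms sum.distrib distrib_left)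

lemma ext_deriv_cmult:
  assumes "\<And>vs. (\<lambda>y. \<alpha> y vs) differentiable at x"
  shows "ext_deriv k (\<lambda>y vs. c * \<alpha> y vs) x vs = c * ext_deriv k \<alpha> x vs"
  by (simp add: ext_deriv_def frechet_cmult assms sum_distrib_left mult.left_commute)

lemma differentiable_one_wedge:
  assumes "\<And>vs. (\<lambda>y. \<beta> y vs) differentiable at x"
  shows "(\<lambda>y. one_wedge k r (\<beta> y) vs) differentiable at x"
  unfolding one_wedge_def using assms by (cases "length vs = Suc k") (auto intro!: derivative_intros)

text \<open>The one-form \<open>r\<close> does not depend on the base point, hence it is closed and
  d passes it at the cost of a sign.\<close>

lemma ext_deriv_one_wedge:
  assumes b: "\<And>vs. (\<lambda>y. \<beta> y vs) differentiable at x"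
  shows "ext_deriv 3 (\<lambda>y. one_wedge 2 r (\<beta> y)) x vs = - one_wedge 3 r (ext_deriv 2 \<beta> x) vs"
    and "ext_deriv 4 (\<lambda>y. one_wedge 3 r (\<beta> y)) x vs = - one_wedge 4 r (ext_deriv 3 \<beta> x) vs"
proof -
  have d: "(\<lambda>y. c * \<beta> y vs) differentiable at x" for c vs using b by (auto intro!: derivative_intros)
  show "ext_deriv 3 (\<lambda>y. one_wedge 2 r (\<beta> y)) x vs = - one_wedge 3 r (ext_deriv 2 \<beta> x) vs"
  proof (cases "length vs = 4")
    case True
    then obtain a b c d where vs: "vs = [a, b, c, d]" using length_4D by blast
    show ?thesis unfolding vs
      by (simp add: ext_deriv_simps one_wedge_simps frechet_lin frechet_cmult b d differentiable_diff differentiable_add)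
         (simp add: algebra_simps)
  qed (simp add: ext_deriv_length one_wedge_length)
  show "ext_deriv 4 (\<lambda>y. one_wedge 3 r (\<beta> y)) x vs = - one_wedge 4 r (ext_deriv 3 \<beta> x) vs"
  proof (cases "length vs = 5")
    case True
    then obtain a b c d e where vs: "vs = [a, b, c, d, e]" using length_5D by blast
    show ?thesis unfolding vs
      by (simp add: ext_deriv_simps one_wedge_simps one_wedge_4 frechet_lin frechet_cmult b d differentiable_diff differentiable_add)
         (simp add: algebra_simps)
  qed (simp add: ext_deriv_length one_wedge_length)
qed

definition wedge22 :: "('e list \<Rightarrow> real) \<Rightarrow> ('e list \<Rightarrow> real) \<Rightarrow> 'e list \<Rightarrow> real" where
  "wedge22 \<alpha> \<beta> vs = (if length vs = 4 then
     \<alpha> [vs!0, vs!1] * \<beta> [vs!2, vs!3] - \<alpha> [vs!0, vs!2] * \<beta> [vs!1, vs!3] + \<alpha> [vs!0, vs!3] * \<beta> [vs!1, vs!2]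
     + \<alpha> [vs!1, vs!2] * \<beta> [vs!0, vs!3] - \<alpha> [vs!1, vs!3] * \<beta> [vs!0, vs!2] + \<alpha> [vs!2, vs!3] * \<beta> [vs!0, vs!1] else 0)"

lemma wedge22_simp: "wedge22 \<alpha> \<beta> [a, b, c, d] = \<alpha> [a, b] * \<beta> [c, d] - \<alpha> [a, c] * \<beta> [b, d] + \<alpha> [a, d] * \<beta> [b, c]
     + \<alpha> [b, c] * \<beta> [a, d] - \<alpha> [b, d] * \<beta> [a, c] + \<alpha> [c, d] * \<beta> [a, b]"
  by (simp add: wedge22_def numeral_eq_Suc)

lemma alt_form_wedge22: "alt_form 2 \<alpha> \<Longrightarrow> alt_form 2 \<beta> \<Longrightarrow> alt_form 4 (wedge22 \<alpha> \<beta>)"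
proof -
  assume a: "alt_form 2 \<alpha>" "alt_form 2 \<beta>"
  have "wedge22 \<alpha> \<beta> = wedge 2 2 \<alpha> \<beta>"
  proof
    fix vs show "wedge22 \<alpha> \<beta> vs = wedge 2 2 \<alpha> \<beta> vs"
      using length_4D[of vs] wedge_2_2[OF a] wedge22_simp
      by (cases "length vs = 4") (auto simp: wedge_def wedge22_def)
  qed
  then show ?thesis using alt_form_wedge[OF a] by simp
qed

lemma ext_deriv_wedge22:
  assumes b: "\<And>vs. (\<lambda>y. \<beta> y vs) differentiable at x" and c: "\<And>vs. ext_deriv 2 \<beta> x vs = 0"
  shows "ext_deriv 4 (\<lambda>y. wedge22 (\<beta> y) (\<beta> y)) x vs = 0"
proof (cases "length vs = 5")
  case True
  then obtain p q r s t where vs: "vs = [p, q, r, s, t]" using length_5D by blast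
  let ?D = "\<lambda>a b c. fd (\<lambda>y. \<beta> y [b, c]) x a"
  have d: "(\<lambda>y. \<beta> y us * \<beta> y ws) differentiable at x" for us ws using b by (auto intro!: derivative_intros)
  \<comment> \<open>Closedness eliminates one derivative for each of the ten increasing triples of
    arguments; the remaining terms cancel. The explicit instances below keep this rewriting from
    looping.\<close>
  have cl: "?D a b c = ?D b a c - ?D c a b" for a b c
    using c[of "[a, b, c]"] by (simp add: ext_deriv_simps)
  show ?thesis unfolding vs
    apply (simp add: ext_deriv_simps wedge22_simp frechet_lin b d differentiable_diff differentiable_add)
    apply (simp only: cl[where a = p and b = q and c = r] cl[where a = p and b = q and c = s] cl[where a = p and b = q and c = t] cl[where a = p and b = r and c = s] cl[where a = p and b = r and c = t] cl[where a = p and b = s and c = t] cl[where a = q and b = r and c = s] cl[where a = q and b = r and c = t] cl[where a = q and b = s and c = t] cl[where a = r and b = s and c = t])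
    apply (simp add: algebra_simps)
    done
qed (simp add: ext_deriv_length)

lemma ext_deriv_one_wedge_form:
  assumes b: "\<And>vs. (\<lambda>y. \<beta> y vs) differentiable at x" and e: "\<And>vs. (\<lambda>y. \<eta> y vs) differentiable at x"
    and c: "\<And>vs. ext_deriv 2 \<beta> x vs = 0" and vs: "length vs = 4"
  shows "ext_deriv 3 (\<lambda>y. one_wedge 2 (\<lambda>v. \<eta> y [v]) (\<beta> y)) x vs = wedge22 (ext_deriv 1 \<eta> x) (\<beta> x) vs"
proof -
  obtain p q r s where vs: "vs = [p, q, r, s]" using length_4D[OF vs] by blast
  let ?D = "\<lambda>a b c. fd (\<lambda>y. \<beta> y [b, c]) x a"
  have d: "(\<lambda>y. \<eta> y us * \<beta> y ws) differentiable at x" for us ws using b e by (auto intro!: derivative_intros)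
  have cl: "?D a b c = ?D b a c - ?D c a b" for a b c
    using c[of "[a, b, c]"] by (simp add: ext_deriv_simps)
  show ?thesis unfolding vs
    apply (simp add: ext_deriv_simps(3) one_wedge_simps wedge22_simp ext_deriv_simps(1)[unfolded One_nat_def] frechet_lin b e d differentiable_diff differentiable_add)
    apply (simp only: cl[where a = p and b = q and c = r] cl[where a = p and b = q and c = s] cl[where a = p and b = r and c = s] cl[where a = q and b = r and c = s])
    apply (simp add: algebra_simps)
    done
qed

lemma ext_deriv_linear_pull:
  assumes p: "bounded_linear p" and b: "\<And>vs. (\<lambda>y. \<beta> y vs) differentiable (at (p x))"
  shows "ext_deriv k (\<lambda>y vs. \<beta> (p y) (map p vs)) x vs = ext_deriv k \<beta> (p x) (map p vs)"
proof -
  have "fd (\<lambda>y. \<beta> (p y) ws) x h = fd (\<lambda>y. \<beta> y ws) (p x) (p h)" for ws h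
    using fun_cong[OF frechet_eq[OF has_derivative_compose[OF bounded_linear_imp_has_derivative[OF p] differentiable_frechet[OF b]]], where x = h]
    by (simp add: o_def)
  then show ?thesis by (auto simp: ext_deriv_def take_map drop_map simp flip: map_append intro!: sum.cong)
qed

lemma differentiable_linear_pull:
  assumes p: "bounded_linear p" and b: "f differentiable (at (p x))"
  shows "(\<lambda>y. f (p y)) differentiable at x"
  using has_derivative_compose[OF bounded_linear_imp_has_derivative[OF p] differentiable_frechet[OF b]]
  unfolding differentiable_def by (auto simp: o_def)

section \<open>\<open>SU(n)\<close>-frames\<close>

lemma incs_3_7: "incs 3 0 7 =
   [[0,1,2], [0,1,3], [0,1,4], [0,1,5], [0,1,6], [0,2,3], [0,2,4], [0,2,5],
    [0,2,6], [0,3,4], [0,3,5], [0,3,6], [0,4,5], [0,4,6], [0,5,6], [1,2,3],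
    [1,2,4], [1,2,5], [1,2,6], [1,3,4], [1,3,5], [1,3,6], [1,4,5], [1,4,6],
    [1,5,6], [2,3,4], [2,3,5], [2,3,6], [2,4,5], [2,4,6], [2,5,6], [3,4,5],
    [3,4,6], [3,5,6], [4,5,6]]"
  by code_simp

lemma incs_4_7: "incs 4 0 7 =
   [[0,1,2,3], [0,1,2,4], [0,1,2,5], [0,1,2,6], [0,1,3,4], [0,1,3,5], [0,1,3,6], [0,1,4,5],
    [0,1,4,6], [0,1,5,6], [0,2,3,4], [0,2,3,5], [0,2,3,6], [0,2,4,5], [0,2,4,6], [0,2,5,6],
    [0,3,4,5], [0,3,4,6], [0,3,5,6], [0,4,5,6], [1,2,3,4], [1,2,3,5], [1,2,3,6], [1,2,4,5],
    [1,2,4,6], [1,2,5,6], [1,3,4,5], [1,3,4,6], [1,3,5,6], [1,4,5,6], [2,3,4,5], [2,3,4,6],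
    [2,3,5,6], [2,4,5,6], [3,4,5,6]]"
  by code_simp

lemma incs_2_6: "incs 2 0 6 =
   [[0,1], [0,2], [0,3], [0,4], [0,5], [1,2], [1,3], [1,4],
    [1,5], [2,3], [2,4], [2,5], [3,4], [3,5], [4,5]]"
  by code_simp

lemma incs_3_6: "incs 3 0 6 =
   [[0,1,2], [0,1,3], [0,1,4], [0,1,5], [0,2,3], [0,2,4], [0,2,5], [0,3,4],
    [0,3,5], [0,4,5], [1,2,3], [1,2,4], [1,2,5], [1,3,4], [1,3,5], [1,4,5],
    [2,3,4], [2,3,5], [2,4,5], [3,4,5]]"
  by code_simp

lemma incs_2_4: "incs 2 0 4 =
   [[0,1], [0,2], [0,3], [1,2], [1,3], [2,3]]"
  by code_simp

text \<open>This table and the next four list the values of the standard Kaehler form and of the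
  real and imaginary parts of dz1 \<and> dz2 \<and> dz3 and dz1 \<and> dz2, in the basis of real and
  imaginary coordinate directions taken alternately.\<close>

definition tab\<omega> :: "nat list \<Rightarrow> int" where
  "tab\<omega> is = (if is = [0,1] \<or> is = [2,3] \<or> is = [4,5] then 1 else 0)"

definition tabRe3 :: "nat list \<Rightarrow> int" where
  "tabRe3 is = (if is = [0,2,4] then 1 else if is = [0,3,5] \<or> is = [1,2,5] \<or> is = [1,3,4] then - 1 else 0)"

definition tabIm3 :: "nat list \<Rightarrow> int" where
  "tabIm3 is = (if is = [1,3,5] then - 1 else if is = [0,2,5] \<or> is = [0,3,4] \<or> is = [1,2,4] then 1 else 0)"

definition tabRe2 :: "nat list \<Rightarrow> int" where
  "tabRe2 is = (if is = [0,2] then 1 else if is = [1,3] then - 1 else 0)"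

definition tabIm2 :: "nat list \<Rightarrow> int" where
  "tabIm2 is = (if is = [0,3] \<or> is = [1,2] then 1 else 0)"

lemma table_values:
  "has_table us k (\<lambda>vs. \<alpha> vs * c) t \<Longrightarrow> c \<noteq> 0 \<Longrightarrow>
     \<forall>is\<in>set (incs k 0 (length us)). \<alpha> (map ((!) us) is) = of_int (t is) / c"
  by (simp add: has_table_def field_simps)

text \<open>The gradient of \<open>log F\<close> for the metric in which the frame \<open>us\<close> is orthonormal.\<close>

definition grad_log :: "('x::euclidean_space \<Rightarrow> real) \<Rightarrow> 'x \<Rightarrow> 'x list \<Rightarrow> 'x" where
  "grad_log F x us = (\<Sum>i<length us. (fd F x (us ! i) / F x) *\<^sub>R us ! i)"

lemma spanning_Cons_real:
  assumes s: "spanning us" and a: "a \<noteq> 0"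
  shows "spanning ((a, 0) # map (Pair (0::real)) us)"
  unfolding spanning_def
proof
  fix v :: "real \<times> 'a"
  obtain c where c: "snd v = (\<Sum>i<length us. c i *\<^sub>R us ! i)" using s unfolding spanning_def by blast
  define d where "d i = (case i of 0 \<Rightarrow> fst v / a | Suc j \<Rightarrow> c j)" for i
  have "(\<Sum>i<length ((a, 0) # map (Pair (0::real)) us). d i *\<^sub>R ((a, 0) # map (Pair 0) us) ! i) =
     d 0 *\<^sub>R (a, 0) + (\<Sum>i<length us. d (Suc i) *\<^sub>R (0, us ! i))"
    by (simp only: length_Cons length_map sum.lessThan_Suc_shift) simp
  also have "\<dots> = (fst v, 0) + (\<Sum>i<length us. (0, c i *\<^sub>R us ! i))" using a by (simp add: d_def)
  also have "(\<Sum>i<length us. (0, c i *\<^sub>R us ! i)) = (0 :: real, snd v)"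
    unfolding c by (simp add: prod_eq_iff fst_sum snd_sum)
  finally show "\<exists>c. v = (\<Sum>i<length ((a, 0) # map (Pair (0::real)) us). c i *\<^sub>R ((a, 0) # map (Pair 0) us) ! i)"
    by (intro exI[of _ d]) (simp only: add_Pair add_0_left add_0_right prod.collapse)
qed

lemma frechet_snd:
  assumes "F differentiable (at (p y))" "bounded_linear p"
  shows "fd (\<lambda>y. F (p y)) y h = fd F (p y) (p h)"
  using fun_cong[OF frechet_eq[OF has_derivative_compose[OF bounded_linear_imp_has_derivative[OF assms(2)]
    differentiable_frechet[OF assms(1)]]], where x = h] by (simp add: o_def)

lemma ext_deriv_one_wedge_1:
  assumes b: "\<And>vs. (\<lambda>y. \<beta> y vs) differentiable at x"
  shows "ext_deriv 2 (\<lambda>y. one_wedge 1 r (\<beta> y)) x vs = - one_wedge 2 r (ext_deriv 1 \<beta> x) vs"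
proof (cases "length vs = 3")
  case True
  have d: "(\<lambda>y. c * \<beta> y vs) differentiable at x" for c vs using b by (auto intro!: derivative_intros)
  obtain p q s where vs: "vs = [p, q, s]" using length_3D[OF True] by blast
  show ?thesis unfolding vs ext_deriv_simps one_wedge_simps one_wedge_1
    by (simp add: frechet_lin frechet_cmult b d algebra_simps)
qed (simp add: ext_deriv_length one_wedge_length)

lemma one_wedge_cong: "(\<And>ws. length ws = k \<Longrightarrow> \<alpha> ws = \<beta> ws) \<Longrightarrow> one_wedge k r \<alpha> vs = one_wedge k r \<beta> vs"
  by (auto simp: one_wedge_def intro!: sum.cong)

lemma differentiable_wedge22:
  assumes "\<And>vs. (\<lambda>y. \<beta> y vs) differentiable at x"
  shows "(\<lambda>y. wedge22 (\<beta> y) (\<beta> y) vs) differentiable at x"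
  unfolding wedge22_def using assms
  by (cases "length vs = 4") (auto intro!: differentiable_add differentiable_diff differentiable_mult)

section \<open>The product with a circle\<close>

text \<open>The situation on X in a chart at a fixed time: \<open>F\<close>, \<open>w\<close>,
  \<open>R\<close>, \<open>I\<close> stand for the pullbacks of |\<Omega>|, the Kaehler form and the
  two parts of \<Omega>. The frame is already stretched by sqrt 2, so \<open>w\<close> is twice and
  \<open>R\<close>, \<open>I\<close> are \<open>F\<close> times their model values.\<close>

locale S1_local =
  fixes F :: "'x::euclidean_space \<Rightarrow> real" and w R I :: "'x \<Rightarrow> 'x list \<Rightarrow> real" and Y :: "'x \<Rightarrow> 'x" and U :: "'x set"
  assumes dim: "DIM('x) = 6" and U: "open U"
    and xframe: "\<And>x. x \<in> U \<Longrightarrow> \<exists>us. length us = 6 \<and> spanning us \<and> has_table us 2 (\<lambda>vs. w x vs * (1 / 2)) tab\<omega> \<and>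
       has_table us 3 (\<lambda>vs. R x vs * (1 / F x)) tabRe3 \<and> has_table us 3 (\<lambda>vs. I x vs * (1 / F x)) tabIm3 \<and> Y x = grad_log F x us"
    and F: "\<And>x. x \<in> U \<Longrightarrow> F x > 0" "\<And>x. x \<in> U \<Longrightarrow> F differentiable at x"
    and alt: "\<And>x. x \<in> U \<Longrightarrow> alt_form 2 (w x)" "\<And>x. x \<in> U \<Longrightarrow> alt_form 3 (R x)" "\<And>x. x \<in> U \<Longrightarrow> alt_form 3 (I x)"
    and diff: "\<And>x vs. x \<in> U \<Longrightarrow> (\<lambda>x. w x vs) differentiable at x" "\<And>x vs. x \<in> U \<Longrightarrow> (\<lambda>x. R x vs) differentiable at x"
      "\<And>x vs. x \<in> U \<Longrightarrow> (\<lambda>x. I x vs) differentiable at x"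
    and closed: "\<And>x vs. x \<in> U \<Longrightarrow> ext_deriv 2 w x vs = 0" "\<And>x vs. x \<in> U \<Longrightarrow> ext_deriv 3 R x vs = 0"
      "\<And>x vs. x \<in> U \<Longrightarrow> ext_deriv 3 I x vs = 0"
begin

abbreviation "wp (y :: real \<times> 'x) \<equiv> \<lambda>ws. w (snd y) (map snd ws)"
abbreviation "Ip (y :: real \<times> 'x) \<equiv> \<lambda>ws. I (snd y) (map snd ws)"

text \<open>The model one-form on the line is 2 F dr, the model Kaehler form is w / 2, and the model
  volume form is (R + i I) / F. Hence - 2 F dr \<and> I / F = - 2 dr \<and> I and - (w / 2)^2 / 2 =
  - w^2 / 8, both free of \<open>F\<close>.\<close>

definition "Q (y :: real \<times> 'x) vs = (- 1) * one_wedge 2 fst (wp y) vs"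
definition "P (y :: real \<times> 'x) (vs :: (real \<times> 'x) list) = R (snd y) (map snd vs)"
definition "A (y :: real \<times> 'x) vs = (- 2) * one_wedge 3 fst (Ip y) vs"
definition "B (y :: real \<times> 'x) (vs :: (real \<times> 'x) list) = (- 1 / 8) * wedge22 (wp y) (wp y) vs"

lemma bl: "bounded_linear (snd :: real \<times> 'x \<Rightarrow> 'x)" "linear (snd :: real \<times> 'x \<Rightarrow> 'x)" "linear (fst :: real \<times> 'x \<Rightarrow> real)"
  by (simp_all add: bounded_linear_snd bounded_linear.linear bounded_linear_fst)

lemma alts:
  assumes "snd y \<in> U"
  shows "alt_form 3 (P y)" "alt_form 3 (Q y)" "alt_form 4 (A y)" "alt_form 4 (B y)"
proof -
  note c = alt_form_compose[OF alt(1)[OF assms] bl(2)]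
  show "alt_form 3 (P y)" unfolding P_def[abs_def] by (rule alt_form_compose[OF alt(2)[OF assms] bl(2)])
  show "alt_form 3 (Q y)" unfolding Q_def[abs_def] by (rule alt_form_mult[OF alt_form_one_wedge(2)[OF bl(3) c]])
  show "alt_form 4 (A y)" unfolding A_def[abs_def]
    by (rule alt_form_mult[OF alt_form_one_wedge(3)[OF bl(3) alt_form_compose[OF alt(3)[OF assms] bl(2)]]])
  show "alt_form 4 (B y)" unfolding B_def[abs_def] by (rule alt_form_mult[OF alt_form_wedge22[OF c c]])
qed

lemma std:
  assumes y: "snd y \<in> U"
  shows "\<exists>es. g2_std es (\<lambda>vs. P y vs / F (snd y)) (\<lambda>vs. F (snd y) * Q y vs) (A y) (B y) \<and>
    (0, Y (snd y)) = (\<Sum>i<7. (fd (\<lambda>y. F (snd y)) y (es ! i) / F (snd y)) *\<^sub>R es ! i)"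
proof -
  let ?x = "snd y"
  obtain us where us: "length us = 6" "spanning us" "has_table us 2 (\<lambda>vs. w ?x vs * (1 / 2)) tab\<omega>"
       "has_table us 3 (\<lambda>vs. R ?x vs * (1 / F ?x)) tabRe3" "has_table us 3 (\<lambda>vs. I ?x vs * (1 / F ?x)) tabIm3" "Y ?x = grad_log F ?x us"
    using xframe[OF y] by blast
  obtain c0 c1 c2 c3 c4 c5 where c: "us = [c0, c1, c2, c3, c4, c5]"
    using us(1) by (auto simp: numeral_eq_Suc length_Suc_conv)
  have Fn: "F ?x \<noteq> 0" using F(1)[OF y] by simp
  have tw: "\<forall>is\<in>set (incs 2 0 6). w ?x (map ((!) us) is) = of_int (tab\<omega> is) / (1 / 2)"
    using table_values[OF us(3)] us(1) by simp
  have tR: "\<forall>is\<in>set (incs 3 0 6). R ?x (map ((!) us) is) = of_int (tabRe3 is) / (1 / F ?x)"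
    using table_values[OF us(4)] us(1) Fn by simp
  have tI: "\<forall>is\<in>set (incs 3 0 6). I ?x (map ((!) us) is) = of_int (tabIm3 is) / (1 / F ?x)"
    using table_values[OF us(5)] us(1) Fn by simp
  note w_values = tw[unfolded incs_2_6 c, simplified tab\<omega>_def, simplified]
  note R_values = tR[unfolded incs_3_6 c, simplified tabRe3_def, simplified]
  note I_values = tI[unfolded incs_3_6 c, simplified tabIm3_def, simplified]
  \<comment> \<open>The length 1 / (2 F) of the circle vector is forced by F dr \<and> w, since
    \<open>w\<close> takes the value 2 on the frame.\<close>
  define es where "es = (1 / (2 * F ?x), 0 :: 'x) # map (Pair 0) us"
  have len: "length es = 7" by (simp add: es_def us)
  have es: "es = [(1 / (2 * F ?x), 0), (0, c0), (0, c1), (0, c2), (0, c3), (0, c4), (0, c5)]" by (simp add: es_def c)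
  have sp: "spanning es" unfolding es_def by (rule spanning_Cons_real[OF us(2)]) (use Fn in simp)
  have z: "R ?x [0, a, b] = 0" "I ?x [0, a, b] = 0" "w ?x [0, a] = 0" for a b
    using linear_0[OF alt_form_linear_hd[OF alt(1)[OF y]], of "[a]"] linear_0[OF alt_form_linear_hd[OF alt(2)[OF y]], of "[a, b]"]
      linear_0[OF alt_form_linear_hd[OF alt(3)[OF y]], of "[a, b]"] by simp_all
  have tP: "has_table es 3 (\<lambda>vs. P y vs / F ?x) tabP"
    unfolding has_table_def len incs_3_7
    using alt_form_mult[OF alts(1)[OF y], of "1 / F ?x"]
    by (simp add: P_def es R_values z tabP_def Fn)
  have tQ: "has_table es 3 (\<lambda>vs. F ?x * Q y vs) tabQ"
    unfolding has_table_def len incs_3_7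
    using alt_form_mult[OF alts(2)[OF y], of "F ?x"]
    by (simp add: Q_def es one_wedge_simps w_values z tabQ_def Fn)
  have tA: "has_table es 4 (A y) tabA"
    unfolding has_table_def len incs_4_7
    using alts(3)[OF y]
    by (simp add: A_def es one_wedge_simps I_values z tabA_def Fn)
  have tB: "has_table es 4 (B y) tabB"
    unfolding has_table_def len incs_4_7
    using alts(4)[OF y]
    by (simp add: B_def es wedge22_simp w_values z tabB_def)
  have l0: "fd F ?x 0 = 0"
    using linear_0[OF has_derivative_linear[OF differentiable_frechet[OF F(2)[OF y]]]] .
  have "(0, Y ?x) = (\<Sum>i<7. (fd (\<lambda>y. F (snd y)) y (es ! i) / F ?x) *\<^sub>R es ! i)"
    unfolding frechet_snd[of F snd y, OF F(2)[OF y] bl(1)] us(6) grad_log_def us(1)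
    by (simp add: es c l0 numeral_eq_Suc)
  then show ?thesis using len sp tP tQ tA tB unfolding g2_std_def by blast
qed

lemma pull_diff:
  assumes "snd y \<in> U"
  shows "(\<lambda>y. w (snd y) (map snd vs)) differentiable (at (y :: real \<times> 'x))"
    "(\<lambda>y. R (snd y) (map snd vs)) differentiable at y" "(\<lambda>y. I (snd y) (map snd vs)) differentiable at y"
  using differentiable_linear_pull[OF bl(1)] diff assms by blast+

text \<open>It remains to contract with the gradient, which has no circle component, and to
  differentiate. The result is expressed by derivatives on X alone, ready to be compared with the
  velocity of the pulled-back forms.\<close>

lemma dual_and_laplacian:
  assumes x0: "x0 \<in> U"
    and dk: "\<And>vs. (\<lambda>x. I x (Y x # vs)) differentiable (at x0)" and de: "\<And>vs. (\<lambda>x. w x (Y x # vs)) differentiable (at x0)"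
    and \<phi>: "\<And>y. snd y \<in> U \<Longrightarrow> \<phi> y = (\<lambda>vs. R (snd y) (map snd vs) / F (snd y) - F (snd y) * one_wedge 2 fst (wp y) vs)"
  shows "hodge 3 (g2_metric (\<phi> (r, x0))) (g2_vol (\<phi> (r, x0))) (\<phi> (r, x0)) vs =
      (- 2) * one_wedge 3 fst (\<lambda>ws. I x0 (map snd ws)) vs - (1 / 8) * wedge22 (\<lambda>ws. w x0 (map snd ws)) (\<lambda>ws. w x0 (map snd ws)) vs" (is ?dual)
    and "hodge_laplacian 4 (\<lambda>y. g2_metric (\<phi> y)) (\<lambda>y. g2_vol (\<phi> y)) (\<lambda>y. hodge 3 (g2_metric (\<phi> y)) (g2_vol (\<phi> y)) (\<phi> y)) (r, x0) vs =
      (- 2) * one_wedge 3 fst (\<lambda>ws. ext_deriv 2 (\<lambda>x vs. I x (Y x # vs)) x0 (map snd ws)) vs +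
      (1 / 4) * wedge22 (\<lambda>ws. ext_deriv 1 (\<lambda>x vs. w x (Y x # vs)) x0 (map snd ws)) (\<lambda>ws. w x0 (map snd ws)) vs" (is ?lap)
proof -
  let ?U = "UNIV \<times> U" and ?F = "\<lambda>y :: real \<times> 'x. F (snd y)" and ?Y = "\<lambda>y :: real \<times> 'x. (0 :: real, Y (snd y))"
  let ?\<kappa> = "\<lambda>x vs. I x (Y x # vs)" and ?\<eta> = "\<lambda>x vs. w x (Y x # vs)"
  have d7: "DIM(real \<times> 'x) = 7" by (simp add: dim)
  have oU: "open ?U" by (intro open_Times U) simp
  have in_U: "(r, x0) \<in> ?U" using x0 by simp
  have zero: "one_wedge k r (\<lambda>_. 0) vs = 0" for k vs and r :: "real \<times> 'x \<Rightarrow> real" by (simp add: one_wedge_def)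
  have cQ: "ext_deriv 3 Q y vs = 0" if "y \<in> ?U" for y vs
  proof -
    have y: "snd y \<in> U" using that by auto
    have "ext_deriv 3 Q y vs = (- 1) * ext_deriv 3 (\<lambda>y. one_wedge 2 fst (wp y)) y vs"
      unfolding Q_def[abs_def] by (rule ext_deriv_cmult[OF differentiable_one_wedge[OF pull_diff(1)[OF y]]])
    also have "\<dots> = one_wedge 3 fst (ext_deriv 2 wp y) vs"
      by (simp add: ext_deriv_one_wedge(1)[OF pull_diff(1)[OF y]])
    also have "ext_deriv 2 wp y = (\<lambda>_. 0)"
      using ext_deriv_linear_pull[where \<beta> = w, OF bl(1) diff(1)[OF y]] closed(1)[OF y] by (simp add: fun_eq_iff)
    finally show ?thesis by (simp add: zero)
  qed
  have cP: "ext_deriv 3 P y vs = 0" if "y \<in> ?U" for y vs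
    using ext_deriv_linear_pull[where \<beta> = R, OF bl(1) diff(2), of y 3 vs] closed(2) that by (auto simp: P_def[abs_def])
  have dA: "(\<lambda>y. A y vs) differentiable at y" and dB: "(\<lambda>y. B y vs) differentiable at y" if "snd y \<in> U" for y vs
    unfolding A_def B_def
    by (intro differentiable_mult differentiable_const differentiable_one_wedge differentiable_wedge22 pull_diff that)+
  have cAB: "ext_deriv 4 (\<lambda>y vs. A y vs + B y vs) y vs = 0" if "y \<in> ?U" for y vs
  proof -
    have y: "snd y \<in> U" using that by auto
    have w0: "ext_deriv 2 wp y ws = 0" for ws
      using ext_deriv_linear_pull[where \<beta> = w, OF bl(1) diff(1)[OF y]] closed(1)[OF y] by simp
    have I0: "ext_deriv 3 Ip y = (\<lambda>_. 0)"
      using ext_deriv_linear_pull[where \<beta> = I, OF bl(1) diff(3)[OF y]] closed(3)[OF y] by (simp add: fun_eq_iff)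
    have "ext_deriv 4 A y vs = 0"
      unfolding A_def[abs_def]
      by (subst ext_deriv_cmult[OF differentiable_one_wedge[OF pull_diff(3)[OF y]]])
         (simp add: ext_deriv_one_wedge(2)[OF pull_diff(3)[OF y]] I0 zero)
    moreover have "ext_deriv 4 B y vs = 0"
      unfolding B_def[abs_def]
      by (subst ext_deriv_cmult[OF differentiable_wedge22[OF pull_diff(1)[OF y]]])
         (simp add: ext_deriv_wedge22[OF pull_diff(1)[OF y] w0])
    ultimately show ?thesis by (simp add: ext_deriv_add[OF dA[OF y] dB[OF y]])
  qed
  have \<phi>': "\<phi> y = (\<lambda>vs. P y vs / ?F y + ?F y * Q y vs)" if "y \<in> ?U" for y
    using \<phi>[of y] that by (auto simp: P_def Q_def)
  have F': "?F differentiable at y" if "y \<in> ?U" for y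
    using differentiable_linear_pull[OF bl(1) F(2)] that by auto
  have dPQ: "(\<lambda>y. P y vs) differentiable at y" "(\<lambda>y. Q y vs) differentiable at y" if "y \<in> ?U" for y vs
    using that pull_diff[of y] by (auto simp: P_def Q_def intro!: differentiable_minus differentiable_one_wedge)
  have st: "\<exists>es. g2_std es (\<lambda>vs. P y vs / ?F y) (\<lambda>vs. ?F y * Q y vs) (A y) (B y) \<and>
       ?Y y = (\<Sum>i<7. (fd ?F y (es ! i) / ?F y) *\<^sub>R es ! i)" if "y \<in> ?U" for y
    using std[of y] that by auto
  have Fn: "?F y \<noteq> 0" if "y \<in> ?U" for y using F(1)[of "snd y"] that by auto
  note lap = g2_laplacian_dual[of ?U "(r, x0)" \<phi> P ?F Q A B ?Y, OF d7 oU in_U \<phi>' st F' Fn dPQ cP cQ cAB]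
  show ?dual
    using fun_cong[OF lap(2), of vs] by (simp add: A_def B_def)
  let ?e = "\<lambda>y :: real \<times> 'x. one_wedge 2 (\<lambda>v :: real \<times> 'x. ?\<eta> (snd y) (map snd [v])) (wp y)"
  have pk: "(\<lambda>y. ?\<kappa> (snd y) (map snd vs)) differentiable (at (r, x0))" and pe: "(\<lambda>y. ?\<eta> (snd y) (map snd vs)) differentiable (at (r, x0))" for vs
    using differentiable_linear_pull[OF bl(1), of "\<lambda>x. ?\<kappa> x (map snd vs)" "(r, x0)"] dk
      differentiable_linear_pull[OF bl(1), of "\<lambda>x. ?\<eta> x (map snd vs)" "(r, x0)"] de by auto
  \<comment> \<open>The contraction passes dr with a sign, so - 2 becomes 2; in w^2 it hits both
    factors equally, so the coefficient 1/8 becomes 1/4.\<close>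
  have contr: "A y (?Y y # ws) - B y (?Y y # ws) =
     2 * one_wedge 2 fst (\<lambda>us. ?\<kappa> (snd y) (map snd us)) ws + (1 / 4) * ?e y ws" if "y \<in> ?U" for y ws
  proof (cases "length ws = 3")
    case True
    then obtain a b c where ws: "ws = [a, b, c]" using length_3D by blast
    have y: "snd y \<in> U" using that by auto
    have sw: "w (snd y) [a, b] = - w (snd y) [b, a]" for a b
      using alt_form_swap[OF alt(1)[OF y], of "[]" a b "[]"] by simp
    show ?thesis unfolding ws by (simp add: A_def B_def one_wedge_simps wedge22_simp algebra_simps)
  qed (simp add: A_def B_def one_wedge_length wedge22_def)
  have "ext_deriv 3 (\<lambda>y ws. A y (?Y y # ws) - B y (?Y y # ws)) (r, x0) vs =
    ext_deriv 3 (\<lambda>y ws. 2 * one_wedge 2 fst (\<lambda>us. ?\<kappa> (snd y) (map snd us)) ws + (1 / 4) * ?e y ws) (r, x0) vs"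
    by (rule ext_deriv_cong_open[OF oU in_U contr])
  also have "\<dots> = 2 * ext_deriv 3 (\<lambda>y. one_wedge 2 fst (\<lambda>us. ?\<kappa> (snd y) (map snd us))) (r, x0) vs + (1 / 4) * ext_deriv 3 ?e (r, x0) vs"
  proof -
    have 1: "(\<lambda>y. one_wedge 2 fst (\<lambda>us. ?\<kappa> (snd y) (map snd us)) vs) differentiable (at (r, x0))" for vs
      by (rule differentiable_one_wedge[OF pk])
    have w': "(\<lambda>y. w (snd y) (map snd vs)) differentiable (at (r, x0))" for vs using pull_diff(1)[of "(r, x0)"] x0 by simp
    have pe1: "(\<lambda>y. w (snd y) [Y (snd y), snd u]) differentiable (at (r, x0))" for u :: "real \<times> 'x"
      using pe[of "[u]"] by simp
    have w1: "(\<lambda>y. w (snd y) (map snd a @ map snd b)) differentiable (at (r, x0))" for a b :: "(real \<times> 'x) list"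
      using w'[of "a @ b"] by simp
    have 2: "(\<lambda>y. ?e y vs) differentiable (at (r, x0))" for vs
      unfolding one_wedge_def using pe1 w1
      by (cases "length vs = Suc 2") (auto intro!: differentiable_sum differentiable_mult)
    show ?thesis
      by (subst ext_deriv_add, intro differentiable_mult differentiable_const 1, intro differentiable_mult differentiable_const 2)
         (simp only: ext_deriv_cmult[OF 1] ext_deriv_cmult[OF 2])
  qed
  also have "ext_deriv 3 (\<lambda>y. one_wedge 2 fst (\<lambda>us. ?\<kappa> (snd y) (map snd us))) (r, x0) vs =
     - one_wedge 3 fst (\<lambda>ws. ext_deriv 2 ?\<kappa> x0 (map snd ws)) vs"
    unfolding ext_deriv_one_wedge(1)[OF pk]
    by (intro arg_cong[where f = uminus] one_wedge_cong) (use ext_deriv_linear_pull[OF bl(1), of ?\<kappa> "(r, x0)"] dk in simp)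
  also have "ext_deriv 3 ?e (r, x0) vs =
    wedge22 (\<lambda>ws. ext_deriv 1 ?\<eta> x0 (map snd ws)) (\<lambda>ws. w x0 (map snd ws)) vs"
  proof (cases "length vs = 4")
    case True
    have w': "(\<lambda>y. w (snd y) (map snd vs)) differentiable (at (r, x0))" for vs using pull_diff(1)[of "(r, x0)"] x0 by simp
    have w0: "ext_deriv 2 wp (r, x0) ws = 0" for ws
      using ext_deriv_linear_pull[OF bl(1), of w "(r, x0)"] diff(1)[OF x0] closed(1)[OF x0] by simp
    have "ext_deriv 1 (\<lambda>y ws. ?\<eta> (snd y) (map snd ws)) (r, x0) = (\<lambda>ws. ext_deriv 1 ?\<eta> x0 (map snd ws))"
      using ext_deriv_linear_pull[OF bl(1), of ?\<eta> "(r, x0)"] de by (simp add: fun_eq_iff)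
    with ext_deriv_one_wedge_form[where \<eta> = "\<lambda>y ws. ?\<eta> (snd y) (map snd ws)" and \<beta> = wp, OF w' pe w0 True] show ?thesis by simp
  qed (simp add: ext_deriv_length wedge22_def)
  finally have fin: "ext_deriv 3 (\<lambda>y ws. A y (?Y y # ws) - B y (?Y y # ws)) (r, x0) vs =
      (- 2) * one_wedge 3 fst (\<lambda>ws. ext_deriv 2 ?\<kappa> x0 (map snd ws)) vs +
      (1 / 4) * wedge22 (\<lambda>ws. ext_deriv 1 ?\<eta> x0 (map snd ws)) (\<lambda>ws. w x0 (map snd ws)) vs"
    by simp
  show ?lap
    by (rule trans[OF lap(1) fin])
qed

end

section \<open>The product with a three-torus\<close>

lemma ext_deriv_diff:
  assumes "\<And>vs. (\<lambda>y. \<alpha> y vs) differentiable at x" "\<And>vs. (\<lambda>y. \<beta> y vs) differentiable at x"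
  shows "ext_deriv k (\<lambda>y vs. \<alpha> y vs - \<beta> y vs) x vs = ext_deriv k \<alpha> x vs - ext_deriv k \<beta> x vs"
  by (simp add: ext_deriv_def frechet_lin assms sum_subtractf right_diff_distrib)

type_synonym 'e t3 = "real \<times> real \<times> real \<times> 'e"

text \<open>The same situation for complex dimension two. The frame is stretched by
  \<open>k\<close>, so \<open>w\<close> is \<open>K\<close> times and \<open>R\<close>,
  \<open>I\<close> are F / k times their model values.\<close>

locale T3_local =
  fixes K k :: real and F :: "'x::euclidean_space \<Rightarrow> real" and w R I :: "'x \<Rightarrow> 'x list \<Rightarrow> real" and Y :: "'x \<Rightarrow> 'x" and U :: "'x set"
  assumes K: "k > 0" "k * k = K" and dim: "DIM('x) = 4" and U: "open U"
    and xframe: "\<And>x. x \<in> U \<Longrightarrow> \<exists>us. length us = 4 \<and> spanning us \<and> has_table us 2 (\<lambda>vs. w x vs * (1 / K)) tab\<omega> \<and>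
       has_table us 2 (\<lambda>vs. R x vs * (k / F x)) tabRe2 \<and> has_table us 2 (\<lambda>vs. I x vs * (k / F x)) tabIm2 \<and> Y x = grad_log F x us"
    and F: "\<And>x. x \<in> U \<Longrightarrow> F x > 0" "\<And>x. x \<in> U \<Longrightarrow> F differentiable at x"
    and alt: "\<And>x. x \<in> U \<Longrightarrow> alt_form 2 (w x)" "\<And>x. x \<in> U \<Longrightarrow> alt_form 2 (R x)" "\<And>x. x \<in> U \<Longrightarrow> alt_form 2 (I x)"
    and diff: "\<And>x vs. x \<in> U \<Longrightarrow> (\<lambda>x. w x vs) differentiable at x" "\<And>x vs. x \<in> U \<Longrightarrow> (\<lambda>x. R x vs) differentiable at x"
      "\<And>x vs. x \<in> U \<Longrightarrow> (\<lambda>x. I x vs) differentiable at x"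
    and closed: "\<And>x vs. x \<in> U \<Longrightarrow> ext_deriv 2 w x vs = 0" "\<And>x vs. x \<in> U \<Longrightarrow> ext_deriv 2 R x vs = 0"
      "\<And>x vs. x \<in> U \<Longrightarrow> ext_deriv 2 I x vs = 0"
begin

abbreviation r1 :: "'x t3 \<Rightarrow> real" where "r1 y \<equiv> fst y"
abbreviation r2 :: "'x t3 \<Rightarrow> real" where "r2 y \<equiv> fst (snd y)"
abbreviation r3 :: "'x t3 \<Rightarrow> real" where "r3 y \<equiv> fst (snd (snd y))"
abbreviation pr :: "'x t3 \<Rightarrow> 'x" where "pr y \<equiv> snd (snd (snd y))"

abbreviation "wp y \<equiv> \<lambda>ws. w (pr y) (map pr ws)"
abbreviation "Rp y \<equiv> \<lambda>ws. R (pr y) (map pr ws)"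
abbreviation "Ip y \<equiv> \<lambda>ws. I (pr y) (map pr ws)"

text \<open>The model C^3 is C times the tangent space of X, with dx1 = dr2 / k and dy1 = - dr3 / k
  on the first factor, and - F K dr1 is the model one-form on the line. Inserting w / K and (k / F)
  (R + i I) for the standard forms of C^2 cancels \<open>F\<close> in \<open>A\<close> and
  \<open>B\<close> and leaves the constants K and 1 / K^2.\<close>

definition "P (y :: 'x t3) vs =
  one_wedge 2 r2 (Rp y) vs + one_wedge 2 r3 (Ip y) vs"
definition "Q (y :: 'x t3) vs =
  one_wedge 2 r1 (wp y) vs - one_wedge 2 r1 (one_wedge 1 r2 (one_form r3)) vs"
definition "A (y :: 'x t3) vs =
  K * (one_wedge 3 r1 (one_wedge 2 r2 (Ip y)) vs - one_wedge 3 r1 (one_wedge 2 r3 (Rp y)) vs)"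
definition "B (y :: 'x t3) vs =
  (1 / K\<^sup>2) * (one_wedge 3 r2 (one_wedge 2 r3 (wp y)) vs
     - wedge22 (wp y) (wp y) vs / 2)"

lemma bl: "bounded_linear pr" "linear pr" "linear r1" "linear r2" "linear r3"
  by (simp_all add: bounded_linear.linear bounded_linear_snd_comp bounded_linear_fst_comp bounded_linear_snd bounded_linear_fst)

lemma alts:
  assumes "pr y \<in> U"
  shows "alt_form 3 (P y)" "alt_form 3 (Q y)" "alt_form 4 (A y)" "alt_form 4 (B y)"
proof -
  note c = alt_form_compose[OF alt(1)[OF assms] bl(2)] alt_form_compose[OF alt(2)[OF assms] bl(2)] alt_form_compose[OF alt(3)[OF assms] bl(2)]
  show "alt_form 3 (P y)" unfolding P_def[abs_def]
    by (intro alt_form_add alt_form_one_wedge(2) bl c)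
  show "alt_form 3 (Q y)" unfolding Q_def[abs_def]
    by (intro alt_form_diff alt_form_one_wedge(1,2) bl c alt_form_one_form)
  show "alt_form 4 (A y)" unfolding A_def[abs_def]
    by (intro alt_form_mult alt_form_diff alt_form_one_wedge(2,3) bl c)
  have "alt_form 4 (\<lambda>vs. (1 / 2) * wedge22 (wp y) (wp y) vs)"
    by (intro alt_form_mult alt_form_wedge22 c)
  then have h: "alt_form 4 (\<lambda>vs. wedge22 (wp y) (wp y) vs / 2)" by simp
  show "alt_form 4 (B y)" unfolding B_def[abs_def]
    by (intro alt_form_mult alt_form_diff alt_form_one_wedge(2,3) bl c h)
qed

lemma spanning_Cons_real3:
  assumes s: "spanning us" and a: "a \<noteq> 0" "b \<noteq> 0" "c \<noteq> 0"
  shows "spanning ((a, 0, 0, 0) # (0, b, 0, 0) # (0, 0, c, 0) # map (\<lambda>u. (0 :: real, 0 :: real, 0 :: real, u)) us)"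
  using spanning_Cons_real[OF spanning_Cons_real[OF spanning_Cons_real[OF s a(3)] a(2)] a(1)]
  by (simp add: zero_prod_def o_def)

lemma std:
  assumes y: "pr y \<in> U"
  shows "\<exists>es. g2_std es (\<lambda>vs. P y vs / F (pr y)) (\<lambda>vs. F (pr y) * Q y vs) (A y) (B y) \<and>
    (0, 0, 0, Y (pr y)) = (\<Sum>i<7. (fd (\<lambda>y. F (pr y)) y (es ! i) / F (pr y)) *\<^sub>R es ! i)"
proof -
  let ?x = "pr y"
  obtain us where us: "length us = 4" "spanning us" "has_table us 2 (\<lambda>vs. w ?x vs * (1 / K)) tab\<omega>"
       "has_table us 2 (\<lambda>vs. R ?x vs * (k / F ?x)) tabRe2" "has_table us 2 (\<lambda>vs. I ?x vs * (k / F ?x)) tabIm2" "Y ?x = grad_log F ?x us"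
    using xframe[OF y] by blast
  obtain c0 c1 c2 c3 where c: "us = [c0, c1, c2, c3]"
    using us(1) by (auto simp: numeral_eq_Suc length_Suc_conv)
  have Fn: "F ?x \<noteq> 0" using F(1)[OF y] by simp
  have Kn: "K \<noteq> 0" "k \<noteq> 0" using K by auto
  have tw: "\<forall>is\<in>set (incs 2 0 4). w ?x (map ((!) us) is) = of_int (tab\<omega> is) / (1 / K)"
    using table_values[OF us(3)] us(1) Kn by simp
  have tR: "\<forall>is\<in>set (incs 2 0 4). R ?x (map ((!) us) is) = of_int (tabRe2 is) / (k / F ?x)"
    using table_values[OF us(4)] us(1) Fn Kn by simp
  have tI: "\<forall>is\<in>set (incs 2 0 4). I ?x (map ((!) us) is) = of_int (tabIm2 is) / (k / F ?x)"
    using table_values[OF us(5)] us(1) Fn Kn by simp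
  note w_values = tw[unfolded incs_2_4 c, simplified tab\<omega>_def, simplified]
  note R_values = tR[unfolded incs_2_4 c, simplified tabRe2_def, simplified]
  note I_values = tI[unfolded incs_2_4 c, simplified tabIm2_def, simplified]
  \<comment> \<open>The first sign turns - dr \<and> \<omega> of the model into + dr1 \<and> w. The
    sign of the third vector matches Re (dz1 \<and> \<Upsilon>) = dx1 \<and> Re \<Upsilon> - dy1
    \<and> Im \<Upsilon> with dr2 \<and> R + dr3 \<and> I; the lengths make every coefficient 1 or
    -1.\<close>
  define es where "es = (- 1 / (F ?x * K), 0, 0, 0 :: 'x) # (0, k, 0, 0) # (0, 0, - k, 0) # map (\<lambda>u. (0, 0, 0, u)) us"
  have len: "length es = 7" by (simp add: es_def us)
  have es: "es = [(- 1 / (F ?x * K), 0, 0, 0), (0, k, 0, 0), (0, 0, - k, 0), (0, 0, 0, c0), (0, 0, 0, c1), (0, 0, 0, c2), (0, 0, 0, c3)]"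
    by (simp add: es_def c)
  have sp: "spanning es" unfolding es_def by (rule spanning_Cons_real3[OF us(2)]) (use Fn Kn in simp_all)
  have z: "R ?x [0, a] = 0" "I ?x [0, a] = 0" "w ?x [0, a] = 0" for a
    using linear_0[OF alt_form_linear_hd[OF alt(1)[OF y]], of "[a]"] linear_0[OF alt_form_linear_hd[OF alt(2)[OF y]], of "[a]"]
      linear_0[OF alt_form_linear_hd[OF alt(3)[OF y]], of "[a]"] by simp_all
  have kk: "k * (k * x) = K * x" "k * (x * k) = K * x" for x using K(2) by (simp_all add: mult.left_commute flip: mult.assoc)
  note ev = one_wedge_simps one_wedge_1[unfolded One_nat_def] one_form_simp
  have tP: "has_table es 3 (\<lambda>vs. P y vs / F ?x) tabP"
    unfolding has_table_def len incs_3_7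
    using alt_form_mult[OF alts(1)[OF y], of "1 / F ?x"]
    by (simp add: P_def es ev R_values I_values z tabP_def Fn Kn)
  have tQ: "has_table es 3 (\<lambda>vs. F ?x * Q y vs) tabQ"
    unfolding has_table_def len incs_3_7
    using alt_form_mult[OF alts(2)[OF y], of "F ?x"]
    by (simp add: Q_def es ev w_values z tabQ_def Fn Kn K(2))
  have tA: "has_table es 4 (A y) tabA"
    unfolding has_table_def len incs_4_7
    using alts(3)[OF y]
    by (simp add: A_def es ev I_values R_values z tabA_def Fn Kn)
  have tB: "has_table es 4 (B y) tabB"
    unfolding has_table_def len incs_4_7
    using alts(4)[OF y]
    by (simp add: B_def es ev wedge22_simp w_values z tabB_def Kn power2_eq_square kk K(2))
  have l0: "fd F ?x 0 = 0"
    using linear_0[OF has_derivative_linear[OF differentiable_frechet[OF F(2)[OF y]]]] .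
  have "(0, 0, 0, Y ?x) = (\<Sum>i<7. (fd (\<lambda>y. F (pr y)) y (es ! i) / F ?x) *\<^sub>R es ! i)"
    unfolding frechet_snd[of F pr y, OF F(2)[OF y] bl(1)] us(6) grad_log_def us(1)
    by (simp add: es c l0 numeral_eq_Suc)
  then show ?thesis using len sp tP tQ tA tB unfolding g2_std_def by blast
qed

lemma pull_diff:
  assumes "pr y \<in> U"
  shows "(\<lambda>y. w (pr y) (map pr vs)) differentiable at y"
    "(\<lambda>y. R (pr y) (map pr vs)) differentiable at y" "(\<lambda>y. I (pr y) (map pr vs)) differentiable at y"
  using differentiable_linear_pull[OF bl(1)] diff assms by blast+

lemma dual_and_laplacian:
  assumes x0: "x0 \<in> U"
    and dI: "\<And>vs. (\<lambda>x. I x (Y x # vs)) differentiable (at x0)" and dR: "\<And>vs. (\<lambda>x. R x (Y x # vs)) differentiable (at x0)"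
    and de: "\<And>vs. (\<lambda>x. w x (Y x # vs)) differentiable (at x0)"
    and \<phi>: "\<And>y. pr y \<in> U \<Longrightarrow> \<phi> y = (\<lambda>vs. - F (pr y) * one_wedge 2 r1 (one_wedge 1 r2 (one_form r3)) vs
       + F (pr y) * one_wedge 2 r1 (wp y) vs
       + one_wedge 2 r2 (Rp y) vs / F (pr y) + one_wedge 2 r3 (Ip y) vs / F (pr y))"
    and y0: "pr y0 = x0"
  defines "dw \<equiv> \<lambda>ws. ext_deriv 1 (\<lambda>x vs. w x (Y x # vs)) x0 (map pr ws)"
  shows "hodge 3 (g2_metric (\<phi> y0)) (g2_vol (\<phi> y0)) (\<phi> y0) vs =
      K * (one_wedge 3 r1 (one_wedge 2 r2 (\<lambda>ws. I x0 (map pr ws))) vs - one_wedge 3 r1 (one_wedge 2 r3 (\<lambda>ws. R x0 (map pr ws))) vs)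
      + (1 / K\<^sup>2) * (one_wedge 3 r2 (one_wedge 2 r3 (\<lambda>ws. w x0 (map pr ws))) vs
        - wedge22 (\<lambda>ws. w x0 (map pr ws)) (\<lambda>ws. w x0 (map pr ws)) vs / 2)" (is ?dual)
    and "hodge_laplacian 4 (\<lambda>y. g2_metric (\<phi> y)) (\<lambda>y. g2_vol (\<phi> y)) (\<lambda>y. hodge 3 (g2_metric (\<phi> y)) (g2_vol (\<phi> y)) (\<phi> y)) y0 vs =
      K * (one_wedge 3 r1 (one_wedge 2 r2 (\<lambda>ws. ext_deriv 1 (\<lambda>x vs. I x (Y x # vs)) x0 (map pr ws))) vs
         - one_wedge 3 r1 (one_wedge 2 r3 (\<lambda>ws. ext_deriv 1 (\<lambda>x vs. R x (Y x # vs)) x0 (map pr ws))) vs)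
      - (1 / K\<^sup>2) * (one_wedge 3 r2 (one_wedge 2 r3 dw) vs - wedge22 dw (\<lambda>ws. w x0 (map pr ws)) vs)" (is ?lap)
proof -
  let ?U = "UNIV \<times> UNIV \<times> UNIV \<times> U" and ?F = "\<lambda>y. F (pr y)" and ?Y = "\<lambda>y. (0 :: real, 0 :: real, 0 :: real, Y (pr y))"
  have d7: "DIM('x t3) = 7" by (simp add: dim)
  have oU: "open ?U" by (intro open_Times U open_UNIV)
  have in_U: "y0 \<in> ?U" using x0 y0 by (cases y0) auto
  have UD: "pr y \<in> U" if "y \<in> ?U" for y using that by auto
  have zero: "one_wedge k r (\<lambda>_. 0) = (\<lambda>_. 0)" for k and r :: "'x t3 \<Rightarrow> real" by (simp add: one_wedge_def fun_eq_iff)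
  have cl: "ext_deriv 2 wp y = (\<lambda>_. 0)" "ext_deriv 2 Rp y = (\<lambda>_. 0)"
    "ext_deriv 2 Ip y = (\<lambda>_. 0)" if y: "pr y \<in> U" for y
    using ext_deriv_linear_pull[where \<beta> = w and x = y, OF bl(1) diff(1)[OF y]] closed(1)[OF y]
      ext_deriv_linear_pull[where \<beta> = R and x = y, OF bl(1) diff(2)[OF y]] closed(2)[OF y]
      ext_deriv_linear_pull[where \<beta> = I and x = y, OF bl(1) diff(3)[OF y]] closed(3)[OF y] by (simp_all add: fun_eq_iff)
  have d1: "(\<lambda>y. one_wedge k r (wp y) vs) differentiable at y"
    "(\<lambda>y. one_wedge k r (Rp y) vs) differentiable at y"
    "(\<lambda>y. one_wedge k r (Ip y) vs) differentiable at y" if y: "pr y \<in> U" for y k r vs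
    by (rule differentiable_one_wedge, rule pull_diff[OF y])+
  have d2: "(\<lambda>y. one_wedge l s (one_wedge k r (wp y)) vs) differentiable at y"
    "(\<lambda>y. one_wedge l s (one_wedge k r (Rp y)) vs) differentiable at y"
    "(\<lambda>y. one_wedge l s (one_wedge k r (Ip y)) vs) differentiable at y" if y: "pr y \<in> U" for y k r l s vs
    by (rule differentiable_one_wedge, rule d1[OF y])+
  have e1: "ext_deriv 3 (\<lambda>y. one_wedge 2 r (wp y)) y = (\<lambda>_. 0)"
    "ext_deriv 3 (\<lambda>y. one_wedge 2 r (Rp y)) y = (\<lambda>_. 0)"
    "ext_deriv 3 (\<lambda>y. one_wedge 2 r (Ip y)) y = (\<lambda>_. 0)" if y: "pr y \<in> U" for y r
    by (simp_all add: fun_eq_iff ext_deriv_one_wedge(1)[OF pull_diff(1)[OF y]] ext_deriv_one_wedge(1)[OF pull_diff(2)[OF y]]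
      ext_deriv_one_wedge(1)[OF pull_diff(3)[OF y]] cl[OF y] zero)
  have e2: "ext_deriv 4 (\<lambda>y. one_wedge 3 s (one_wedge 2 r (wp y))) y vs = 0"
    "ext_deriv 4 (\<lambda>y. one_wedge 3 s (one_wedge 2 r (Rp y))) y vs = 0"
    "ext_deriv 4 (\<lambda>y. one_wedge 3 s (one_wedge 2 r (Ip y))) y vs = 0" if y: "pr y \<in> U" for y r s vs
    by (simp_all add: ext_deriv_one_wedge(2)[OF d1(1)[OF y]] ext_deriv_one_wedge(2)[OF d1(2)[OF y]]
      ext_deriv_one_wedge(2)[OF d1(3)[OF y]] e1[OF y] zero)
  have const: "ext_deriv k (\<lambda>_. \<alpha>) y vs = 0" for k \<alpha> vs and y :: "'x t3"
    by (simp add: ext_deriv_def)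
  have cP: "ext_deriv 3 P y vs = 0" if "y \<in> ?U" for y vs
    unfolding P_def[abs_def] using e1[OF UD[OF that]] by (subst ext_deriv_add) (auto intro: d1 UD[OF that])
  have cQ: "ext_deriv 3 Q y vs = 0" if "y \<in> ?U" for y vs
    unfolding Q_def[abs_def] using e1[OF UD[OF that]] const
    by (subst ext_deriv_diff) (auto intro: d1 UD[OF that])
  have dA: "(\<lambda>y. A y vs) differentiable at y" and dB: "(\<lambda>y. B y vs) differentiable at y" if y: "pr y \<in> U" for y vs
  proof -
    show "(\<lambda>y. A y vs) differentiable at y" unfolding A_def
      by (intro differentiable_mult differentiable_const differentiable_diff d2[OF y])
    have "(\<lambda>y. wedge22 (wp y) (wp y) vs) differentiable at y"
      by (rule differentiable_wedge22[where \<beta> = wp, OF pull_diff(1)[OF y]])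
    then show "(\<lambda>y. B y vs) differentiable at y" unfolding B_def
      by (intro differentiable_mult differentiable_const differentiable_diff d2[OF y] differentiable_divide) auto
  qed
  have cAB: "ext_deriv 4 (\<lambda>y vs. A y vs + B y vs) y vs = 0" if "y \<in> ?U" for y vs
  proof -
    note y = UD[OF that]
    note w22 = differentiable_wedge22[where \<beta> = wp, OF pull_diff(1)[OF y]]
    have w0: "ext_deriv 2 wp y ws = 0" for ws using cl(1)[OF y] by simp
    have "ext_deriv 4 A y vs = 0"
      unfolding A_def[abs_def]
      by (subst ext_deriv_cmult) (auto intro!: differentiable_diff d2[OF y] simp: ext_deriv_diff[OF d2(3)[OF y] d2(2)[OF y]] e2[OF y])
    moreover have "ext_deriv 4 B y vs = 0"
    proof -
      have "B = (\<lambda>y vs. (1 / K\<^sup>2) * (one_wedge 3 r2 (one_wedge 2 r3 (wp y)) vs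
         - (1 / 2) * wedge22 (wp y) (wp y) vs))"
        by (simp add: B_def[abs_def])
      then show ?thesis
        by (simp only:) (subst ext_deriv_cmult, auto intro!: differentiable_diff differentiable_mult d2[OF y] w22
          simp: ext_deriv_diff[OF d2(1)[OF y] differentiable_mult[OF differentiable_const w22]] e2[OF y] ext_deriv_cmult[OF w22]
            ext_deriv_wedge22[OF pull_diff(1)[OF y] w0] simp del: times_divide_eq_left)
    qed
    ultimately show ?thesis by (simp add: ext_deriv_add[OF dA[OF y] dB[OF y]])
  qed
  have \<phi>': "\<phi> y = (\<lambda>vs. P y vs / ?F y + ?F y * Q y vs)" if "y \<in> ?U" for y
    using \<phi>[OF UD[OF that]] by (simp add: P_def Q_def fun_eq_iff algebra_simps add_divide_distrib)
  have F': "?F differentiable at y" if "y \<in> ?U" for y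
    using differentiable_linear_pull[OF bl(1) F(2)] UD[OF that] by auto
  have dPQ: "(\<lambda>y. P y vs) differentiable at y" "(\<lambda>y. Q y vs) differentiable at y" if "y \<in> ?U" for y vs
    using d1[OF UD[OF that]] by (auto simp: P_def Q_def intro!: differentiable_add differentiable_diff)
  have st: "\<exists>es. g2_std es (\<lambda>vs. P y vs / ?F y) (\<lambda>vs. ?F y * Q y vs) (A y) (B y) \<and>
       ?Y y = (\<Sum>i<7. (fd ?F y (es ! i) / ?F y) *\<^sub>R es ! i)" if "y \<in> ?U" for y
    using std[OF UD[OF that]] .
  have Fn: "?F y \<noteq> 0" if "y \<in> ?U" for y using F(1)[OF UD[OF that]] by simp
  note lap = g2_laplacian_dual[of ?U "y0" \<phi> P ?F Q A B ?Y, OF d7 oU in_U \<phi>' st F' Fn dPQ cP cQ cAB]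
  show ?dual
    using fun_cong[OF lap(2), of vs] by (simp add: A_def B_def y0)
  let ?\<kappa>I = "\<lambda>x vs. I x (Y x # vs)" and ?\<kappa>R = "\<lambda>x vs. R x (Y x # vs)" and ?\<eta> = "\<lambda>x vs. w x (Y x # vs)"
  let ?e = "\<lambda>y. one_wedge 2 (\<lambda>v. ?\<eta> (pr y) (map pr [v])) (wp y)"
  let ?p = "\<lambda>\<kappa> (y :: 'x t3) vs. \<kappa> (pr y) (map pr vs) :: real"
  have pI: "(\<lambda>y. ?p ?\<kappa>I y vs) differentiable (at y0)" and pR: "(\<lambda>y. ?p ?\<kappa>R y vs) differentiable (at y0)"
    and pe: "(\<lambda>y. ?p ?\<eta> y vs) differentiable (at y0)" for vs
    using differentiable_linear_pull[OF bl(1), of "\<lambda>x. ?\<kappa>I x (map pr vs)" y0] dI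
      differentiable_linear_pull[OF bl(1), of "\<lambda>x. ?\<kappa>R x (map pr vs)" y0] dR
      differentiable_linear_pull[OF bl(1), of "\<lambda>x. ?\<eta> x (map pr vs)" y0] de y0 by auto
  have contr: "A y (?Y y # ws) - B y (?Y y # ws) =
     K * (one_wedge 2 r1 (one_wedge 1 r2 (?p ?\<kappa>I y)) ws - one_wedge 2 r1 (one_wedge 1 r3 (?p ?\<kappa>R y)) ws)
     + (1 / K\<^sup>2) * (?e y ws - one_wedge 2 r2 (one_wedge 1 r3 (?p ?\<eta> y)) ws)" if "y \<in> ?U" for y ws
  proof (cases "length ws = 3")
    case True
    then obtain a b c where ws: "ws = [a, b, c]" using length_3D by blast
    show ?thesis unfolding ws
      by (simp add: A_def B_def one_wedge_simps one_wedge_1[unfolded One_nat_def] wedge22_simp algebra_simps add_divide_distrib diff_divide_distrib)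
  qed (simp add: A_def B_def one_wedge_length wedge22_def)
  \<comment> \<open>Passing two constant one-forms costs two signs, which cancel.\<close>
  have dd: "ext_deriv 3 (\<lambda>y. one_wedge 2 s (one_wedge 1 r (?p ka y))) y0 vs =
      one_wedge 3 s (one_wedge 2 r (\<lambda>ws. ext_deriv 1 ka x0 (map pr ws))) vs"
    and dd': "(\<lambda>y. one_wedge 2 s (one_wedge 1 r (?p ka y)) vs) differentiable (at y0)"
    if p: "\<And>vs. (\<lambda>y. ?p ka y vs) differentiable (at y0)" and q: "\<And>vs. (\<lambda>x. ka x vs) differentiable (at x0)" for ka s r vs
  proof -
    have p1: "(\<lambda>y. one_wedge 1 r (?p ka y) vs) differentiable (at y0)" for vs
      by (rule differentiable_one_wedge[where \<beta> = "\<lambda>y. ?p ka y", OF p])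
    show "(\<lambda>y. one_wedge 2 s (one_wedge 1 r (?p ka y)) vs) differentiable (at y0)"
      by (rule differentiable_one_wedge[where \<beta> = "\<lambda>y. one_wedge 1 r (?p ka y)", OF p1])
    have "ext_deriv 3 (\<lambda>y. one_wedge 2 s (one_wedge 1 r (?p ka y))) y0 vs =
      - one_wedge 3 s (\<lambda>ws. - one_wedge 2 r (ext_deriv 1 (?p ka) y0) ws) vs"
      unfolding ext_deriv_one_wedge(1)[where \<beta> = "\<lambda>y. one_wedge 1 r (?p ka y)", OF p1]
      by (intro arg_cong[where f = uminus] one_wedge_cong) (rule ext_deriv_one_wedge_1[where \<beta> = "\<lambda>y. ?p ka y", OF p])
    also have "\<dots> = one_wedge 3 s (one_wedge 2 r (ext_deriv 1 (?p ka) y0)) vs"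
      by (simp add: one_wedge_def sum_negf)
    also have "ext_deriv 1 (?p ka) y0 = (\<lambda>ws. ext_deriv 1 ka x0 (map pr ws))"
      using ext_deriv_linear_pull[OF bl(1), of ka y0] q y0 by (simp add: fun_eq_iff)
    finally show "ext_deriv 3 (\<lambda>y. one_wedge 2 s (one_wedge 1 r (?p ka y))) y0 vs =
      one_wedge 3 s (one_wedge 2 r (\<lambda>ws. ext_deriv 1 ka x0 (map pr ws))) vs" .
  qed
  note ddI = dd[of "?\<kappa>I", OF pI dI] and dd'I = dd'[of "?\<kappa>I", OF pI dI]
  note ddR = dd[of "?\<kappa>R", OF pR dR] and dd'R = dd'[of "?\<kappa>R", OF pR dR]
  note dde = dd[of "?\<eta>", OF pe de] and dd'e = dd'[of "?\<eta>", OF pe de]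
  have y0U: "pr y0 \<in> U" using x0 y0 by simp
  have w': "(\<lambda>y. w (pr y) (map pr vs)) differentiable (at y0)" for vs by (rule pull_diff(1)[OF y0U])
  have pe1: "(\<lambda>y. w (pr y) [Y (pr y), pr u]) differentiable (at y0)" for u
    using pe[of "[u]"] by simp
  have w1: "(\<lambda>y. w (pr y) (map pr a @ map pr b)) differentiable (at y0)" for a b
    using w'[of "a @ b"] by simp
  have d\<eta>: "(\<lambda>y. ?e y vs) differentiable (at y0)" for vs
    unfolding one_wedge_def using pe1 w1
    by (cases "length vs = Suc 2") (auto intro!: differentiable_sum differentiable_mult)
  have e\<eta>: "ext_deriv 3 ?e y0 vs = wedge22 dw (\<lambda>ws. w x0 (map pr ws)) vs"
  proof (cases "length vs = 4")
    case True
    have w0: "ext_deriv 2 wp y0 ws = 0" for ws using cl(1)[OF y0U] by simp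
    have "ext_deriv 1 (?p ?\<eta>) y0 = dw"
      using ext_deriv_linear_pull[OF bl(1), of ?\<eta> y0] de y0 by (simp add: fun_eq_iff dw_def)
    with ext_deriv_one_wedge_form[where \<eta> = "?p ?\<eta>" and \<beta> = wp, OF w' pe w0 True] show ?thesis by (simp add: y0)
  qed (simp add: ext_deriv_length wedge22_def)
  have "ext_deriv 3 (\<lambda>y ws. A y (?Y y # ws) - B y (?Y y # ws)) y0 vs =
    ext_deriv 3 (\<lambda>y ws. K * (one_wedge 2 r1 (one_wedge 1 r2 (?p ?\<kappa>I y)) ws - one_wedge 2 r1 (one_wedge 1 r3 (?p ?\<kappa>R y)) ws)
     + (1 / K\<^sup>2) * (?e y ws - one_wedge 2 r2 (one_wedge 1 r3 (?p ?\<eta> y)) ws)) y0 vs"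
    by (rule ext_deriv_cong_open[OF oU in_U contr])
  also have "\<dots> = K * (ext_deriv 3 (\<lambda>y. one_wedge 2 r1 (one_wedge 1 r2 (?p ?\<kappa>I y))) y0 vs
       - ext_deriv 3 (\<lambda>y. one_wedge 2 r1 (one_wedge 1 r3 (?p ?\<kappa>R y))) y0 vs)
     + (1 / K\<^sup>2) * (ext_deriv 3 ?e y0 vs - ext_deriv 3 (\<lambda>y. one_wedge 2 r2 (one_wedge 1 r3 (?p ?\<eta> y))) y0 vs)"
    by (subst ext_deriv_add, intro differentiable_mult differentiable_const differentiable_diff dd'I dd'R,
        intro differentiable_mult differentiable_const differentiable_diff d\<eta> dd'e)
       (simp only: ext_deriv_cmult ext_deriv_diff differentiable_diff dd'I dd'R d\<eta> dd'e)
  finally have fin: "ext_deriv 3 (\<lambda>y ws. A y (?Y y # ws) - B y (?Y y # ws)) y0 vs =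
      K * (one_wedge 3 r1 (one_wedge 2 r2 (\<lambda>ws. ext_deriv 1 ?\<kappa>I x0 (map pr ws))) vs
         - one_wedge 3 r1 (one_wedge 2 r3 (\<lambda>ws. ext_deriv 1 ?\<kappa>R x0 (map pr ws))) vs)
      - (1 / K\<^sup>2) * (one_wedge 3 r2 (one_wedge 2 r3 dw) vs - wedge22 dw (\<lambda>ws. w x0 (map pr ws)) vs)"
    unfolding ddI ddR dde e\<eta> by (simp add: dw_def algebra_simps)
  show ?lap
    by (rule trans[OF lap(1) fin])
qed

end

section \<open>Charts\<close>

lemma atlas_chart:
  assumes "smooth_atlas A" "c \<in> A"
  shows "open (cdom c)" "open (cimg c)" "continuous_on (cdom c) (cmap c)" "continuous_on (cimg c) (cinv c)"
    "x \<in> cimg c \<Longrightarrow> cmap c (cinv c x) = x" "p \<in> cdom c \<Longrightarrow> cinv c (cmap c p) = p"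
    "x \<in> cimg c \<Longrightarrow> cinv c x \<in> cdom c" "p \<in> cdom c \<Longrightarrow> cmap c p \<in> cimg c"
proof -
  have h: "open (cdom c)" "open (cimg c)" "homeomorphism (cdom c) (cimg c) (cmap c) (cinv c)"
    using assms unfolding smooth_atlas_def by auto
  show "open (cdom c)" "open (cimg c)" "continuous_on (cdom c) (cmap c)" "continuous_on (cimg c) (cinv c)"
    "x \<in> cimg c \<Longrightarrow> cmap c (cinv c x) = x" "p \<in> cdom c \<Longrightarrow> cinv c (cmap c p) = p"
    "x \<in> cimg c \<Longrightarrow> cinv c x \<in> cdom c" "p \<in> cdom c \<Longrightarrow> cmap c p \<in> cimg c"
    using h unfolding homeomorphism_def by auto
qed

lemma atlas_covers: "smooth_atlas A \<Longrightarrow> \<exists>c\<in>A. p \<in> cdom c"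
  unfolding smooth_atlas_def by blast

lemma rep_domain:
  assumes "smooth_atlas A" "c \<in> A"
  shows "cmap c ` (cdom c \<inter> f -` D) = {x \<in> cimg c. f (cinv c x) \<in> D}"
proof (intro set_eqI iffI)
  fix x assume "x \<in> cmap c ` (cdom c \<inter> f -` D)"
  then obtain p where "p \<in> cdom c" "f p \<in> D" "x = cmap c p" by auto
  then show "x \<in> {x \<in> cimg c. f (cinv c x) \<in> D}" using atlas_chart(6,8)[OF assms] by simp
next
  fix x assume "x \<in> {x \<in> cimg c. f (cinv c x) \<in> D}"
  then have "cinv c x \<in> cdom c \<inter> f -` D" "x = cmap c (cinv c x)" using atlas_chart(5,7)[OF assms] by auto
  then show "x \<in> cmap c ` (cdom c \<inter> f -` D)" by (rule image_eqI[rotated])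
qed

lemma open_rep_domain:
  assumes A: "smooth_atlas A" "c \<in> A" and f: "continuous_on UNIV f" and D: "open D"
  shows "open {x \<in> cimg c. f (cinv c x) \<in> D}"
proof -
  have "continuous_on (cimg c) (\<lambda>x. f (cinv c x))"
    by (rule continuous_on_compose2[OF f atlas_chart(4)[OF A]]) simp
  from continuous_open_preimage[OF this atlas_chart(2)[OF A] D]
  have "open (cimg c \<inter> (\<lambda>x. f (cinv c x)) -` D)" .
  moreover have "cimg c \<inter> (\<lambda>x. f (cinv c x)) -` D = {x \<in> cimg c. f (cinv c x) \<in> D}" by blast
  ultimately show ?thesis by (simp only:)
qed

lemma transition_eq: "transition c d x = cmap d (cinv c x)"
  by (simp add: transition_def coord_rep_def)

lemma coord_rep_eq: "coord_rep c d f x = cmap d (f (cinv c x))"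
  by (simp add: coord_rep_def)

lemma smooth_map_rep:
  assumes A: "smooth_atlas A" "smooth_atlas B" and f: "smooth_map A B f" and c: "c \<in> A" "d \<in> B"
  shows "open {x \<in> cimg c. f (cinv c x) \<in> cdom d}"
    and "smooth_on {x \<in> cimg c. f (cinv c x) \<in> cdom d} (coord_rep c d f)"
proof -
  show "open {x \<in> cimg c. f (cinv c x) \<in> cdom d}"
    using open_rep_domain[OF A(1) c(1) _ atlas_chart(1)[OF A(2) c(2)], of f] f unfolding smooth_map_def by simp
  have "smooth_on (cmap c ` (cdom c \<inter> f -` cdom d)) (coord_rep c d f)"
    using f c unfolding smooth_map_def by simp
  then show "smooth_on {x \<in> cimg c. f (cinv c x) \<in> cdom d} (coord_rep c d f)"
    unfolding rep_domain[OF A(1) c(1)] .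
qed

lemma smooth_map_id: "smooth_atlas A \<Longrightarrow> smooth_map A A id"
  unfolding smooth_map_def transition_def[symmetric] by (auto simp: smooth_atlas_def)

lemma transition_smooth:
  assumes A: "smooth_atlas A" and c: "c \<in> A" "d \<in> A"
  shows "open {x \<in> cimg c. cinv c x \<in> cdom d}" "smooth_on {x \<in> cimg c. cinv c x \<in> cdom d} (transition c d)"
  using smooth_map_rep[OF A A smooth_map_id[OF A] c] by (simp_all add: transition_def)

section \<open>Compatible local representatives and their pullbacks\<close>

definition form_compat :: "('m, 'e::real_normed_vector) chart set \<Rightarrow> ('m, 'e, 'b) form \<Rightarrow> bool" where
  "form_compat A \<alpha> \<longleftrightarrow> (\<forall>c\<in>A. \<forall>d\<in>A. \<forall>x\<in>cimg c. cinv c x \<in> cdom d \<longrightarrow> (\<forall>vs.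
        \<alpha> c x vs = \<alpha> d (transition c d x) (map (fd (transition c d) x) vs)))"

lemma smooth_form_iff:
  assumes "smooth_atlas A"
  shows "smooth_form A k \<alpha> \<longleftrightarrow>
     (\<forall>c\<in>A. (\<forall>x\<in>cimg c. alt_form k (\<alpha> c x)) \<and> (\<forall>vs. smooth_on (cimg c) (\<lambda>x. \<alpha> c x vs))) \<and> form_compat A \<alpha>"
proof -
  have e: "cmap c ` (cdom c \<inter> cdom d) = {x \<in> cimg c. cinv c x \<in> cdom d}" if "c \<in> A" for c d
    using rep_domain[OF assms that, of id "cdom d"] by simp
  have "(\<forall>c\<in>A. \<forall>d\<in>A. \<forall>x\<in>cmap c ` (cdom c \<inter> cdom d). \<forall>vs.
        \<alpha> c x vs = \<alpha> d (transition c d x) (map (fd (transition c d) x) vs)) = form_compat A \<alpha>"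
    unfolding form_compat_def
  proof (rule ball_cong[OF refl], rule ball_cong[OF refl])
    fix c d assume "c \<in> A"
    show "(\<forall>x\<in>cmap c ` (cdom c \<inter> cdom d). \<forall>vs. \<alpha> c x vs = \<alpha> d (transition c d x) (map (fd (transition c d) x) vs)) =
      (\<forall>x\<in>cimg c. cinv c x \<in> cdom d \<longrightarrow> (\<forall>vs. \<alpha> c x vs = \<alpha> d (transition c d x) (map (fd (transition c d) x) vs)))"
      unfolding e[OF \<open>c \<in> A\<close>] by blast
  qed
  then show ?thesis unfolding smooth_form_def by (simp only:)
qed

text \<open>In the situation of this lemma \<open>g\<close> is the coordinate expression of \<open>f\<close> for the fixed target chart \<open>d\<close>.\<close>

lemma pullback_in_chart:
  assumes B: "\<And>d d' x. d \<in> B \<Longrightarrow> d' \<in> B \<Longrightarrow> x \<in> cimg d \<Longrightarrow> cinv d x \<in> cdom d' \<Longrightarrow> transition d d' differentiable at x"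
    and \<beta>: "form_compat B \<beta>" and d: "d \<in> B"
    and W: "open W" "x \<in> W" and g: "\<And>y. y \<in> W \<Longrightarrow> f (cinv c y) = cinv d (g y)" "\<And>y. y \<in> W \<Longrightarrow> g y \<in> cimg d"
    and dd: "cinv d (g x) \<in> cdom d" and D: "(g has_derivative D) (at x)"
  shows "pullback B f \<beta> c x vs = \<beta> d (g x) (map D vs)"
proof -
  \<comment> \<open>The chart selected inside \<open>pullback\<close> is exchanged for the
    prescribed \<open>d\<close> by the transition map, and compatibility of \<beta> absorbs the
    exchange.\<close>
  define e where "e = (SOME e. e \<in> B \<and> f (cinv c x) \<in> cdom e)"
  have "d \<in> B \<and> f (cinv c x) \<in> cdom d" using d dd g(1)[OF W(2)] by simp
  then have e: "e \<in> B" "f (cinv c x) \<in> cdom e" unfolding e_def by (metis (mono_tags, lifting) someI_ex)+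
  have rep: "coord_rep c e f y = transition d e (g y)" if "y \<in> W" for y
    by (simp add: coord_rep_eq transition_eq g(1)[OF that])
  have ge: "cinv d (g x) \<in> cdom e" "g x \<in> cimg d" using e(2) g W(2) by auto
  have T: "(transition d e has_derivative fd (transition d e) (g x)) (at (g x))"
    using B[OF d e(1) ge(2,1)] frechet_derivative_works by blast
  have "((\<lambda>y. transition d e (g y)) has_derivative (\<lambda>h. fd (transition d e) (g x) (D h))) (at x)"
    using has_derivative_compose[OF D T] by (simp add: o_def)
  from frechet_eq[OF this] have F: "fd (coord_rep c e f) x = (\<lambda>h. fd (transition d e) (g x) (D h))"
    using frechet_derivative_cong_open[OF W rep] by (simp add: fun_eq_iff)
  have "pullback B f \<beta> c x vs = \<beta> e (coord_rep c e f x) (map (fd (coord_rep c e f) x) vs)"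
    unfolding pullback_def e_def[symmetric] by (simp add: Let_def)
  also have "\<dots> = \<beta> e (transition d e (g x)) (map (fd (transition d e) (g x)) (map D vs))"
    by (simp add: F rep[OF W(2)] o_def)
  also have "\<dots> = \<beta> d (g x) (map D vs)" using \<beta> d e(1) ge unfolding form_compat_def by metis
  finally show ?thesis .
qed

lemma atlas_transition_differentiable:
  assumes "smooth_atlas A" "c \<in> A" "d \<in> A" "x \<in> cimg c" "cinv c x \<in> cdom d"
  shows "transition c d differentiable at x"
  using smooth_on_frechet(1)[OF transition_smooth[OF assms(1-3)], of x] assms(4,5)
  unfolding differentiable_def by auto

lemma pullback_eq:
  assumes A: "smooth_atlas A" and f: "smooth_map A A f" and \<beta>: "form_compat A \<beta>"
    and c: "c \<in> A" "d \<in> A" "x \<in> cimg c" "f (cinv c x) \<in> cdom d"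
  shows "pullback A f \<beta> c x vs = \<beta> d (coord_rep c d f x) (map (fd (coord_rep c d f) x) vs)"
proof (rule pullback_in_chart[OF atlas_transition_differentiable[OF A] \<beta> c(2)])
  let ?W = "{x \<in> cimg c. f (cinv c x) \<in> cdom d}"
  show "open ?W" "x \<in> ?W" using smooth_map_rep(1)[OF A A f c(1,2)] c by auto
  show "f (cinv c y) = cinv d (coord_rep c d f y)" "coord_rep c d f y \<in> cimg d" if "y \<in> ?W" for y
    using that atlas_chart[OF A c(2)] by (auto simp: coord_rep_eq)
  show "cinv d (coord_rep c d f x) \<in> cdom d" using c(4) atlas_chart[OF A c(2)] by (simp add: coord_rep_eq)
  show "(coord_rep c d f has_derivative fd (coord_rep c d f) x) (at x)"
    using smooth_on_frechet(1)[OF smooth_map_rep[OF A A f c(1,2)]] c by simp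
qed

lemma pullback_compat:
  assumes A: "smooth_atlas A" and f: "smooth_map A A f" and \<beta>: "form_compat A \<beta>"
  shows "form_compat A (pullback A f \<beta>)"
  unfolding form_compat_def
proof (intro ballI impI allI)
  fix c c' x vs assume c: "c \<in> A" "c' \<in> A" "x \<in> cimg c" "cinv c x \<in> cdom c'"
  obtain d where d: "d \<in> A" "f (cinv c x) \<in> cdom d" using atlas_covers[OF A] by blast
  let ?x = "transition c c' x"
  have x': "?x \<in> cimg c'" "cinv c' ?x = cinv c x" using c atlas_chart[OF A c(2)] by (auto simp: transition_eq)
  let ?W = "{y \<in> cimg c. cinv c y \<in> cdom c'}"
  have W: "open ?W" "x \<in> ?W" using transition_smooth[OF A c(1,2)] c by auto
  have rep: "coord_rep c d f y = coord_rep c' d f (transition c c' y)" if "y \<in> ?W" for y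
    using that atlas_chart[OF A c(2)] by (auto simp: coord_rep_eq transition_eq)
  have 1: "(transition c c' has_derivative fd (transition c c') x) (at x)"
    using atlas_transition_differentiable[OF A c] frechet_derivative_works by blast
  have 2: "(coord_rep c' d f has_derivative fd (coord_rep c' d f) ?x) (at ?x)"
    using smooth_on_frechet(1)[OF smooth_map_rep[OF A A f c(2) d(1)], of ?x] x' d by simp
  have "((\<lambda>y. coord_rep c' d f (transition c c' y)) has_derivative
    (\<lambda>h. fd (coord_rep c' d f) ?x (fd (transition c c') x h))) (at x)"
    using has_derivative_compose[OF 1 2] by (simp add: o_def)
  from frechet_eq[OF this] have F: "fd (coord_rep c d f) x =
      (\<lambda>h. fd (coord_rep c' d f) ?x (fd (transition c c') x h))"
    using frechet_derivative_cong_open[OF W rep] by (simp add: fun_eq_iff)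
  show "pullback A f \<beta> c x vs = pullback A f \<beta> c' ?x (map (fd (transition c c') x) vs)"
    using pullback_eq[OF A f \<beta> c(1) d(1) c(3) d(2), of vs]
      pullback_eq[OF A f \<beta> c(2) d(1) x'(1), of "map (fd (transition c c') x) vs"] d(2) x'(2) rep[OF W(2)]
    by (simp add: F o_def)
qed

text \<open>As in the product rule above, expanding the first argument in \<open>Basis\<close>
  reduces the claim to sums of products and to forms of lower degree.\<close>

lemma smooth_on_alt_form_apply:
  fixes m :: "'z::real_normed_vector \<Rightarrow> 'e::euclidean_space list \<Rightarrow> 'b::real_normed_vector" and W :: "'i \<Rightarrow> 'z \<Rightarrow> 'e"
  shows "(\<And>z. z \<in> S \<Longrightarrow> alt_form (length js) (m z)) \<Longrightarrow> (\<And>j. j \<in> set js \<Longrightarrow> smooth_on S (W j)) \<Longrightarrow>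
    (\<And>vs. smooth_on S (\<lambda>z. m z vs)) \<Longrightarrow> smooth_on S (\<lambda>z. m z (map (\<lambda>j. W j z) js))"
proof (induction js arbitrary: m)
  case (Cons j js)
  let ?r = "\<lambda>z. map (\<lambda>j. W j z) js"
  have IH: "smooth_on S (\<lambda>z. m z (b # ?r z))" for b
    by (rule Cons.IH[where m = "\<lambda>z vs. m z (b # vs)"]) (use Cons.prems in \<open>auto intro!: alt_form_Cons\<close>)
  have sm: "smooth_on S (\<lambda>z. \<Sum>b\<in>Basis. (W j z \<bullet> b) *\<^sub>R m z (b # ?r z))"
    by (intro smooth_on_sum smooth_on_scaleR IH smooth_on_bounded_linear[OF bounded_linear_inner_left] Cons.prems(2)) simp
  have eq: "(\<Sum>b\<in>Basis. (W j z \<bullet> b) *\<^sub>R m z (b # ?r z)) = m z (map (\<lambda>j. W j z) (j # js))" if "z \<in> S" for z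
  proof -
    interpret l: linear "\<lambda>u. m z (u # ?r z)"
      by (rule alt_form_linear_hd[OF Cons.prems(1)[OF that]]) simp
    have "m z (W j z # ?r z) = m z ((\<Sum>b\<in>Basis. (W j z \<bullet> b) *\<^sub>R b) # ?r z)" by (simp add: euclidean_representation)
    then show ?thesis by (simp only: l.sum l.scale list.map)
  qed
  show ?case by (rule smooth_on_cong[OF eq sm])
qed simp

lemma smooth_form_pullback:
  assumes A: "smooth_atlas A" and f: "smooth_map A A f" and \<beta>: "smooth_form A k \<beta>"
  shows "smooth_form A k (pullback A f \<beta>)"
proof -
  have \<beta>': "form_compat A \<beta>" "\<And>c x. c \<in> A \<Longrightarrow> x \<in> cimg c \<Longrightarrow> alt_form k (\<beta> c x)"
    "\<And>c vs. c \<in> A \<Longrightarrow> smooth_on (cimg c) (\<lambda>x. \<beta> c x vs)" using \<beta> unfolding smooth_form_iff[OF A] by auto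
  have alt: "alt_form k (pullback A f \<beta> c x)" if c: "c \<in> A" "x \<in> cimg c" for c x
  proof -
    obtain d where d: "d \<in> A" "f (cinv c x) \<in> cdom d" using atlas_covers[OF A] by blast
    have D: "linear (fd (coord_rep c d f) x)"
    proof (rule has_derivative_linear)
      show "(coord_rep c d f has_derivative fd (coord_rep c d f) x) (at x)"
        by (rule smooth_on_frechet(1)[OF smooth_map_rep[OF A A f c(1) d(1)]]) (use c d in simp)
    qed
    have p: "coord_rep c d f x \<in> cimg d" using atlas_chart[OF A d(1)] d by (simp add: coord_rep_eq)
    have "pullback A f \<beta> c x = (\<lambda>vs. \<beta> d (coord_rep c d f x) (map (fd (coord_rep c d f) x) vs))"
      by (rule ext) (rule pullback_eq[OF A f \<beta>'(1) c(1) d(1) c(2) d(2)])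
    then show ?thesis using alt_form_compose[OF \<beta>'(2)[OF d(1) p] D] by (simp only:)
  qed
  have "smooth_on (cimg c) (\<lambda>x. pullback A f \<beta> c x vs)" if c: "c \<in> A" for c vs
  proof (rule smooth_on_local)
    fix x assume x: "x \<in> cimg c"
    obtain d where d: "d \<in> A" "f (cinv c x) \<in> cdom d" using atlas_covers[OF A] by blast
    let ?W = "{x \<in> cimg c. f (cinv c x) \<in> cdom d}"
    note W = smooth_map_rep[OF A A f c d(1)]
    have sub: "coord_rep c d f ` ?W \<subseteq> cimg d" using atlas_chart[OF A d(1)] by (auto simp: coord_rep_eq)
    have "smooth_on ?W (\<lambda>x. \<beta> d (coord_rep c d f x) (map (\<lambda>v. fd (coord_rep c d f) x v) vs))"
    proof (cases "length vs = k")
      case True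
      show ?thesis
        by (rule smooth_on_alt_form_apply[where m = "\<lambda>x. \<beta> d (coord_rep c d f x)" and W = "\<lambda>v x. fd (coord_rep c d f) x v"])
           (use True sub \<beta>'(2)[OF d(1)] in \<open>auto intro!: smooth_on_frechet(2)[OF W] smooth_on_compose[OF \<beta>'(3)[OF d(1)] W(2)]\<close>)
    next
      case False
      have "\<beta> d (coord_rep c d f x) (map (fd (coord_rep c d f) x) vs) = 0" if "x \<in> ?W" for x
        using alt_form_length[OF \<beta>'(2)[OF d(1)]] sub that False by auto
      then show ?thesis by (intro smooth_on_cong[OF _ smooth_on_const[of _ 0]]) auto
    qed
    then have "smooth_on ?W (\<lambda>x. pullback A f \<beta> c x vs)"
      by (rule smooth_on_cong[rotated]) (simp add: pullback_eq[OF A f \<beta>'(1) c d(1)])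
    then show "\<exists>U. open U \<and> x \<in> U \<and> U \<subseteq> cimg c \<and> smooth_on U (\<lambda>x. pullback A f \<beta> c x vs)"
      using W(1) x d(2) by (intro exI[of _ ?W]) auto
  qed
  with alt pullback_compat[OF A f \<beta>'(1)] show ?thesis unfolding smooth_form_iff[OF A] by blast
qed

section \<open>The circle\<close>

lemma cis_eq_iff: "cis x = cis y \<longleftrightarrow> (\<exists>n::int. x = y + 2 * pi * of_int n)"
  unfolding complex_eq_iff using sin_cos_eq_iff[of x y] by (auto simp: mult_ac)

lemma cis_window: "norm z = 1 \<Longrightarrow> z \<noteq> cis a \<Longrightarrow> \<exists>r. a < r \<and> r < a + 2 * pi \<and> z = cis r"
proof -
  assume z: "norm z = 1" "z \<noteq> cis a"
  have "z \<noteq> 0" "sgn z = z" using z(1) by (auto simp: sgn_div_norm)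
  then obtain s where s: "z = cis s" using cis_Arg[of z] by metis
  \<comment> \<open>Subtracting whole turns brings the argument into [a, a + 2 pi); the left end is
    excluded because \<open>z\<close> differs from \<open>cis a\<close>.\<close>
  define n where "n = \<lfloor>(s - a) / (2 * pi)\<rfloor>"
  define r where "r = s - 2 * pi * of_int n"
  have "cis r = cis s" unfolding cis_eq_iff by (rule exI[of _ "- n"]) (simp add: r_def)
  moreover have "of_int n \<le> (s - a) / (2 * pi)" "(s - a) / (2 * pi) < of_int n + 1"
    unfolding n_def by linarith+
  then have "a \<le> r" "r < a + 2 * pi" unfolding r_def by (simp_all add: field_simps)
  moreover have "r \<noteq> a" using z(2) s \<open>cis r = cis s\<close> by auto
  ultimately show ?thesis using s by (intro exI[of _ r]) auto
qed

lemma cis_window_unique: "a < r \<Longrightarrow> r < a + 2 * pi \<Longrightarrow> a < r' \<Longrightarrow> r' < a + 2 * pi \<Longrightarrow> cis r = cis r' \<Longrightarrow> r = r'"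
proof -
  assume h: "a < r" "r < a + 2 * pi" "a < r'" "r' < a + 2 * pi" "cis r = cis r'"
  then obtain n :: int where n: "r = r' + 2 * pi * of_int n" unfolding cis_eq_iff by blast
  then have "\<bar>2 * pi * of_int n\<bar> < 2 * pi" using h by linarith
  then have "\<bar>of_int n :: real\<bar> < 1" by (simp add: abs_mult)
  then have "n = 0" by linarith
  then show ?thesis using n by simp
qed

lemma angle_chart_facts:
  fixes a :: real
  defines "k \<equiv> angle_chart a"
  shows "cimg k = {a<..<a + 2 * pi}" "r \<in> cimg k \<Longrightarrow> Rep_circle (cinv k r) = cis r" "inj_on (cmap k) (cdom k)"
    "z \<in> cdom k \<Longrightarrow> Rep_circle z = cis (cmap k z)" "z \<in> cdom k \<Longrightarrow> cmap k z \<in> {a<..<a + 2 * pi}"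
proof -
  have dom: "cdom k = {z. Rep_circle z \<noteq> cis a}" and cm: "cmap k = (\<lambda>z. THE r. a < r \<and> r < a + 2 * pi \<and> Rep_circle z = cis r)"
    by (simp_all add: k_def angle_chart_def cdom_def cmap_def)
  have N: "norm (Rep_circle z) = 1" for z using Rep_circle[of z] by simp
  have *: "a < cmap k z \<and> cmap k z < a + 2 * pi \<and> Rep_circle z = cis (cmap k z)" if "z \<in> cdom k" for z
  proof -
    have "\<exists>!r. a < r \<and> r < a + 2 * pi \<and> Rep_circle z = cis r"
    proof (rule ex_ex1I)
      have "Rep_circle z \<noteq> cis a" using that unfolding dom by simp
      then show "\<exists>r. a < r \<and> r < a + 2 * pi \<and> Rep_circle z = cis r" by (rule cis_window[OF N])
      show "r = s" if "a < r \<and> r < a + 2 * pi \<and> Rep_circle z = cis r" "a < s \<and> s < a + 2 * pi \<and> Rep_circle z = cis s" for r s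
        by (rule cis_window_unique[of a]) (use that in auto)
    qed
    from theI'[OF this] show ?thesis unfolding cm .
  qed
  show inj: "inj_on (cmap k) (cdom k)"
    by (rule inj_onI) (metis "*" Rep_circle_inject)
  have val: "Abs_circle (cis r) \<in> cdom k \<and> cmap k (Abs_circle (cis r)) = r" if r: "r \<in> {a<..<a + 2 * pi}" for r
  proof -
    have R: "Rep_circle (Abs_circle (cis r)) = cis r" by (simp add: Abs_circle_inverse)
    have "cis r \<noteq> cis a"
    proof
      assume "cis r = cis a"
      then obtain n :: int where n: "r = a + 2 * pi * of_int n" unfolding cis_eq_iff by blast
      with r have "0 < 2 * pi * of_int n" "2 * pi * of_int n < 2 * pi" by auto
      then have "0 < n" "n < 1" by (simp_all add: zero_less_mult_iff)
      then show False by simp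
    qed
    then have dm: "Abs_circle (cis r) \<in> cdom k" by (simp add: dom R)
    have "cmap k (Abs_circle (cis r)) = r"
      by (rule cis_window_unique[of a]) (use *[OF dm] r R in auto)
    with dm show ?thesis by blast
  qed
  show img: "cimg k = {a<..<a + 2 * pi}"
  proof (intro set_eqI iffI)
    fix r assume "r \<in> cimg k" then show "r \<in> {a<..<a + 2 * pi}" using * by (auto simp: cimg_def)
  next
    fix r assume "r \<in> {a<..<a + 2 * pi}" then show "r \<in> cimg k" using val[of r] unfolding cimg_def by (metis image_eqI)
  qed
  show "Rep_circle (cinv k r) = cis r" if "r \<in> cimg k"
  proof -
    have "cinv k r \<in> cdom k" "cmap k (cinv k r) = r"
      using that unfolding cimg_def cinv_def by (auto simp: inv_into_into f_inv_into_f)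
    then show ?thesis using * by metis
  qed
  show "z \<in> cdom k \<Longrightarrow> Rep_circle z = cis (cmap k z)" "z \<in> cdom k \<Longrightarrow> cmap k z \<in> {a<..<a + 2 * pi}" using * by auto
qed

lemma circle_chart:
  assumes "k \<in> circle_atlas"
  shows "open (cimg k)" "inj_on (cmap k) (cdom k)"
  using assms angle_chart_facts unfolding circle_atlas_def by auto

text \<open>Two branches of the angle differ locally by a constant multiple of 2 pi. This makes
  \<open>dr\<close> compatible on the circle and all transitions between product charts trivial in
  the angle directions.\<close>

lemma circle_transition:
  assumes k: "k \<in> circle_atlas" "k' \<in> circle_atlas" and r: "r \<in> cimg k" "cinv k r \<in> cdom k'"
  shows "(transition k k' has_derivative (\<lambda>h. h)) (at r)"
proof -
  obtain a b where ab: "k = angle_chart a" "k' = angle_chart b" using k unfolding circle_atlas_def by auto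
  note ka = angle_chart_facts[where a = a, folded ab(1)] and kb = angle_chart_facts[where a = b, folded ab(2)]
  define r' where "r' = transition k k' r"
  have r': "r' \<in> {b<..<b + 2 * pi}" "cis r' = cis r"
    using kb(4,5)[OF r(2)] ka(2)[OF r(1)] unfolding r'_def transition_eq by auto
  then obtain n :: int where n: "r' = r + 2 * pi * of_int n" unfolding cis_eq_iff by blast
  \<comment> \<open>On this neighbourhood the same number \<open>n\<close> of turns relates the two
    branches.\<close>
  let ?W = "{a<..<a + 2 * pi} \<inter> {b - 2 * pi * of_int n<..<b + 2 * pi - 2 * pi * of_int n}"
  have W: "open ?W" "r \<in> ?W" using r'(1) r(1) n ka(1) by auto
  have eq: "transition k k' s = s + 2 * pi * of_int n" if s: "s \<in> ?W" for s
  proof -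
    have 1: "Rep_circle (cinv k s) = cis s" using s ka by auto
    have 2: "s + 2 * pi * of_int n \<in> cimg k'" using s kb(1) by auto
    have "cis (s + 2 * pi * of_int n) = cis s" unfolding cis_eq_iff by blast
    then have "cinv k s = cinv k' (s + 2 * pi * of_int n)" using 1 kb(2)[OF 2] by (simp flip: Rep_circle_inject)
    then show ?thesis unfolding transition_eq using 2 unfolding cimg_def cinv_def by (simp add: f_inv_into_f)
  qed
  have "((\<lambda>s. s + 2 * pi * of_int n) has_derivative (\<lambda>h. h)) (at r)" by (auto intro!: derivative_eq_intros)
  then show ?thesis by (rule has_derivative_transform_within_open[OF _ W]) (simp add: eq)
qed

lemma dr_compat: "form_compat circle_atlas dr"
  unfolding form_compat_def
proof (intro ballI impI allI)
  fix k k' r vs assume "k \<in> circle_atlas" "k' \<in> circle_atlas" "r \<in> cimg k" "cinv k r \<in> cdom k'"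
  from frechet_eq[OF circle_transition[OF this]]
  show "dr k r vs = dr k' (transition k k' r) (map (fd (transition k k') r) vs)"
    by (simp add: dr_def)
qed

section \<open>Product charts\<close>

definition pchart :: "('m, 'e) chart \<Rightarrow> ('k, 'f) chart \<Rightarrow> ('m \<times> 'k, 'e \<times> 'f) chart" where
  "pchart c d = (cdom c \<times> cdom d, map_prod (cmap c) (cmap d))"

lemma pchart_facts:
  assumes "inj_on (cmap c) (cdom c)" "inj_on (cmap d) (cdom d)"
  shows "cdom (pchart c d) = cdom c \<times> cdom d" "cimg (pchart c d) = cimg c \<times> cimg d"
    "inj_on (cmap (pchart c d)) (cdom (pchart c d))"
    "x \<in> cimg c \<Longrightarrow> y \<in> cimg d \<Longrightarrow> cinv (pchart c d) (x, y) = (cinv c x, cinv d y)"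
    "cmap (pchart c d) (p, q) = (cmap c p, cmap d q)"
proof -
  show d: "cdom (pchart c d) = cdom c \<times> cdom d" and m: "cmap (pchart c d) (p, q) = (cmap c p, cmap d q)" for p q
    by (simp_all add: pchart_def cdom_def cmap_def)
  have m': "cmap (pchart c d) = map_prod (cmap c) (cmap d)" by (simp add: pchart_def cmap_def)
  show i: "cimg (pchart c d) = cimg c \<times> cimg d" unfolding cimg_def d m' by auto
  show inj: "inj_on (cmap (pchart c d)) (cdom (pchart c d))"
    unfolding d m' using assms by (rule map_prod_inj_on)
  show "cinv (pchart c d) (x, y) = (cinv c x, cinv d y)" if "x \<in> cimg c" "y \<in> cimg d"
  proof -
    have "cinv c x \<in> cdom c" "cmap c (cinv c x) = x" "cinv d y \<in> cdom d" "cmap d (cinv d y) = y"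
      using that unfolding cimg_def cinv_def by (auto simp: inv_into_into f_inv_into_f)
    then have "inv_into (cdom (pchart c d)) (cmap (pchart c d)) (cmap (pchart c d) (cinv c x, cinv d y)) = (cinv c x, cinv d y)"
      by (intro inv_into_f_f[OF inj]) (simp add: d)
    then show ?thesis using \<open>cmap c (cinv c x) = x\<close> \<open>cmap d (cinv d y) = y\<close> by (simp add: m cinv_def)
  qed
qed

lemma product_atlas_pchart: "product_atlas A B = {pchart c d | c d. c \<in> A \<and> d \<in> B}"
  unfolding product_atlas_def pchart_def ..

lemma atlas_inj: "smooth_atlas A \<Longrightarrow> c \<in> A \<Longrightarrow> inj_on (cmap c) (cdom c)"
  by (rule inj_onI) (metis atlas_chart(6))

text \<open>In product charts a projection is linear, so pulling back just applies it to the point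
  and to the vectors. Asking for differentiable transitions covers the circle and X alike.\<close>

lemma pullback_projection:
  assumes B: "\<And>d d' x. d \<in> B \<Longrightarrow> d' \<in> B \<Longrightarrow> x \<in> cimg d \<Longrightarrow> cinv d x \<in> cdom d' \<Longrightarrow> transition d d' differentiable at x"
    and \<beta>: "form_compat B \<beta>" and d: "d \<in> B" and W: "open W" "y \<in> W"
    and f: "\<And>y. y \<in> W \<Longrightarrow> f (cinv c y) = cinv d (p y)" "\<And>y. y \<in> W \<Longrightarrow> p y \<in> cimg d" and p: "bounded_linear p"
  shows "pullback B f \<beta> c y vs = \<beta> d (p y) (map p vs)"
proof (rule pullback_in_chart[where g = p, OF B \<beta> d W f])
  show "cinv d (p y) \<in> cdom d" using f(2)[OF W(2)] unfolding cimg_def cinv_def by (auto simp: inv_into_into)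
qed (simp_all add: bounded_linear_imp_has_derivative[OF p])

section \<open>Hermitian linear algebra\<close>

text \<open>Together with \<open>n0_point\<close> and \<open>pnorm\<close>, the content of the
  manifold notions at one point, so that the linear algebra of frames can be done without
  charts.\<close>

definition kaehler_point :: "((complex^'n) list \<Rightarrow> real) \<Rightarrow> bool" where
  "kaehler_point \<sigma> \<longleftrightarrow> alt_form 2 \<sigma> \<and> (\<forall>u v. \<sigma> [\<i> *s u, \<i> *s v] = \<sigma> [u, v]) \<and> (\<forall>v. v \<noteq> 0 \<longrightarrow> \<sigma> [v, \<i> *s v] > 0)"

definition n0_point :: "((complex^'n) list \<Rightarrow> complex) \<Rightarrow> bool" where
  "n0_point \<mu> \<longleftrightarrow> alt_form CARD('n) \<mu> \<and> (\<forall>vs i. length vs = CARD('n) \<and> i < CARD('n) \<longrightarrow>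
           \<mu> (vs[i := \<i> *s (vs ! i)]) = \<i> * \<mu> vs) \<and> (\<exists>vs. \<mu> vs \<noteq> 0)"

definition pnorm :: "((complex^'n) list \<Rightarrow> complex) \<Rightarrow> ((complex^'n) list \<Rightarrow> real) \<Rightarrow> real" where
  "pnorm \<mu> \<sigma> = sqrt ((cmod (vol_coeff \<mu>))\<^sup>2 / herm_det \<sigma>)"

lemma ii_smult: "\<i> *s (\<i> *s v) = - v" "\<i> *s (c *\<^sub>R v) = c *\<^sub>R (\<i> *s v)" "\<i> *s (u + v) = \<i> *s u + \<i> *s v"
  "\<i> *s (- v) = - (\<i> *s v)" for u v :: "complex^'n"
  by (auto simp: vec_eq_iff distrib_left)

lemma linear_ii: "linear (\<lambda>v :: complex^'n. \<i> *s v)"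
  by (rule linearI) (simp_all add: ii_smult)

lemma smult_complex: "c *s v = Re c *\<^sub>R v + Im c *\<^sub>R (\<i> *s v)" for v :: "complex^'n"
  by (auto simp: vec_eq_iff complex_eq_iff)

context
  fixes \<sigma> :: "(complex^'n) list \<Rightarrow> real"
  assumes k: "kaehler_point \<sigma>"
begin

lemma kp_alt: "alt_form 2 \<sigma>" and kp_J: "\<sigma> [\<i> *s u, \<i> *s v] = \<sigma> [u, v]" and kp_pos: "v \<noteq> 0 \<Longrightarrow> \<sigma> [v, \<i> *s v] > 0"
  using k by (auto simp: kaehler_point_def)

lemma kp_swap: "\<sigma> [u, v] = - \<sigma> [v, u]"
  using alt_form_swap[OF kp_alt, of "[]" u v "[]"] by simp

lemma kp_lin: "linear (\<lambda>u. \<sigma> [u, v])" "linear (\<lambda>v. \<sigma> [u, v])"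
  using alt_form_2[OF kp_alt] by blast+

lemma kp_neg: "\<sigma> [- u, v] = - \<sigma> [u, v]" "\<sigma> [u, - v] = - \<sigma> [u, v]"
  using linear_neg[OF kp_lin(1)] linear_neg[OF kp_lin(2)] by auto

lemma kp_J2: "\<sigma> [\<i> *s u, v] = - \<sigma> [u, \<i> *s v]"
  using kp_J[of u "\<i> *s v"] by (simp add: ii_smult kp_neg)

lemma kp_metric: "kaehler_metric \<sigma> u v = \<sigma> [u, \<i> *s v]"
  by (simp add: kaehler_metric_def kp_neg kp_J2)

lemma kp_inner: "inner_product (kaehler_metric \<sigma>)"
  unfolding inner_product_def
proof (intro conjI allI impI)
  show "kaehler_metric \<sigma> u v = kaehler_metric \<sigma> v u" for u v
    using kp_swap[of u "\<i> *s v"] kp_J2[of v u] by (simp add: kp_metric)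
  show "linear (kaehler_metric \<sigma> u)" for u
    unfolding kp_metric[abs_def] using linear_compose[OF linear_ii kp_lin(2)] by (simp add: o_def)
qed (simp add: kp_metric kp_pos)

text \<open>As h(u, v) = \<sigma>(u, J v), the two conditions say that the vectors together with
  their images under J are orthonormal for h.\<close>

definition unitary :: "(complex^'n) list \<Rightarrow> bool" where
  "unitary us \<longleftrightarrow> (\<forall>i<length us. \<forall>j<length us. \<sigma> [us ! i, \<i> *s (us ! j)] = (if i = j then 1 else 0) \<and> \<sigma> [us ! i, us ! j] = 0)"

text \<open>Gram-Schmidt over the complex numbers, carried out with real inner products: the new
  vector is made orthogonal to the previous ones and to their images under J.\<close>

lemma unitary_exists: "m \<le> CARD('n) \<Longrightarrow> \<exists>us. length us = m \<and> unitary us"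
proof (induction m)
  case 0 then show ?case by (intro exI[of _ "[]"]) (simp add: unitary_def)
next
  case (Suc m)
  then obtain us where us: "length us = m" "unitary us" by auto
  let ?h = "kaehler_metric \<sigma>"
  \<comment> \<open>The at most 2 m vectors of \<open>?S\<close> cannot span a real space of
    dimension 2 n > 2 m, so some vector lies outside their span.\<close>
  let ?S = "set us \<union> (\<lambda>v. \<i> *s v) ` set us"
  have "dim ?S \<le> card ?S" by (rule dim_le_card') simp
  also have "\<dots> \<le> card (set us) + card ((\<lambda>v. \<i> *s v) ` set us)" by (rule card_Un_le)
  also have "\<dots> \<le> m + m" using us(1) card_length[of us] card_image_le[of "set us" "\<lambda>v. \<i> *s v"] by simp
  also have "\<dots> < DIM(complex^'n)" using Suc.prems by simp
  finally have "span ?S \<noteq> UNIV" using dim_span[of ?S] by (metis dim_UNIV less_irrefl)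
  then obtain w where w: "w \<notin> span ?S" by blast
  let ?p = "\<Sum>j<m. ?h w (us ! j) *\<^sub>R (us ! j) + ?h w (\<i> *s (us ! j)) *\<^sub>R (\<i> *s (us ! j))"
  define w' where "w' = w - ?p"
  have "?p \<in> span ?S" using us(1) by (intro span_sum span_add span_scale span_base) auto
  then have "w' \<noteq> 0" using w by (auto simp: w'_def)
  have hl: "linear (\<lambda>u. ?h u v)" for v by (rule inner_product_linear_left[OF kp_inner])
  have u: "?h (us ! i) (us ! j) = (if i = j then 1 else 0)" "?h (us ! i) (\<i> *s (us ! j)) = 0"
     "?h (\<i> *s (us ! i)) (us ! j) = 0" "?h (\<i> *s (us ! i)) (\<i> *s (us ! j)) = (if i = j then 1 else 0)"
    if "i < m" "j < m" for i j
    using us that by (auto simp: unitary_def kp_metric ii_smult kp_neg kp_J kp_J2)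
  have o1: "?h w' (us ! j) = 0" if j: "j < m" for j
  proof -
    have "?h ?p (us ! j) = (\<Sum>i<m. if i = j then ?h w (us ! j) else 0)"
      unfolding linear_sum[OF hl] linear_add[OF hl] linear_cmul[OF hl] using j
      by (intro sum.cong refl) (auto simp: u)
    then show ?thesis using j by (simp add: w'_def linear_diff[OF hl])
  qed
  have o2: "?h w' (\<i> *s (us ! j)) = 0" if j: "j < m" for j
  proof -
    have "?h ?p (\<i> *s (us ! j)) = (\<Sum>i<m. if i = j then ?h w (\<i> *s (us ! j)) else 0)"
      unfolding linear_sum[OF hl] linear_add[OF hl] linear_cmul[OF hl] using j
      by (intro sum.cong refl) (auto simp: u)
    then show ?thesis using j by (simp add: w'_def linear_diff[OF hl])
  qed
  define r where "r = ?h w' w'"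
  have r: "r > 0" using kp_inner \<open>w' \<noteq> 0\<close> unfolding inner_product_def r_def by blast
  define x where "x = (1 / sqrt r) *\<^sub>R w'"
  have hx: "?h x v = (1 / sqrt r) * ?h w' v" for v unfolding x_def linear_cmul[OF hl] by simp
  have sym: "?h u v = ?h v u" for u v using kp_inner by (simp add: inner_product_def)
  have xx: "?h x x = 1"
  proof -
    have "?h x x = (1 / sqrt r) * ((1 / sqrt r) * ?h w' w')" unfolding hx sym[of w' x] hx ..
    also have "\<dots> = r / (sqrt r * sqrt r)" by (simp add: r_def)
    finally show ?thesis using r by simp
  qed
  have s: "\<sigma> [x, \<i> *s v] = ?h x v" "\<sigma> [v, \<i> *s x] = ?h x v" "\<sigma> [x, v] = - ?h x (\<i> *s v)" "\<sigma> [v, x] = ?h x (\<i> *s v)" for v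
    using kp_metric[of x v] kp_metric[of v x] sym[of v x] kp_metric[of x "\<i> *s v"] kp_swap[of v x] by (auto simp: ii_smult kp_neg)
  have hxo: "?h x (us ! j) = 0" "?h x (\<i> *s (us ! j)) = 0" if "j < m" for j
    using that by (simp_all add: hx o1 o2)
  have "\<sigma> [x, x] = 0" using alt_form_2(3)[OF kp_alt] .
  have "unitary (us @ [x])"
    unfolding unitary_def
  proof (intro allI impI)
    fix i j assume "i < length (us @ [x])" "j < length (us @ [x])"
    then have "i < m \<or> i = m" "j < m \<or> j = m" using us(1) by auto
    then consider "i < m" "j < m" | "i < m" "j = m" | "i = m" "j < m" | "i = m" "j = m" by blast
    then show "\<sigma> [(us @ [x]) ! i, \<i> *s ((us @ [x]) ! j)] = (if i = j then 1 else 0) \<and> \<sigma> [(us @ [x]) ! i, (us @ [x]) ! j] = 0"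
    proof cases
      case 1 then show ?thesis using us by (simp add: nth_append unitary_def)
    next
      case 2
      then have "\<sigma> [us ! i, \<i> *s x] = 0" "\<sigma> [us ! i, x] = 0" using s(2,4)[of "us ! i"] hxo by simp_all
      with 2 show ?thesis using us(1) by (simp add: nth_append)
    next
      case 3
      then have "\<sigma> [x, \<i> *s (us ! j)] = 0" "\<sigma> [x, us ! j] = 0" using s(1,3)[of "us ! j"] hxo by simp_all
      with 3 show ?thesis using us(1) by (simp add: nth_append)
    next
      case 4 then show ?thesis using us(1) xx s(1)[of x] \<open>\<sigma> [x, x] = 0\<close> by (simp add: nth_append)
    qed
  qed
  then show ?case using us(1) by (intro exI[of _ "us @ [x]"]) simp
qed

lemma herm_form: "(\<Sum>p\<in>UNIV. \<Sum>q\<in>UNIV. herm_matrix \<sigma> $ p $ q * (u $ p * cnj (v $ q))) =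
   (of_real (\<sigma> [u, \<i> *s v]) - \<i> * of_real (\<sigma> [u, v])) / 2"
proof -
  let ?M = "\<lambda>u v. \<Sum>p\<in>UNIV. \<Sum>q\<in>UNIV. herm_matrix \<sigma> $ p $ q * (u $ p * cnj (v $ q))"
  have 1: "of_real (\<sigma> [u, v]) = \<i> * (?M u v - ?M v u)" for u v
    using herm_matrix[OF kp_alt kp_J, of u v] by (simp add: right_diff_distrib sum_subtractf)
  \<comment> \<open>The lemma \<open>herm_matrix\<close> gives the difference of M(u, v) and M(v,
    u). Replacing v by J v, in which M is conjugate linear, gives their sum as well, and the two
    equations determine M(u, v).\<close>
  have "?M u (\<i> *s v) = - \<i> * ?M u v" "?M (\<i> *s v) u = \<i> * ?M v u"
    unfolding sum_distrib_left by (simp_all add: algebra_simps)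
  with 1[of u "\<i> *s v"] have "of_real (\<sigma> [u, \<i> *s v]) = \<i> * (- \<i> * ?M u v - \<i> * ?M v u)" by (simp only:)
  moreover define a b where "a = ?M u v" and "b = ?M v u"
  ultimately have 2: "of_real (\<sigma> [u, \<i> *s v]) = \<i> * (- \<i> * a - \<i> * b)" "of_real (\<sigma> [u, v]) = \<i> * (a - b)"
    using 1[of u v] by (simp_all only:)
  have "a = (of_real (\<sigma> [u, \<i> *s v]) - \<i> * of_real (\<sigma> [u, v])) / 2"
    unfolding 2 by (simp add: complex_eq_iff)
  then show ?thesis by (simp only: a_def)
qed

end

lemma cnj_det: "cnj (det U) = det (\<chi> p q. cnj (U $ p $ q))" for U :: "complex^'n^'n"
  unfolding det_def by (simp add: cnj_sum cnj_prod)

text \<open>The normalisation \<omega> = i h_pq dz^p \<and> d(bar z)^q makes h(d/dx^p, d/dx^p) twice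
  h_pp. For vectors of unit length the Hermitian matrix is therefore half the identity, and
  determinants give the power of 1/2.\<close>

lemma herm_det_unitary:
  fixes \<sigma> :: "(complex^'n) list \<Rightarrow> real" and U :: "complex^'n^'n"
  assumes k: "kaehler_point \<sigma>" and U: "\<And>p q. \<sigma> [U $ p, \<i> *s (U $ q)] = (if p = q then 1 else 0)" "\<And>p q. \<sigma> [U $ p, U $ q] = 0"
  shows "(cmod (det U))\<^sup>2 * herm_det \<sigma> = (1 / 2) ^ CARD('n)" "herm_det \<sigma> > 0"
proof -
  let ?H = "herm_matrix \<sigma>"
  let ?V = "transpose (\<chi> p q. cnj (U $ p $ q))"
  have "(U ** ?H ** ?V) $ i $ j = (if i = j then 1 / 2 else 0)" for i j
  proof -
    have "(U ** ?H ** ?V) $ i $ j = (\<Sum>q\<in>UNIV. \<Sum>p\<in>UNIV. ?H $ p $ q * (U $ i $ p * cnj (U $ j $ q)))"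
      by (simp add: matrix_matrix_mult_def transpose_def sum_distrib_left sum_distrib_right mult_ac)
    also have "\<dots> = (\<Sum>p\<in>UNIV. \<Sum>q\<in>UNIV. ?H $ p $ q * (U $ i $ p * cnj (U $ j $ q)))" by (rule sum.swap)
    finally show ?thesis by (cases "i = j") (simp_all add: herm_form[OF k] U)
  qed
  then have "det (U ** ?H ** ?V) = (1 / 2) ^ CARD('n)" by (subst det_diagonal) auto
  moreover have "det (U ** ?H ** ?V) = det U * det ?H * cnj (det U)"
    by (simp add: det_mul det_transpose cnj_det)
  ultimately have e: "of_real ((cmod (det U))\<^sup>2) * det ?H = (1 / 2) ^ CARD('n)"
    by (metis complex_norm_square mult.assoc mult.commute)
  have "Re (of_real ((cmod (det U))\<^sup>2) * det ?H) = (cmod (det U))\<^sup>2 * herm_det \<sigma>" by (simp add: herm_det_def)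
  moreover have "Re ((1 / 2 :: complex) ^ CARD('n)) = (1 / 2) ^ CARD('n)"
  proof -
    have "(1 / 2 :: complex) ^ CARD('n) = of_real ((1 / 2) ^ CARD('n))" by simp
    then show ?thesis by (metis Re_complex_of_real)
  qed
  ultimately show 1: "(cmod (det U))\<^sup>2 * herm_det \<sigma> = (1 / 2) ^ CARD('n)" using e by metis
  then have "(cmod (det U))\<^sup>2 * herm_det \<sigma> > 0" by simp
  then show "herm_det \<sigma> > 0" by (metis zero_less_mult_pos zero_less_power2 zero_le_power2 less_eq_real_def mult_zero_left less_irrefl)
qed

section \<open>Determinants and complex multilinear top forms\<close>

lemma enum_list: "distinct (SOME ps. distinct ps \<and> set ps = (UNIV :: 'n::finite set))"
    "set (SOME ps. distinct ps \<and> set ps = (UNIV :: 'n set)) = UNIV"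
proof -
  have "\<exists>ps. distinct ps \<and> set ps = (UNIV :: 'n set)" using finite_distinct_list[OF finite] by metis
  from someI_ex[OF this] show "distinct (SOME ps. distinct ps \<and> set ps = (UNIV :: 'n::finite set))"
    "set (SOME ps. distinct ps \<and> set ps = (UNIV :: 'n set)) = UNIV" by auto
qed

lemma n0_point_smult:
  fixes \<mu> :: "(complex^'n) list \<Rightarrow> complex"
  assumes y: "n0_point \<mu>" and l: "length xs + length ys + 1 = CARD('n)"
  shows "\<mu> (xs @ (\<i> *s v) # ys) = \<i> * \<mu> (xs @ v # ys)" "\<mu> (xs @ (c *s v) # ys) = c * \<mu> (xs @ v # ys)"
    "\<mu> (xs @ (u + v) # ys) = \<mu> (xs @ u # ys) + \<mu> (xs @ v # ys)"
    "\<mu> (xs @ (r *\<^sub>R v) # ys) = of_real r * \<mu> (xs @ v # ys)"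
proof -
  have a: "alt_form CARD('n) \<mu>" using y by (simp add: n0_point_def)
  interpret l: linear "\<lambda>u. \<mu> (xs @ u # ys)" by (rule alt_form_linear_mid[OF a l])
  have "length (xs @ v # ys) = CARD('n) \<and> length xs < CARD('n)" using l by simp
  then have "\<mu> ((xs @ v # ys)[length xs := \<i> *s ((xs @ v # ys) ! length xs)]) = \<i> * \<mu> (xs @ v # ys)"
    using y unfolding n0_point_def by blast
  then show 1: "\<mu> (xs @ (\<i> *s v) # ys) = \<i> * \<mu> (xs @ v # ys)" by simp
  show 2: "\<mu> (xs @ (u + v) # ys) = \<mu> (xs @ u # ys) + \<mu> (xs @ v # ys)" for u v by (rule l.add)
  show 3: "\<mu> (xs @ (r *\<^sub>R v) # ys) = of_real r * \<mu> (xs @ v # ys)" for r v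
    unfolding l.scale by (simp add: scaleR_conv_of_real)
  show "\<mu> (xs @ (c *s v) # ys) = c * \<mu> (xs @ v # ys)"
    unfolding smult_complex[of c v] 2 3 1 by (simp add: complex_eq_iff algebra_simps)
qed

lemma det_two:
  fixes U :: "complex^'n^'n"
  assumes "distinct [a, b]" "UNIV = {a, b}"
  shows "det U = U $ a $ a * U $ b $ b - U $ a $ b * U $ b $ a"
proof -
  have f: "finite {b}" "a \<notin> {b}" using assms(1) by auto
  show ?thesis unfolding det_def assms(2) sum_over_permutations_insert[OF f] permutes_sing
    using assms(1) by (simp add: sign_swap_id sign_compose permutation_swap_id Transposition.transpose_def cong del: sign_on_cong)
qed

lemma det_three:
  fixes U :: "complex^'n^'n"
  assumes "distinct [a, b, c]" "UNIV = {a, b, c}"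
  shows "det U = U $ a $ a * U $ b $ b * U $ c $ c + U $ a $ b * U $ b $ c * U $ c $ a + U $ a $ c * U $ b $ a * U $ c $ b
     - U $ a $ a * U $ b $ c * U $ c $ b - U $ a $ b * U $ b $ a * U $ c $ c - U $ a $ c * U $ b $ b * U $ c $ a"
proof -
  have f: "finite {b, c}" "a \<notin> {b, c}" "finite {c}" "b \<notin> {c}" using assms(1) by auto
  have ne: "a \<noteq> b" "a \<noteq> c" "b \<noteq> c" "b \<noteq> a" "c \<noteq> a" "c \<noteq> b" using assms(1) by auto
  show ?thesis unfolding det_def assms(2) sum_over_permutations_insert[OF f(1,2)] sum_over_permutations_insert[OF f(3,4)] permutes_sing
    by (simp add: ne sign_swap_id sign_compose permutation_swap_id permutation_compose Transposition.transpose_def algebra_simps cong del: sign_on_cong)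
qed

lemma vec_expand: "u = (\<Sum>p\<in>UNIV. (u $ p) *s axis p 1)" for u :: "complex^'n"
  by (simp add: vec_eq_iff sum_component axis_def if_distrib cong: if_cong)

lemma n0_point_expand2:
  fixes \<mu> :: "(complex^'n) list \<Rightarrow> complex"
  assumes y: "n0_point \<mu>" and n: "CARD('n) = 2" and ab: "distinct [a, b]" "UNIV = {a, b}"
  shows "\<mu> [u, v] = (u $ a * v $ b - u $ b * v $ a) * \<mu> [axis a 1, axis b 1]"
proof -
  have a: "alt_form 2 \<mu>" using y n by (simp add: n0_point_def)
  have S: "(\<Sum>p\<in>UNIV. f p) = f a + f b" for f :: "'n \<Rightarrow> complex^'n" by (subst ab(2)) (use ab(1) in simp)
  have lin: "\<mu> [p + q, x] = \<mu> [p, x] + \<mu> [q, x]" "\<mu> [c *s p, x] = c * \<mu> [p, x]"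
    "\<mu> [x, p + q] = \<mu> [x, p] + \<mu> [x, q]" "\<mu> [x, c *s p] = c * \<mu> [x, p]" for p q x c
    using n0_point_smult(2,3)[OF y, of "[]" "[x]"] n0_point_smult(2,3)[OF y, of "[x]" "[]"] n by simp_all
  have z: "\<mu> [x, x] = 0" for x using alt_form_eq_0[OF a, of 0 1 "[x, x]"] by simp
  have sw: "\<mu> [axis b 1, axis a 1] = - \<mu> [axis a 1, axis b 1]" using alt_form_swap[OF a, of "[]" "axis b 1" "axis a 1" "[]"] by simp
  have "\<mu> [u, v] = \<mu> [u $ a *s axis a 1 + u $ b *s axis b 1, v $ a *s axis a 1 + v $ b *s axis b 1]"
    using vec_expand[of u] vec_expand[of v] unfolding S by simp
  also have "\<dots> = (u $ a * v $ b - u $ b * v $ a) * \<mu> [axis a 1, axis b 1]"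
    by (simp only: lin z sw) (simp add: algebra_simps)
  finally show ?thesis .
qed

text \<open>The rows of \<open>U\<close> are the given vectors, indexed in the enumeration that
  \<open>vol_coeff\<close> has chosen. The injection \<open>f\<close> records which vector is which
  row, so that unitarity of the list transfers to the rows.\<close>

lemma n0_point_det2:
  fixes \<mu> :: "(complex^'n) list \<Rightarrow> complex"
  assumes y: "n0_point \<mu>" and n: "CARD('n) = 2" and l: "length us = 2"
  shows "\<exists>U. \<mu> us = det U * vol_coeff \<mu> \<and> (\<exists>f. inj f \<and> (\<forall>p. f p < length us \<and> U $ p = us ! f p))"
proof -
  let ?ps = "SOME ps. distinct ps \<and> set ps = (UNIV :: 'n set)"
  have "length ?ps = 2" using distinct_card[OF enum_list(1)[where 'n = 'n]] by (simp add: enum_list(2) n)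
  then obtain a b where ps: "?ps = [a, b]" using length_2D by blast
  have ab: "distinct [a, b]" "UNIV = {a, b}" using enum_list[where 'n = 'n] unfolding ps by auto
  obtain u v where us: "us = [u, v]" using length_2D[OF l] by blast
  define U where "U = (\<chi> p. if p = a then u else v)"
  have U: "U $ a = u" "U $ b = v" using ab(1) by (auto simp: U_def)
  have vc: "vol_coeff \<mu> = \<mu> [axis a 1, axis b 1]" by (simp add: vol_coeff_def ps)
  have "\<mu> us = det U * vol_coeff \<mu>"
    unfolding us vc n0_point_expand2[OF y n ab, of u v] det_two[OF ab] U by (simp add: algebra_simps)
  moreover have "\<exists>f. inj f \<and> (\<forall>p. f p < length us \<and> U $ p = us ! f p)"
    by (rule exI[of _ "\<lambda>p. if p = a then 0 else 1"]) (use ab in \<open>auto simp: us U_def inj_def\<close>)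
  ultimately show ?thesis by (intro exI[of _ U]) (auto simp: us U_def)
qed

lemma n0_point_expand3:
  fixes \<mu> :: "(complex^'n) list \<Rightarrow> complex"
  assumes y: "n0_point \<mu>" and n: "CARD('n) = 3" and ab: "distinct [a, b, c]" "UNIV = {a, b, c}"
  shows "\<mu> [u, v, w] = (u $ a * v $ b * w $ c + u $ b * v $ c * w $ a + u $ c * v $ a * w $ b
     - u $ a * v $ c * w $ b - u $ b * v $ a * w $ c - u $ c * v $ b * w $ a) * \<mu> [axis a 1, axis b 1, axis c 1]"
proof -
  have a: "alt_form 3 \<mu>" using y n by (simp add: n0_point_def)
  have S: "(\<Sum>p\<in>UNIV. f p) = f a + f b + f c" for f :: "'n \<Rightarrow> complex^'n" by (subst ab(2)) (use ab(1) in simp)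
  note lin = n0_point_smult[OF y, of "[]" "[_, _]", unfolded n, simplified] n0_point_smult[OF y, of "[_]" "[_]", unfolded n, simplified] n0_point_smult[OF y, of "[_, _]" "[]", unfolded n, simplified]
  have z: "\<mu> [x, x, y] = 0" "\<mu> [x, y, x] = 0" "\<mu> [y, x, x] = 0" for x y
    using alt_form_eq_0[OF a, of 0 1 "[x, x, y]"] alt_form_eq_0[OF a, of 0 2 "[x, y, x]"] alt_form_eq_0[OF a, of 1 2 "[y, x, x]"] by auto
  let ?e = "\<mu> [axis a 1, axis b 1, axis c 1]"
  have sw: "\<mu> [axis b 1, axis a 1, axis c 1] = - ?e" "\<mu> [axis a 1, axis c 1, axis b 1] = - ?e" "\<mu> [axis b 1, axis c 1, axis a 1] = ?e"
    "\<mu> [axis c 1, axis a 1, axis b 1] = ?e" "\<mu> [axis c 1, axis b 1, axis a 1] = - ?e"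
    using alt_form_swap[OF a, of "[]" "axis b 1" "axis a 1" "[axis c 1]"] alt_form_swap[OF a, of "[axis a 1]" "axis c 1" "axis b 1" "[]"]
      alt_form_swap[OF a, of "[axis b 1]" "axis c 1" "axis a 1" "[]"] alt_form_swap[OF a, of "[]" "axis c 1" "axis a 1" "[axis b 1]"]
      alt_form_swap[OF a, of "[]" "axis c 1" "axis b 1" "[axis a 1]"] by auto
  have "\<mu> [u, v, w] = \<mu> [u $ a *s axis a 1 + u $ b *s axis b 1 + u $ c *s axis c 1, v $ a *s axis a 1 + v $ b *s axis b 1 + v $ c *s axis c 1,
      w $ a *s axis a 1 + w $ b *s axis b 1 + w $ c *s axis c 1]"
    using vec_expand[of u] vec_expand[of v] vec_expand[of w] unfolding S by simp
  also have "\<dots> = (u $ a * v $ b * w $ c + u $ b * v $ c * w $ a + u $ c * v $ a * w $ b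
     - u $ a * v $ c * w $ b - u $ b * v $ a * w $ c - u $ c * v $ b * w $ a) * ?e"
    by (simp add: lin z sw) (simp add: algebra_simps)
  finally show ?thesis .
qed

lemma n0_point_det3:
  fixes \<mu> :: "(complex^'n) list \<Rightarrow> complex"
  assumes y: "n0_point \<mu>" and n: "CARD('n) = 3" and l: "length us = 3"
  shows "\<exists>U. \<mu> us = det U * vol_coeff \<mu> \<and> (\<exists>f. inj f \<and> (\<forall>p. f p < length us \<and> U $ p = us ! f p))"
proof -
  let ?ps = "SOME ps. distinct ps \<and> set ps = (UNIV :: 'n set)"
  have "length ?ps = 3" using distinct_card[OF enum_list(1)[where 'n = 'n]] by (simp add: enum_list(2) n)
  then obtain a b c where ps: "?ps = [a, b, c]" using length_3D by blast
  have ab: "distinct [a, b, c]" "UNIV = {a, b, c}" using enum_list[where 'n = 'n] unfolding ps by auto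
  obtain u v w where us: "us = [u, v, w]" using length_3D[OF l] by blast
  define U where "U = (\<chi> p. if p = a then u else if p = b then v else w)"
  have U: "U $ a = u" "U $ b = v" "U $ c = w" using ab(1) by (auto simp: U_def)
  have vc: "vol_coeff \<mu> = \<mu> [axis a 1, axis b 1, axis c 1]" by (simp add: vol_coeff_def ps)
  have "\<mu> us = det U * vol_coeff \<mu>"
    unfolding us vc n0_point_expand3[OF y n ab, of u v w] det_three[OF ab] U by (simp add: algebra_simps)
  moreover have "\<exists>f. inj f \<and> (\<forall>p. f p < length us \<and> U $ p = us ! f p)"
    by (rule exI[of _ "\<lambda>p. if p = a then 0 else if p = b then 1 else 2"]) (use ab in \<open>auto simp: us U_def inj_def\<close>)
  ultimately show ?thesis by (intro exI[of _ U]) (auto simp: us U_def)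
qed

text \<open>For a unitary frame, \<open>|\<mu>|\<close> is \<open>2\<^bsup>n/2\<^esup> |\<mu>(u\<^sub>1, \<dots>, u\<^sub>n)|\<close>: the length of \<open>dz\<^sup>p\<close> is \<open>\<surd>2\<close> for the flat metric.\<close>

lemma pnorm_unitary:
  fixes \<mu> :: "(complex^'n) list \<Rightarrow> complex"
  assumes n: "CARD('n) = 2 \<or> CARD('n) = 3" and k: "kaehler_point \<sigma>" and y: "n0_point \<mu>"
    and us: "length us = CARD('n)" "unitary \<sigma> us"
  shows "pnorm \<mu> \<sigma> = sqrt (2 ^ CARD('n)) * cmod (\<mu> us)" "herm_det \<sigma> > 0" "pnorm \<mu> \<sigma> > 0"
proof -
  have det: "\<exists>U. \<mu> vs = det U * vol_coeff \<mu> \<and> (\<exists>f. inj f \<and> (\<forall>p. f p < length vs \<and> U $ p = vs ! f p))"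
    if "length vs = CARD('n)" for vs
    using n n0_point_det2[OF y] n0_point_det3[OF y] that by metis
  obtain U f where U: "\<mu> us = det U * vol_coeff \<mu>" "inj f" "\<And>p. f p < length us \<and> U $ p = us ! f p" using det[OF us(1)] by blast
  have o: "\<sigma> [U $ p, \<i> *s (U $ q)] = (if p = q then 1 else 0)" "\<sigma> [U $ p, U $ q] = 0" for p q
    using us(2) U(2,3) unfolding unitary_def[OF k] by (auto dest: injD)
  note hd = herm_det_unitary[OF k o]
  show "herm_det \<sigma> > 0" by (rule hd)
  have dn: "det U \<noteq> 0" using hd(1) by auto
  have "pnorm \<mu> \<sigma> = sqrt (2 ^ CARD('n) * (cmod (\<mu> us))\<^sup>2)"
  proof -
    have h: "herm_det \<sigma> = 1 / (2 ^ CARD('n) * (cmod (det U))\<^sup>2)" using hd(1) dn by (simp add: field_simps power_divide)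
    show ?thesis unfolding pnorm_def U(1) h by (simp add: norm_mult power_mult_distrib algebra_simps)
  qed
  then show eq: "pnorm \<mu> \<sigma> = sqrt (2 ^ CARD('n)) * cmod (\<mu> us)" by (simp add: real_sqrt_mult)
  have "vol_coeff \<mu> \<noteq> 0"
  proof
    assume z: "vol_coeff \<mu> = 0"
    obtain vs where vs: "\<mu> vs \<noteq> 0" using y by (auto simp: n0_point_def)
    then have "length vs = CARD('n)" using y alt_form_length unfolding n0_point_def by blast
    from det[OF this] z vs show False by auto
  qed
  then show "pnorm \<mu> \<sigma> > 0" unfolding eq using dn by (simp add: U(1))
qed

section \<open>Unitary frames normalised in phase and scale\<close>

lemma has_table_scale:
  assumes t: "has_table fs k \<alpha> t" and c: "c \<noteq> 0"
  shows "has_table (map (\<lambda>v. c *\<^sub>R v) fs) k (\<lambda>vs. \<alpha> vs * (1 / c ^ k)) t"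
  unfolding has_table_def
proof (intro conjI ballI)
  have a: "alt_form k \<alpha>" using t by (simp add: has_table_def)
  show "alt_form k (\<lambda>vs. \<alpha> vs * (1 / c ^ k))" using alt_form_mult[OF a, of "1 / c ^ k"] by (simp add: mult.commute)
  fix "is" assume i: "is \<in> set (incs k 0 (length (map (\<lambda>v. c *\<^sub>R v) fs)))"
  then have i': "set is \<subseteq> {0..<length fs}" "length is = k" using incs_sound by (metis length_map)+
  have e: "map ((!) (map (\<lambda>v. c *\<^sub>R v) fs)) is = map (\<lambda>v. c *\<^sub>R v) (map ((!) fs) is)" using i' by (auto simp: subset_iff)
  have "\<alpha> (map ((!) (map (\<lambda>v. c *\<^sub>R v) fs)) is) = c ^ k *\<^sub>R \<alpha> (map ((!) fs) is)"
    unfolding e by (rule alt_form_scale[OF a]) (simp add: i')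
  then show "\<alpha> (map ((!) (map (\<lambda>v. c *\<^sub>R v) fs)) is) * (1 / c ^ k) = of_int (t is)"
    using t i c by (simp add: has_table_def)
qed

lemma spanning_scale:
  assumes s: "spanning fs" and c: "c \<noteq> 0"
  shows "spanning (map (\<lambda>v. c *\<^sub>R v) fs)"
  unfolding spanning_def
proof
  fix v
  obtain a where "v = (\<Sum>i<length fs. a i *\<^sub>R fs ! i)" using s unfolding spanning_def by blast
  then show "\<exists>a. v = (\<Sum>i<length (map (\<lambda>v. c *\<^sub>R v) fs). a i *\<^sub>R map (\<lambda>v. c *\<^sub>R v) fs ! i)"
    using c by (intro exI[of _ "\<lambda>i. a i / c"]) simp
qed

text \<open>Multiplying one vector of a unitary frame by a complex number of modulus 1 keeps the
  frame unitary and rotates the value of the top form to the positive real axis; its modulus is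
  known from \<open>pnorm_unitary\<close>.\<close>

lemma unitary_phase:
  fixes \<mu> :: "(complex^'n) list \<Rightarrow> complex"
  assumes n: "CARD('n) = 2 \<or> CARD('n) = 3" and k: "kaehler_point \<sigma>" and y: "n0_point \<mu>"
  shows "\<exists>us. length us = CARD('n) \<and> unitary \<sigma> us \<and> \<mu> us = of_real (pnorm \<mu> \<sigma> / sqrt (2 ^ CARD('n)))"
proof -
  obtain us where us: "length us = CARD('n)" "unitary \<sigma> us" using unitary_exists[OF k, of "CARD('n)"] by auto
  note pn = pnorm_unitary[OF n k y us]
  define z where "z = \<mu> us"
  have z: "z \<noteq> 0" using pn by (auto simp: z_def)
  obtain u r where ur: "us = u # r" using us(1) n by (cases us) auto
  \<comment> \<open>The unit number that turns \<open>z\<close> into its modulus.\<close>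
  define c where "c = cnj z / of_real (cmod z)"
  have c1: "(Re c)\<^sup>2 + (Im c)\<^sup>2 = 1"
  proof -
    have "cmod c = 1" using z by (simp add: c_def norm_divide)
    then show ?thesis by (metis cmod_power2 one_power2)
  qed
  obtain v where v: "v = c *s u" by blast
  let ?v = v
  have un: "\<sigma> [u, \<i> *s u] = 1" "\<sigma> [u, u] = 0"
    using us(2) unfolding unitary_def[OF k] ur by (auto dest!: spec[of _ 0])
  have ur': "\<sigma> [r ! i, \<i> *s u] = 0" "\<sigma> [r ! i, u] = 0" "\<sigma> [u, \<i> *s (r ! i)] = 0" "\<sigma> [u, r ! i] = 0" if "i < length r" for i
    using us(2) that unfolding unitary_def[OF k] ur
    by (auto dest: spec[of _ "Suc i"] spec[of _ 0] simp: All_less_Suc2)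
  note l = linear_add[OF kp_lin(1)[OF k]] linear_add[OF kp_lin(2)[OF k]] linear_cmul[OF kp_lin(1)[OF k]] linear_cmul[OF kp_lin(2)[OF k]]
    linear_diff[OF kp_lin(1)[OF k]] linear_diff[OF kp_lin(2)[OF k]] kp_neg[OF k] kp_J[OF k] kp_J2[OF k] ii_smult
  have vv: "\<sigma> [?v, \<i> *s ?v] = 1" "\<sigma> [?v, ?v] = 0"
    using c1 unfolding v smult_complex[of c u] by (simp_all add: l un power2_eq_square)
  have vr: "\<sigma> [r ! i, \<i> *s ?v] = 0" "\<sigma> [r ! i, ?v] = 0" "\<sigma> [?v, \<i> *s (r ! i)] = 0" "\<sigma> [?v, r ! i] = 0" if "i < length r" for i
    unfolding v smult_complex[of c u] by (simp_all add: l ur'[OF that])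
  have rr: "\<sigma> [r ! i, \<i> *s (r ! j)] = (if i = j then 1 else 0) \<and> \<sigma> [r ! i, r ! j] = 0" if "i < length r" "j < length r" for i j
  proof -
    have "Suc i < length us" "Suc j < length us" using that by (simp_all add: ur)
    with us(2) have "\<sigma> [us ! Suc i, \<i> *s (us ! Suc j)] = (if Suc i = Suc j then 1 else 0) \<and> \<sigma> [us ! Suc i, us ! Suc j] = 0"
      unfolding unitary_def[OF k] by blast
    then show ?thesis by (simp add: ur)
  qed
  have "unitary \<sigma> (?v # r)"
    unfolding unitary_def[OF k]
  proof (intro allI impI)
    fix i j assume "i < length (?v # r)" "j < length (?v # r)"
    then show "\<sigma> [(?v # r) ! i, \<i> *s ((?v # r) ! j)] = (if i = j then 1 else 0) \<and> \<sigma> [(?v # r) ! i, (?v # r) ! j] = 0"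
      using rr by (cases i; cases j) (auto simp: vv vr)
  qed
  moreover have "\<mu> (?v # r) = of_real (cmod z)"
  proof -
    have "\<mu> (?v # r) = c * z" using n0_point_smult(2)[OF y, of "[]" r c u] us(1) by (simp add: v ur z_def)
    also have "\<dots> = of_real (cmod z)" using z complex_norm_square[of z] by (simp add: c_def field_simps power2_eq_square)
    finally show ?thesis .
  qed
  moreover have "cmod z = pnorm \<mu> \<sigma> / sqrt (2 ^ CARD('n))" unfolding pn(1) z_def by simp
  ultimately show ?thesis using us(1) ur by (intro exI[of _ "?v # r"]) simp
qed

text \<open>The frame stretched by \<open>k\<close> is orthonormal for g / K, and the sharp of g / K
  is K times the sharp of g.\<close>

lemma sharp_scaled_frame:
  fixes \<xi> :: "'e::euclidean_space \<Rightarrow> real"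
  assumes f: "frame g fs" and x: "linear \<xi>" and k: "k * k = K"
  shows "K *\<^sub>R sharp g \<xi> = (\<Sum>i<length (map (\<lambda>v. k *\<^sub>R v) fs). \<xi> (map (\<lambda>v. k *\<^sub>R v) fs ! i) *\<^sub>R map (\<lambda>v. k *\<^sub>R v) fs ! i)"
proof -
  have l: "length fs = DIM('e)" using f by (simp add: frame_def)
  show ?thesis unfolding sharp_frame[OF f x]
    by (simp add: l scaleR_sum_right linear_cmul[OF x] mult_ac flip: k)
qed

text \<open>On a unitary frame of the right phase \<mu> takes the value |\<mu>| / 2^(3/2).
  Stretching by sqrt 2 multiplies it by 2^(3/2), giving |\<mu>|, and doubles \<sigma>.\<close>

lemma su3_frame:
  fixes \<mu> :: "(complex^'n) list \<Rightarrow> complex"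
  assumes n: "CARD('n) = 3" and k: "kaehler_point \<sigma>" and y: "n0_point \<mu>"
  shows "\<exists>es. length es = 6 \<and> spanning es \<and> has_table es 2 (\<lambda>vs. \<sigma> vs * (1 / 2)) tab\<omega> \<and>
    has_table es 3 (\<lambda>vs. Re (\<mu> vs) * (1 / pnorm \<mu> \<sigma>)) tabRe3 \<and> has_table es 3 (\<lambda>vs. Im (\<mu> vs) * (1 / pnorm \<mu> \<sigma>)) tabIm3 \<and>
    (\<forall>\<xi>. linear \<xi> \<longrightarrow> 2 *\<^sub>R sharp (kaehler_metric \<sigma>) \<xi> = (\<Sum>i<length es. \<xi> (es ! i) *\<^sub>R es ! i))"
proof -
  let ?N = "pnorm \<mu> \<sigma>"
  define \<rho> where "\<rho> = ?N / sqrt (2 ^ 3)"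
  obtain us where us: "length us = 3" "unitary \<sigma> us" "\<mu> us = of_real \<rho>"
    using unitary_phase[OF _ k y] n unfolding \<rho>_def by auto
  have \<rho>: "\<rho> > 0" using pnorm_unitary(3)[OF _ k y] us n unfolding \<rho>_def by auto
  obtain u v w where uvw: "us = [u, v, w]" using length_3D[OF us(1)] by blast
  have "\<sigma> [us ! i, \<i> *s (us ! j)] = (if i = j then 1 else 0) \<and> \<sigma> [us ! i, us ! j] = 0" if "i \<in> {0, 1, 2}" "j \<in> {0, 1, 2}" for i j
    using us(2) that unfolding unitary_def[OF k] us(1) by auto
  from this[of 0 0] this[of 0 1] this[of 0 2] this[of 1 0] this[of 1 1] this[of 1 2] this[of 2 0] this[of 2 1] this[of 2 2]
  have un: "\<sigma> [u, \<i> *s u] = 1" "\<sigma> [u, \<i> *s v] = 0" "\<sigma> [u, \<i> *s w] = 0" "\<sigma> [v, \<i> *s u] = 0" "\<sigma> [v, \<i> *s v] = 1" "\<sigma> [v, \<i> *s w] = 0"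
    "\<sigma> [w, \<i> *s u] = 0" "\<sigma> [w, \<i> *s v] = 0" "\<sigma> [w, \<i> *s w] = 1" "\<sigma> [u, u] = 0" "\<sigma> [u, v] = 0" "\<sigma> [u, w] = 0" "\<sigma> [v, u] = 0" "\<sigma> [v, v] = 0" "\<sigma> [v, w] = 0"
    "\<sigma> [w, u] = 0" "\<sigma> [w, v] = 0" "\<sigma> [w, w] = 0"
    by (simp_all add: uvw)
  let ?fs = "[u, \<i> *s u, v, \<i> *s v, w, \<i> *s w]"
  have len: "length ?fs = 6" by simp
  have s: "\<sigma> [\<i> *s x, \<i> *s y] = \<sigma> [x, y]" "\<sigma> [\<i> *s x, y] = - \<sigma> [x, \<i> *s y]" "\<sigma> [x, - y] = - \<sigma> [x, y]" "\<sigma> [- x, y] = - \<sigma> [x, y]" for x y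
    by (simp_all add: kp_J[OF k] kp_J2[OF k] kp_neg[OF k])
  have tw: "has_table ?fs 2 \<sigma> tab\<omega>"
    unfolding has_table_def len incs_2_6 incs_3_6 using kp_alt[OF k] un by (simp add: tab\<omega>_def s)
  have a: "alt_form 3 \<mu>" using y n by (simp add: n0_point_def)
  have z: "\<mu> [x, x, y] = 0" "\<mu> [x, y, x] = 0" "\<mu> [y, x, x] = 0" for x y
    using alt_form_eq_0[OF a, of 0 1 "[x, x, y]"] alt_form_eq_0[OF a, of 0 2 "[x, y, x]"] alt_form_eq_0[OF a, of 1 2 "[y, x, x]"] by auto
  have lin: "\<mu> [\<i> *s p, x, x'] = \<i> * \<mu> [p, x, x']" "\<mu> [x, \<i> *s p, x'] = \<i> * \<mu> [x, p, x']" "\<mu> [x, x', \<i> *s p] = \<i> * \<mu> [x, x', p]" for p x x'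
    using n0_point_smult(1)[OF y, of "[]" "[x, x']"] n0_point_smult(1)[OF y, of "[x]" "[x']"] n0_point_smult(1)[OF y, of "[x, x']" "[]"] n by simp_all
  have R: "alt_form 3 (\<lambda>vs. Re (\<mu> vs))" "alt_form 3 (\<lambda>vs. Im (\<mu> vs))"
    by (rule alt_form_linear_comp[OF a], simp add: bounded_linear.linear[OF bounded_linear_Re] bounded_linear.linear[OF bounded_linear_Im])+
  have val: "\<mu> [u, v, w] = of_real \<rho>" using us(3) uvw by simp
  have tR: "has_table ?fs 3 (\<lambda>vs. Re (\<mu> vs) * (1 / \<rho>)) tabRe3"
    unfolding has_table_def len incs_2_6 incs_3_6 using alt_form_mult[OF R(1), of "1 / \<rho>"] \<rho>
    by (simp add: tabRe3_def lin z val)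
  have tI: "has_table ?fs 3 (\<lambda>vs. Im (\<mu> vs) * (1 / \<rho>)) tabIm3"
    unfolding has_table_def len incs_2_6 incs_3_6 using alt_form_mult[OF R(2), of "1 / \<rho>"] \<rho>
    by (simp add: tabIm3_def lin z val)
  have f: "frame (kaehler_metric \<sigma>) ?fs"
    unfolding frame_def using kp_inner[OF k] un n
    by (simp add: kp_metric[OF k] numeral_eq_Suc All_less_Suc2 s ii_smult)
  let ?k = "sqrt 2"
  have k3: "\<rho> * ?k ^ 3 = ?N" unfolding \<rho>_def by (simp flip: real_sqrt_power)
  let ?es = "map (\<lambda>v. ?k *\<^sub>R v) ?fs"
  have "has_table ?es 2 (\<lambda>vs. \<sigma> vs * (1 / 2)) tab\<omega>" using has_table_scale[OF tw, of ?k] by simp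
  moreover have "has_table ?es 3 (\<lambda>vs. Re (\<mu> vs) * (1 / ?N)) tabRe3" "has_table ?es 3 (\<lambda>vs. Im (\<mu> vs) * (1 / ?N)) tabIm3"
    using has_table_scale[OF tR, of ?k] has_table_scale[OF tI, of ?k] unfolding k3[symmetric] by simp_all
  moreover have "spanning ?es" by (rule spanning_scale[OF frame_spanning[OF f]]) simp
  ultimately show ?thesis using sharp_scaled_frame[OF f, of _ ?k 2] by (intro exI[of _ ?es]) simp
qed

text \<open>On a unitary frame of the right phase \<mu> takes the value |\<mu>| / 2. Stretching by
  \<kappa> gives \<kappa>^2 |\<mu>| / 2 = |\<mu>| / \<kappa>, because \<kappa>^3 = 2. The leftover 1
  / \<kappa> is compensated later by torus vectors of length \<kappa>.\<close>

lemma su2_frame: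
  fixes \<mu> :: "(complex^'n) list \<Rightarrow> complex"
  assumes n: "CARD('n) = 2" and k: "kaehler_point \<sigma>" and y: "n0_point \<mu>" and kk: "\<kappa> > 0" "\<kappa> ^ 3 = 2"
  shows "\<exists>es. length es = 4 \<and> spanning es \<and> has_table es 2 (\<lambda>vs. \<sigma> vs * (1 / (\<kappa> * \<kappa>))) tab\<omega> \<and>
    has_table es 2 (\<lambda>vs. Re (\<mu> vs) * (\<kappa> / pnorm \<mu> \<sigma>)) tabRe2 \<and> has_table es 2 (\<lambda>vs. Im (\<mu> vs) * (\<kappa> / pnorm \<mu> \<sigma>)) tabIm2 \<and>
    (\<forall>\<xi>. linear \<xi> \<longrightarrow> (\<kappa> * \<kappa>) *\<^sub>R sharp (kaehler_metric \<sigma>) \<xi> = (\<Sum>i<length es. \<xi> (es ! i) *\<^sub>R es ! i))"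
proof -
  let ?N = "pnorm \<mu> \<sigma>"
  define \<rho> where "\<rho> = ?N / sqrt (2 ^ 2)"
  obtain us where us: "length us = 2" "unitary \<sigma> us" "\<mu> us = of_real \<rho>"
    using unitary_phase[OF _ k y] n unfolding \<rho>_def by auto
  have N: "?N > 0" using pnorm_unitary(3)[OF _ k y] us n by auto
  then have \<rho>: "\<rho> > 0" unfolding \<rho>_def by simp
  obtain u v where uvw: "us = [u, v]" using length_2D[OF us(1)] by blast
  have "\<sigma> [us ! i, \<i> *s (us ! j)] = (if i = j then 1 else 0) \<and> \<sigma> [us ! i, us ! j] = 0" if "i \<in> {0, 1}" "j \<in> {0, 1}" for i j
    using us(2) that unfolding unitary_def[OF k] us(1) by auto
  from this[of 0 0] this[of 0 1] this[of 1 0] this[of 1 1]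
  have un: "\<sigma> [u, \<i> *s u] = 1" "\<sigma> [u, \<i> *s v] = 0" "\<sigma> [v, \<i> *s u] = 0" "\<sigma> [v, \<i> *s v] = 1"
    "\<sigma> [u, u] = 0" "\<sigma> [u, v] = 0" "\<sigma> [v, u] = 0" "\<sigma> [v, v] = 0"
    by (simp_all add: uvw)
  let ?fs = "[u, \<i> *s u, v, \<i> *s v]"
  have len: "length ?fs = 4" by simp
  have s: "\<sigma> [\<i> *s x, \<i> *s y] = \<sigma> [x, y]" "\<sigma> [\<i> *s x, y] = - \<sigma> [x, \<i> *s y]" "\<sigma> [x, - y] = - \<sigma> [x, y]" "\<sigma> [- x, y] = - \<sigma> [x, y]" for x y
    by (simp_all add: kp_J[OF k] kp_J2[OF k] kp_neg[OF k])
  have tw: "has_table ?fs 2 \<sigma> tab\<omega>"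
    unfolding has_table_def len incs_2_4 using kp_alt[OF k] un by (simp add: tab\<omega>_def s)
  have a: "alt_form 2 \<mu>" using y n by (simp add: n0_point_def)
  have z: "\<mu> [x, x] = 0" for x using alt_form_eq_0[OF a, of 0 1 "[x, x]"] by simp
  have lin: "\<mu> [\<i> *s p, x] = \<i> * \<mu> [p, x]" "\<mu> [x, \<i> *s p] = \<i> * \<mu> [x, p]" for p x
    using n0_point_smult(1)[OF y, of "[]" "[x]"] n0_point_smult(1)[OF y, of "[x]" "[]"] n by simp_all
  have R: "alt_form 2 (\<lambda>vs. Re (\<mu> vs))" "alt_form 2 (\<lambda>vs. Im (\<mu> vs))"
    by (rule alt_form_linear_comp[OF a], simp add: bounded_linear.linear[OF bounded_linear_Re] bounded_linear.linear[OF bounded_linear_Im])+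
  have val: "\<mu> [u, v] = of_real \<rho>" using us(3) uvw by simp
  have tR: "has_table ?fs 2 (\<lambda>vs. Re (\<mu> vs) * (1 / \<rho>)) tabRe2"
    unfolding has_table_def len incs_2_4 using alt_form_mult[OF R(1), of "1 / \<rho>"] \<rho>
    by (simp add: tabRe2_def lin z val)
  have tI: "has_table ?fs 2 (\<lambda>vs. Im (\<mu> vs) * (1 / \<rho>)) tabIm2"
    unfolding has_table_def len incs_2_4 using alt_form_mult[OF R(2), of "1 / \<rho>"] \<rho>
    by (simp add: tabIm2_def lin z val)
  have f: "frame (kaehler_metric \<sigma>) ?fs"
    unfolding frame_def using kp_inner[OF k] un n
    by (simp add: kp_metric[OF k] numeral_eq_Suc All_less_Suc2 s ii_smult)
  have k3: "1 / \<rho> * (1 / \<kappa> ^ 2) = \<kappa> / ?N"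
    using kk N by (simp add: \<rho>_def field_simps eval_nat_numeral)
  let ?es = "map (\<lambda>v. \<kappa> *\<^sub>R v) ?fs"
  have kn: "\<kappa> \<noteq> 0" using kk by simp
  have "has_table ?es 2 (\<lambda>vs. \<sigma> vs * (1 / (\<kappa> * \<kappa>))) tab\<omega>" using has_table_scale[OF tw kn] by (simp add: power2_eq_square)
  moreover have "has_table ?es 2 (\<lambda>vs. Re (\<mu> vs) * (\<kappa> / ?N)) tabRe2" "has_table ?es 2 (\<lambda>vs. Im (\<mu> vs) * (\<kappa> / ?N)) tabIm2"
    using has_table_scale[OF tR kn] has_table_scale[OF tI kn] unfolding k3[symmetric] by (simp_all add: mult.assoc)
  moreover have "spanning ?es" by (rule spanning_scale[OF frame_spanning[OF f]]) (rule kn)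
  ultimately show ?thesis using sharp_scaled_frame[OF f, of _ \<kappa> "\<kappa> * \<kappa>"] by (intro exI[of _ ?es]) simp
qed

section \<open>The norm of the holomorphic volume form\<close>

lemma kaehler_form_point: "kaehler_form A \<omega> \<Longrightarrow> c \<in> A \<Longrightarrow> x \<in> cimg c \<Longrightarrow> kaehler_point (\<omega> c x)"
  unfolding kaehler_form_def kaehler_point_def smooth_form_def by auto

lemma volume_form_point: "holomorphic_volume_form A \<Omega> \<Longrightarrow> c \<in> A \<Longrightarrow> x \<in> cimg c \<Longrightarrow> n0_point (\<Omega> c x)"
  unfolding holomorphic_volume_form_def n0_point_def smooth_form_def by auto

lemma vol_norm_pnorm: "vol_norm \<Omega> \<omega> c x [] = pnorm (\<Omega> c x) (\<omega> c x)"
  by (simp add: vol_norm_def pnorm_def)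

context
  fixes A :: "('x::{t2_space, second_countable_topology}, complex^'n) chart set"
    and \<omega> :: "('x, complex^'n, real) form" and \<Omega> :: "('x, complex^'n, complex) form"
  assumes A: "complex_atlas A" and \<omega>: "kaehler_form A \<omega>" and \<Omega>: "holomorphic_volume_form A \<Omega>"
    and n: "CARD('n) = 2 \<or> CARD('n) = 3"
begin

lemma sA: "smooth_atlas A" using A by (simp add: complex_atlas_def)

lemma norm_pos:
  assumes "c \<in> A" "x \<in> cimg c"
  shows "vol_norm \<Omega> \<omega> c x [] > 0" "herm_det (\<omega> c x) > 0" "vol_coeff (\<Omega> c x) \<noteq> 0"
proof -
  note k = kaehler_form_point[OF \<omega> assms] and y = volume_form_point[OF \<Omega> assms]
  obtain us where us: "length us = CARD('n)" "unitary (\<omega> c x) us" using unitary_exists[OF k, of "CARD('n)"] by auto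
  show "vol_norm \<Omega> \<omega> c x [] > 0" "herm_det (\<omega> c x) > 0"
    unfolding vol_norm_pnorm using pnorm_unitary[OF n k y us] by auto
  then show "vol_coeff (\<Omega> c x) \<noteq> 0" by (auto simp: vol_norm_def)
qed

text \<open>The derivative of a transition commutes with J and carries one Kaehler form to the
  other, hence unitary frames to unitary frames. On such frames the norm is a constant times the
  modulus of \<Omega>, which matches by compatibility of \<Omega>.\<close>

lemma norm_compat: "form_compat A (vol_norm \<Omega> \<omega>)"
  unfolding form_compat_def
proof (intro ballI impI allI)
  fix c d x vs assume c: "c \<in> A" "d \<in> A" "x \<in> cimg c" "cinv c x \<in> cdom d"
  let ?y = "transition c d x" and ?T = "fd (transition c d) x"
  have y: "?y \<in> cimg d" using c atlas_chart[OF sA c(2)] by (simp add: transition_eq)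
  note k = kaehler_form_point[OF \<omega> c(1,3)] and v = volume_form_point[OF \<Omega> c(1,3)]
  note k' = kaehler_form_point[OF \<omega> c(2) y] and v' = volume_form_point[OF \<Omega> c(2) y]
  have x: "x \<in> cmap c ` (cdom c \<inter> cdom d)" using rep_domain[OF sA c(1), of id "cdom d"] c by simp
  have T: "?T (\<i> *s u) = \<i> *s ?T u" for u using A c x unfolding complex_atlas_def by blast
  have e: "\<omega> c x us = \<omega> d ?y (map ?T us)" "\<Omega> c x us = \<Omega> d ?y (map ?T us)" for us
    using \<omega> \<Omega> x c unfolding kaehler_form_def holomorphic_volume_form_def smooth_form_def by blast+
  obtain us where us: "length us = CARD('n)" "unitary (\<omega> c x) us" using unitary_exists[OF k, of "CARD('n)"] by auto
  have us': "length (map ?T us) = CARD('n)" "unitary (\<omega> d ?y) (map ?T us)"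
    using us unfolding unitary_def[OF k] unitary_def[OF k'] by (simp_all add: e(1) T)
  show "vol_norm \<Omega> \<omega> c x vs = vol_norm \<Omega> \<omega> d ?y (map ?T vs)"
  proof (cases "vs = []")
    case True
    then show ?thesis using pnorm_unitary(1)[OF n k v us] pnorm_unitary(1)[OF n k' v' us'] e(2)[of us]
      by (simp add: vol_norm_pnorm)
  qed (simp add: vol_norm_def)
qed

lemma smooth_parts:
  assumes c: "c \<in> A"
  shows "smooth_on (cimg c) (\<lambda>x. vol_coeff (\<Omega> c x))" "smooth_on (cimg c) (\<lambda>x. herm_det (\<omega> c x))"
    "smooth_on (cimg c) (\<lambda>x. (cmod (vol_coeff (\<Omega> c x)))\<^sup>2)" "smooth_on (cimg c) (\<lambda>x. vol_norm \<Omega> \<omega> c x [])"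
proof -
  have w: "smooth_on (cimg c) (\<lambda>x. \<omega> c x vs)" for vs using \<omega> c unfolding kaehler_form_def smooth_form_def by auto
  show f: "smooth_on (cimg c) (\<lambda>x. vol_coeff (\<Omega> c x))"
    using \<Omega> c unfolding holomorphic_volume_form_def smooth_form_def vol_coeff_def by auto
  have or: "smooth_on (cimg c) (\<lambda>x. complex_of_real (\<omega> c x vs))" for vs
    by (rule smooth_on_bounded_linear[OF bounded_linear_of_real w])
  have h: "smooth_on (cimg c) (\<lambda>x. herm_matrix (\<omega> c x) $ p $ q)" for p q
  proof -
    have "smooth_on (cimg c) (\<lambda>x. (of_real (\<omega> c x [axis p 1, axis q \<i>]) - \<i> * of_real (\<omega> c x [axis p 1, axis q 1])) * (1 / 2))"
      by (intro smooth_on_mult smooth_on_diff smooth_on_const or)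
    then show ?thesis by (simp add: herm_matrix_def)
  qed
  have "smooth_on (cimg c) (\<lambda>x. det (herm_matrix (\<omega> c x)))"
    unfolding det_def by (intro smooth_on_sum smooth_on_mult smooth_on_const smooth_on_prod h)
  then show hd: "smooth_on (cimg c) (\<lambda>x. herm_det (\<omega> c x))"
    unfolding herm_det_def by (rule smooth_on_bounded_linear[OF bounded_linear_Re])
  have e: "(cmod z)\<^sup>2 = Re z * Re z + Im z * Im z" for z by (simp add: cmod_power2 power2_eq_square[of "Re z"] power2_eq_square[of "Im z"])
  have "smooth_on (cimg c) (\<lambda>x. Re (vol_coeff (\<Omega> c x)) * Re (vol_coeff (\<Omega> c x)) + Im (vol_coeff (\<Omega> c x)) * Im (vol_coeff (\<Omega> c x)))"
    by (intro smooth_on_add smooth_on_mult smooth_on_bounded_linear[OF bounded_linear_Re f] smooth_on_bounded_linear[OF bounded_linear_Im f])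
  then show f2: "smooth_on (cimg c) (\<lambda>x. (cmod (vol_coeff (\<Omega> c x)))\<^sup>2)"
    unfolding e .
  have "smooth_on (cimg c) (\<lambda>x. (cmod (vol_coeff (\<Omega> c x)))\<^sup>2 * inverse (herm_det (\<omega> c x)))"
    using norm_pos[OF c] by (intro smooth_on_mult f2 smooth_on_inverse hd) (metis less_irrefl)
  then have "smooth_on (cimg c) (\<lambda>x. sqrt ((cmod (vol_coeff (\<Omega> c x)))\<^sup>2 / herm_det (\<omega> c x)))"
    using norm_pos[OF c] by (intro smooth_on_sqrt) (simp_all add: divide_inverse)
  then show "smooth_on (cimg c) (\<lambda>x. vol_norm \<Omega> \<omega> c x [])" by (simp add: vol_norm_def)
qed

lemma norm_smooth_form: "smooth_form A 0 (vol_norm \<Omega> \<omega>)"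
proof -
  have "smooth_on (cimg c) (\<lambda>x. vol_norm \<Omega> \<omega> c x vs)" if "c \<in> A" for c vs
    using smooth_parts(4)[OF that] smooth_on_const[of "cimg c" 0] by (cases "vs = []") (simp_all add: vol_norm_def)
  moreover have "alt_form 0 (vol_norm \<Omega> \<omega> c x)" for c x by (simp add: alt_form_def vol_norm_def)
  ultimately show ?thesis unfolding smooth_form_iff[OF sA] using norm_compat by blast
qed

end

section \<open>Second derivatives\<close>

lemma open_parallelogram:
  fixes x :: "'a::real_normed_vector"
  assumes "open U" "x \<in> U"
  shows "\<exists>e>0. \<forall>a b. 0 \<le> a \<longrightarrow> a \<le> e \<longrightarrow> 0 \<le> b \<longrightarrow> b \<le> e \<longrightarrow> x + a *\<^sub>R h + b *\<^sub>R k \<in> U"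
proof -
  obtain r where r: "r > 0" "ball x r \<subseteq> U" using assms open_contains_ball by blast
  let ?m = "norm h + norm k + 1"
  have m: "?m > 0" by (simp add: add_nonneg_pos)
  have "x + a *\<^sub>R h + b *\<^sub>R k \<in> U" if ab: "0 \<le> a" "a \<le> r / ?m" "0 \<le> b" "b \<le> r / ?m" for a b
  proof -
    have "norm (a *\<^sub>R h + b *\<^sub>R k) \<le> a * norm h + b * norm k"
      using norm_triangle_ineq[of "a *\<^sub>R h" "b *\<^sub>R k"] ab by simp
    also have "\<dots> \<le> r / ?m * norm h + r / ?m * norm k" using ab by (intro add_mono mult_right_mono) auto
    also have "\<dots> < r / ?m * ?m" using r(1) m by (simp add: distrib_left)
    also have "\<dots> = r" using m by simp
    finally have "dist x (x + (a *\<^sub>R h + b *\<^sub>R k)) < r" unfolding dist_norm by (subst norm_minus_commute) simp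
    then show ?thesis using r(2) by (auto simp: add.assoc)
  qed
  then show ?thesis using r(1) m by (intro exI[of _ "r / ?m"]) simp
qed

definition hess :: "('e::real_normed_vector \<Rightarrow> 'b::real_normed_vector) \<Rightarrow> 'e \<Rightarrow> 'e \<Rightarrow> 'e \<Rightarrow> 'b" where
  "hess g x u w = fd (\<lambda>y. fd g y w) x u"

lemma hess_facts:
  fixes g :: "'e::euclidean_space \<Rightarrow> 'b::euclidean_space"
  assumes U: "open U" "x \<in> U" and g: "smooth_on U g"
  shows "hess g x u w = hess g x w u"
    "((\<lambda>y. fd g y w) has_derivative (\<lambda>u. hess g x u w)) (at x)"
    "linear (\<lambda>u. hess g x u w)" "linear (hess g x u)"
proof -
  have d: "((\<lambda>y. fd g y w) has_derivative (\<lambda>u. hess g y u w)) (at y)" if "y \<in> U" for y w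
    unfolding hess_def by (rule smooth_on_frechet(1)[OF U(1) smooth_on_frechet(2)[OF U(1) g] that])
  show "((\<lambda>y. fd g y w) has_derivative (\<lambda>u. hess g x u w)) (at x)" by (rule d[OF U(2)])
  from has_derivative_linear[OF d[OF U(2)]] show l: "linear (\<lambda>u. hess g x u w)" for w .
  have s: "hess g x u w = hess g x w u" for u w
  proof -
    obtain e where e: "e > 0" "\<And>a b. 0 \<le> a \<Longrightarrow> a \<le> e \<Longrightarrow> 0 \<le> b \<Longrightarrow> b \<le> e \<Longrightarrow> x + a *\<^sub>R w + b *\<^sub>R u \<in> U"
      using open_parallelogram[OF U] by meson
    have "continuous_on U (\<lambda>y. hess g y k h)" for h k
      unfolding hess_def
      by (rule Ck_on_continuous[of 0, OF smooth_on_imp_Ck[OF smooth_on_frechet(2)[OF U(1) smooth_on_frechet(2)[OF U(1) g]]]])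
    from second_derivative_symmetric_euclidean[where f = g and f' = "\<lambda>z. fd g z" and f'' = "\<lambda>h z k. hess g z k h"
        and S = U and h = w and k = u, OF has_derivative_at_withinI[OF smooth_on_frechet(1)[OF U(1) g]] has_derivative_at_withinI[OF d] this e(2) e(1)]
    show ?thesis .
  qed
  then show "hess g x u w = hess g x w u" .
  show "linear (hess g x u)" using l[of u] unfolding s[of u, abs_def] by (simp add: s[of _ u])
qed

section \<open>The Ricci form\<close>

text \<open>In real terms the form is - (1/2) d (dg \<circ> J). The proof writes this expression as
  \<tau>, finds that the mixed Wirtinger derivatives are the entries of
  \<open>herm_matrix \<tau>\<close>, and lets the lemma \<open>herm_matrix\<close> reassemble the
  form.\<close>

lemma i_del_delbar_hess:
  fixes g :: "complex^'n \<Rightarrow> real"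
  assumes U: "open U" "x \<in> U" and g: "smooth_on U g"
  shows "i_del_delbar g x [u, v] = - (1 / 2) * (hess g x u (\<i> *s v) - hess g x v (\<i> *s u))"
    and "alt_form 2 (i_del_delbar g x)"
proof -
  let ?H = "hess g x"
  note h = hess_facts[OF U g]
  define \<tau> :: "(complex^'n) list \<Rightarrow> real" where "\<tau> vs = (if length vs = 2 then - (1 / 2) * (?H (vs ! 0) (\<i> *s (vs ! 1)) - ?H (\<i> *s (vs ! 0)) (vs ! 1)) else 0)" for vs
  have neg: "?H (- u) v = - ?H u v" "?H u (- v) = - ?H u v" for u v
    using linear_neg[OF h(3)] linear_neg[OF h(4)] by auto
  have \<tau>e: "\<tau> [u, v] = - (1 / 2) * (?H u (\<i> *s v) - ?H (\<i> *s u) v)" for u v by (simp add: \<tau>_def)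
  have lin: "linear (\<lambda>u. \<tau> [u, v])" "linear (\<lambda>v. \<tau> [u, v])" for u v
    unfolding \<tau>e
    by (intro linearI; simp add: ii_smult linear_add[OF h(3)] linear_add[OF h(4)] linear_cmul[OF h(3)] linear_cmul[OF h(4)]; simp add: field_simps)+
  have z: "\<tau> [u, u] = 0" for u using h(1)[of u "\<i> *s u"] by (simp add: \<tau>_def)
  have alt: "alt_form 2 \<tau>"
    unfolding alt_form_def
  proof (intro conjI allI impI)
    fix vs :: "(complex^'n) list" and i :: nat assume "length vs = 2 \<and> i < 2"
    then obtain a b where "vs = [a, b]" "i = 0 \<or> i = 1" using length_2D[of vs] less_2_cases[of i] by auto
    then show "linear (\<lambda>u. \<tau> (vs[i := u]))" using lin[of b] lin[of a] by auto
  next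
    fix vs :: "(complex^'n) list" and i j :: nat assume a: "length vs = 2 \<and> i < j \<and> j < 2 \<and> vs ! i = vs ! j"
    then obtain p q where pq: "vs = [p, q]" using length_2D[of vs] by auto
    have ij: "i = 0" "j = 1" using a by auto
    have "p = q" using a by (simp add: pq ij)
    then show "\<tau> vs = 0" using z by (simp add: pq)
  qed (simp add: \<tau>_def)
  have J: "\<tau> [\<i> *s u, \<i> *s v] = \<tau> [u, v]" for u v by (simp add: \<tau>_def ii_smult neg)
  let ?D = "\<lambda>y w. fd g y w"
  have b: "wirtinger_bar q (\<lambda>y. complex_of_real (g y)) y = (of_real (?D y (axis q 1)) + \<i> * of_real (?D y (axis q \<i>))) / 2" if "y \<in> U" for q y
  proof -
    have "((\<lambda>y. complex_of_real (g y)) has_derivative (\<lambda>w. of_real (?D y w))) (at y)"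
      by (rule bounded_linear.has_derivative[OF bounded_linear_of_real smooth_on_frechet(1)[OF U(1) g that]])
    from frechet_eq[OF this] show ?thesis by (simp add: wirtinger_bar_def)
  qed
  have ax: "\<i> *s axis p 1 = (axis p \<i> :: complex^'n)" "\<i> *s axis p \<i> = - (axis p 1 :: complex^'n)" for p
    by (auto simp: vec_eq_iff axis_def)
  have W: "wirtinger p (wirtinger_bar q (\<lambda>y. complex_of_real (g y))) x = herm_matrix \<tau> $ p $ q" for p q
  proof -
    have "((\<lambda>y. (of_real (?D y (axis q 1)) + \<i> * of_real (?D y (axis q \<i>))) / 2) has_derivative
        (\<lambda>u. (of_real (?H u (axis q 1)) + \<i> * of_real (?H u (axis q \<i>))) / 2)) (at x)"
      by (intro bounded_linear.has_derivative[OF bounded_linear_divide] has_derivative_add has_derivative_mult_right bounded_linear.has_derivative[OF bounded_linear_of_real] h(2))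
    from frechet_eq[OF this] frechet_derivative_cong_open[OF U b[of _ q]]
    have e: "fd (wirtinger_bar q (\<lambda>y. complex_of_real (g y))) x =
       (\<lambda>u. (of_real (?H u (axis q 1)) + \<i> * of_real (?H u (axis q \<i>))) / 2)" by simp
    show ?thesis unfolding wirtinger_def e
      by (simp add: herm_matrix_def \<tau>_def ax neg complex_eq_iff field_simps)
  qed
  have e: "i_del_delbar g x [u, v] = Re (of_real (\<tau> [u, v]))" for u v
    unfolding herm_matrix[OF alt J] i_del_delbar_def W by simp
  then show "i_del_delbar g x [u, v] = - (1 / 2) * (hess g x u (\<i> *s v) - hess g x v (\<i> *s u))"
    using h(1)[of "\<i> *s u" v] by (simp add: \<tau>_def)
  have "i_del_delbar g x vs = \<tau> vs" for vs
    using e length_2D[of vs] by (cases "length vs = 2") (auto simp: i_del_delbar_def \<tau>_def)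
  then have "i_del_delbar g x = \<tau>" by blast
  then show "alt_form 2 (i_del_delbar g x)" using alt by simp
qed

text \<open>The function log |f|^2 is pluriharmonic: its derivative is 2 Re (df / f), which
  precomposed with J is - 2 Im (df / f), and the derivative of df / f is symmetric because it is the
  second derivative of log f.\<close>

lemma hess_log_holomorphic:
  fixes f :: "complex^'n \<Rightarrow> complex"
  assumes U: "open U" "x \<in> U" and f: "smooth_on U f" and nz: "\<And>y. y \<in> U \<Longrightarrow> f y \<noteq> 0"
    and hol: "\<And>y u. y \<in> U \<Longrightarrow> fd f y (\<i> *s u) = \<i> * fd f y u"
  shows "hess (\<lambda>y. ln ((cmod (f y))\<^sup>2)) x u (\<i> *s v) = hess (\<lambda>y. ln ((cmod (f y))\<^sup>2)) x v (\<i> *s u)"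
proof -
  let ?D = "\<lambda>y w. fd f y w" and ?a = "\<lambda>y. ln ((cmod (f y))\<^sup>2)"
  note D = smooth_on_frechet(1)[OF U(1) f] and h = hess_facts[OF U f]
  have da: "fd ?a y w = 2 * Re (?D y w / f y)" if y: "y \<in> U" for y w
  proof -
    have e: "(cmod z)\<^sup>2 = Re z * Re z + Im z * Im z" for z by (simp add: cmod_power2 power2_eq_square[of "Re z"] power2_eq_square[of "Im z"])
    have p: "0 < Re (f y) * Re (f y) + Im (f y) * Im (f y)" using nz[OF y] unfolding e[symmetric] by simp
    have "((\<lambda>y. ln (Re (f y) * Re (f y) + Im (f y) * Im (f y))) has_derivative
      (\<lambda>w. (Re (f y) * Re (?D y w) + Re (?D y w) * Re (f y) + (Im (f y) * Im (?D y w) + Im (?D y w) * Im (f y))) *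
           inverse (Re (f y) * Re (f y) + Im (f y) * Im (f y)))) (at y)"
      by (rule derivative_eq_intros bounded_linear.has_derivative[OF bounded_linear_Re D[OF y]]
           bounded_linear.has_derivative[OF bounded_linear_Im D[OF y]] p refl | simp add: fun_eq_iff)+
    from frechet_eq[OF this] show ?thesis
      unfolding e by (simp add: Re_divide power2_eq_square divide_inverse distrib_right)
  qed
  have "hess ?a x u (\<i> *s v) = - 2 * Im ((hess f x u v * f x - ?D x v * ?D x u) / (f x * f x))" for u v
  proof -
    have i: "fd ?a y (\<i> *s v) = - 2 * Im (?D y v / f y)" if "y \<in> U" for y
      unfolding da[OF that] hol[OF that] by (simp flip: times_divide_eq_right)
    have "((\<lambda>y. - 2 * Im (?D y v / f y)) has_derivative
       (\<lambda>u. - 2 * Im ((hess f x u v * f x - ?D x v * ?D x u) / (f x * f x)))) (at x)"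
      by (intro has_derivative_mult_right bounded_linear.has_derivative[OF bounded_linear_Im] has_derivative_divide' h(2) D[OF U(2)] nz[OF U(2)])
    from frechet_eq[OF this] frechet_derivative_cong_open[OF U i] show ?thesis unfolding hess_def by simp
  qed
  then show ?thesis using h(1)[of u v] by (simp add: mult.commute)
qed

text \<open>The map sending v to the functional g v, read off on \<open>Basis\<close>, is injective
  by positivity, hence surjective. This supplies the existence needed by the description in
  \<open>sharp\<close>.\<close>

lemma sharp_inner:
  fixes g :: "'e::euclidean_space \<Rightarrow> 'e \<Rightarrow> real"
  assumes g: "inner_product g" and x: "linear \<xi>"
  shows "g (sharp g \<xi>) w = \<xi> w"
proof -
  have gl: "linear (g v)" "linear (\<lambda>u. g u v)" for v using g inner_product_linear_left[OF g, of v] by (simp_all add: inner_product_def)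
  let ?T = "\<lambda>v. \<Sum>b\<in>Basis. g v b *\<^sub>R b"
  have T: "linear ?T"
    by (intro linearI) (simp_all add: linear_add[OF gl(2)] linear_cmul[OF gl(2)] scaleR_left_distrib sum.distrib scaleR_sum_right)
  have ext: "g v = \<xi>'" if "linear \<xi>'" "\<And>b. b \<in> Basis \<Longrightarrow> g v b = \<xi>' b" for v \<xi>'
    using linear_eq_stdbasis[OF gl(1) that(1)] that(2) by blast
  have Tb: "?T v \<bullet> b = g v b" if "b \<in> Basis" for v b using that by (simp add: inner_sum_left inner_Basis if_distrib cong: if_cong)
  have inj: "u = v" if "g u = g v" for u v
  proof (rule ccontr)
    assume "u \<noteq> v"
    then have "g (u - v) (u - v) > 0" using g by (simp add: inner_product_def)
    moreover have "g (u - v) (u - v) = g u (u - v) - g v (u - v)" by (rule linear_diff[OF gl(2)])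
    ultimately show False using that by simp
  qed
  have "inj ?T"
  proof (rule injI)
    fix u v assume "?T u = ?T v"
    then have "g u b = g v b" if "b \<in> Basis" for b using Tb[OF that] by metis
    from ext[OF gl(1) this] show "u = v" by (rule inj)
  qed
  then have "surj ?T" using linear_injective_imp_surjective[OF T] by simp
  from surjD[OF this, of "\<Sum>b\<in>Basis. \<xi> b *\<^sub>R b"] obtain v where v: "(\<Sum>b\<in>Basis. \<xi> b *\<^sub>R b) = ?T v" by (elim exE)
  have "g v b = \<xi> b" if "b \<in> Basis" for b
    using Tb[OF that, of v] that unfolding v[symmetric] by (simp add: inner_sum_left inner_Basis if_distrib cong: if_cong)
  from ext[OF x this] have v: "g v = \<xi>" .
  have "sharp g \<xi> = v" unfolding sharp_def
  proof (rule the_equality)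
    show "v' = v" if "\<forall>w. g v' w = \<xi> w" for v' by (rule inj) (use that v in \<open>simp add: fun_eq_iff\<close>)
  qed (use v in simp)
  then show ?thesis using v by simp
qed

section \<open>Ricci form and gradient in terms of the norm of the volume form\<close>

context
  fixes A :: "('x::{t2_space, second_countable_topology}, complex^'n) chart set"
    and \<omega> :: "('x, complex^'n, real) form" and \<Omega> :: "('x, complex^'n, complex) form"
  assumes A: "complex_atlas A" and \<omega>: "kaehler_form A \<omega>" and \<Omega>: "holomorphic_volume_form A \<Omega>"
    and n: "CARD('n) = 2 \<or> CARD('n) = 3"
begin

abbreviation "lnN c \<equiv> \<lambda>y. ln (vol_norm \<Omega> \<omega> c y [])"

lemma lnN_smooth: "c \<in> A \<Longrightarrow> smooth_on (cimg c) (lnN c)"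
  using smooth_parts(4)[OF A \<omega> \<Omega> n] norm_pos(1)[OF A \<omega> \<Omega> n] by (intro smooth_on_ln)

lemma chart_open: "c \<in> A \<Longrightarrow> open (cimg c)"
  using atlas_chart(2)[OF sA[OF A \<omega> \<Omega> n]] .

text \<open>By the formula for the norm, log det h = log |f|^2 - 2 log |\<Omega>|, where the first
  term is pluriharmonic. So the Ricci form is 2 i del delbar log |\<Omega>|.\<close>

lemma ricci_form_hess:
  assumes c: "c \<in> A" "x \<in> cimg c"
  shows "ricci_form \<omega> c x [u, v] = - (hess (lnN c) x u (\<i> *s v) - hess (lnN c) x v (\<i> *s u))"
proof -
  note pos = norm_pos[OF A \<omega> \<Omega> n c(1)] and sp = smooth_parts[OF A \<omega> \<Omega> n c(1)] and o = chart_open[OF c(1)]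
  let ?f = "\<lambda>y. vol_coeff (\<Omega> c y)" and ?a = "\<lambda>y. ln ((cmod (vol_coeff (\<Omega> c y)))\<^sup>2)" and ?d = "\<lambda>y. ln (herm_det (\<omega> c y))"
  have hol: "fd ?f y (\<i> *s u) = \<i> * fd ?f y u" if "y \<in> cimg c" for y u
    using \<Omega> c(1) that unfolding holomorphic_volume_form_def vol_coeff_def by blast
  have sd: "smooth_on (cimg c) ?d" by (rule smooth_on_ln[OF sp(2) pos(2)])
  have sa: "smooth_on (cimg c) ?a" by (rule smooth_on_ln[OF sp(3)]) (use pos(3) in simp)
  have e: "?d y = ?a y - 2 * lnN c y" if y: "y \<in> cimg c" for y
  proof -
    have "lnN c y = ln ((cmod (?f y))\<^sup>2 / herm_det (\<omega> c y)) / 2"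
      unfolding vol_norm_def using pos[OF y] by (simp add: ln_sqrt)
    also have "\<dots> = (?a y - ?d y) / 2" using pos[OF y] by (subst ln_div) auto
    finally show ?thesis by simp
  qed
  have d1: "fd ?d y w = fd ?a y w - 2 * fd (lnN c) y w" if y: "y \<in> cimg c" for y w
  proof -
    have "((\<lambda>y. ?a y - 2 * lnN c y) has_derivative (\<lambda>w. fd ?a y w - 2 * fd (lnN c) y w)) (at y)"
      by (intro has_derivative_diff has_derivative_mult_right smooth_on_frechet(1)[OF o _ y] sa lnN_smooth c)
    from frechet_eq[OF this] frechet_derivative_cong_open[OF o y e] show ?thesis by simp
  qed
  have d2: "hess ?d x u w = hess ?a x u w - 2 * hess (lnN c) x u w" for u w
  proof -
    have "((\<lambda>y. fd ?a y w - 2 * fd (lnN c) y w) has_derivative (\<lambda>u. hess ?a x u w - 2 * hess (lnN c) x u w)) (at x)"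
      by (intro has_derivative_diff has_derivative_mult_right hess_facts(2)[OF o c(2)] sa lnN_smooth c)
    from frechet_eq[OF this] frechet_derivative_cong_open[OF o c(2) d1] show ?thesis unfolding hess_def by simp
  qed
  show ?thesis
    unfolding ricci_form_def i_del_delbar_hess(1)[OF o c(2) sd] d2
    using hess_log_holomorphic[OF o c(2) sp(1) pos(3) hol, of u v] by simp
qed

lemma alt_form_ricci_form:
  assumes c: "c \<in> A" "x \<in> cimg c"
  shows "alt_form 2 (ricci_form \<omega> c x)"
proof -
  have "smooth_on (cimg c) (\<lambda>y. ln (herm_det (\<omega> c y)))"
    by (rule smooth_on_ln[OF smooth_parts(2)[OF A \<omega> \<Omega> n c(1)] norm_pos(2)[OF A \<omega> \<Omega> n c(1)]])
  from alt_form_uminus[OF i_del_delbar_hess(2)[OF chart_open[OF c(1)] c(2) this]]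
  show ?thesis by (simp add: ricci_form_def[abs_def])
qed

text \<open>The gradient satisfies h(Y, .) = K d log |\<Omega>|, and \<omega>(Y, w) = - h(Y, J
  w).\<close>

lemma contraction_hess:
  assumes c: "c \<in> A" "x \<in> cimg c"
  shows "\<omega> c x [log_norm_gradient K \<Omega> \<omega> c x, w] = - K * fd (lnN c) x (\<i> *s w)"
proof -
  note k = kaehler_form_point[OF \<omega> c]
  let ?s = "sharp (kaehler_metric (\<omega> c x)) (fd (lnN c) x)"
  have "linear (fd (lnN c) x)"
    by (rule has_derivative_linear[OF smooth_on_frechet(1)[OF chart_open[OF c(1)] lnN_smooth[OF c(1)] c(2)]])
  from sharp_inner[OF kp_inner[OF k] this, of "\<i> *s w"]
  have "\<omega> c x [?s, w] = - fd (lnN c) x (\<i> *s w)"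
    by (simp add: kp_metric[OF k] ii_smult kp_neg[OF k])
  then show ?thesis unfolding log_norm_gradient_def by (simp add: linear_cmul[OF kp_lin(1)[OF k]])
qed

text \<open>The contraction is - K (d log |\<Omega>|) \<circ> J, and d of it is the antisymmetrised
  Hessian that \<open>ricci_form_hess\<close> found for the Ricci form. This is what ties the
  Kaehler-Ricci flow to the gradient field.\<close>

lemma ricci_form_contraction:
  assumes c: "c \<in> A" "x \<in> cimg c"
  shows "K * ricci_form \<omega> c x vs = ext_deriv 1 (\<lambda>p ws. \<omega> c p (log_norm_gradient K \<Omega> \<omega> c p # ws)) x vs"
proof (cases "length vs = 2")
  case True
  then obtain u v where uv: "vs = [u, v]" using length_2D by blast
  note o = chart_open[OF c(1)]
  have "fd (\<lambda>p. \<omega> c p [log_norm_gradient K \<Omega> \<omega> c p, w]) x u = - K * hess (lnN c) x u (\<i> *s w)" for u w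
  proof -
    have "((\<lambda>p. - K * fd (lnN c) p (\<i> *s w)) has_derivative (\<lambda>u. - K * hess (lnN c) x u (\<i> *s w))) (at x)"
      by (intro has_derivative_mult_right hess_facts(2)[OF o c(2)] lnN_smooth c)
    from frechet_eq[OF this] frechet_derivative_cong_open[OF o c(2) contraction_hess[OF c(1)]] show ?thesis by simp
  qed
  then show ?thesis unfolding uv ext_deriv_simps(1) ricci_form_hess[OF c] by (simp add: algebra_simps)
next
  case False
  then show ?thesis by (simp add: ext_deriv_length ricci_form_def i_del_delbar_def)
qed

lemma gradient_grad_log:
  assumes c: "c \<in> A" "x \<in> cimg c"
    and es: "\<And>\<xi>. linear \<xi> \<Longrightarrow> K *\<^sub>R sharp (kaehler_metric (\<omega> c x)) \<xi> = (\<Sum>i<length es. \<xi> (es ! i) *\<^sub>R es ! i)"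
  shows "log_norm_gradient K \<Omega> \<omega> c x = grad_log (\<lambda>y. vol_norm \<Omega> \<omega> c y []) x es"
proof -
  note o = chart_open[OF c(1)]
  let ?N = "\<lambda>y. vol_norm \<Omega> \<omega> c y []"
  have "(lnN c has_derivative (\<lambda>w. fd ?N x w * inverse (?N x))) (at x)"
    by (rule has_derivative_ln[OF norm_pos(1)[OF A \<omega> \<Omega> n c] smooth_on_frechet(1)[OF o smooth_parts(4)[OF A \<omega> \<Omega> n c(1)] c(2)]])
  note e = frechet_eq[OF this]
  have "linear (fd (lnN c) x)"
    by (rule has_derivative_linear[OF smooth_on_frechet(1)[OF o lnN_smooth[OF c(1)] c(2)]])
  from es[OF this] show ?thesis unfolding log_norm_gradient_def grad_log_def e by (simp add: divide_inverse)
qed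

lemma contraction_smooth:
  assumes c: "c \<in> A"
  shows "smooth_on (cimg c) (\<lambda>y. \<omega> c y [log_norm_gradient K \<Omega> \<omega> c y, w])"
  by (rule smooth_on_cong[OF contraction_hess[OF c, symmetric]], assumption)
     (intro smooth_on_mult smooth_on_const smooth_on_frechet(2)[OF chart_open[OF c] lnN_smooth[OF c]])

end

section \<open>Forms moved by a flow\<close>

text \<open>At time 0 a parallelogram stays in \<open>S\<close> only if both directions have
  nonnegative time component, so symmetry is first obtained for those and then extended to all pairs
  by oddness. The flow uses only the directions (1, 0) and (0, v), for which \<open>D2\<close> is
  the derivative.\<close>

lemma smooth_half_space_derivatives:
  fixes \<theta> :: "real \<times> 'a::real_normed_vector \<Rightarrow> 'e::euclidean_space"
  assumes T: "open T" and S: "S = {z \<in> T. 0 \<le> fst z}" and \<theta>: "smooth_on S \<theta>"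
  shows "\<exists>\<theta>' D2. (\<forall>z\<in>S. (\<theta> has_derivative \<theta>' z) (at z within S)) \<and>
     (\<forall>z\<in>S. \<forall>h. 0 \<le> fst h \<longrightarrow> ((\<lambda>z. \<theta>' z h) has_derivative D2 z h) (at z within S)) \<and> (\<forall>z\<in>S. \<forall>h k. D2 z h k = D2 z k h)"
proof -
  have "Ck_on (Suc (Suc 0)) S \<theta>" by (rule smooth_on_imp_Ck[OF \<theta>])
  then obtain \<theta>' where d: "\<And>z. z \<in> S \<Longrightarrow> (\<theta> has_derivative \<theta>' z) (at z within S)" and c: "\<And>v. Ck_on (Suc 0) S (\<lambda>z. \<theta>' z v)"
    by (elim Ck_on_SucE) blast
  have "\<forall>v. \<exists>f. (\<forall>z\<in>S. ((\<lambda>z. \<theta>' z v) has_derivative f z) (at z within S)) \<and> (\<forall>w. continuous_on S (\<lambda>z. f z w))"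
    using c by simp
  then obtain F where F: "\<And>v z. z \<in> S \<Longrightarrow> ((\<lambda>z. \<theta>' z v) has_derivative F v z) (at z within S)" "\<And>v w. continuous_on S (\<lambda>z. F v z w)"
    by metis
  have lin: "linear (F v z)" if "z \<in> S" for v z by (rule has_derivative_linear[OF F(1)[OF that]])
  have sym: "F h z k = F k z h" if z: "z \<in> S" and hk: "0 \<le> fst h" "0 \<le> fst k" for z h k
  proof -
    have "z \<in> T" using z S by simp
    then obtain e where e: "e > 0" "\<And>a b. 0 \<le> a \<Longrightarrow> a \<le> e \<Longrightarrow> 0 \<le> b \<Longrightarrow> b \<le> e \<Longrightarrow> z + a *\<^sub>R h + b *\<^sub>R k \<in> T"
      using open_parallelogram[OF T] by meson
    have "z + a *\<^sub>R h + b *\<^sub>R k \<in> S" if "0 \<le> a" "a \<le> e" "0 \<le> b" "b \<le> e" for a b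
      using e(2)[OF that] z hk that by (simp add: S)
    from second_derivative_symmetric_euclidean[where f = \<theta> and f' = \<theta>' and f'' = F and S = S, OF d F(1) F(2) this e(1)]
    show ?thesis .
  qed
  \<comment> \<open>A direction pointing back in time is represented by minus the derivative for its
    opposite, whose symmetry is already known.\<close>
  define D2 where "D2 z h = (if 0 \<le> fst h then F h z else (\<lambda>k. - F (- h) z k))" for z h
  have "D2 z h k = D2 z k h" if z: "z \<in> S" for z h k
  proof -
    have n: "F a z (- b) = - F a z b" for a b by (rule linear_neg[OF lin[OF z]])
    have r: "F h z k = - F (- k) z h" if "0 \<le> fst h" "\<not> 0 \<le> fst k" for h k
    proof -
      have "- F h z k = F (- k) z h" using sym[OF z, of h "- k"] that n[of h k] by simp
      from arg_cong[OF this, of uminus] show ?thesis by (simp only: minus_minus)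
    qed
    show ?thesis using sym[OF z, of h k] sym[OF z, of "- h" "- k"] r[of h k] r[of k h] by (simp add: D2_def n)
  qed
  moreover have "((\<lambda>z. \<theta>' z h) has_derivative D2 z h) (at z within S)" if "z \<in> S" "0 \<le> fst h" for z h
    using F(1)[OF that(1), of h] that(2) by (simp add: D2_def)
  ultimately show ?thesis using d by (intro exI[of _ \<theta>'] exI[of _ D2]) blast
qed

text \<open>Needed for uniqueness of one-sided derivatives, including those at time 0.\<close>

lemma half_line_nontrivial:
  assumes "0 \<le> (t :: real)"
  shows "at t within {0..} \<noteq> bot"
proof -
  have "at_right t \<le> at t within {0..}" using assms by (intro at_le) auto
  then show ?thesis using trivial_limit_at_right_real[of t] le_bot[of "at_right t"] by auto
qed

text \<open>A chart expression \<theta> of a flow on space-time, on the part \<open>S\<close> of an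
  open set where time is nonnegative. \<open>pl\<close> is a component of the space-time pullback
  and \<open>pd\<close> its derivative.\<close>

locale flow_chart =
  fixes T S :: "(real \<times> 'e::euclidean_space) set" and V :: "'e set" and \<theta> :: "real \<times> 'e \<Rightarrow> 'e"
    and \<theta>' :: "real \<times> 'e \<Rightarrow> real \<times> 'e \<Rightarrow> 'e" and D2 :: "real \<times> 'e \<Rightarrow> real \<times> 'e \<Rightarrow> real \<times> 'e \<Rightarrow> 'e"
  assumes T: "open T" and S: "S = {z \<in> T. 0 \<le> fst z}" and V: "open V" "\<And>z. z \<in> S \<Longrightarrow> \<theta> z \<in> V"
    and der: "\<And>z. z \<in> S \<Longrightarrow> (\<theta> has_derivative \<theta>' z) (at z within S)"
    and der2: "\<And>z h. z \<in> S \<Longrightarrow> 0 \<le> fst h \<Longrightarrow> ((\<lambda>z. \<theta>' z h) has_derivative D2 z h) (at z within S)"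
    and sym: "\<And>z h k. z \<in> S \<Longrightarrow> D2 z h k = D2 z k h"
begin

abbreviation (input) "pl \<alpha> z hs \<equiv> \<alpha> (\<theta> z) (map (\<theta>' z) hs)"
abbreviation (input) "pd \<alpha> z hs \<equiv> pull_deriv \<alpha> (\<theta> z) (\<theta>' z) (D2 z) hs"

lemma open_slices: "open {y. (t, y) \<in> T}" "open {s. (s, x) \<in> T}"
  using open_vimage[OF T continuous_on_Pair[OF continuous_on_const continuous_on_id], of t]
    open_vimage[OF T continuous_on_Pair[OF continuous_on_id continuous_on_const], of x]
  by (simp_all add: vimage_def)

lemma slice_open: "0 \<le> t \<Longrightarrow> open {y. (t, y) \<in> S}"
  using open_slices(1)[of t] by (simp add: S)

lemma slice_space:
  assumes z: "(t, x) \<in> S" and f: "(f has_derivative f') (at (t, x) within S)"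
  shows "((\<lambda>y. f (t, y)) has_derivative (\<lambda>v. f' (0, v))) (at x)"
proof -
  let ?W = "{y. (t, y) \<in> S}"
  have W: "open ?W" "x \<in> ?W" using z slice_open[of t] by (auto simp: S)
  have "(Pair t has_derivative (\<lambda>v. (0, v))) (at x within ?W)"
    by (rule has_derivative_Pair[OF has_derivative_const has_derivative_ident])
  moreover have "(f has_derivative f') (at (t, x) within (Pair t ` ?W))" by (rule has_derivative_subset[OF f]) auto
  ultimately have "((\<lambda>y. f (t, y)) has_derivative (\<lambda>v. f' (0, v))) (at x within ?W)" by (rule has_derivative_in_compose)
  then show ?thesis using at_within_open[OF W(2,1)] by simp
qed

text \<open>Since \<open>T\<close> is open, the times allowed at \<open>x\<close> fill a
  neighbourhood of \<open>t\<close> in the half-line.\<close>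

lemma within_half_line:
  assumes z: "(t, x) \<in> S"
  shows "at t within {s. (s, x) \<in> S} = at t within {0..}"
  by (rule at_within_nhd[OF _ open_slices(2)[of x], of t]) (use z in \<open>auto simp: S\<close>)

lemma slice_time:
  assumes z: "(t, x) \<in> S" and f: "(f has_derivative f') (at (t, x) within S)"
  shows "((\<lambda>s. f (s, x)) has_vector_derivative f' (1, 0)) (at t within {0..})"
proof -
  let ?W = "{s. (s, x) \<in> S}"
  have "((\<lambda>s. (s, x)) has_derivative (\<lambda>r. (r, 0))) (at t within ?W)"
    by (rule has_derivative_Pair[OF has_derivative_ident has_derivative_const])
  moreover have "(f has_derivative f') (at (t, x) within ((\<lambda>s. (s, x)) ` ?W))" by (rule has_derivative_subset[OF f]) auto
  ultimately have "((\<lambda>s. f (s, x)) has_derivative (\<lambda>r. f' (r, 0))) (at t within ?W)" by (rule has_derivative_in_compose)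
  moreover have "(\<lambda>r. f' (r, 0)) = (\<lambda>r. r *\<^sub>R f' (1, 0))"
  proof
    fix r
    have "f' (r *\<^sub>R (1, 0)) = r *\<^sub>R f' (1, 0)" by (rule linear_cmul[OF has_derivative_linear[OF f]])
    then show "f' (r, 0) = r *\<^sub>R f' (1, 0)" by (simp only: scaleR_Pair scaleR_zero_right real_scaleR_def mult_1_right)
  qed
  ultimately show ?thesis unfolding has_vector_derivative_def within_half_line[OF z] by (simp only:)
qed

lemma pull_derivative:
  assumes z: "z \<in> S" and a: "\<And>p. p \<in> V \<Longrightarrow> alt_form (length hs) (\<alpha> p)" and d: "\<And>vs. (\<lambda>p. \<alpha> p vs) differentiable (at (\<theta> z))"
    and h: "\<And>h. h \<in> set hs \<Longrightarrow> 0 \<le> fst h"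
  shows "((\<lambda>z. pl \<alpha> z hs) has_derivative pd \<alpha> z hs) (at z within S)"
  using has_derivative_pull[where \<alpha> = \<alpha> and \<theta> = \<theta> and \<theta>' = \<theta>' and ?z0.0 = z and hs = hs and S = S and V = V, OF z V der[OF z] der2[OF z h] a d]
  by blast

lemma pull_space:
  assumes z: "(t, x) \<in> S" and a: "\<And>p. p \<in> V \<Longrightarrow> alt_form (length hs) (\<alpha> p)" and d: "\<And>vs. (\<lambda>p. \<alpha> p vs) differentiable (at (\<theta> (t, x)))"
    and h: "\<And>h. h \<in> set hs \<Longrightarrow> 0 \<le> fst h"
  shows "fd (\<lambda>y. pl \<alpha> (t, y) hs) x v = pd \<alpha> (t, x) hs (0, v)"
    and "(\<lambda>y. pl \<alpha> (t, y) hs) differentiable at x"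
  using slice_space[OF z pull_derivative[where \<alpha> = \<alpha>, OF z a d h]] frechet_eq[OF slice_space[OF z pull_derivative[where \<alpha> = \<alpha>, OF z a d h]]]
  by (auto simp: differentiable_def)

lemma pull_differentiable:
  fixes \<alpha> :: "'e \<Rightarrow> 'e list \<Rightarrow> real"
  assumes z: "(t, x) \<in> S" and a: "\<And>p. p \<in> V \<Longrightarrow> alt_form k (\<alpha> p)" and d: "\<And>vs. (\<lambda>p. \<alpha> p vs) differentiable (at (\<theta> (t, x)))"
    and h: "\<And>h. h \<in> set hs \<Longrightarrow> 0 \<le> fst h"
  shows "(\<lambda>y. pl \<alpha> (t, y) hs) differentiable at x"
proof (cases "length hs = k")
  case True
  show ?thesis by (rule pull_space(2)[where \<alpha> = \<alpha>, OF z]) (use True a d h in auto)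
next
  case False
  have W: "open {y. (t, y) \<in> S}" "x \<in> {y. (t, y) \<in> S}" using z slice_open[of t] by (auto simp: S)
  have "((\<lambda>y. pl \<alpha> (t, y) hs) has_derivative (\<lambda>_. 0)) (at x)"
    by (rule has_derivative_transform_within_open[OF has_derivative_const[of 0] W])
       (use False alt_form_length[OF a] V(2) in auto)
  then show ?thesis by (auto simp: differentiable_def)
qed

lemma cartan:
  assumes z: "(t, x) \<in> S" and k: "k = 2 \<or> k = 3" and a: "\<And>p. p \<in> V \<Longrightarrow> alt_form k (\<alpha> p)" and d: "\<And>vs. (\<lambda>p. \<alpha> p vs) differentiable (at (\<theta> (t, x)))"
    and c: "\<And>vs. ext_deriv k \<alpha> (\<theta> (t, x)) vs = 0" and l: "length vs = k"
  shows "pd \<alpha> (t, x) (map (Pair 0) vs) (1, 0) =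
    ext_deriv (k - 1) (\<lambda>y ws. pl \<alpha> (t, y) ((1, 0) # map (Pair 0) ws)) x vs"
proof -
  note ps = pull_space(1)[where \<alpha> = \<alpha>, OF z _ d]
  note pe = pull_deriv_ext_deriv[where ?D2.0 = "D2 (t, x)" and \<alpha> = \<alpha> and p = "\<theta> (t, x)" and L = "\<theta>' (t, x)", OF sym[OF z]]
  have at: "alt_form k (\<alpha> (\<theta> (t, x)))" by (rule a[OF V(2)[OF z]])
  have f: "fd (\<lambda>y. \<alpha> (\<theta> (t, y)) (map (\<theta>' (t, y)) ws)) x v =
       pd \<alpha> (t, x) ws (0, v)" if "length ws = k" "\<forall>h\<in>set ws. 0 \<le> fst h" for ws v
    by (rule ps) (use that a in auto)
  from k show ?thesis
  proof
    assume k: "k = 2"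
    then obtain u v where uv: "vs = [u, v]" using length_2D l by blast
    have f: "fd (\<lambda>y. \<alpha> (\<theta> (t, y)) [\<theta>' (t, y) (1, 0), \<theta>' (t, y) (0, b)]) x w =
       pd \<alpha> (t, x) [(1, 0), (0, b)] (0, w)" for b w
      using f[of "[(1, 0), (0, b)]" w] k by simp
    \<comment> \<open>The vector (1, 0) is the first argument \<open>a\<close> of the identity for d
      of the pullback, which vanishes as \<alpha> is closed. The term differentiated in time stands
      alone; the others form the spatial d of the contraction with (1, 0).\<close>
    show ?thesis using trans[OF pe(2)[of "(0, u)" "(0, v)" "(1, 0)", OF at[unfolded k]] c[unfolded k]]
      by (simp add: k uv ext_deriv_simps(1)[unfolded One_nat_def] f)
  next
    assume k: "k = 3"
    then obtain u v w where uv: "vs = [u, v, w]" using length_3D l by blast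
    have f: "fd (\<lambda>y. \<alpha> (\<theta> (t, y)) [\<theta>' (t, y) (1, 0), \<theta>' (t, y) (0, b), \<theta>' (t, y) (0, b')]) x w =
       pd \<alpha> (t, x) [(1, 0), (0, b), (0, b')] (0, w)" for b b' w
      using f[of "[(1, 0), (0, b), (0, b')]" w] k by simp
    show ?thesis using trans[OF pe(3)[of "(0, u)" "(0, v)" "(0, w)" "(1, 0)", OF at[unfolded k]] c[unfolded k]]
      by (simp add: k uv ext_deriv_simps f)
  qed
qed

lemma ext_deriv_pull:
  assumes z: "(t, x) \<in> S" and k: "k \<in> {1, 2, 3}" and a: "\<And>p. p \<in> V \<Longrightarrow> alt_form k (\<alpha> p)" and d: "\<And>vs. (\<lambda>p. \<alpha> p vs) differentiable (at (\<theta> (t, x)))"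
  shows "ext_deriv k (\<lambda>y ws. pl \<alpha> (t, y) (map (Pair 0) ws)) x vs =
    ext_deriv k \<alpha> (\<theta> (t, x)) (map (\<theta>' (t, x)) (map (Pair 0) vs))"
proof (cases "length vs = Suc k")
  case True
  note ps = pull_space(1)[where \<alpha> = \<alpha>, OF z _ d]
  note pe = pull_deriv_ext_deriv[where ?D2.0 = "D2 (t, x)" and \<alpha> = \<alpha> and p = "\<theta> (t, x)" and L = "\<theta>' (t, x)", OF sym[OF z]]
  have at: "alt_form k (\<alpha> (\<theta> (t, x)))" by (rule a[OF V(2)[OF z]])
  have f: "fd (\<lambda>y. pl \<alpha> (t, y) (map (Pair 0) ws)) x v =
       pd \<alpha> (t, x) (map (Pair 0) ws) (0, v)" if "length ws = k" for ws v
    by (rule ps) (use that a in auto)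
  from k consider "k = 1" | "k = 2" | "k = 3" by blast
  then show ?thesis
  proof cases
    case 1
    then obtain u v where uv: "vs = [u, v]" using length_2D[of vs] True by (auto simp: numeral_2_eq_2)
    show ?thesis using pe(1)[of "(0, v)" "(0, u)"] at f[of "[_]"] 1
      by (simp add: uv ext_deriv_simps(1)[unfolded One_nat_def])
  next
    case 2
    then obtain u v w where uv: "vs = [u, v, w]" using length_3D[of vs] True by auto
    show ?thesis using pe(2)[of "(0, v)" "(0, w)" "(0, u)"] at f[of "[_, _]"] 2
      by (simp add: uv ext_deriv_simps)
  next
    case 3
    then obtain u v w q where uv: "vs = [u, v, w, q]" using length_4D[of vs] True by auto
    show ?thesis using pe(3)[of "(0, v)" "(0, w)" "(0, q)" "(0, u)"] at f[of "[_, _, _]"] 3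
      by (simp add: uv ext_deriv_simps)
  qed
qed (simp add: ext_deriv_length)

text \<open>The chain rule along s \<mapsto> (s, \<theta>(s, x)) for a form that also depends on
  time: its own change \<open>wd\<close>, plus the change \<open>pd\<close> of the pullback of the
  form frozen at time \<open>t\<close>.\<close>

lemma moving_form:
  assumes z: "(t, x) \<in> S" and a: "\<And>s p. 0 \<le> s \<Longrightarrow> p \<in> V \<Longrightarrow> alt_form (length hs) (w s p)"
    and joint: "\<And>vs. ((\<lambda>(s, p). w s p vs) has_derivative G vs) (at (t, \<theta> (t, x)) within {0..} \<times> V)"
    and wd: "\<And>vs. ((\<lambda>s. w s (\<theta> (t, x)) vs) has_real_derivative wd vs) (at t within {0..})"
    and ad: "alt_form (length hs) wd" and h: "\<And>h. h \<in> set hs \<Longrightarrow> 0 \<le> fst h"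
  shows "((\<lambda>s. pl (w s) (s, x) hs) has_real_derivative
     wd (map (\<theta>' (t, x)) hs) + pd (w t) (t, x) hs (1, 0)) (at t within {0..})"
proof -
  let ?p = "\<theta> (t, x)" and ?Z = "\<theta>' (t, x) (1, 0)" and ?Q = "{s. (s, x) \<in> S}"
  have t0: "0 \<le> t" using z S by simp
  have pV: "?p \<in> V" by (rule V(2)[OF z])
  have Gs: "((\<lambda>p. w t p vs) has_derivative (\<lambda>v. G vs (0, v))) (at ?p)" for vs
  proof -
    have "(Pair t has_derivative (\<lambda>v. (0, v))) (at ?p within V)"
      by (rule has_derivative_Pair[OF has_derivative_const has_derivative_ident])
    moreover have "((\<lambda>(s, p). w s p vs) has_derivative G vs) (at (t, ?p) within (Pair t ` V))"
      by (rule has_derivative_subset[OF joint]) (use t0 in auto)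
    ultimately have "((\<lambda>p. (\<lambda>(s, p). w s p vs) (t, p)) has_derivative (\<lambda>v. G vs (0, v))) (at ?p within V)" by (rule has_derivative_in_compose)
    then show ?thesis using at_within_open[OF pV V(1)] by simp
  qed
  \<comment> \<open>The time component of the joint derivative is the given partial derivative
    \<open>wd\<close>, by uniqueness of derivatives on the half-line.\<close>
  have Gt: "G vs (1, 0) = wd vs" for vs
  proof -
    have "((\<lambda>s. (s, ?p)) has_derivative (\<lambda>r. (r, 0))) (at t within {0..})"
      by (rule has_derivative_Pair[OF has_derivative_ident has_derivative_const])
    moreover have "((\<lambda>(s, p). w s p vs) has_derivative G vs) (at (t, ?p) within ((\<lambda>s. (s, ?p)) ` {0..}))"
      by (rule has_derivative_subset[OF joint]) (use pV in auto)
    ultimately have "((\<lambda>s. (\<lambda>(s, p). w s p vs) (s, ?p)) has_derivative (\<lambda>r. G vs (r, 0))) (at t within {0..})" by (rule has_derivative_in_compose)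
    moreover have "(\<lambda>r. G vs (r, 0)) = (\<lambda>r. r *\<^sub>R G vs (1, 0))"
    proof
      fix r
      have "G vs (r *\<^sub>R (1, 0)) = r *\<^sub>R G vs (1, 0)" by (rule linear_cmul[OF has_derivative_linear[OF joint]])
      then show "G vs (r, 0) = r *\<^sub>R G vs (1, 0)" by (simp only: scaleR_Pair scaleR_zero_right real_scaleR_def mult_1_right)
    qed
    ultimately have "((\<lambda>s. w s ?p vs) has_vector_derivative G vs (1, 0)) (at t within {0..})"
      unfolding has_vector_derivative_def by (simp only: prod.case)
    moreover have "((\<lambda>s. w s ?p vs) has_vector_derivative wd vs) (at t within {0..})"
      using wd by (simp add: has_real_derivative_iff_has_vector_derivative)
    moreover note half_line_nontrivial[OF t0]
    ultimately show ?thesis using vector_derivative_unique_within by blast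
  qed
  define m' where "m' vs r = r * (wd vs + fd (\<lambda>p. w t p vs) ?p ?Z)" for vs r
  have m: "((\<lambda>s. w s (\<theta> (s, x)) vs) has_derivative m' vs) (at t within ?Q)" for vs
  proof -
    have "((\<lambda>s. \<theta> (s, x)) has_derivative (\<lambda>r. r *\<^sub>R ?Z)) (at t within ?Q)"
      using slice_time[OF z der[OF z]] unfolding has_vector_derivative_def within_half_line[OF z] .
    then have "((\<lambda>s. (s, \<theta> (s, x))) has_derivative (\<lambda>r. (r, r *\<^sub>R ?Z))) (at t within ?Q)"
      by (rule has_derivative_Pair[OF has_derivative_ident])
    moreover have "((\<lambda>(s, p). w s p vs) has_derivative G vs) (at (t, ?p) within ((\<lambda>s. (s, \<theta> (s, x))) ` ?Q))"
      by (rule has_derivative_subset[OF joint]) (use V(2) in \<open>auto simp: S\<close>)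
    ultimately have "((\<lambda>s. (\<lambda>(s, p). w s p vs) (s, \<theta> (s, x))) has_derivative (\<lambda>r. G vs (r, r *\<^sub>R ?Z))) (at t within ?Q)"
      by (rule has_derivative_in_compose)
    moreover have "G vs (r, r *\<^sub>R ?Z) = m' vs r" for r
    proof -
      have "G vs (r *\<^sub>R ((1, 0) + (0, ?Z))) = r *\<^sub>R (G vs (1, 0) + G vs (0, ?Z))"
        unfolding linear_cmul[OF has_derivative_linear[OF joint]] linear_add[OF has_derivative_linear[OF joint]] ..
      then show ?thesis by (simp add: m'_def Gt frechet_eq[OF Gs])
    qed
    ultimately show ?thesis by simp
  qed
  have dw: "(\<lambda>p. w t p vs) differentiable (at ?p)" for vs using Gs unfolding differentiable_def by blast
  have "((\<lambda>s. w s (\<theta> (s, x)) (map (\<lambda>h. \<theta>' (s, x) h) hs)) has_derivative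
     (\<lambda>r. m' (map (\<lambda>h. \<theta>' (t, x) h) hs) r + (\<Sum>i<length hs. w t ?p ((map (\<lambda>h. \<theta>' (t, x) h) hs)[i := r *\<^sub>R D2 (t, x) (hs ! i) (1, 0)])))) (at t within ?Q)"
  proof (rule has_derivative_alt_form_apply[where m = "\<lambda>s. w s (\<theta> (s, x))" and W = "\<lambda>h s. \<theta>' (s, x) h"
        and W' = "\<lambda>h r. r *\<^sub>R D2 (t, x) h (1, 0)" and m' = m'])
    show "t \<in> ?Q" using z by simp
    show "alt_form (length hs) (w s (\<theta> (s, x)))" if "s \<in> ?Q" for s using that V(2) by (intro a) (auto simp: S)
    show "((\<lambda>s. \<theta>' (s, x) h) has_derivative (\<lambda>r. r *\<^sub>R D2 (t, x) h (1, 0))) (at t within ?Q)" if "h \<in> set hs" for h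
      using slice_time[OF z der2[OF z]] h that unfolding has_vector_derivative_def within_half_line[OF z] by blast
    show "alt_form (length hs) (\<lambda>vs. m' vs r)" for r
      unfolding m'_def by (intro alt_form_mult alt_form_add ad alt_form_frechet[OF V(1) pV a[OF t0] dw])
  qed (rule m)
  moreover define D where "D = (\<lambda>r. m' (map (\<lambda>h. \<theta>' (t, x) h) hs) r + (\<Sum>i<length hs. w t ?p ((map (\<lambda>h. \<theta>' (t, x) h) hs)[i := r *\<^sub>R D2 (t, x) (hs ! i) (1, 0)])))"
  ultimately have d: "((\<lambda>s. pl (w s) (s, x) hs) has_derivative D) (at t within {0..})"
    unfolding within_half_line[OF z] by simp
  have "D r = D 1 * r" for r using linear_cmul[OF has_derivative_linear[OF d], of r 1] by simp
  then have "D = (*) (D 1)" by blast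
  moreover have "D 1 = wd (map (\<theta>' (t, x)) hs) + pd (w t) (t, x) hs (1, 0)"
    by (simp add: D_def m'_def pull_deriv_def)
  ultimately show ?thesis using d unfolding has_field_derivative_def by metis
qed

end

section \<open>Holomorphic volume forms are closed\<close>

text \<open>In coordinates the form is f dz1 \<and> ... \<and> dzn with f holomorphic, so df is a
  combination of dz1, ..., dzn and df \<and> dz1 \<and> ... \<and> dzn vanishes. Here this is an
  identity between minors of n + 1 vectors. \<open>L\<close> will be the real or the imaginary
  part.\<close>

lemma volume_form_closed:
  fixes A :: "('x::{t2_space, second_countable_topology}, complex^'n) chart set" and \<Omega> :: "('x, complex^'n, complex) form"
  assumes A: "smooth_atlas A" and \<Omega>: "holomorphic_volume_form A \<Omega>" and n: "CARD('n) = 2 \<or> CARD('n) = 3"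
    and c: "c \<in> A" "x \<in> cimg c" and L: "bounded_linear (L :: complex \<Rightarrow> real)"
  shows "ext_deriv CARD('n) (\<lambda>y vs. L (\<Omega> c y vs)) x vs = 0"
proof (cases "length vs = Suc CARD('n)")
  case True
  have o: "open (cimg c)" by (rule atlas_chart(2)[OF A c(1)])
  have sm: "smooth_on (cimg c) (\<lambda>y. \<Omega> c y us)" for us using \<Omega> c(1) unfolding holomorphic_volume_form_def smooth_form_def by auto
  have n0: "n0_point (\<Omega> c y)" if "y \<in> cimg c" for y by (rule volume_form_point[OF \<Omega> c(1) that])
  have D: "fd (\<lambda>y. L (\<Omega> c y us)) x w = L (d * fd (\<lambda>y. \<Omega> c y es) x w)"
    if "\<And>y. y \<in> cimg c \<Longrightarrow> \<Omega> c y us = d * \<Omega> c y es" for us es d w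
  proof -
    have "((\<lambda>y. L (d * \<Omega> c y es)) has_derivative (\<lambda>w. L (d * fd (\<lambda>y. \<Omega> c y es) x w))) (at x)"
      by (intro bounded_linear.has_derivative[OF L] has_derivative_mult_right smooth_on_frechet(1)[OF o sm c(2)])
    from frechet_eq[OF this] frechet_derivative_cong_open[OF o c(2), of "\<lambda>y. L (\<Omega> c y us)" "\<lambda>y. L (d * \<Omega> c y es)"] that
    show ?thesis by simp
  qed
  have hol: "fd (\<lambda>y. \<Omega> c y es) x (z *s u) = z * fd (\<lambda>y. \<Omega> c y es) x u" for es z u
  proof -
    note l = has_derivative_linear[OF smooth_on_frechet(1)[OF o sm c(2)]]
    have "fd (\<lambda>y. \<Omega> c y es) x (\<i> *s u) = \<i> * fd (\<lambda>y. \<Omega> c y es) x u"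
      using \<Omega> c unfolding holomorphic_volume_form_def by blast
    then show ?thesis unfolding smult_complex[of z u] linear_add[OF l] linear_cmul[OF l]
      by (simp add: complex_eq_iff algebra_simps)
  qed
  obtain ps where ps: "distinct ps" "set ps = (UNIV :: 'n set)" using finite_distinct_list[OF finite] by metis
  have lps: "length ps = CARD('n)" using distinct_card[OF ps(1)] ps(2) by simp
  from n show ?thesis
  proof
    assume n: "CARD('n) = 2"
    then obtain a b where ab: "ps = [a, b]" using length_2D[of ps] lps by auto
    have ab: "distinct [a, b]" "UNIV = {a, b}" using ps unfolding ab by auto
    obtain u v w where vs: "vs = [u, v, w]" using length_3D[of vs] True n by auto
    let ?f = "fd (\<lambda>y. \<Omega> c y [axis a 1, axis b 1]) x"
    have f: "?f u = u $ a * ?f (axis a 1) + u $ b * ?f (axis b 1)" for u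
    proof -
      have S: "(\<Sum>p\<in>UNIV. f p) = f a + f b" for f :: "'n \<Rightarrow> complex^'n" by (subst ab(2)) (use ab(1) in simp)
      have "u = u $ a *s axis a 1 + u $ b *s axis b 1" by (rule vec_expand[of u, unfolded S])
      then have "?f u = ?f (u $ a *s axis a 1 + u $ b *s axis b 1)" by simp
      then show ?thesis unfolding linear_add[OF has_derivative_linear[OF smooth_on_frechet(1)[OF o sm c(2)]]] hol .
    qed
    have D: "fd (\<lambda>y. L (\<Omega> c y [p, p'])) x w = L ((p $ a * p' $ b - p $ b * p' $ a) * ?f w)" for p p' w
      by (rule D) (rule n0_point_expand2[OF n0 n ab])
    have "ext_deriv 2 (\<lambda>y vs. L (\<Omega> c y vs)) x vs = L ((v $ a * w $ b - v $ b * w $ a) * ?f u - (u $ a * w $ b - u $ b * w $ a) * ?f v + (u $ a * v $ b - u $ b * v $ a) * ?f w)"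
      unfolding vs ext_deriv_simps D by (simp add: bounded_linear.linear[OF L] linear_add linear_diff)
    also have "(v $ a * w $ b - v $ b * w $ a) * ?f u - (u $ a * w $ b - u $ b * w $ a) * ?f v + (u $ a * v $ b - u $ b * v $ a) * ?f w = 0"
      unfolding f[of u] f[of v] f[of w] by (simp add: algebra_simps)
    finally show ?thesis using n by (simp add: linear_0[OF bounded_linear.linear[OF L]])
  next
    assume n: "CARD('n) = 3"
    then obtain a b k where ab: "ps = [a, b, k]" using length_3D[of ps] lps by auto
    have ab: "distinct [a, b, k]" "UNIV = {a, b, k}" using ps unfolding ab by auto
    obtain u v w q where vs: "vs = [u, v, w, q]" using length_4D[of vs] True n by auto
    let ?f = "fd (\<lambda>y. \<Omega> c y [axis a 1, axis b 1, axis k 1]) x"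
    define g1 g2 g3 where "g1 = ?f (axis a 1)" "g2 = ?f (axis b 1)" "g3 = ?f (axis k 1)"
    have f: "?f u = u $ a * g1 + u $ b * g2 + u $ k * g3" for u
    proof -
      have S: "(\<Sum>p\<in>UNIV. f p) = f a + f b + f k" for f :: "'n \<Rightarrow> complex^'n" by (subst ab(2)) (use ab(1) in simp)
      have "u = u $ a *s axis a 1 + u $ b *s axis b 1 + u $ k *s axis k 1" by (rule vec_expand[of u, unfolded S])
      then have "?f u = ?f (u $ a *s axis a 1 + u $ b *s axis b 1 + u $ k *s axis k 1)" by simp
      then show ?thesis unfolding linear_add[OF has_derivative_linear[OF smooth_on_frechet(1)[OF o sm c(2)]]] hol g1_g2_g3_def .
    qed
    define d where "d u v w = u $ a * v $ b * w $ k + u $ b * v $ k * w $ a + u $ k * v $ a * w $ b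
     - u $ a * v $ k * w $ b - u $ b * v $ a * w $ k - u $ k * v $ b * w $ a" for u v w :: "complex^'n"
    have D: "fd (\<lambda>y. L (\<Omega> c y [p, p', p''])) x w = L (d p p' p'' * ?f w)" for p p' p'' w
      by (rule D) (unfold d_def, rule n0_point_expand3[OF n0 n ab])
    have "ext_deriv 3 (\<lambda>y vs. L (\<Omega> c y vs)) x vs = L (d v w q * ?f u - d u w q * ?f v + d u v q * ?f w - d u v w * ?f q)"
      unfolding vs ext_deriv_simps D by (simp add: bounded_linear.linear[OF L] linear_add linear_diff)
    also have "d v w q * ?f u - d u w q * ?f v + d u v q * ?f w - d u v w * ?f q = 0"
      unfolding f[of u] f[of v] f[of w] f[of q] d_def by (simp add: algebra_simps)
    finally show ?thesis using n by (simp add: linear_0[OF bounded_linear.linear[OF L]])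
  qed
qed (simp add: ext_deriv_length)

section \<open>The flow in charts\<close>

locale coflow =
  fixes A :: "('x::{t2_space, second_countable_topology}, complex^'n) chart set"
    and \<omega> :: "('x, complex^'n, real) form" and \<Omega> :: "('x, complex^'n, complex) form"
    and \<omega>t :: "real \<Rightarrow> ('x, complex^'n, real) form" and \<Theta> :: "real \<Rightarrow> 'x \<Rightarrow> 'x" and K :: real
  assumes n: "CARD('n) = 2 \<or> CARD('n) = 3" and A: "complex_atlas A" and \<Omega>: "holomorphic_volume_form A \<Omega>"
    and krf: "kaehler_ricci_flow A K \<omega> \<omega>t" and flow: "gradient_flow A K \<Omega> \<omega>t \<Theta>"
begin

lemma kf: "0 \<le> t \<Longrightarrow> kaehler_form A (\<omega>t t)" using krf unfolding kaehler_ricci_flow_def by blast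

lemma atlas: "smooth_atlas A" using A by (simp add: complex_atlas_def)

lemma \<omega>t_smooth: "0 \<le> t \<Longrightarrow> smooth_form A 2 (\<omega>t t)" and \<Omega>_smooth: "smooth_form A CARD('n) \<Omega>"
  using kf[of t] \<Omega> unfolding kaehler_form_def holomorphic_volume_form_def by blast+

lemma \<Theta>_smooth: "0 \<le> t \<Longrightarrow> smooth_map A A (\<Theta> t)" and \<Theta>_inv: "0 \<le> t \<Longrightarrow> smooth_map A A (inv (\<Theta> t))" "0 \<le> t \<Longrightarrow> bij (\<Theta> t)"
  using flow unfolding gradient_flow_def diffeomorphism_def by blast+

abbreviation "N t \<equiv> vol_norm \<Omega> (\<omega>t t)"
abbreviation "Nf t \<equiv> pullback A (\<Theta> t) (N t)"
abbreviation "Wf t \<equiv> pullback A (\<Theta> t) (\<omega>t t)"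
abbreviation "Of t \<equiv> pullback A (\<Theta> t) \<Omega>"

text \<open>A single target chart \<open>d\<close> serves all pullbacks on a space-time
  neighbourhood. Time derivatives can then be taken with \<open>d\<close> fixed, whereas
  \<open>pullback\<close> selects a chart at each time separately. The complex form \<Omega> has its
  own clause, as \<beta> ranges over real forms.\<close>

lemma flow_in_charts:
  assumes t: "0 \<le> t" and c: "c \<in> A" "x \<in> cimg c"
  shows "\<exists>d\<in>A. \<exists>T S \<theta> \<theta>' D2. flow_chart T S (cimg d) \<theta> \<theta>' D2 \<and> (t, x) \<in> S \<and>
     (\<forall>s y. (s, y) \<in> S \<longrightarrow> 0 \<le> s \<and> y \<in> cimg c) \<and>
     (\<forall>s y (\<beta> :: ('x, complex^'n, real) form) vs. (s, y) \<in> S \<longrightarrow> form_compat A \<beta> \<longrightarrow> pullback A (\<Theta> s) \<beta> c y vs = \<beta> d (\<theta> (s, y)) (map (\<theta>' (s, y)) (map (Pair 0) vs))) \<and>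
     (\<forall>s y vs. (s, y) \<in> S \<longrightarrow> Of s c y vs = \<Omega> d (\<theta> (s, y)) (map (\<theta>' (s, y)) (map (Pair 0) vs))) \<and>
     (\<forall>s y. (s, y) \<in> S \<longrightarrow> \<theta>' (s, y) (1, 0) = log_norm_gradient K \<Omega> (\<omega>t s) d (\<theta> (s, y)) \<and> inj (\<lambda>v. \<theta>' (s, y) (0, v)))"
proof -
  obtain d where d: "d \<in> A" "\<Theta> t (cinv c x) \<in> cdom d" using atlas_covers[OF atlas] by blast
  define S where "S = {(s, y). 0 \<le> s \<and> y \<in> cimg c \<and> \<Theta> s (cinv c y) \<in> cdom d}"
  define \<theta> where "\<theta> = (\<lambda>(s, y). coord_rep c d (\<Theta> s) y)"
  have fam: "smooth_family A \<Theta>" using flow unfolding gradient_flow_def by blast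
  have sm: "smooth_on S \<theta>" using fam c(1) d(1) unfolding smooth_family_def S_def \<theta>_def by blast
  let ?g = "\<lambda>z. (\<lambda>(t, p). \<Theta> t p) (fst z, cinv c (snd z))"
  have "continuous_on ({0..} \<times> cimg c) ?g"
  proof (rule continuous_on_compose2[of "{0..} \<times> UNIV"])
    show "continuous_on ({0..} \<times> UNIV) (\<lambda>(t, p). \<Theta> t p)" using fam unfolding smooth_family_def by blast
    show "continuous_on ({0..} \<times> cimg c) (\<lambda>z. (fst z, cinv c (snd z)))"
      by (intro continuous_on_Pair continuous_on_fst continuous_on_id continuous_on_compose2[OF atlas_chart(4)[OF atlas c(1)]] continuous_on_snd) auto
  qed auto
  \<comment> \<open>\<open>S\<close> is only relatively open in the half-space of nonnegative times;
    \<open>T1\<close> is an open set of space-time that cuts it out.\<close>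
  from continuous_openin_preimage_gen[OF this atlas_chart(1)[OF atlas d(1)]]
  obtain T1 where T1: "open T1" "({0..} \<times> cimg c) \<inter> ?g -` cdom d = ({0..} \<times> cimg c) \<inter> T1" unfolding openin_open by blast
  define T where "T = T1 \<inter> (UNIV \<times> cimg c)"
  have oT: "open T" unfolding T_def by (intro open_Int T1 open_Times open_UNIV atlas_chart(2)[OF atlas c(1)])
  have ST: "S = {z \<in> T. 0 \<le> fst z}"
  proof -
    have "z \<in> S \<longleftrightarrow> z \<in> ({0..} \<times> cimg c) \<inter> ?g -` cdom d" for z by (cases z) (simp add: S_def)
    then show ?thesis unfolding T1(2) by (auto simp: T_def)
  qed
  have V: "\<theta> z \<in> cimg d" if "z \<in> S" for z
    using that atlas_chart(8)[OF atlas d(1)] by (auto simp: S_def \<theta>_def coord_rep_eq)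
  obtain \<theta>' D2 where der: "\<And>z. z \<in> S \<Longrightarrow> (\<theta> has_derivative \<theta>' z) (at z within S)"
     "\<And>z h. z \<in> S \<Longrightarrow> 0 \<le> fst h \<Longrightarrow> ((\<lambda>z. \<theta>' z h) has_derivative D2 z h) (at z within S)" "\<And>z h k. z \<in> S \<Longrightarrow> D2 z h k = D2 z k h"
    using smooth_half_space_derivatives[OF oT ST sm] by blast
  interpret fc: flow_chart T S "cimg d" \<theta> \<theta>' D2
    by unfold_locales (fact oT, fact ST, rule atlas_chart(2)[OF atlas d(1)], (fact V der)+)
  have tx: "(t, x) \<in> S" using t c d by (simp add: S_def)
  have slice: "(coord_rep c d (\<Theta> s) has_derivative (\<lambda>v. \<theta>' (s, y) (0, v))) (at y)" if "(s, y) \<in> S" for s y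
  proof -
    have "(\<lambda>y. \<theta> (s, y)) = coord_rep c d (\<Theta> s)" by (simp add: \<theta>_def)
    with fc.slice_space[OF that fc.der[OF that]] show ?thesis by (simp only:)
  qed
  have inS: "0 \<le> s" "y \<in> cimg c" "\<Theta> s (cinv c y) \<in> cdom d" if "(s, y) \<in> S" for s y using that by (auto simp: S_def)
  have Z: "\<theta>' (s, y) (1, 0) = log_norm_gradient K \<Omega> (\<omega>t s) d (\<theta> (s, y))" if sy: "(s, y) \<in> S" for s y
  proof -
    have "((\<lambda>r. \<theta> (r, y)) has_vector_derivative \<theta>' (s, y) (1, 0)) (at s within {0..})" by (rule fc.slice_time[OF sy fc.der[OF sy]])
    moreover have "((\<lambda>r. cmap d (\<Theta> r (cinv c y))) has_vector_derivative log_norm_gradient K \<Omega> (\<omega>t s) d (cmap d (\<Theta> s (cinv c y)))) (at s within {0..})"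
      using flow inS[OF sy] d(1) unfolding gradient_flow_def by blast
    ultimately show ?thesis
      using vector_derivative_unique_within[OF half_line_nontrivial[OF inS(1)[OF sy]]] by (simp add: \<theta>_def coord_rep_eq)
  qed
  have inj: "inj (\<lambda>v. \<theta>' (s, y) (0, v))" if sy: "(s, y) \<in> S" for s y
  proof -
    \<comment> \<open>The chart expression of the inverse diffeomorphism undoes that of the flow
      map, so its derivative is a left inverse of the spatial derivative.\<close>
    let ?i = "coord_rep d c (inv (\<Theta> s))" and ?p = "coord_rep c d (\<Theta> s) y"
    let ?W = "{y. (s, y) \<in> S}"
    have W: "open ?W" "y \<in> ?W" using sy fc.slice_open[OF inS(1)[OF sy]] by auto
    have e: "?i (coord_rep c d (\<Theta> s) z) = z" "inv (\<Theta> s) (cinv d (coord_rep c d (\<Theta> s) z)) \<in> cdom c" "coord_rep c d (\<Theta> s) z \<in> cimg d" if "z \<in> ?W" for z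
      using inS[of s z] that atlas_chart[OF atlas c(1)] atlas_chart[OF atlas d(1)] inv_f_f[OF bij_is_inj[OF \<Theta>_inv(2)]]
      by (simp_all add: coord_rep_eq)
    note i = smooth_map_rep[OF atlas atlas \<Theta>_inv(1)[OF inS(1)[OF sy]] d(1) c(1)]
    have "(?i has_derivative fd ?i ?p) (at ?p)"
      by (rule smooth_on_frechet(1)[OF i]) (use e(2,3)[OF W(2)] in simp)
    from has_derivative_compose[OF slice[OF sy] this]
    have "((\<lambda>z. ?i (coord_rep c d (\<Theta> s) z)) has_derivative (\<lambda>v. fd ?i ?p (\<theta>' (s, y) (0, v)))) (at y)" by (simp add: o_def)
    then have "((\<lambda>z. z) has_derivative (\<lambda>v. fd ?i ?p (\<theta>' (s, y) (0, v)))) (at y)"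
      by (rule has_derivative_transform_within_open[OF _ W]) (rule e(1))
    from has_derivative_unique[OF this has_derivative_ident]
    have "fd ?i ?p (\<theta>' (s, y) (0, v)) = v" for v by meson
    then show ?thesis by (rule inj_on_inverseI)
  qed
  have pbr: "pullback A (\<Theta> s) \<beta> c y vs = \<beta> d (\<theta> (s, y)) (map (\<theta>' (s, y)) (map (Pair 0) vs))" if sy: "(s, y) \<in> S" and b: "form_compat A \<beta>" for s y vs and \<beta> :: "('x, complex^'n, real) form"
    using pullback_eq[OF atlas \<Theta>_smooth[OF inS(1)[OF sy]] b c(1) d(1) inS(2,3)[OF sy], of vs]
    unfolding frechet_eq[OF slice[OF sy]] by (simp add: \<theta>_def o_def)
  have "form_compat A \<Omega>" using \<Omega>_smooth unfolding smooth_form_iff[OF atlas] by (rule conjunct2)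
  then have pbc: "Of s c y vs = \<Omega> d (\<theta> (s, y)) (map (\<theta>' (s, y)) (map (Pair 0) vs))" if sy: "(s, y) \<in> S" for s y vs
    using pullback_eq[OF atlas \<Theta>_smooth[OF inS(1)[OF sy]] _ c(1) d(1) inS(2,3)[OF sy], of \<Omega> vs]
    unfolding frechet_eq[OF slice[OF sy]] by (simp add: \<theta>_def o_def)
  show ?thesis
  proof (rule bexI[OF _ d(1)], intro exI conjI)
    show "flow_chart T S (cimg d) \<theta> \<theta>' D2" by unfold_locales
  qed (use tx inS pbr pbc Z inj in blast)+
qed

end

section \<open>Time derivatives of forms carried by the flow\<close>

context flow_chart begin

text \<open>\<open>Y\<close> is the velocity of the flow transported back to the source. Contracting
  the pulled-back form with it is the same as contracting the space-time pullback with the time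
  direction, the expression that occurs in \<open>cartan\<close>.\<close>

lemma contraction_in_flow:
  fixes \<alpha> :: "'e \<Rightarrow> 'e list \<Rightarrow> real"
  assumes f: "\<And>y vs. (t, y) \<in> S \<Longrightarrow> f y vs = pl \<alpha> (t, y) (map (Pair 0) vs)"
    and Y: "\<And>y. (t, y) \<in> S \<Longrightarrow> \<theta>' (t, y) (0, Y y) = \<theta>' (t, y) (1, 0)" and y: "(t, y) \<in> S"
  shows "f y (Y y # vs) = pl \<alpha> (t, y) ((1, 0) # map (Pair 0) vs)"
  using f[OF y] Y[OF y] by simp

lemma transform_time:
  assumes tx: "(t, x) \<in> S" and e: "\<And>s. (s, x) \<in> S \<Longrightarrow> f s = g s" and d: "(g has_real_derivative D) (at t within {0..})"
  shows "(f has_real_derivative D) (at t within {0..})"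
  using d unfolding has_field_derivative_def within_half_line[OF tx, symmetric]
  by (rule has_derivative_transform[rotated 2]) (use tx e in auto)

lemma
  fixes \<alpha> :: "'e \<Rightarrow> 'e list \<Rightarrow> real"
  assumes tx: "(t, x) \<in> S" and k: "k = 2 \<or> k = 3" and a: "\<And>p. p \<in> V \<Longrightarrow> alt_form k (\<alpha> p)"
    and d: "\<And>p vs. p \<in> V \<Longrightarrow> (\<lambda>p. \<alpha> p vs) differentiable (at p)" and c: "\<And>p vs. p \<in> V \<Longrightarrow> ext_deriv k \<alpha> p vs = 0"
    and f: "\<And>s y vs. (s, y) \<in> S \<Longrightarrow> f s y vs = pl \<alpha> (s, y) (map (Pair 0) vs)"
    and Y: "\<And>y. (t, y) \<in> S \<Longrightarrow> \<theta>' (t, y) (0, Y y) = \<theta>' (t, y) (1, 0)"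
  shows contraction_differentiable: "(\<lambda>y. f t y (Y y # vs)) differentiable at x"
    and pulled_closed: "ext_deriv k (f t) x vs = 0"
    and closed_form_derivative: "((\<lambda>s. f s x vs) has_real_derivative ext_deriv (k - 1) (\<lambda>y ws. f t y (Y y # ws)) x vs) (at t within {0..})"
proof -
  have t0: "0 \<le> t" using tx S by simp
  have W: "open {y. (t, y) \<in> S}" "x \<in> {y. (t, y) \<in> S}" using slice_open[OF t0] tx by auto
  have pV: "\<theta> (t, x) \<in> V" by (rule V(2)[OF tx])
  note ctr = contraction_in_flow[where f = "f t" and \<alpha> = \<alpha> and Y = Y and t = t, OF f Y]
  have "(\<lambda>y. pl \<alpha> (t, y) ((1, 0) # map (Pair 0) vs)) differentiable at x"
    by (rule pull_differentiable[OF tx a d[OF pV]]) auto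
  then obtain D where "((\<lambda>y. pl \<alpha> (t, y) ((1, 0) # map (Pair 0) vs)) has_derivative D) (at x)"
    unfolding differentiable_def by blast
  from has_derivative_transform_within_open[OF this W, of "\<lambda>y. f t y (Y y # vs)"] ctr
  show "(\<lambda>y. f t y (Y y # vs)) differentiable at x" unfolding differentiable_def by auto
  have "ext_deriv k (f t) x vs = ext_deriv k (\<lambda>y ws. pl \<alpha> (t, y) (map (Pair 0) ws)) x vs"
    by (rule ext_deriv_cong_open[OF W]) (use f in blast)
  also have "\<dots> = ext_deriv k \<alpha> (\<theta> (t, x)) (map (\<theta>' (t, x)) (map (Pair 0) vs))"
    by (rule ext_deriv_pull[OF tx _ a d[OF pV]]) (use k in auto)
  finally show "ext_deriv k (f t) x vs = 0" using c[OF pV] by simp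
  show "((\<lambda>s. f s x vs) has_real_derivative ext_deriv (k - 1) (\<lambda>y ws. f t y (Y y # ws)) x vs) (at t within {0..})"
  proof (cases "length vs = k")
    case True
    have "((\<lambda>s. pl \<alpha> (s, x) (map (Pair 0) vs)) has_vector_derivative
        pd \<alpha> (t, x) (map (Pair 0) vs) (1, 0)) (at t within {0..})"
      by (rule slice_time[OF tx pull_derivative[OF tx _ d[OF pV]]]) (use a True in auto)
    moreover have "pd \<alpha> (t, x) (map (Pair 0) vs) (1, 0) =
        ext_deriv (k - 1) (\<lambda>y ws. pl \<alpha> (t, y) ((1, 0) # map (Pair 0) ws)) x vs"
      by (rule cartan[OF tx k a d[OF pV] c[OF pV] True])
    moreover have "\<dots> = ext_deriv (k - 1) (\<lambda>y ws. f t y (Y y # ws)) x vs"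
      by (rule ext_deriv_cong_open[OF W]) (use ctr in simp)
    ultimately have "((\<lambda>s. pl \<alpha> (s, x) (map (Pair 0) vs)) has_real_derivative
        ext_deriv (k - 1) (\<lambda>y ws. f t y (Y y # ws)) x vs) (at t within {0..})"
      by (simp only: has_real_derivative_iff_has_vector_derivative)
    from transform_time[where f = "\<lambda>s. f s x vs", OF tx f this] show ?thesis .
  next
    \<comment> \<open>On lists of the wrong length both the form and the exterior derivative are 0
      by convention.\<close>
    case False
    then have "length vs \<noteq> Suc (k - 1)" using k by auto
    then have "ext_deriv (k - 1) (\<lambda>y ws. f t y (Y y # ws)) x vs = 0" by (rule ext_deriv_length)
    moreover have "f s x vs = 0" if "(s, x) \<in> S" for s using f[OF that] alt_form_length[OF a[OF V(2)[OF that]]] False by simp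
    ultimately show ?thesis using transform_time[OF tx, of "\<lambda>s. f s x vs" "\<lambda>_. 0" 0] by simp
  qed
qed

text \<open>With \<open>\<omega>' = - 2 d \<eta>\<close> for the contraction \<open>\<eta>\<close> of \<open>\<omega>\<close> with the velocity \<open>Z\<close>, half of the change is compensated by
  the Lie derivative \<open>d \<eta>\<close>.\<close>

lemma moving_form_derivative:
  assumes tx: "(t, x) \<in> S" and a: "\<And>s p. 0 \<le> s \<Longrightarrow> p \<in> V \<Longrightarrow> alt_form 2 (w s p)"
    and joint: "\<And>vs. ((\<lambda>(s, p). w s p vs) has_derivative G vs) (at (t, \<theta> (t, x)) within {0..} \<times> V)"
    and wd: "\<And>vs. ((\<lambda>s. w s (\<theta> (t, x)) vs) has_real_derivative wd vs) (at t within {0..})"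
    and ad: "alt_form 2 wd" and wd_eq: "\<And>vs. wd vs = - 2 * ext_deriv 1 (\<lambda>p ws. w t p (Z p # ws)) (\<theta> (t, x)) vs"
    and d: "\<And>p vs. p \<in> V \<Longrightarrow> (\<lambda>p. w t p vs) differentiable (at p)" and c: "\<And>p vs. p \<in> V \<Longrightarrow> ext_deriv 2 (w t) p vs = 0"
    and dZ: "\<And>ws. (\<lambda>p. w t p (Z p # ws)) differentiable (at (\<theta> (t, x)))"
    and Z: "\<And>y. (t, y) \<in> S \<Longrightarrow> \<theta>' (t, y) (1, 0) = Z (\<theta> (t, y))"
    and f: "\<And>s y vs. (s, y) \<in> S \<Longrightarrow> f s y vs = pl (w s) (s, y) (map (Pair 0) vs)"
    and Y: "\<And>y. (t, y) \<in> S \<Longrightarrow> \<theta>' (t, y) (0, Y y) = \<theta>' (t, y) (1, 0)"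
  shows "((\<lambda>s. f s x vs) has_real_derivative - ext_deriv 1 (\<lambda>y ws. f t y (Y y # ws)) x vs) (at t within {0..})"
proof (cases "length vs = 2")
  case True
  have t0: "0 \<le> t" using tx S by simp
  have W: "open {y. (t, y) \<in> S}" "x \<in> {y. (t, y) \<in> S}" using slice_open[OF t0] tx by auto
  have pV: "\<theta> (t, x) \<in> V" by (rule V(2)[OF tx])
  note ctr = contraction_in_flow[where f = "f t" and \<alpha> = "w t" and Y = Y and t = t, OF f Y]
  let ?E = "ext_deriv 1 (\<lambda>y ws. f t y (Y y # ws)) x vs"
  have "pd (w t) (t, x) (map (Pair 0) vs) (1, 0) =
        ext_deriv (2 - 1) (\<lambda>y ws. pl (w t) (t, y) ((1, 0) # map (Pair 0) ws)) x vs"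
    by (rule cartan[where \<alpha> = "w t", OF tx _ a[OF t0] d[OF pV] c[OF pV] True]) simp_all
  also have "\<dots> = ext_deriv (2 - 1) (\<lambda>y ws. f t y (Y y # ws)) x vs" by (rule ext_deriv_cong_open[OF W]) (use ctr in simp)
  finally have 1: "pd (w t) (t, x) (map (Pair 0) vs) (1, 0) = ?E" by simp
  \<comment> \<open>The contraction is itself the pullback of the contraction with \<open>Z\<close>,
    so d may be taken on the target. There it is - 1/2 of the change \<open>wd\<close>.\<close>
  have "?E = ext_deriv 1 (\<lambda>y ws. w t (\<theta> (t, y)) (Z (\<theta> (t, y)) # map (\<theta>' (t, y)) (map (Pair 0) ws))) x vs"
    by (rule ext_deriv_cong_open[OF W]) (use ctr Z in simp)
  also have "\<dots> = ext_deriv 1 (\<lambda>p ws. w t p (Z p # ws)) (\<theta> (t, x)) (map (\<theta>' (t, x)) (map (Pair 0) vs))"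
    by (rule ext_deriv_pull[where \<alpha> = "\<lambda>p ws. w t p (Z p # ws)", OF tx _ _ dZ]) (use alt_form_Cons a[OF t0] in \<open>auto simp: numeral_2_eq_2\<close>)
  finally have 2: "wd (map (\<theta>' (t, x)) (map (Pair 0) vs)) = - 2 * ?E" unfolding wd_eq by simp
  have "((\<lambda>s. pl (w s) (s, x) (map (Pair 0) vs)) has_real_derivative
     wd (map (\<theta>' (t, x)) (map (Pair 0) vs)) + pd (w t) (t, x) (map (Pair 0) vs) (1, 0)) (at t within {0..})"
    by (rule moving_form[OF tx _ joint wd]) (use True a ad in auto)
  then have "((\<lambda>s. pl (w s) (s, x) (map (Pair 0) vs)) has_real_derivative - ?E) (at t within {0..})"
    unfolding 1 2 by simp
  from transform_time[where f = "\<lambda>s. f s x vs", OF tx f this] show ?thesis .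
next
  case False
  then have "ext_deriv 1 (\<lambda>y ws. f t y (Y y # ws)) x vs = 0" by (intro ext_deriv_length) simp
  moreover have "f s x vs = 0" if "(s, x) \<in> S" for s
    using f[OF that] alt_form_length[OF a[OF _ V(2)[OF that]]] False that S by simp
  ultimately show ?thesis using transform_time[OF tx, of "\<lambda>s. f s x vs" "\<lambda>_. 0" 0] by simp
qed

end

section \<open>Pulled back frames\<close>

lemma inverse_linear:
  fixes L :: "'e::euclidean_space \<Rightarrow> 'e"
  assumes "linear L" "inj L"
  shows "L (inv L v) = v" "inv L (L v) = v" "linear (inv L)"
proof -
  have s: "surj L" using linear_injective_imp_surjective[OF assms] by simp
  show 1: "L (inv L v) = v" for v using surj_f_inv_f[OF s] .
  show 2: "inv L (L v) = v" for v using inv_f_f[OF assms(2)] .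
  show "linear (inv L)"
  proof (rule linearI)
    show "inv L (u + v) = inv L u + inv L v" for u v
      by (rule injD[OF assms(2)]) (simp add: 1 linear_add[OF assms(1)])
    show "inv L (r *\<^sub>R v) = r *\<^sub>R inv L v" for r v
      by (rule injD[OF assms(2)]) (simp add: 1 linear_cmul[OF assms(1)])
  qed
qed

lemma has_table_pull:
  fixes L :: "'e::euclidean_space \<Rightarrow> 'e"
  assumes L: "linear L" "inj L" and t: "has_table es k \<alpha> tb"
  shows "has_table (map (inv L) es) k (\<lambda>vs. \<alpha> (map L vs)) tb"
  unfolding has_table_def
proof (intro conjI ballI)
  show "alt_form k (\<lambda>vs. \<alpha> (map L vs))" using alt_form_compose[OF _ L(1)] t by (auto simp: has_table_def)
  fix "is" assume i: "is \<in> set (incs k 0 (length (map (inv L) es)))"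
  then have "set is \<subseteq> {0..<length es}" using incs_sound by (metis length_map)
  then have e: "map L (map ((!) (map (inv L) es)) is) = map ((!) es) is" by (auto simp: inverse_linear[OF L])
  show "\<alpha> (map L (map ((!) (map (inv L) es)) is)) = of_int (tb is)" unfolding e using t i by (simp add: has_table_def)
qed

lemma spanning_pull:
  fixes L :: "'e::euclidean_space \<Rightarrow> 'e"
  assumes L: "linear L" "inj L" and s: "spanning es"
  shows "spanning (map (inv L) es)"
  unfolding spanning_def
proof
  fix v
  obtain a where a: "L v = (\<Sum>i<length es. a i *\<^sub>R es ! i)" using s unfolding spanning_def by blast
  have "v = inv L (L v)" by (simp add: inverse_linear[OF L])
  also have "\<dots> = (\<Sum>i<length (map (inv L) es). a i *\<^sub>R map (inv L) es ! i)"
    unfolding a by (simp add: linear_sum[OF inverse_linear(3)[OF L]] linear_cmul[OF inverse_linear(3)[OF L]])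
  finally show "\<exists>a. v = (\<Sum>i<length (map (inv L) es). a i *\<^sub>R map (inv L) es ! i)" by blast
qed

lemma grad_log_pull:
  fixes L :: "'e::euclidean_space \<Rightarrow> 'e"
  assumes L: "linear L" "inj L" and F: "F x = G p" "\<And>v. fd F x v = fd G p (L v)"
    and Y: "L Y = grad_log G p es"
  shows "Y = grad_log F x (map (inv L) es)"
proof -
  have "Y = inv L (L Y)" by (simp add: inverse_linear[OF L])
  also have "\<dots> = grad_log F x (map (inv L) es)"
    unfolding Y grad_log_def
    by (simp add: linear_sum[OF inverse_linear(3)[OF L]] linear_cmul[OF inverse_linear(3)[OF L]] inverse_linear[OF L] F)
  finally show ?thesis .
qed

section \<open>The flow near a point, packaged for the product computations\<close>

context coflow begin

lemma Nf_smooth: "0 \<le> t \<Longrightarrow> smooth_form A 0 (Nf t)"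
  by (rule smooth_form_pullback[OF atlas \<Theta>_smooth norm_smooth_form[OF A kf \<Omega> n]])

lemma Wf_smooth: "0 \<le> t \<Longrightarrow> smooth_form A 2 (Wf t)"
  by (rule smooth_form_pullback[OF atlas \<Theta>_smooth \<omega>t_smooth])

lemma Of_smooth: "0 \<le> t \<Longrightarrow> smooth_form A CARD('n) (Of t)"
  by (rule smooth_form_pullback[OF atlas \<Theta>_smooth \<Omega>_smooth])

lemma smooth_form_differentiable:
  assumes "smooth_form A k \<alpha>" "c \<in> A" "x \<in> cimg c"
  shows "(\<lambda>y. \<alpha> c y vs) differentiable at x"
proof -
  have "smooth_on (cimg c) (\<lambda>y. \<alpha> c y vs)" using assms unfolding smooth_form_def by blast
  from smooth_on_frechet(1)[OF atlas_chart(2)[OF atlas assms(2)] this assms(3)] show ?thesis unfolding differentiable_def by blast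
qed

text \<open>At a point all pulled-back data come from the data at the image point through one linear
  isomorphism \<open>L\<close>, so a frame adapted there can be carried back.\<close>

definition in_flow :: "real \<Rightarrow> ('x, complex^'n) chart \<Rightarrow> complex^'n \<Rightarrow> complex^'n \<Rightarrow> bool" where
  "in_flow t c x Y \<longleftrightarrow> (\<exists>d\<in>A. \<exists>q\<in>cimg d. \<exists>L. linear L \<and> inj L \<and>
     (\<forall>vs. Wf t c x vs = \<omega>t t d q (map L vs)) \<and> (\<forall>vs. Of t c x vs = \<Omega> d q (map L vs)) \<and>
     Nf t c x [] = N t d q [] \<and>
     (\<forall>v. fd (\<lambda>y. Nf t c y []) x v = fd (\<lambda>p. N t d p []) q (L v)) \<and>
     L Y = log_norm_gradient K \<Omega> (\<omega>t t) d q)"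

text \<open>All that the computation on the products needs about the flow. The Kaehler form moves by
  minus and \<Omega> by plus the derivative of its contraction with \<open>Y\<close>, the two signs
  of the Laplacian.\<close>

definition local_flow :: "real \<Rightarrow> ('x, complex^'n) chart \<Rightarrow> complex^'n \<Rightarrow> (complex^'n) set \<Rightarrow> (complex^'n \<Rightarrow> complex^'n) \<Rightarrow> bool" where
  "local_flow t c x0 U Y \<longleftrightarrow> open U \<and> x0 \<in> U \<and> U \<subseteq> cimg c \<and> (\<forall>x\<in>U. in_flow t c x (Y x)) \<and>
     (\<forall>vs. (\<lambda>x. Wf t c x (Y x # vs)) differentiable (at x0)) \<and>
     (\<forall>x\<in>U. \<forall>vs. ext_deriv 2 (Wf t c) x vs = 0) \<and>
     (\<forall>vs. ((\<lambda>s. Wf s c x0 vs) has_real_derivative - ext_deriv 1 (\<lambda>x ws. Wf t c x (Y x # ws)) x0 vs) (at t within {0..})) \<and>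
     (\<forall>P :: complex \<Rightarrow> real. bounded_linear P \<longrightarrow>
       (\<forall>vs. (\<lambda>x. P (Of t c x (Y x # vs))) differentiable (at x0)) \<and>
       (\<forall>x\<in>U. \<forall>vs. ext_deriv CARD('n) (\<lambda>x vs. P (Of t c x vs)) x vs = 0) \<and>
       (\<forall>vs. ((\<lambda>s. P (Of s c x0 vs)) has_real_derivative
          ext_deriv (CARD('n) - 1) (\<lambda>x ws. P (Of t c x (Y x # ws))) x0 vs) (at t within {0..})))"

text \<open>\<open>U\<close> is the slice at time \<open>t\<close> of the space-time neighbourhood,
  and \<open>Y\<close> is the preimage of the velocity under the spatial derivative of the flow. For
  the Kaehler form the change prescribed by the Ricci flow enters through
  \<open>ricci_form_contraction\<close>.\<close>

lemma flow_local:
  assumes t: "0 \<le> t" and c: "c \<in> A" "x0 \<in> cimg c"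
  shows "\<exists>U Y. local_flow t c x0 U Y"
proof -
  from flow_in_charts[OF assms] show ?thesis
  proof (elim bexE exE conjE)
  fix d T S \<theta> \<theta>' D2
  assume d: "d \<in> A" and fc: "flow_chart T S (cimg d) \<theta> \<theta>' D2" and tx: "(t, x0) \<in> S"
    and inS': "\<forall>s y. (s, y) \<in> S \<longrightarrow> 0 \<le> s \<and> y \<in> cimg c"
    and pb': "\<forall>s y (\<beta> :: ('x, complex^'n, real) form) vs. (s, y) \<in> S \<longrightarrow> form_compat A \<beta> \<longrightarrow> pullback A (\<Theta> s) \<beta> c y vs = \<beta> d (\<theta> (s, y)) (map (\<theta>' (s, y)) (map (Pair 0) vs))"
    and pbO': "\<forall>s y vs. (s, y) \<in> S \<longrightarrow> Of s c y vs = \<Omega> d (\<theta> (s, y)) (map (\<theta>' (s, y)) (map (Pair 0) vs))"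
    and Z': "\<forall>s y. (s, y) \<in> S \<longrightarrow> \<theta>' (s, y) (1, 0) = log_norm_gradient K \<Omega> (\<omega>t s) d (\<theta> (s, y)) \<and> inj (\<lambda>v. \<theta>' (s, y) (0, v))"
  note inS = inS'[rule_format] and pb = pb'[rule_format] and pbO = pbO'[rule_format] and Z = Z'[rule_format]
  interpret fc: flow_chart T S "cimg d" \<theta> \<theta>' D2 by (rule fc)
  define U where "U = {y. (t, y) \<in> S}"
  define L where "L y v = \<theta>' (t, y) (0, v)" for y v
  define Y where "Y y = inv (L y) (\<theta>' (t, y) (1, 0))" for y
  have U: "open U" "x0 \<in> U" "U \<subseteq> cimg c" using fc.slice_open[OF t] tx inS by (auto simp: U_def)
  have sl: "((\<lambda>y. \<theta> (t, y)) has_derivative L y) (at y)" if "y \<in> U" for y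
    unfolding L_def using fc.slice_space[OF _ fc.der] that by (simp add: U_def)
  have L: "linear (L y)" "inj (L y)" if "y \<in> U" for y
    using has_derivative_linear[OF sl[OF that]] Z[of t y] that by (simp_all add: L_def[abs_def] U_def)
  have Y: "\<theta>' (t, y) (0, Y y) = \<theta>' (t, y) (1, 0)" if "(t, y) \<in> S" for y
    using inverse_linear(1)[OF L, of y "\<theta>' (t, y) (1, 0)"] that by (simp add: Y_def L_def U_def)
  have mapL: "map (\<theta>' (t, y)) (map (Pair 0) vs) = map (L y) vs" for y vs by (simp add: L_def)
  have q: "\<theta> (t, y) \<in> cimg d" if "y \<in> U" for y using fc.V(2)[of "(t, y)"] that by (simp add: U_def)
  have cN: "form_compat A (N s)" if "0 \<le> s" for s
    using norm_smooth_form[OF A kf[OF that] \<Omega> n] unfolding smooth_form_iff[OF atlas] by (rule conjunct2)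
  have cW: "form_compat A (\<omega>t s)" if "0 \<le> s" for s
    using \<omega>t_smooth[OF that] unfolding smooth_form_iff[OF atlas] by (rule conjunct2)
  have Nq: "Nf t c y vs = N t d (\<theta> (t, y)) (map (L y) vs)" if "y \<in> U" for y vs
    using pb[OF _ cN[OF t], of t y vs] that unfolding mapL by (simp add: U_def)
  have fl: "in_flow t c y (Y y)" if y: "y \<in> U" for y
    unfolding in_flow_def
  proof (rule bexI[OF _ d], rule bexI[OF _ q[OF y]], rule exI[of _ "L y"], intro conjI allI)
    have yS: "(t, y) \<in> S" using y by (simp add: U_def)
    show "linear (L y)" "inj (L y)" by (fact L[OF y])+
    show "Wf t c y vs = \<omega>t t d (\<theta> (t, y)) (map (L y) vs)" for vs using pb[OF yS cW[OF t]] unfolding mapL .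
    show "Of t c y vs = \<Omega> d (\<theta> (t, y)) (map (L y) vs)" for vs using pbO[OF yS] unfolding mapL .
    show "Nf t c y [] = N t d (\<theta> (t, y)) []" using Nq[OF y, of "[]"] by simp
    show "L y (Y y) = log_norm_gradient K \<Omega> (\<omega>t t) d (\<theta> (t, y))" using Y[OF yS] Z[OF yS] by (simp add: L_def)
    fix v
    have "((\<lambda>p. N t d p []) has_derivative fd (\<lambda>p. N t d p []) (\<theta> (t, y))) (at (\<theta> (t, y)))"
      by (rule smooth_on_frechet(1)[OF atlas_chart(2)[OF atlas d] smooth_parts(4)[OF A kf[OF t] \<Omega> n d] q[OF y]])
    from frechet_eq[OF has_derivative_compose[OF sl[OF y] this]]
      frechet_derivative_cong_open[OF U(1) y, of "\<lambda>y. Nf t c y []" "\<lambda>y. N t d (\<theta> (t, y)) []"] Nq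
    show "fd (\<lambda>y. Nf t c y []) y v = fd (\<lambda>p. N t d p []) (\<theta> (t, y)) (L y v)"
      by (simp add: o_def)
  qed
  have aw: "alt_form 2 (\<omega>t s d p)" if "0 \<le> s" "p \<in> cimg d" for s p using \<omega>t_smooth[OF that(1)] d that(2) unfolding smooth_form_def by blast
  have dw: "(\<lambda>p. \<omega>t t d p vs) differentiable (at p)" if "p \<in> cimg d" for p vs by (rule smooth_form_differentiable[OF \<omega>t_smooth[OF t] d that])
  have clw: "ext_deriv 2 (\<omega>t t d) p vs = 0" if "p \<in> cimg d" for p vs using kf[OF t] d that unfolding kaehler_form_def by blast
  have fw: "Wf s c y vs = \<omega>t s d (\<theta> (s, y)) (map (\<theta>' (s, y)) (map (Pair 0) vs))" if "(s, y) \<in> S" for s y vs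
    using pb[OF that cW] inS[OF that] by blast
  have pV: "\<theta> (t, x0) \<in> cimg d" by (rule q[OF U(2)])
  note o = atlas_chart(2)[OF atlas d]
  have W1: "(\<lambda>x. Wf t c x (Y x # vs)) differentiable (at x0)" for vs
    unfolding differentiable_def
  proof -
    have "(\<lambda>y. \<omega>t t d (\<theta> (t, y)) (map (\<theta>' (t, y)) ((1, 0) # map (Pair 0) vs))) differentiable (at x0)"
      by (rule fc.pull_differentiable[where \<alpha> = "\<omega>t t d", OF tx aw[OF t] dw[OF pV]]) auto
    then obtain D where "((\<lambda>y. \<omega>t t d (\<theta> (t, y)) (map (\<theta>' (t, y)) ((1, 0) # map (Pair 0) vs))) has_derivative D) (at x0)"
      unfolding differentiable_def by blast
    from has_derivative_transform_within_open[OF this U(1,2), of "\<lambda>x. Wf t c x (Y x # vs)"]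
    show "\<exists>D. ((\<lambda>x. Wf t c x (Y x # vs)) has_derivative D) (at x0)" using fw Y by (auto simp: U_def)
  qed
  have W2: "ext_deriv 2 (Wf t c) x vs = 0" if "x \<in> U" for x vs
  proof -
    have "ext_deriv 2 (Wf t c) x vs = ext_deriv 2 (\<lambda>y ws. \<omega>t t d (\<theta> (t, y)) (map (\<theta>' (t, y)) (map (Pair 0) ws))) x vs"
      by (rule ext_deriv_cong_open[OF U(1) that]) (use fw in \<open>simp add: U_def\<close>)
    also have "\<dots> = ext_deriv 2 (\<omega>t t d) (\<theta> (t, x)) (map (\<theta>' (t, x)) (map (Pair 0) vs))"
      by (rule fc.ext_deriv_pull[where \<alpha> = "\<omega>t t d", OF _ _ aw[OF t] dw[OF q[OF that]]]) (use that in \<open>auto simp: U_def\<close>)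
    finally show ?thesis using clw[OF q[OF that]] by simp
  qed
  have sm: "smooth_on ({0..} \<times> cimg d) (\<lambda>(s, p). \<omega>t s d p vs)" for vs using krf d unfolding kaehler_ricci_flow_def by blast
  have "\<exists>G. ((\<lambda>(s, p). \<omega>t s d p vs) has_derivative G) (at (t, \<theta> (t, x0)) within {0..} \<times> cimg d)" for vs
  proof -
    have "Ck_on (Suc 0) ({0..} \<times> cimg d) (\<lambda>(s, p). \<omega>t s d p vs)" by (rule smooth_on_imp_Ck[OF sm])
    then show ?thesis by (rule Ck_on_SucE) (use t pV in blast)
  qed
  then obtain G where G: "((\<lambda>(s, p). \<omega>t s d p vs) has_derivative G vs) (at (t, \<theta> (t, x0)) within {0..} \<times> cimg d)" for vs by metis
  let ?Z = "log_norm_gradient K \<Omega> (\<omega>t t) d"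
  note rc = ricci_form_contraction[OF A kf[OF t] \<Omega> n d pV, of K]
  have wd: "((\<lambda>s. \<omega>t s d (\<theta> (t, x0)) vs) has_real_derivative - 2 * K * ricci_form (\<omega>t t) d (\<theta> (t, x0)) vs) (at t within {0..})" for vs
    using krf t d pV unfolding kaehler_ricci_flow_def by blast
  have W3: "((\<lambda>s. Wf s c x0 vs) has_real_derivative - ext_deriv 1 (\<lambda>x ws. Wf t c x (Y x # ws)) x0 vs) (at t within {0..})" for vs
  proof (rule fc.moving_form_derivative[where w = "\<lambda>s. \<omega>t s d" and f = "\<lambda>s. Wf s c" and Z = ?Z and Y = Y, OF tx aw G wd _ _ dw clw])
    show "alt_form 2 (\<lambda>vs. - 2 * K * ricci_form (\<omega>t t) d (\<theta> (t, x0)) vs)"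
      by (rule alt_form_mult[OF alt_form_ricci_form[OF A kf[OF t] \<Omega> n d pV]])
    show "- 2 * K * ricci_form (\<omega>t t) d (\<theta> (t, x0)) vs = - 2 * ext_deriv 1 (\<lambda>p ws. \<omega>t t d p (?Z p # ws)) (\<theta> (t, x0)) vs" for vs
      unfolding rc[symmetric] by simp
    show "(\<lambda>p. \<omega>t t d p (?Z p # ws)) differentiable (at (\<theta> (t, x0)))" for ws
    proof (cases "length ws = 1")
      case True
      then obtain w where "ws = [w]" by (auto simp: length_Suc_conv)
      then show ?thesis
        using smooth_on_frechet(1)[OF o contraction_smooth[OF A kf[OF t] \<Omega> n d] pV] unfolding differentiable_def by blast
    next
      case False
      have "((\<lambda>p. \<omega>t t d p (?Z p # ws)) has_derivative (\<lambda>_. 0)) (at (\<theta> (t, x0)))"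
        by (rule has_derivative_transform_within_open[OF has_derivative_const[of 0] o pV])
           (use alt_form_length[OF aw[OF t]] False in simp)
      then show ?thesis unfolding differentiable_def by blast
    qed
    show "\<theta>' (t, y) (1, 0) = ?Z (\<theta> (t, y))" if "(t, y) \<in> S" for y using Z[OF that] by simp
  qed (assumption | fact fw Y)+
  have P: "(\<lambda>x. P (Of t c x (Y x # vs))) differentiable (at x0)"
    "x \<in> U \<Longrightarrow> ext_deriv CARD('n) (\<lambda>x vs. P (Of t c x vs)) x vs = 0"
    "((\<lambda>s. P (Of s c x0 vs)) has_real_derivative ext_deriv (CARD('n) - 1) (\<lambda>x ws. P (Of t c x (Y x # ws))) x0 vs) (at t within {0..})"
    if P: "bounded_linear P" for P :: "complex \<Rightarrow> real" and x vs
  proof -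
    have aO: "alt_form CARD('n) (\<lambda>vs. P (\<Omega> d p vs))" if "p \<in> cimg d" for p
    proof -
      have "alt_form CARD('n) (\<Omega> d p)" using \<Omega>_smooth d that unfolding smooth_form_def by blast
      from alt_form_linear_comp[OF this bounded_linear.linear[OF P]] show ?thesis .
    qed
    have dO: "(\<lambda>p. P (\<Omega> d p vs)) differentiable (at p)" if "p \<in> cimg d" for p vs
      using smooth_form_differentiable[OF \<Omega>_smooth d that, of vs] bounded_linear.has_derivative[OF P] unfolding differentiable_def by blast
    have cO: "ext_deriv CARD('n) (\<lambda>p vs. P (\<Omega> d p vs)) p vs = 0" if "p \<in> cimg d" for p vs
      by (rule volume_form_closed[OF atlas \<Omega> n d that P])
    have fO: "P (Of s c y vs) = P (\<Omega> d (\<theta> (s, y)) (map (\<theta>' (s, y)) (map (Pair 0) vs)))" if "(s, y) \<in> S" for s y vs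
      using pbO[OF that] by simp
    note g = fc.contraction_differentiable[where \<alpha> = "\<lambda>p vs. P (\<Omega> d p vs)" and f = "\<lambda>s y vs. P (Of s c y vs)" and Y = Y and t = t, OF _ n aO dO cO fO Y]
      fc.pulled_closed[where \<alpha> = "\<lambda>p vs. P (\<Omega> d p vs)" and f = "\<lambda>s y vs. P (Of s c y vs)" and Y = Y and t = t, OF _ n aO dO cO fO Y]
      fc.closed_form_derivative[where \<alpha> = "\<lambda>p vs. P (\<Omega> d p vs)" and f = "\<lambda>s y vs. P (Of s c y vs)" and Y = Y and t = t, OF _ n aO dO cO fO Y]
    show "(\<lambda>x. P (Of t c x (Y x # vs))) differentiable (at x0)" by (rule g(1)[OF tx])
    show "ext_deriv CARD('n) (\<lambda>x vs. P (Of t c x vs)) x vs = 0" if "x \<in> U" by (rule g(2)) (use that in \<open>simp add: U_def\<close>)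
    show "((\<lambda>s. P (Of s c x0 vs)) has_real_derivative ext_deriv (CARD('n) - 1) (\<lambda>x ws. P (Of t c x (Y x # ws))) x0 vs) (at t within {0..})"
      by (rule g(3)[OF tx])
  qed
  show ?thesis unfolding local_flow_def
    by (rule exI[of _ U], rule exI[of _ Y]) (intro conjI ballI allI impI U fl W1 W2 W3 P)
  qed
qed

text \<open>The adapted frame at the image point is carried back by the inverse of \<open>L\<close>.
  Norms agree along \<open>L\<close> and differentials of log F are composed with it, so the
  transported velocity is the gradient in the transported frame.\<close>

lemma in_flow_frame:
  assumes t: "0 \<le> t" and fl: "in_flow t c x Y"
  shows in_flow_pos: "Nf t c x [] > 0"
    and "CARD('n) = 3 \<Longrightarrow> K = 2 \<Longrightarrow> \<exists>us. length us = 6 \<and> spanning us \<and> has_table us 2 (\<lambda>vs. Wf t c x vs * (1 / 2)) tab\<omega> \<and>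
       has_table us 3 (\<lambda>vs. Re (Of t c x vs) * (1 / Nf t c x [])) tabRe3 \<and> has_table us 3 (\<lambda>vs. Im (Of t c x vs) * (1 / Nf t c x [])) tabIm3 \<and>
       Y = grad_log (\<lambda>y. Nf t c y []) x us" (is "_ \<Longrightarrow> _ \<Longrightarrow> ?three")
    and "CARD('n) = 2 \<Longrightarrow> \<kappa> > 0 \<Longrightarrow> \<kappa> ^ 3 = 2 \<Longrightarrow> K = \<kappa> * \<kappa> \<Longrightarrow>
       \<exists>us. length us = 4 \<and> spanning us \<and> has_table us 2 (\<lambda>vs. Wf t c x vs * (1 / K)) tab\<omega> \<and>
       has_table us 2 (\<lambda>vs. Re (Of t c x vs) * (\<kappa> / Nf t c x [])) tabRe2 \<and> has_table us 2 (\<lambda>vs. Im (Of t c x vs) * (\<kappa> / Nf t c x [])) tabIm2 \<and>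
       Y = grad_log (\<lambda>y. Nf t c y []) x us" (is "_ \<Longrightarrow> _ \<Longrightarrow> _ \<Longrightarrow> _ \<Longrightarrow> ?two")
proof -
  obtain d q L where d: "d \<in> A" "q \<in> cimg d" and L: "linear L" "inj L"
    and e: "\<And>vs. Wf t c x vs = \<omega>t t d q (map L vs)" "\<And>vs. Of t c x vs = \<Omega> d q (map L vs)"
    and N: "Nf t c x [] = N t d q []"
      "\<And>v. fd (\<lambda>y. Nf t c y []) x v = fd (\<lambda>p. N t d p []) q (L v)"
    and Y: "L Y = log_norm_gradient K \<Omega> (\<omega>t t) d q"
    using fl unfolding in_flow_def by blast
  note k = kaehler_form_point[OF kf[OF t] d] and v = volume_form_point[OF \<Omega> d]
  have pn: "pnorm (\<Omega> d q) (\<omega>t t d q) = N t d q []" by (simp add: vol_norm_pnorm)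
  show "Nf t c x [] > 0" unfolding N(1) by (rule norm_pos(1)[OF A kf[OF t] \<Omega> n d])
  show ?three if n3: "CARD('n) = 3" "K = 2"
  proof -
    obtain es where es: "length es = 6" "spanning es" "has_table es 2 (\<lambda>vs. \<omega>t t d q vs * (1 / 2)) tab\<omega>"
      "has_table es 3 (\<lambda>vs. Re (\<Omega> d q vs) * (1 / N t d q [])) tabRe3" "has_table es 3 (\<lambda>vs. Im (\<Omega> d q vs) * (1 / N t d q [])) tabIm3"
      and s: "\<And>\<xi>. linear \<xi> \<Longrightarrow> 2 *\<^sub>R sharp (kaehler_metric (\<omega>t t d q)) \<xi> = (\<Sum>i<length es. \<xi> (es ! i) *\<^sub>R es ! i)"
      using su3_frame[OF n3(1) k v] unfolding pn by blast
    have "L Y = grad_log (\<lambda>p. N t d p []) q es"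
      unfolding Y n3(2) by (rule gradient_grad_log[OF A kf[OF t] \<Omega> n d s])
    from grad_log_pull[where F = "\<lambda>y. Nf t c y []" and G = "\<lambda>p. N t d p []", OF L N this]
    show ?thesis unfolding e N(1)
      using es(1) spanning_pull[OF L es(2)] has_table_pull[OF L es(3)] has_table_pull[OF L es(4)] has_table_pull[OF L es(5)]
      by (intro exI[of _ "map (inv L) es"]) simp
  qed
  show ?two if n2: "CARD('n) = 2" "\<kappa> > 0" "\<kappa> ^ 3 = 2" "K = \<kappa> * \<kappa>"
  proof -
    obtain es where es: "length es = 4" "spanning es" "has_table es 2 (\<lambda>vs. \<omega>t t d q vs * (1 / K)) tab\<omega>"
      "has_table es 2 (\<lambda>vs. Re (\<Omega> d q vs) * (\<kappa> / N t d q [])) tabRe2" "has_table es 2 (\<lambda>vs. Im (\<Omega> d q vs) * (\<kappa> / N t d q [])) tabIm2"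
      and s: "\<And>\<xi>. linear \<xi> \<Longrightarrow> K *\<^sub>R sharp (kaehler_metric (\<omega>t t d q)) \<xi> = (\<Sum>i<length es. \<xi> (es ! i) *\<^sub>R es ! i)"
      using su2_frame[OF n2(1) k v n2(2,3)] unfolding pn n2(4)[symmetric] by blast
    have "L Y = grad_log (\<lambda>p. N t d p []) q es"
      unfolding Y by (rule gradient_grad_log[OF A kf[OF t] \<Omega> n d s])
    from grad_log_pull[where F = "\<lambda>y. Nf t c y []" and G = "\<lambda>p. N t d p []", OF L N this]
    show ?thesis unfolding e N(1)
      using es(1) spanning_pull[OF L es(2)] has_table_pull[OF L es(3)] has_table_pull[OF L es(4)] has_table_pull[OF L es(5)]
      by (intro exI[of _ "map (inv L) es"]) simp
  qed
qed

end

section \<open>Forms on the products\<close>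

lemma hodge_laplacian_cong:
  assumes W: "open W" "y \<in> W" and e: "\<And>z. z \<in> W \<Longrightarrow> g z = g' z" "\<And>z. z \<in> W \<Longrightarrow> v z = v' z" "\<And>z. z \<in> W \<Longrightarrow> \<alpha> z = \<alpha>' z"
  shows "hodge_laplacian k g v \<alpha> y vs = hodge_laplacian k g' v' \<alpha>' y vs"
proof -
  have c: "codiff l g v \<beta> z ws = codiff l g' v' \<beta>' z ws" if "z \<in> W" "\<And>z. z \<in> W \<Longrightarrow> \<beta> z = \<beta>' z" for l \<beta> \<beta>' z ws
  proof -
    have "ext_deriv m (\<lambda>y. hodge l (g y) (v y) (\<beta> y)) z = ext_deriv m (\<lambda>y. hodge l (g' y) (v' y) (\<beta>' y)) z" for m
      by (rule ext, rule ext_deriv_cong_open[OF W(1) that(1)]) (simp add: e that(2))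
    then show ?thesis by (simp add: codiff_def e that(1))
  qed
  have "ext_deriv (k - 1) (codiff k g v \<alpha>) y vs = ext_deriv (k - 1) (codiff k g' v' \<alpha>') y vs"
    by (rule ext_deriv_cong_open[OF W]) (rule c[OF _ e(3)])
  moreover have "ext_deriv k \<alpha> z = ext_deriv k \<alpha>' z" if "z \<in> W" for z
    by (rule ext, rule ext_deriv_cong_open[OF W(1) that]) (simp add: e)
  ultimately show ?thesis unfolding hodge_laplacian_def by (simp add: c[OF W(2), of "ext_deriv k \<alpha>" "ext_deriv k \<alpha>'"])
qed

text \<open>Evaluated on \<open>es\<close>, the top form is a nonzero multiple of g(Y, Y) for the
  induced metric.\<close>

lemma g2_std_positive:
  fixes es :: "'e::euclidean_space list"
  assumes d: "DIM('e) = 7" and s: "g2_std es P Q A B" and \<phi>: "\<phi> = (\<lambda>vs. P vs + Q vs)" and Y: "Y \<noteq> 0"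
  shows "\<exists>vs. wedge 4 3 (wedge 2 2 (interior_product Y \<phi>) (interior_product Y \<phi>)) \<phi> vs \<noteq> 0"
proof -
  obtain g v where gv: "v es = 1" "g2_induces (\<lambda>vs. P vs + Q vs) g v" using g2_std_induces[OF d s] by metis
  then have "- (1 / 6) * wedge 4 3 (wedge 2 2 (interior_product Y \<phi>) (interior_product Y \<phi>)) \<phi> es = g Y Y * v es"
    unfolding g2_induces_def \<phi> by blast
  moreover have "g Y Y > 0" using gv(2) Y unfolding g2_induces_def inner_product_def by blast
  ultimately show ?thesis using gv(1) by (intro exI[of _ es]) auto
qed

lemma smooth_on_one_wedge:
  "(\<And>vs. smooth_on S (\<lambda>y. \<beta> y vs)) \<Longrightarrow> smooth_on S (\<lambda>y. one_wedge k \<xi> (\<beta> y) vs)"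
  unfolding one_wedge_def by (cases "length vs = Suc k") (simp_all add: smooth_on_const smooth_on_sum smooth_on_mult)

lemma one_wedge_map: "one_wedge k \<xi> \<beta> (map M vs) = one_wedge k (\<lambda>v. \<xi> (M v)) (\<lambda>ws. \<beta> (map M ws)) vs"
  by (auto simp: one_wedge_def take_map drop_map intro!: sum.cong)

lemma one_wedge_cmult: "one_wedge k \<xi> (\<lambda>ws. c * \<beta> ws) vs = c * one_wedge k \<xi> \<beta> vs"
  by (simp add: one_wedge_def sum_distrib_left mult_ac)

lemma has_real_derivative_one_wedge:
  assumes "\<And>ws. ((\<lambda>s. \<beta> s ws) has_real_derivative b ws) (at t within S)"
  shows "((\<lambda>s. one_wedge k \<xi> (\<beta> s) vs) has_real_derivative one_wedge k \<xi> b vs) (at t within S)"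
  unfolding one_wedge_def
  by (cases "length vs = Suc k") (auto intro!: DERIV_sum DERIV_cmult assms)

lemma has_real_derivative_transform:
  assumes "t \<in> S" "\<And>s. s \<in> S \<Longrightarrow> f s = g s" "(g has_real_derivative D) (at t within S)"
  shows "(f has_real_derivative D) (at t within S)"
  using assms(3) unfolding has_field_derivative_def by (rule has_derivative_transform[rotated 2]) (use assms(1,2) in auto)

lemma has_real_derivative_wedge22:
  assumes d: "\<And>ws. ((\<lambda>s. \<beta> s ws) has_real_derivative b ws) (at t within S)"
  shows "((\<lambda>s. wedge22 (\<beta> s) (\<beta> s) vs) has_real_derivative 2 * wedge22 b (\<beta> t) vs) (at t within S)"
proof (cases "length vs = 4")
  case True
  then obtain p q r s where vs: "vs = [p, q, r, s]" using length_4D by blast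
  note m = DERIV_mult[OF d d]
  have "((\<lambda>s'. wedge22 (\<beta> s') (\<beta> s') vs) has_real_derivative wedge22 b (\<beta> t) vs + wedge22 (\<beta> t) b vs) (at t within S)"
    unfolding vs wedge22_simp by (rule DERIV_cong, (rule DERIV_add DERIV_diff m)+) (simp add: algebra_simps)
  moreover have "wedge22 (\<beta> t) b vs = wedge22 b (\<beta> t) vs" unfolding vs wedge22_simp by simp
  ultimately show ?thesis by simp
qed (simp add: wedge22_def)

lemma product_transition:
  assumes k: "k \<in> circle_atlas" "k' \<in> circle_atlas" "r \<in> cimg k" "cinv k r \<in> cdom k'"
    and c: "inj_on (cmap c) (cdom c)" "inj_on (cmap d) (cdom d)" "open (cimg c)" "x \<in> cimg c" and D: "(transition c d has_derivative D) (at x)"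
  shows "transition (pchart k c) (pchart k' d) (r, x) = (transition k k' r, transition c d x)"
    and "(transition (pchart k c) (pchart k' d) has_derivative (\<lambda>h. (fst h, D (snd h)))) (at (r, x))" (is "?derivative")
proof -
  have e: "transition (pchart k c) (pchart k' d) z = (transition k k' (fst z), transition c d (snd z))" if "z \<in> cimg k \<times> cimg c" for z
    using that pchart_facts(4)[OF circle_chart(2)[OF k(1)] c(1)]
    by (cases z) (simp add: transition_eq pchart_facts(5)[OF circle_chart(2)[OF k(2)] c(2)])
  then show "transition (pchart k c) (pchart k' d) (r, x) = (transition k k' r, transition c d x)" using k c by simp
  have "((\<lambda>z. transition k k' (fst z)) has_derivative (\<lambda>h. fst h)) (at (r, x))"
    using has_derivative_compose[OF has_derivative_fst[OF has_derivative_ident, of "at (r, x)"], of "transition k k'" "\<lambda>h. h"]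
      circle_transition[OF k] by simp
  moreover have "((\<lambda>z. transition c d (snd z)) has_derivative (\<lambda>h. D (snd h))) (at (r, x))"
    using has_derivative_compose[OF has_derivative_snd[OF has_derivative_ident, of "at (r, x)"], of "transition c d" D] D by simp
  ultimately have "((\<lambda>z. (transition k k' (fst z), transition c d (snd z))) has_derivative (\<lambda>h. (fst h, D (snd h)))) (at (r, x))"
    by (rule has_derivative_Pair)
  then show ?derivative
    by (rule has_derivative_transform_within_open[of _ _ _ _ "cimg k \<times> cimg c"])
       (use k c e in \<open>auto intro: open_Times circle_chart(1)\<close>)
qed

lemma circle_transition_differentiable:
  "k \<in> circle_atlas \<Longrightarrow> k' \<in> circle_atlas \<Longrightarrow> r \<in> cimg k \<Longrightarrow> cinv k r \<in> cdom k' \<Longrightarrow> transition k k' differentiable (at r)"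
  using circle_transition unfolding differentiable_def by blast

lemma pullback_fun_times: "pullback B f (fun_times F \<alpha>) = fun_times (pullback B f F) (pullback B f \<alpha>)"
  and pullback_fun_divide: "pullback B f (fun_divide \<alpha> F) = fun_divide (pullback B f \<alpha>) (pullback B f F)"
  by (intro ext; simp add: pullback_def fun_times_def fun_divide_def Let_def)+

lemma
  assumes A: "smooth_atlas A" and F: "smooth_form A 0 F" and a: "smooth_form A k \<alpha>"
  shows smooth_form_fun_times: "smooth_form A k (fun_times F \<alpha>)"
    and smooth_form_fun_divide: "(\<And>c x. c \<in> A \<Longrightarrow> x \<in> cimg c \<Longrightarrow> F c x [] \<noteq> 0) \<Longrightarrow> smooth_form A k (fun_divide \<alpha> F)"
proof -
  have cF: "form_compat A F" and cA: "form_compat A \<alpha>" using F a unfolding smooth_form_iff[OF A] by blast+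
  have aa: "alt_form k (\<alpha> c x)" if "c \<in> A" "x \<in> cimg c" for c x using a that unfolding smooth_form_def by blast
  have sF: "smooth_on (cimg c) (\<lambda>x. F c x [])" and sa: "smooth_on (cimg c) (\<lambda>x. \<alpha> c x vs)" if "c \<in> A" for c vs
    using F a that unfolding smooth_form_def by blast+
  have eF: "F c x [] = F d (transition c d x) []" if "c \<in> A" "d \<in> A" "x \<in> cimg c" "cinv c x \<in> cdom d" for c d x
    using cF that unfolding form_compat_def by (metis list.simps(8))
  have ea: "\<alpha> c x vs = \<alpha> d (transition c d x) (map (fd (transition c d) x) vs)" if "c \<in> A" "d \<in> A" "x \<in> cimg c" "cinv c x \<in> cdom d" for c d x vs
    using cA that unfolding form_compat_def by blast
  show "smooth_form A k (fun_times F \<alpha>)"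
    unfolding smooth_form_iff[OF A] fun_times_def form_compat_def
    by (intro conjI ballI allI impI alt_form_scaleR aa smooth_on_scaleR sF sa) (simp_all add: eF[symmetric] ea[symmetric])
  assume nz: "\<And>c x. c \<in> A \<Longrightarrow> x \<in> cimg c \<Longrightarrow> F c x [] \<noteq> 0"
  show "smooth_form A k (fun_divide \<alpha> F)"
    unfolding smooth_form_iff[OF A] fun_divide_def form_compat_def divide_inverse mult_1_left
    by (intro conjI ballI allI impI alt_form_scaleR aa smooth_on_scaleR sa smooth_on_inverse sF nz) (simp_all add: eF[symmetric] ea[symmetric])
qed

lemma smooth_form_linear:
  assumes A: "smooth_atlas A" and L: "bounded_linear L" and a: "smooth_form A k \<alpha>"
  shows "smooth_form A k (\<lambda>c x vs. L (\<alpha> c x vs))"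
proof -
  have h: "alt_form k (\<lambda>vs. L (\<alpha> c x vs))" if "c \<in> A" "x \<in> cimg c" for c x
    by (rule alt_form_linear_comp[OF _ bounded_linear.linear[OF L]]) (use a that in \<open>auto simp: smooth_form_def\<close>)
  have "form_compat A \<alpha>" using a unfolding smooth_form_iff[OF A] by blast
  then have "form_compat A (\<lambda>c x vs. L (\<alpha> c x vs))" unfolding form_compat_def by metis
  moreover have "smooth_on (cimg c) (\<lambda>x. L (\<alpha> c x vs))" if "c \<in> A" for c vs
    by (rule smooth_on_bounded_linear[OF L]) (use a that in \<open>auto simp: smooth_form_def\<close>)
  ultimately show ?thesis using h unfolding smooth_form_iff[OF A] by blast
qed

lemma pullback_id:
  assumes A: "smooth_atlas A" and b: "form_compat A \<beta>" and c: "c \<in> A" "x \<in> cimg c"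
  shows "pullback A id \<beta> c x vs = \<beta> c x vs"
proof -
  have "pullback A id \<beta> c x vs = \<beta> c x (map (\<lambda>v. v) vs)"
    by (rule pullback_in_chart[where g = "\<lambda>y. y" and W = "cimg c", OF atlas_transition_differentiable[OF A] b c(1) atlas_chart(2)[OF A c(1)] c(2)])
       (use c atlas_chart[OF A c(1)] in \<open>auto simp: has_derivative_ident\<close>)
  then show ?thesis by simp
qed

section \<open>The three-form on the circle product, globally\<close>

definition S1_alg :: "('e list \<Rightarrow> real) \<Rightarrow> ('e list \<Rightarrow> real) \<Rightarrow> (real \<times> 'e) list \<Rightarrow> real" where
  "S1_alg s u vs = u (map snd vs) - one_wedge 2 fst (\<lambda>ws. s (map snd ws)) vs"

text \<open>In a product chart both projections are linear and every angle chart shows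
  \<open>dr\<close> as the differential of its coordinate, so all choices of charts inside
  \<open>pullback\<close> disappear.\<close>

lemma S1_form_alg:
  assumes A: "smooth_atlas A" and s: "smooth_form A 2 \<sigma>" and u: "form_compat A (Re_form \<mu>)"
    and k: "k \<in> circle_atlas" and c: "c \<in> A" and z: "z \<in> cimg k \<times> cimg c"
  shows "S1_form A \<sigma> \<mu> (pchart k c) z = S1_alg (\<sigma> c (snd z)) (\<lambda>vs. Re (\<mu> c (snd z) vs))"
proof
  fix vs
  note pf = pchart_facts(4)[OF circle_chart(2)[OF k] atlas_inj[OF A c]]
  have W: "open (cimg k \<times> cimg c)" by (intro open_Times circle_chart(1)[OF k] atlas_chart(2)[OF A c])
  have p2: "pullback A snd \<beta> (pchart k c) z vs = \<beta> c (snd z) (map snd vs)" if "form_compat A \<beta>" for \<beta> :: "('a, 'b, real) form" and vs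
    by (rule pullback_projection[OF atlas_transition_differentiable[OF A] that c W z]) (auto simp: pf bounded_linear_snd)
  have "pullback circle_atlas fst dr (pchart k c) z vs = dr k (fst z) (map fst vs)" for vs
    by (rule pullback_projection[OF circle_transition_differentiable dr_compat k W z]) (auto simp: pf bounded_linear_fst)
  then have p1: "pullback circle_atlas fst dr (pchart k c) z = one_form fst"
    by (auto simp: dr_def one_form_def fun_eq_iff)
  have "form_compat A \<sigma>" using s unfolding smooth_form_iff[OF A] by blast
  note p2 = p2[OF this] p2[OF u]
  have "alt_form 2 (\<sigma> c (snd z))" using s c z unfolding smooth_form_def by auto
  then have "alt_form 2 (\<lambda>ws :: (real \<times> 'b) list. \<sigma> c (snd z) (map snd ws))" by (rule alt_form_compose) (rule bounded_linear.linear[OF bounded_linear_snd])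
  then have "wedge 1 2 (one_form fst) (pullback A snd \<sigma> (pchart k c) z) = one_wedge 2 fst (\<lambda>ws. \<sigma> c (snd z) (map snd ws))"
    unfolding p2(1)[abs_def] by (rule wedge_one_form(2)[OF bounded_linear.linear[OF bounded_linear_fst]])
  then show "S1_form A \<sigma> \<mu> (pchart k c) z vs = S1_alg (\<sigma> c (snd z)) (\<lambda>vs. Re (\<mu> c (snd z) vs)) vs"
    unfolding S1_form_def S1_alg_def wedge_form_def p1 p2(2) by (simp add: Re_form_def)
qed

lemma S1_smooth_form:
  assumes A: "smooth_atlas A" and s: "smooth_form A 2 \<sigma>" and u: "smooth_form A 3 (Re_form \<mu>)"
  shows "smooth_form (S1_times A) 3 (S1_form A \<sigma> \<mu>)"
proof -
  have cs: "form_compat A \<sigma>" and cu: "form_compat A (Re_form \<mu>)" using s u unfolding smooth_form_iff[OF A] by blast+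
  note alg = S1_form_alg[OF A s cu]
  have bl: "linear (snd :: real \<times> 'b \<Rightarrow> 'b)" "linear (fst :: real \<times> 'b \<Rightarrow> real)" by (simp_all add: bounded_linear.linear bounded_linear_snd bounded_linear_fst)
  show ?thesis
    unfolding smooth_form_def S1_times_def product_atlas_pchart
  proof (intro conjI ballI allI)
    fix c7 assume "c7 \<in> {pchart k c | k c. k \<in> circle_atlas \<and> c \<in> A}"
    then obtain k c where k: "k \<in> circle_atlas" and c: "c \<in> A" and c7: "c7 = pchart k c" by blast
    note pf = pchart_facts[OF circle_chart(2)[OF k] atlas_inj[OF A c]]
    show "alt_form 3 (S1_form A \<sigma> \<mu> c7 z)" if "z \<in> cimg c7" for z
    proof -
      have z: "z \<in> cimg k \<times> cimg c" using that unfolding c7 pf(2) .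
      have "alt_form 2 (\<sigma> c (snd z))" "alt_form 3 (\<lambda>vs. Re (\<mu> c (snd z) vs))" using s u c z unfolding smooth_form_def Re_form_def by auto
      then show ?thesis unfolding c7 alg[OF k c z] S1_alg_def[abs_def]
        by (intro alt_form_diff alt_form_one_wedge(2) alt_form_compose[OF _ bl(1)] bl(2))
    qed
    show "smooth_on (cimg c7) (\<lambda>z. S1_form A \<sigma> \<mu> c7 z vs)" for vs
    proof (rule smooth_on_cong)
      show "S1_alg (\<sigma> c (snd z)) (\<lambda>vs. Re (\<mu> c (snd z) vs)) vs = S1_form A \<sigma> \<mu> c7 z vs" if "z \<in> cimg c7" for z
        using that alg[OF k c, of z] unfolding c7 pf(2) by simp
      have 1: "smooth_on (cimg c7) (\<lambda>z. f (snd z))" if "smooth_on (cimg c) f" for f :: "'b \<Rightarrow> real"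
        by (rule smooth_on_compose[OF that smooth_on_linear[OF bounded_linear_snd]]) (auto simp: c7 pf(2))
      show "smooth_on (cimg c7) (\<lambda>z. S1_alg (\<sigma> c (snd z)) (\<lambda>vs. Re (\<mu> c (snd z) vs)) vs)"
        unfolding S1_alg_def
        by (intro smooth_on_diff smooth_on_one_wedge 1) (use s u c in \<open>auto simp: smooth_form_def Re_form_def\<close>)
    qed
    fix d7 z vs assume "d7 \<in> {pchart k c | k c. k \<in> circle_atlas \<and> c \<in> A}" and z: "z \<in> cmap c7 ` (cdom c7 \<inter> cdom d7)"
    then obtain k' d where k': "k' \<in> circle_atlas" and d: "d \<in> A" and d7: "d7 = pchart k' d" by blast
    note pd = pchart_facts[OF circle_chart(2)[OF k'] atlas_inj[OF A d]]
    from z obtain p q where pq: "(p, q) \<in> cdom c7" "(p, q) \<in> cdom d7" "z = cmap c7 (p, q)" by (auto simp del: cdom_def)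
    then have p: "p \<in> cdom k" "p \<in> cdom k'" and q: "q \<in> cdom c" "q \<in> cdom d" and zz: "z = (cmap k p, cmap c q)"
      unfolding c7 d7 pf(1,5) pd(1) by auto
    have ip: "cinv k (cmap k p) = p" unfolding cinv_def by (rule inv_into_f_f[OF circle_chart(2)[OF k] p(1)])
    have iq: "cinv c (cmap c q) = q" by (rule atlas_chart(6)[OF A c q(1)])
    let ?r = "cmap k p" and ?x = "cmap c q"
    have r: "?r \<in> cimg k" "cinv k ?r \<in> cdom k'" "transition k k' ?r \<in> cimg k'" using p by (auto simp: ip cimg_def transition_eq)
    have x: "?x \<in> cimg c" "cinv c ?x \<in> cdom d" "transition c d ?x \<in> cimg d" using q atlas_chart(8)[OF A c] atlas_chart(8)[OF A d] by (auto simp: iq transition_eq)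
    let ?D = "fd (transition c d) ?x"
    have D: "(transition c d has_derivative ?D) (at ?x)"
      using atlas_transition_differentiable[OF A c d x(1,2)] frechet_derivative_works by blast
    note t = product_transition[OF k k' r(1,2) atlas_inj[OF A c] atlas_inj[OF A d] atlas_chart(2)[OF A c] x(1) D]
    have e: "\<sigma> c ?x ws = \<sigma> d (transition c d ?x) (map ?D ws)" "Re (\<mu> c ?x ws) = Re (\<mu> d (transition c d ?x) (map ?D ws))" for ws
      using cs cu c d x unfolding form_compat_def Re_form_def by blast+
    let ?M = "\<lambda>h. (fst h, ?D (snd h))"
    \<comment> \<open>The derivative of the transition is the identity on the angle and
      \<open>?D\<close> on X, so \<open>dr\<close> is unchanged and compatibility on X finishes the
      claim.\<close>
    have m: "map snd (map (\<lambda>h. (fst h, ?D (snd h))) ws) = map ?D (map snd ws)" for ws :: "(real \<times> 'b) list" by simp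
    have "S1_alg (\<sigma> c ?x) (\<lambda>vs. Re (\<mu> c ?x vs)) vs = S1_alg (\<sigma> d (transition c d ?x)) (\<lambda>vs. Re (\<mu> d (transition c d ?x) vs)) (map ?M vs)"
      by (simp only: S1_alg_def one_wedge_map m e fst_conv)
    moreover have "S1_form A \<sigma> \<mu> d7 (transition k k' ?r, transition c d ?x) = S1_alg (\<sigma> d (transition c d ?x)) (\<lambda>vs. Re (\<mu> d (transition c d ?x) vs))"
      unfolding d7 using alg[OF k' d, of "(transition k k' ?r, transition c d ?x)"] r x by simp
    moreover have "S1_form A \<sigma> \<mu> c7 (?r, ?x) = S1_alg (\<sigma> c ?x) (\<lambda>vs. Re (\<mu> c ?x vs))"
      unfolding c7 using alg[OF k c, of "(?r, ?x)"] r x by simp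
    ultimately show "S1_form A \<sigma> \<mu> c7 z vs = S1_form A \<sigma> \<mu> d7 (transition c7 d7 z) (map (fd (transition c7 d7) z) vs)"
      unfolding zz unfolding c7 d7 frechet_eq[OF t(2)] t(1) by simp
  qed
qed

section \<open>The coflow on the circle product\<close>

context coflow begin

abbreviation "phi3 t \<equiv> S1_form A (pullback A (\<Theta> t) (fun_times (N t) (\<omega>t t))) (pullback A (\<Theta> t) (fun_divide \<Omega> (N t)))"

lemma Nf_pos: "0 \<le> t \<Longrightarrow> c \<in> A \<Longrightarrow> x \<in> cimg c \<Longrightarrow> Nf t c x [] > 0"
  using flow_local[of t c x] in_flow_pos unfolding local_flow_def by blast

lemma moved_smooth:
  assumes t: "0 \<le> t"
  shows "smooth_form A 2 (fun_times (Nf t) (Wf t))" "smooth_form A CARD('n) (fun_divide (Of t) (Nf t))"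
    "smooth_form A CARD('n) (Re_form (fun_divide (Of t) (Nf t)))" "smooth_form A CARD('n) (Im_form (fun_divide (Of t) (Nf t)))"
proof -
  show "smooth_form A 2 (fun_times (Nf t) (Wf t))" by (rule smooth_form_fun_times[OF atlas Nf_smooth[OF t] Wf_smooth[OF t]])
  have "Nf t c x [] \<noteq> 0" if "c \<in> A" "x \<in> cimg c" for c x using Nf_pos[OF t that] by simp
  from smooth_form_fun_divide[OF atlas Nf_smooth[OF t] Of_smooth[OF t] this]
  show 1: "smooth_form A CARD('n) (fun_divide (Of t) (Nf t))" .
  show "smooth_form A CARD('n) (Re_form (fun_divide (Of t) (Nf t)))" "smooth_form A CARD('n) (Im_form (fun_divide (Of t) (Nf t)))"
    unfolding Re_form_def Im_form_def by (rule smooth_form_linear[OF atlas _ 1], rule bounded_linear_Re bounded_linear_Im)+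
qed

lemma compat_of: "smooth_form A k \<alpha> \<Longrightarrow> form_compat A \<alpha>" unfolding smooth_form_iff[OF atlas] by blast

lemma phi3_in_chart:
  assumes n3: "CARD('n) = 3" and t: "0 \<le> t" and k: "k \<in> circle_atlas" and c: "c \<in> A" and z: "z \<in> cimg k \<times> cimg c"
  shows "phi3 t (pchart k c) z = (\<lambda>vs. Re (Of t c (snd z) (map snd vs)) / Nf t c (snd z) [] -
     Nf t c (snd z) [] * one_wedge 2 fst (\<lambda>ws. Wf t c (snd z) (map snd ws)) vs)"
  unfolding pullback_fun_times pullback_fun_divide
    S1_form_alg[OF atlas moved_smooth(1)[OF t] compat_of[OF moved_smooth(3)[OF t]] k c z] S1_alg_def[abs_def]
  by (simp add: fun_times_def fun_divide_def one_wedge_cmult)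

text \<open>The explicit dual form \<psi> contains only the pullbacks of \<Omega> and of the Kaehler
  form, so its time derivative follows from \<open>local_flow\<close> and is compared term by term
  with the Laplacian.\<close>

lemma S1_coflow_point:
  assumes n3: "CARD('n) = 3" and K: "K = 2" and t: "0 \<le> t" and k: "k \<in> circle_atlas" "r \<in> cimg k" and c: "c \<in> A" "x \<in> cimg c"
  defines "\<psi> \<equiv> \<lambda>s vs. (- 2) * one_wedge 3 fst (\<lambda>ws. Im (Of s c x (map snd ws))) vs
     - (1 / 8) * wedge22 (\<lambda>ws. Wf s c x (map snd ws)) (\<lambda>ws. Wf s c x (map snd ws)) vs"
  shows "g2_dual (phi3 t) (pchart k c) (r, x) vs = \<psi> t vs"
    and "Z \<noteq> 0 \<Longrightarrow> \<exists>vs. wedge 4 3 (wedge 2 2 (interior_product Z (phi3 t (pchart k c) (r, x)))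
       (interior_product Z (phi3 t (pchart k c) (r, x)))) (phi3 t (pchart k c) (r, x)) vs \<noteq> 0" (is "_ \<Longrightarrow> ?positive")
    and "((\<lambda>s. \<psi> s vs) has_real_derivative g2_laplacian 4 (phi3 t) (g2_dual (phi3 t)) (pchart k c) (r, x) vs) (at t within {0..})" (is "?derivative")
proof -
  obtain U Y where "local_flow t c x U Y" using flow_local[OF t c] by blast
  note lf = this[unfolded local_flow_def, THEN conjunct2, THEN conjunct2]
    and U = this[unfolded local_flow_def, THEN conjunct1] this[unfolded local_flow_def, THEN conjunct2, THEN conjunct1]
  note U = U lf[THEN conjunct1] and fl = lf[THEN conjunct2, THEN conjunct1]
  note lf = lf[THEN conjunct2, THEN conjunct2]
  note W = lf[THEN conjunct1] lf[THEN conjunct2, THEN conjunct1] lf[THEN conjunct2, THEN conjunct2, THEN conjunct1]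
    and P = lf[THEN conjunct2, THEN conjunct2, THEN conjunct2]
  note PR = P[rule_format, OF bounded_linear_Re] and PI = P[rule_format, OF bounded_linear_Im]
  let ?R = "\<lambda>x vs. Re (Of t c x vs)" and ?I = "\<lambda>x vs. Im (Of t c x vs)" and ?F = "\<lambda>x. Nf t c x []"
  note alt = smooth_form_linear[OF atlas bounded_linear_Re Of_smooth[OF t]] smooth_form_linear[OF atlas bounded_linear_Im Of_smooth[OF t]]
  interpret S1: S1_local ?F "Wf t c" ?R ?I Y U
  proof
    fix x vs assume x: "x \<in> U"
    then have xc: "x \<in> cimg c" using U(3) by blast
    show "\<exists>us. length us = 6 \<and> spanning us \<and> has_table us 2 (\<lambda>vs. Wf t c x vs * (1 / 2)) tab\<omega> \<and>
       has_table us 3 (\<lambda>vs. ?R x vs * (1 / ?F x)) tabRe3 \<and> has_table us 3 (\<lambda>vs. ?I x vs * (1 / ?F x)) tabIm3 \<and> Y x = grad_log ?F x us"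
      by (rule in_flow_frame(2)[OF t fl[rule_format, OF x] n3 K])
    show "?F x > 0" by (rule Nf_pos[OF t c(1) xc])
    show "?F differentiable at x" by (rule smooth_form_differentiable[OF Nf_smooth[OF t] c(1) xc])
    show "alt_form 2 (Wf t c x)" using Wf_smooth[OF t] c(1) xc unfolding smooth_form_def by blast
    show "alt_form 3 (?R x)" "alt_form 3 (?I x)" using alt c(1) xc n3 unfolding smooth_form_def by metis+
    show "(\<lambda>x. Wf t c x vs) differentiable at x" by (rule smooth_form_differentiable[OF Wf_smooth[OF t] c(1) xc])
    show "(\<lambda>x. ?R x vs) differentiable at x" "(\<lambda>x. ?I x vs) differentiable at x"
      by (rule smooth_form_differentiable[OF alt(1) c(1) xc] smooth_form_differentiable[OF alt(2) c(1) xc])+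
    show "ext_deriv 2 (Wf t c) x vs = 0" using W(2) x by blast
    show "ext_deriv 3 ?R x vs = 0" "ext_deriv 3 ?I x vs = 0" using PR PI x n3 by metis+
  qed (use n3 U(1) in simp_all)
  let ?\<phi> = "\<lambda>z vs. ?R (snd z) (map snd vs) / ?F (snd z) - ?F (snd z) * one_wedge 2 fst (\<lambda>ws. Wf t c (snd z) (map snd ws)) vs"
  note eq = phi3_in_chart[OF n3 t k(1) c(1)]
  have rx: "(r, x) \<in> cimg k \<times> cimg c" using k c by simp
  note dl = S1.dual_and_laplacian[where \<phi> = ?\<phi> and r = r, OF U(2) PI[THEN conjunct1, rule_format] W(1)[rule_format] refl]
  show "g2_dual (phi3 t) (pchart k c) (r, x) vs = \<psi> t vs"
    unfolding g2_dual_def eq[OF rx] \<psi>_def by (rule dl(1))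
  have e: "phi3 t (pchart k c) (r, x) = (\<lambda>vs. S1.P (r, x) vs / ?F (snd (r, x)) + ?F (snd (r, x)) * S1.Q (r, x) vs)"
    unfolding eq[OF rx] by (simp add: S1.P_def S1.Q_def)
  show ?positive if Z: "Z \<noteq> 0"
  proof -
    obtain es where es: "g2_std es (\<lambda>vs. S1.P (r, x) vs / ?F (snd (r, x))) (\<lambda>vs. ?F (snd (r, x)) * S1.Q (r, x) vs) (S1.A (r, x)) (S1.B (r, x))"
      using S1.std[of "(r, x)"] U(2) by auto
    have "DIM(real \<times> (complex^'n)) = 7" using n3 by simp
    from g2_std_positive[OF this _ e Z] es show ?thesis by blast
  qed
  have lap: "g2_laplacian 4 (phi3 t) (g2_dual (phi3 t)) (pchart k c) (r, x) vs =
     (- 2) * one_wedge 3 fst (\<lambda>ws. ext_deriv 2 (\<lambda>x vs. ?I x (Y x # vs)) x (map snd ws)) vs +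
     (1 / 4) * wedge22 (\<lambda>ws. ext_deriv 1 (\<lambda>x vs. Wf t c x (Y x # vs)) x (map snd ws)) (\<lambda>ws. Wf t c x (map snd ws)) vs"
    unfolding g2_laplacian_def dl(2)[symmetric]
  proof (rule hodge_laplacian_cong[of "cimg k \<times> cimg c"])
    show "open (cimg k \<times> cimg c)" by (intro open_Times circle_chart(1)[OF k(1)] atlas_chart(2)[OF atlas c(1)])
  qed (use rx eq in \<open>simp_all add: g2_dual_def\<close>)
  \<comment> \<open>The Kaehler form contributes - 1/8 * 2 * (-1) = 1/4, the coefficient in the
    Laplacian.\<close>
  have "((\<lambda>s. \<psi> s vs) has_real_derivative
      (- 2) * one_wedge 3 fst (\<lambda>ws. ext_deriv 2 (\<lambda>x vs. ?I x (Y x # vs)) x (map snd ws)) vs -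
      (1 / 8) * (2 * wedge22 (\<lambda>ws. - ext_deriv 1 (\<lambda>x vs. Wf t c x (Y x # vs)) x (map snd ws)) (\<lambda>ws. Wf t c x (map snd ws)) vs)) (at t within {0..})"
    unfolding \<psi>_def
    by (intro DERIV_diff DERIV_cmult has_real_derivative_one_wedge has_real_derivative_wedge22 W(3)[rule_format])
       (use PI n3 in simp)
  moreover have "wedge22 (\<lambda>ws. - \<alpha> ws) \<beta> vs = - wedge22 \<alpha> \<beta> vs" for \<alpha> \<beta> :: "(real \<times> (complex, 'n) vec) list \<Rightarrow> real" by (simp add: wedge22_def)
  ultimately show ?derivative
    unfolding lap by simp
qed

lemma S1_coflow:
  assumes n3: "CARD('n) = 3" and K: "K = 2"
  shows "g2_laplacian_coflow (S1_times A) phi3"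
  unfolding g2_laplacian_coflow_def
proof (intro conjI allI impI ballI)
  fix t :: real assume t: "0 \<le> t"
  show "g2_structure (S1_times A) (phi3 t)"
    unfolding g2_structure_def
  proof (intro conjI ballI allI impI)
    show "DIM(real \<times> (complex^'n)) = 7" using n3 by simp
    show "smooth_form (S1_times A) 3 (phi3 t)"
      unfolding pullback_fun_times pullback_fun_divide by (rule S1_smooth_form[OF atlas moved_smooth(1,3)[OF t, unfolded n3]])
    fix c7 z and Z :: "real \<times> (complex^'n)" assume "c7 \<in> S1_times A" "z \<in> cimg c7" and Z: "Z \<noteq> 0"
    then obtain k c r x where kc: "k \<in> circle_atlas" "r \<in> cimg k" "c \<in> A" "x \<in> cimg c" "c7 = pchart k c" "z = (r, x)"
      unfolding S1_times_def product_atlas_pchart using pchart_facts(2)[OF circle_chart(2) atlas_inj[OF atlas]] by fastforce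
    show "\<exists>vs. wedge 4 3 (wedge 2 2 (interior_product Z (phi3 t c7 z)) (interior_product Z (phi3 t c7 z))) (phi3 t c7 z) vs \<noteq> 0"
      unfolding kc(5,6) by (rule S1_coflow_point(2)[OF n3 K t kc(1-4) Z])
  qed
  fix c7 z vs assume "c7 \<in> S1_times A" "z \<in> cimg c7"
  then obtain k c r x where kc: "k \<in> circle_atlas" "r \<in> cimg k" "c \<in> A" "x \<in> cimg c" "c7 = pchart k c" "z = (r, x)"
    unfolding S1_times_def product_atlas_pchart using pchart_facts(2)[OF circle_chart(2) atlas_inj[OF atlas]] by fastforce
  \<comment> \<open>The dual form equals the explicit \<psi> at every nonnegative time, so the
    derivative within the half-line transfers, including at time 0.\<close>
  show "((\<lambda>s. g2_dual (phi3 s) c7 z vs) has_real_derivative g2_laplacian 4 (phi3 t) (g2_dual (phi3 t)) c7 z vs) (at t within {0..})"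
    unfolding kc(5,6)
    by (rule has_real_derivative_transform[OF _ _ S1_coflow_point(3)[OF n3 K t kc(1-4)]])
       (use t S1_coflow_point(1)[OF n3 K _ kc(1-4)] in auto)
qed

abbreviation "nrm0 \<equiv> vol_norm \<Omega> \<omega>"

lemma initial_values:
  assumes \<omega>: "kaehler_form A \<omega>" and c: "c \<in> A" "x \<in> cimg c"
  shows "Nf 0 c x [] = nrm0 c x []" "Wf 0 c x = \<omega> c x" "Of 0 c x = \<Omega> c x"
proof -
  have id: "\<Theta> 0 = id" using flow unfolding gradient_flow_def by blast
  have w: "\<omega>t 0 c x = \<omega> c x" using krf c unfolding kaehler_ricci_flow_def form_eq_def by blast
  show "Wf 0 c x = \<omega> c x" unfolding id w[symmetric] by (rule ext, rule pullback_id[OF atlas compat_of[OF \<omega>t_smooth] c]) simp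
  show "Of 0 c x = \<Omega> c x" unfolding id by (rule ext, rule pullback_id[OF atlas compat_of[OF \<Omega>_smooth] c])
  have "Nf 0 c x [] = N 0 c x []"
    unfolding id by (rule pullback_id[OF atlas compat_of[OF norm_smooth_form[OF A kf \<Omega> n]] c]) simp
  then show "Nf 0 c x [] = nrm0 c x []" by (simp add: vol_norm_def w)
qed

lemma initial_smooth:
  assumes \<omega>: "kaehler_form A \<omega>"
  shows "smooth_form A 2 (fun_times nrm0 \<omega>)" "smooth_form A CARD('n) (fun_divide \<Omega> nrm0)"
proof -
  have s: "smooth_form A 2 \<omega>" using \<omega> unfolding kaehler_form_def by blast
  note m = norm_smooth_form[OF A \<omega> \<Omega> n]
  show "smooth_form A 2 (fun_times nrm0 \<omega>)" by (rule smooth_form_fun_times[OF atlas m s])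
  have "nrm0 c x [] \<noteq> 0" if "c \<in> A" "x \<in> cimg c" for c x using norm_pos(1)[OF A \<omega> \<Omega> n that] by simp
  from smooth_form_fun_divide[OF atlas m \<Omega>_smooth this] show "smooth_form A CARD('n) (fun_divide \<Omega> nrm0)" .
qed

lemma S1_initial:
  assumes n3: "CARD('n) = 3" and \<omega>: "kaehler_form A \<omega>"
  shows "form_eq (S1_times A) (phi3 0) (S1_form A (fun_times nrm0 \<omega>) (fun_divide \<Omega> nrm0))"
  unfolding form_eq_def
proof (intro ballI)
  fix c7 z assume "c7 \<in> S1_times A" "z \<in> cimg c7"
  then obtain k c r x where kc: "k \<in> circle_atlas" "r \<in> cimg k" "c \<in> A" "x \<in> cimg c" "c7 = pchart k c" "z = (r, x)"
    unfolding S1_times_def product_atlas_pchart using pchart_facts(2)[OF circle_chart(2) atlas_inj[OF atlas]] by fastforce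
  have z: "(r, x) \<in> cimg k \<times> cimg c" using kc by simp
  note i = initial_values[OF \<omega> kc(3,4)]
  note s = initial_smooth[OF \<omega>]
  have cr: "form_compat A (Re_form (fun_divide \<Omega> nrm0))"
    unfolding Re_form_def by (rule compat_of[OF smooth_form_linear[OF atlas bounded_linear_Re s(2)]])
  show "phi3 0 c7 z = S1_form A (fun_times nrm0 \<omega>) (fun_divide \<Omega> nrm0) c7 z"
    unfolding kc(5,6) S1_form_alg[OF atlas s(1) cr kc(1,3) z] phi3_in_chart[OF n3 order_refl kc(1,3) z] S1_alg_def[abs_def]
    by (simp add: i fun_times_def fun_divide_def one_wedge_cmult)
qed

end

section \<open>The product with a three-torus, globally\<close>

definition tchart :: "(circle, real) chart \<Rightarrow> (circle, real) chart \<Rightarrow> (circle, real) chart \<Rightarrow> ('m, 'e) chart \<Rightarrow>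
    (circle \<times> circle \<times> circle \<times> 'm, 'e t3) chart" where
  "tchart k1 k2 k3 c = pchart k1 (pchart k2 (pchart k3 c))"

lemma T3_times_tchart: "T3_times A = {tchart k1 k2 k3 c | k1 k2 k3 c. k1 \<in> circle_atlas \<and> k2 \<in> circle_atlas \<and> k3 \<in> circle_atlas \<and> c \<in> A}"
  unfolding T3_times_def product_atlas_pchart tchart_def by blast

lemma tchart_facts:
  assumes k: "k1 \<in> circle_atlas" "k2 \<in> circle_atlas" "k3 \<in> circle_atlas" and c: "inj_on (cmap c) (cdom c)"
  shows "cdom (tchart k1 k2 k3 c) = cdom k1 \<times> cdom k2 \<times> cdom k3 \<times> cdom c"
    "cimg (tchart k1 k2 k3 c) = cimg k1 \<times> cimg k2 \<times> cimg k3 \<times> cimg c"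
    "cmap (tchart k1 k2 k3 c) (p1, p2, p3, q) = (cmap k1 p1, cmap k2 p2, cmap k3 p3, cmap c q)"
    "a1 \<in> cimg k1 \<Longrightarrow> a2 \<in> cimg k2 \<Longrightarrow> a3 \<in> cimg k3 \<Longrightarrow> x \<in> cimg c \<Longrightarrow>
      cinv (tchart k1 k2 k3 c) (a1, a2, a3, x) = (cinv k1 a1, cinv k2 a2, cinv k3 a3, cinv c x)"
proof -
  note p3 = pchart_facts[OF circle_chart(2)[OF k(3)] c]
  note p2 = pchart_facts[OF circle_chart(2)[OF k(2)] p3(3)]
  note p1 = pchart_facts[OF circle_chart(2)[OF k(1)] p2(3)]
  show "cdom (tchart k1 k2 k3 c) = cdom k1 \<times> cdom k2 \<times> cdom k3 \<times> cdom c"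
    "cimg (tchart k1 k2 k3 c) = cimg k1 \<times> cimg k2 \<times> cimg k3 \<times> cimg c"
    "cmap (tchart k1 k2 k3 c) (p1, p2, p3, q) = (cmap k1 p1, cmap k2 p2, cmap k3 p3, cmap c q)"
    unfolding tchart_def p1(1,2,5) p2(1,2,5) p3(1,2,5) by simp_all
  show "cinv (tchart k1 k2 k3 c) (a1, a2, a3, x) = (cinv k1 a1, cinv k2 a2, cinv k3 a3, cinv c x)"
    if "a1 \<in> cimg k1" "a2 \<in> cimg k2" "a3 \<in> cimg k3" "x \<in> cimg c"
    unfolding tchart_def using that by (simp add: p1(4) p2(2,4) p3(2,4))
qed

lemma tchart_transition:
  assumes k1: "k1 \<in> circle_atlas" "k1' \<in> circle_atlas" "a1 \<in> cimg k1" "cinv k1 a1 \<in> cdom k1'"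
    and k2: "k2 \<in> circle_atlas" "k2' \<in> circle_atlas" "a2 \<in> cimg k2" "cinv k2 a2 \<in> cdom k2'"
    and k3: "k3 \<in> circle_atlas" "k3' \<in> circle_atlas" "a3 \<in> cimg k3" "cinv k3 a3 \<in> cdom k3'"
    and c: "inj_on (cmap c) (cdom c)" "inj_on (cmap d) (cdom d)" "open (cimg c)" "x \<in> cimg c" and D: "(transition c d has_derivative D) (at x)"
  shows "transition (tchart k1 k2 k3 c) (tchart k1' k2' k3' d) (a1, a2, a3, x) = (transition k1 k1' a1, transition k2 k2' a2, transition k3 k3' a3, transition c d x)"
    and "(transition (tchart k1 k2 k3 c) (tchart k1' k2' k3' d) has_derivative
      (\<lambda>h. (fst h, fst (snd h), fst (snd (snd h)), D (snd (snd (snd h)))))) (at (a1, a2, a3, x))" (is "?derivative")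
proof -
  note p3 = pchart_facts[OF circle_chart(2)[OF k3(1)] c(1)] and q3 = pchart_facts[OF circle_chart(2)[OF k3(2)] c(2)]
  note p2 = pchart_facts[OF circle_chart(2)[OF k2(1)] p3(3)] and q2 = pchart_facts[OF circle_chart(2)[OF k2(2)] q3(3)]
  have o3: "open (cimg (pchart k3 c))" unfolding p3(2) by (intro open_Times circle_chart(1)[OF k3(1)] c(3))
  have o2: "open (cimg (pchart k2 (pchart k3 c)))" unfolding p2(2) by (intro open_Times circle_chart(1)[OF k2(1)] o3)
  have i3: "(a3, x) \<in> cimg (pchart k3 c)" unfolding p3(2) using k3 c by simp
  have i2: "(a2, a3, x) \<in> cimg (pchart k2 (pchart k3 c))" unfolding p2(2) using k2 i3 by simp
  note t3 = product_transition[OF k3 c D]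
  note t2 = product_transition[OF k2 p3(3) q3(3) o3 i3 t3(2)]
  note t1 = product_transition[OF k1 p2(3) q2(3) o2 i2 t2(2)]
  show "transition (tchart k1 k2 k3 c) (tchart k1' k2' k3' d) (a1, a2, a3, x) = (transition k1 k1' a1, transition k2 k2' a2, transition k3 k3' a3, transition c d x)"
    unfolding tchart_def t1(1) t2(1) t3(1) ..
  show ?derivative
    using t1(2) unfolding tchart_def .
qed

lemma one_wedge_divide: "one_wedge k \<xi> (\<lambda>ws. \<beta> ws / c) vs = one_wedge k \<xi> \<beta> vs / c"
  using one_wedge_cmult[of k \<xi> "1 / c" \<beta> vs] by simp

lemma one_wedge_uminus: "one_wedge k \<xi> (\<lambda>ws. - \<beta> ws) vs = - one_wedge k \<xi> \<beta> vs"
  using one_wedge_cmult[of k \<xi> "- 1" \<beta> vs] by simp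

lemma one_form_map: "one_form \<xi> (map M vs) = one_form (\<lambda>v. \<xi> (M v)) vs"
  by (simp add: one_form_def)

abbreviation (input) q2 :: "'e t3 \<Rightarrow> real" where "q2 \<equiv> \<lambda>y. fst (snd y)"
abbreviation (input) q3 :: "'e t3 \<Rightarrow> real" where "q3 \<equiv> \<lambda>y. fst (snd (snd y))"
abbreviation (input) q4 :: "'e t3 \<Rightarrow> 'e" where "q4 \<equiv> \<lambda>y. snd (snd (snd y))"

text \<open>The form on the torus product at a point of a product chart, in terms of the values on
  X; it plays the part of \<open>S1_alg\<close>.\<close>

definition T3_alg :: "real \<Rightarrow> ('e list \<Rightarrow> real) \<Rightarrow> ('e list \<Rightarrow> real) \<Rightarrow> ('e list \<Rightarrow> real) \<Rightarrow> ('e t3) list \<Rightarrow> real" where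
  "T3_alg f s u v vs = - f * one_wedge 2 fst (one_wedge 1 q2 (one_form q3)) vs + one_wedge 2 fst (\<lambda>ws. s (map q4 ws)) vs
     + one_wedge 2 q2 (\<lambda>ws. u (map q4 ws)) vs + one_wedge 2 q3 (\<lambda>ws. v (map q4 ws)) vs"

lemma torus_projections:
  "bounded_linear (fst :: ('e::euclidean_space) t3 \<Rightarrow> real)" "bounded_linear (q2 :: 'e t3 \<Rightarrow> real)"
  "bounded_linear (q3 :: 'e t3 \<Rightarrow> real)" "bounded_linear (q4 :: 'e t3 \<Rightarrow> 'e)"
  by (simp_all add: bounded_linear_snd_comp bounded_linear_fst_comp bounded_linear_snd bounded_linear_fst)

lemmas torus_linear = torus_projections[THEN bounded_linear.linear]

lemma T3_form_alg:
  fixes \<sigma> :: "('m::topological_space, 'e::euclidean_space, real) form"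
  assumes A: "smooth_atlas A" and F: "form_compat A F" and s: "smooth_form A 2 \<sigma>" and u: "smooth_form A 2 (Re_form \<mu>)" "smooth_form A 2 (Im_form \<mu>)"
    and k: "k1 \<in> circle_atlas" "k2 \<in> circle_atlas" "k3 \<in> circle_atlas" and c: "c \<in> A" and z: "z \<in> cimg k1 \<times> cimg k2 \<times> cimg k3 \<times> cimg c"
  shows "T3_form A F \<sigma> \<mu> (tchart k1 k2 k3 c) z = T3_alg (F c (q4 z) []) (\<sigma> c (q4 z)) (\<lambda>vs. Re (\<mu> c (q4 z) vs)) (\<lambda>vs. Im (\<mu> c (q4 z) vs))"
proof
  fix vs
  note pf = tchart_facts(4)[OF k atlas_inj[OF A c]]
  have W: "open (cimg k1 \<times> cimg k2 \<times> cimg k3 \<times> cimg c)" by (intro open_Times circle_chart(1) k atlas_chart(2)[OF A c])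
  have p4: "pullback A (\<lambda>(r1, r2, r3, p). p) \<beta> (tchart k1 k2 k3 c) z vs = \<beta> c (q4 z) (map q4 vs)" if "form_compat A \<beta>" for \<beta> :: "('m, 'e, real) form" and vs
    by (rule pullback_projection[OF atlas_transition_differentiable[OF A] that c W z _ _ torus_projections(4)]) (auto simp: pf)
  have p1: "pullback circle_atlas (\<lambda>(r1, r2, r3, p). r1) dr (tchart k1 k2 k3 c) z vs = dr k1 (fst z) (map fst vs)" for vs
    by (rule pullback_projection[OF circle_transition_differentiable dr_compat k(1) W z _ _ torus_projections(1)]) (auto simp: pf)
  have p2: "pullback circle_atlas (\<lambda>(r1, r2, r3, p). r2) dr (tchart k1 k2 k3 c) z vs = dr k2 (q2 z) (map q2 vs)" for vs
    by (rule pullback_projection[OF circle_transition_differentiable dr_compat k(2) W z _ _ torus_projections(2)]) (auto simp: pf)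
  have p3: "pullback circle_atlas (\<lambda>(r1, r2, r3, p). r3) dr (tchart k1 k2 k3 c) z vs = dr k3 (q3 z) (map q3 vs)" for vs
    by (rule pullback_projection[OF circle_transition_differentiable dr_compat k(3) W z _ _ torus_projections(3)]) (auto simp: pf)
  have dr: "dr k r (map \<xi> vs) = one_form \<xi> vs" for k r \<xi> and vs :: "('e t3) list"
    by (simp add: dr_def one_form_def)
  note p = p1[unfolded dr, abs_def] p2[unfolded dr, abs_def] p3[unfolded dr, abs_def]
  have cs: "form_compat A \<sigma>" "form_compat A (Re_form \<mu>)" "form_compat A (Im_form \<mu>)"
    using s u unfolding smooth_form_iff[OF A] by blast+
  have a: "alt_form 2 (\<lambda>ws. \<sigma> c (q4 z) (map q4 ws))" "alt_form 2 (\<lambda>ws. Re_form \<mu> c (q4 z) (map q4 ws))" "alt_form 2 (\<lambda>ws. Im_form \<mu> c (q4 z) (map q4 ws))"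
    using s u c z unfolding smooth_form_def by (auto intro!: alt_form_compose[OF _ torus_linear(4)])
  note w1 = wedge_one_form(2)[OF torus_linear(1)] and w2 = wedge_one_form(2)[OF torus_linear(2)] and w3 = wedge_one_form(2)[OF torus_linear(3)]
  have b: "wedge 1 1 (one_form q2) (one_form q3) = one_wedge 1 q2 (one_form (q3 :: 'e t3 \<Rightarrow> real))"
    by (rule wedge_one_form(1)[OF torus_linear(2) alt_form_one_form[OF torus_linear(3)]])
  have b2: "alt_form 2 (one_wedge 1 q2 (one_form (q3 :: 'e t3 \<Rightarrow> real)))"
    by (rule alt_form_one_wedge(1)[OF torus_linear(2) alt_form_one_form[OF torus_linear(3)]])
  show "T3_form A F \<sigma> \<mu> (tchart k1 k2 k3 c) z vs = T3_alg (F c (q4 z) []) (\<sigma> c (q4 z)) (\<lambda>vs. Re (\<mu> c (q4 z) vs)) (\<lambda>vs. Im (\<mu> c (q4 z) vs)) vs"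
    unfolding T3_form_def Let_def T3_alg_def wedge_form_def fun_times_def p p4[OF F] p4[OF cs(1), abs_def] p4[OF cs(2), abs_def] p4[OF cs(3), abs_def]
      b w1[OF b2] w1[OF a(1)] w2[OF a(2)] w3[OF a(3)]
    by (simp add: Re_form_def Im_form_def)
qed

lemma T3_smooth_form:
  fixes \<sigma> :: "('m::topological_space, 'e::euclidean_space, real) form"
  assumes A: "smooth_atlas A" and F: "smooth_form A 0 F" and s: "smooth_form A 2 \<sigma>" and u: "smooth_form A 2 (Re_form \<mu>)" "smooth_form A 2 (Im_form \<mu>)"
  shows "smooth_form (T3_times A) 3 (T3_form A F \<sigma> \<mu>)"
proof -
  have cF: "form_compat A F" and cs: "form_compat A \<sigma>" and cu: "form_compat A (Re_form \<mu>)" "form_compat A (Im_form \<mu>)"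
    using F s u unfolding smooth_form_iff[OF A] by blast+
  note alg = T3_form_alg[OF A cF s u]
  show ?thesis
    unfolding smooth_form_def T3_times_tchart
  proof (intro conjI ballI allI)
    fix c7 assume "c7 \<in> {tchart k1 k2 k3 c | k1 k2 k3 c. k1 \<in> circle_atlas \<and> k2 \<in> circle_atlas \<and> k3 \<in> circle_atlas \<and> c \<in> A}"
    then obtain k1 k2 k3 c where k: "k1 \<in> circle_atlas" "k2 \<in> circle_atlas" "k3 \<in> circle_atlas" and c: "c \<in> A" and c7: "c7 = tchart k1 k2 k3 c" by blast
    note pf = tchart_facts[OF k atlas_inj[OF A c]]
    show "alt_form 3 (T3_form A F \<sigma> \<mu> c7 z)" if "z \<in> cimg c7" for z
    proof -
      have z: "z \<in> cimg k1 \<times> cimg k2 \<times> cimg k3 \<times> cimg c" using that unfolding c7 pf(2) .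
      have "alt_form 2 (\<sigma> c (q4 z))" "alt_form 2 (\<lambda>vs. Re (\<mu> c (q4 z) vs))" "alt_form 2 (\<lambda>vs. Im (\<mu> c (q4 z) vs))"
        using s u c z unfolding smooth_form_def Re_form_def Im_form_def by auto
      then show ?thesis unfolding c7 alg[OF k c z] T3_alg_def[abs_def]
        by (intro alt_form_add alt_form_mult alt_form_one_wedge(1,2) alt_form_one_form alt_form_compose[OF _ torus_linear(4)] torus_linear(1-3))
    qed
    show "smooth_on (cimg c7) (\<lambda>z. T3_form A F \<sigma> \<mu> c7 z vs)" for vs
    proof (rule smooth_on_cong)
      show "T3_alg (F c (q4 z) []) (\<sigma> c (q4 z)) (\<lambda>vs. Re (\<mu> c (q4 z) vs)) (\<lambda>vs. Im (\<mu> c (q4 z) vs)) vs = T3_form A F \<sigma> \<mu> c7 z vs" if "z \<in> cimg c7" for z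
        using that alg[OF k c, of z] unfolding c7 pf(2) by simp
      have 1: "smooth_on (cimg c7) (\<lambda>z. f (q4 z))" if "smooth_on (cimg c) f" for f :: "'e \<Rightarrow> real"
        by (rule smooth_on_compose[OF that smooth_on_linear[OF torus_projections(4)]]) (auto simp: c7 pf(2))
      show "smooth_on (cimg c7) (\<lambda>z. T3_alg (F c (q4 z) []) (\<sigma> c (q4 z)) (\<lambda>vs. Re (\<mu> c (q4 z) vs)) (\<lambda>vs. Im (\<mu> c (q4 z) vs)) vs)"
        unfolding T3_alg_def
        by (intro smooth_on_add smooth_on_mult smooth_on_minus smooth_on_const smooth_on_one_wedge 1) (use F s u c in \<open>auto simp: smooth_form_def Re_form_def Im_form_def\<close>)
    qed
    fix d7 z vs assume "d7 \<in> {tchart k1 k2 k3 c | k1 k2 k3 c. k1 \<in> circle_atlas \<and> k2 \<in> circle_atlas \<and> k3 \<in> circle_atlas \<and> c \<in> A}"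
      and z: "z \<in> cmap c7 ` (cdom c7 \<inter> cdom d7)"
    then obtain k1' k2' k3' d where k': "k1' \<in> circle_atlas" "k2' \<in> circle_atlas" "k3' \<in> circle_atlas" and d: "d \<in> A" and d7: "d7 = tchart k1' k2' k3' d" by blast
    note pd = tchart_facts[OF k' atlas_inj[OF A d]]
    from z obtain p1 p2 p3 q where pq: "(p1, p2, p3, q) \<in> cdom c7" "(p1, p2, p3, q) \<in> cdom d7" "z = cmap c7 (p1, p2, p3, q)" by auto
    then have p: "p1 \<in> cdom k1" "p1 \<in> cdom k1'" "p2 \<in> cdom k2" "p2 \<in> cdom k2'" "p3 \<in> cdom k3" "p3 \<in> cdom k3'" and q: "q \<in> cdom c" "q \<in> cdom d"
      and zz: "z = (cmap k1 p1, cmap k2 p2, cmap k3 p3, cmap c q)"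
      unfolding c7 d7 pf(1,3) pd(1) by auto
    have r: "cmap k p \<in> cimg k" "cinv k (cmap k p) \<in> cdom k'" "transition k k' (cmap k p) \<in> cimg k'"
      if "k \<in> circle_atlas" "p \<in> cdom k" "p \<in> cdom k'" for k k' and p :: circle
    proof -
      have "cinv k (cmap k p) = p" unfolding cinv_def by (rule inv_into_f_f[OF circle_chart(2)[OF that(1)] that(2)])
      then show "cmap k p \<in> cimg k" "cinv k (cmap k p) \<in> cdom k'" "transition k k' (cmap k p) \<in> cimg k'"
        using that by (auto simp: cimg_def transition_eq)
    qed
    note r1 = r[OF k(1) p(1,2)] and r2 = r[OF k(2) p(3,4)] and r3 = r[OF k(3) p(5,6)]
    have iq: "cinv c (cmap c q) = q" by (rule atlas_chart(6)[OF A c q(1)])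
    let ?x = "cmap c q" and ?r1 = "cmap k1 p1" and ?r2 = "cmap k2 p2" and ?r3 = "cmap k3 p3"
    have x: "?x \<in> cimg c" "cinv c ?x \<in> cdom d" "transition c d ?x \<in> cimg d" using q atlas_chart(8)[OF A c] atlas_chart(8)[OF A d] by (auto simp: iq transition_eq)
    let ?D = "fd (transition c d) ?x"
    have D: "(transition c d has_derivative ?D) (at ?x)"
      using atlas_transition_differentiable[OF A c d x(1,2)] frechet_derivative_works by blast
    note t = tchart_transition[OF k(1) k'(1) r1(1,2) k(2) k'(2) r2(1,2) k(3) k'(3) r3(1,2) atlas_inj[OF A c] atlas_inj[OF A d] atlas_chart(2)[OF A c] x(1) D]
    have e: "\<sigma> c ?x ws = \<sigma> d (transition c d ?x) (map ?D ws)" "Re (\<mu> c ?x ws) = Re (\<mu> d (transition c d ?x) (map ?D ws))"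
      "Im (\<mu> c ?x ws) = Im (\<mu> d (transition c d ?x) (map ?D ws))" "F c ?x [] = F d (transition c d ?x) (map ?D [])" for ws
      using cF cs cu c d x unfolding form_compat_def Re_form_def Im_form_def by blast+
    let ?M = "\<lambda>h. (fst h, fst (snd h), fst (snd (snd h)), ?D (snd (snd (snd h))))"
    let ?y = "(transition k1 k1' ?r1, transition k2 k2' ?r2, transition k3 k3' ?r3, transition c d ?x)"
    \<comment> \<open>As for the circle, the transition is the identity in the three angle
      directions, and only \<open>?D\<close> acts on X.\<close>
    have m: "map q4 (map ?M ws) = map ?D (map q4 ws)" for ws :: "('e t3) list" by simp
    have "T3_alg (F c ?x []) (\<sigma> c ?x) (\<lambda>vs. Re (\<mu> c ?x vs)) (\<lambda>vs. Im (\<mu> c ?x vs)) vs =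
      T3_alg (F d (transition c d ?x) []) (\<sigma> d (transition c d ?x)) (\<lambda>vs. Re (\<mu> d (transition c d ?x) vs)) (\<lambda>vs. Im (\<mu> d (transition c d ?x) vs)) (map ?M vs)"
      by (simp only: T3_alg_def one_wedge_map one_form_map m e fst_conv snd_conv list.map(1))
    moreover have "T3_form A F \<sigma> \<mu> d7 ?y = T3_alg (F d (transition c d ?x) []) (\<sigma> d (transition c d ?x)) (\<lambda>vs. Re (\<mu> d (transition c d ?x) vs)) (\<lambda>vs. Im (\<mu> d (transition c d ?x) vs))"
      unfolding d7 using alg[OF k' d, of ?y] r1 r2 r3 x by simp
    moreover have "T3_form A F \<sigma> \<mu> c7 (?r1, ?r2, ?r3, ?x) = T3_alg (F c ?x []) (\<sigma> c ?x) (\<lambda>vs. Re (\<mu> c ?x vs)) (\<lambda>vs. Im (\<mu> c ?x vs))"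
      unfolding c7 using alg[OF k c, of "(?r1, ?r2, ?r3, ?x)"] r1 r2 r3 x by simp
    ultimately show "T3_form A F \<sigma> \<mu> c7 z vs = T3_form A F \<sigma> \<mu> d7 (transition c7 d7 z) (map (fd (transition c7 d7) z) vs)"
      unfolding zz unfolding c7 d7 frechet_eq[OF t(2)] t(1) by simp
  qed
qed

section \<open>The coflow on the torus product\<close>

context coflow begin

abbreviation "phi2 t \<equiv> T3_form A (Nf t) (pullback A (\<Theta> t) (fun_times (N t) (\<omega>t t))) (pullback A (\<Theta> t) (fun_divide \<Omega> (N t)))"

lemma phi2_in_chart:
  assumes n2: "CARD('n) = 2" and t: "0 \<le> t" and k: "k1 \<in> circle_atlas" "k2 \<in> circle_atlas" "k3 \<in> circle_atlas" and c: "c \<in> A"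
    and z: "z \<in> cimg k1 \<times> cimg k2 \<times> cimg k3 \<times> cimg c"
  shows "phi2 t (tchart k1 k2 k3 c) z = (\<lambda>vs. - Nf t c (q4 z) [] * one_wedge 2 fst (one_wedge 1 q2 (one_form q3)) vs
     + Nf t c (q4 z) [] * one_wedge 2 fst (\<lambda>ws. Wf t c (q4 z) (map q4 ws)) vs
     + one_wedge 2 q2 (\<lambda>ws. Re (Of t c (q4 z) (map q4 ws))) vs / Nf t c (q4 z) [] + one_wedge 2 q3 (\<lambda>ws. Im (Of t c (q4 z) (map q4 ws))) vs / Nf t c (q4 z) [])"
  unfolding pullback_fun_times pullback_fun_divide
    T3_form_alg[OF atlas compat_of[OF Nf_smooth[OF t]] moved_smooth(1)[OF t] moved_smooth(3,4)[OF t, unfolded n2] k c z] T3_alg_def[abs_def]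
  by (simp add: fun_times_def fun_divide_def one_wedge_cmult one_wedge_divide)

text \<open>Both parts of \<Omega> enter the first bracket of \<psi> and move with their Lie
  derivatives; the second bracket is built from the Kaehler form and moves with the opposite
  sign.\<close>

lemma T3_coflow_point:
  assumes n2: "CARD('n) = 2" and K: "\<kappa> > 0" "\<kappa> ^ 3 = 2" "K = \<kappa> * \<kappa>" and t: "0 \<le> t"
    and k: "k1 \<in> circle_atlas" "k2 \<in> circle_atlas" "k3 \<in> circle_atlas" and a: "a1 \<in> cimg k1" "a2 \<in> cimg k2" "a3 \<in> cimg k3" and c: "c \<in> A" "x \<in> cimg c"
  defines "\<psi> \<equiv> \<lambda>s (vs :: ((complex^'n) t3) list).
      K * (one_wedge 3 fst (one_wedge 2 q2 (\<lambda>ws. Im (Of s c x (map q4 ws)))) vs - one_wedge 3 fst (one_wedge 2 q3 (\<lambda>ws. Re (Of s c x (map q4 ws)))) vs)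
      + (1 / K\<^sup>2) * (one_wedge 3 q2 (one_wedge 2 q3 (\<lambda>ws. Wf s c x (map q4 ws))) vs
        - wedge22 (\<lambda>ws. Wf s c x (map q4 ws)) (\<lambda>ws. Wf s c x (map q4 ws)) vs / 2)"
    and "c7 \<equiv> tchart k1 k2 k3 c" and "z \<equiv> (a1, a2, a3, x)"
  shows "g2_dual (phi2 t) c7 z vs = \<psi> t vs"
    and "Z \<noteq> 0 \<Longrightarrow> \<exists>vs. wedge 4 3 (wedge 2 2 (interior_product Z (phi2 t c7 z)) (interior_product Z (phi2 t c7 z))) (phi2 t c7 z) vs \<noteq> 0" (is "_ \<Longrightarrow> ?positive")
    and "((\<lambda>s. \<psi> s vs) has_real_derivative g2_laplacian 4 (phi2 t) (g2_dual (phi2 t)) c7 z vs) (at t within {0..})" (is "?derivative")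
proof -
  obtain U Y where "local_flow t c x U Y" using flow_local[OF t c] by blast
  note lf = this[unfolded local_flow_def, THEN conjunct2, THEN conjunct2]
    and U = this[unfolded local_flow_def, THEN conjunct1] this[unfolded local_flow_def, THEN conjunct2, THEN conjunct1]
  note U = U lf[THEN conjunct1] and fl = lf[THEN conjunct2, THEN conjunct1]
  note lf = lf[THEN conjunct2, THEN conjunct2]
  note W = lf[THEN conjunct1] lf[THEN conjunct2, THEN conjunct1] lf[THEN conjunct2, THEN conjunct2, THEN conjunct1]
    and P = lf[THEN conjunct2, THEN conjunct2, THEN conjunct2]
  note PR = P[rule_format, OF bounded_linear_Re] and PI = P[rule_format, OF bounded_linear_Im]
  let ?R = "\<lambda>x vs. Re (Of t c x vs)" and ?I = "\<lambda>x vs. Im (Of t c x vs)" and ?F = "\<lambda>x. Nf t c x []"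
  note alt = smooth_form_linear[OF atlas bounded_linear_Re Of_smooth[OF t]] smooth_form_linear[OF atlas bounded_linear_Im Of_smooth[OF t]]
  interpret T3: T3_local K \<kappa> ?F "Wf t c" ?R ?I Y U
  proof
    fix x vs assume x: "x \<in> U"
    then have xc: "x \<in> cimg c" using U(3) by blast
    show "\<exists>us. length us = 4 \<and> spanning us \<and> has_table us 2 (\<lambda>vs. Wf t c x vs * (1 / K)) tab\<omega> \<and>
       has_table us 2 (\<lambda>vs. ?R x vs * (\<kappa> / ?F x)) tabRe2 \<and> has_table us 2 (\<lambda>vs. ?I x vs * (\<kappa> / ?F x)) tabIm2 \<and> Y x = grad_log ?F x us"
      by (rule in_flow_frame(3)[OF t fl[rule_format, OF x] n2 K])
    show "?F x > 0" by (rule Nf_pos[OF t c(1) xc])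
    show "?F differentiable at x" by (rule smooth_form_differentiable[OF Nf_smooth[OF t] c(1) xc])
    show "alt_form 2 (Wf t c x)" using Wf_smooth[OF t] c(1) xc unfolding smooth_form_def by blast
    show "alt_form 2 (?R x)" "alt_form 2 (?I x)" using alt c(1) xc n2 unfolding smooth_form_def by metis+
    show "(\<lambda>x. Wf t c x vs) differentiable at x" by (rule smooth_form_differentiable[OF Wf_smooth[OF t] c(1) xc])
    show "(\<lambda>x. ?R x vs) differentiable at x" "(\<lambda>x. ?I x vs) differentiable at x"
      by (rule smooth_form_differentiable[OF alt(1) c(1) xc] smooth_form_differentiable[OF alt(2) c(1) xc])+
    show "ext_deriv 2 (Wf t c) x vs = 0" using W(2) x by blast
    show "ext_deriv 2 ?R x vs = 0" "ext_deriv 2 ?I x vs = 0" using PR PI x n2 by metis+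
  qed (use n2 U(1) K in simp_all)
  let ?\<phi> = "\<lambda>z vs. - ?F (q4 z) * one_wedge 2 fst (one_wedge 1 q2 (one_form q3)) vs + ?F (q4 z) * one_wedge 2 fst (\<lambda>ws. Wf t c (q4 z) (map q4 ws)) vs
     + one_wedge 2 q2 (\<lambda>ws. ?R (q4 z) (map q4 ws)) vs / ?F (q4 z) + one_wedge 2 q3 (\<lambda>ws. ?I (q4 z) (map q4 ws)) vs / ?F (q4 z)"
  note eq = phi2_in_chart[OF n2 t k c(1)]
  have zx: "z \<in> cimg k1 \<times> cimg k2 \<times> cimg k3 \<times> cimg c" "q4 z = x" using a c by (simp_all add: z_def)
  note dl = T3.dual_and_laplacian[where \<phi> = ?\<phi> and ?y0.0 = z, OF U(2) PI[THEN conjunct1, rule_format] PR[THEN conjunct1, rule_format] W(1)[rule_format] refl zx(2)]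
  show "g2_dual (phi2 t) c7 z vs = \<psi> t vs"
    unfolding g2_dual_def c7_def eq[OF zx(1)] \<psi>_def by (rule dl(1))
  have e: "phi2 t c7 z = (\<lambda>vs. T3.P z vs / ?F (q4 z) + ?F (q4 z) * T3.Q z vs)"
    unfolding c7_def eq[OF zx(1)] by (simp add: T3.P_def T3.Q_def fun_eq_iff add_divide_distrib right_diff_distrib)
  show ?positive if Z: "Z \<noteq> 0"
  proof -
    obtain es where es: "g2_std es (\<lambda>vs. T3.P z vs / ?F (q4 z)) (\<lambda>vs. ?F (q4 z) * T3.Q z vs) (T3.A z) (T3.B z)"
      using T3.std[of z] U(2) zx(2) by auto
    have "DIM((complex^'n) t3) = 7" using n2 by simp
    from g2_std_positive[OF this _ e Z] es show ?thesis by blast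
  qed
  let ?dw = "\<lambda>ws. ext_deriv 1 (\<lambda>x vs. Wf t c x (Y x # vs)) x (map q4 ws)"
  have lap: "g2_laplacian 4 (phi2 t) (g2_dual (phi2 t)) c7 z vs =
      K * (one_wedge 3 fst (one_wedge 2 q2 (\<lambda>ws. ext_deriv 1 (\<lambda>x vs. ?I x (Y x # vs)) x (map q4 ws))) vs
         - one_wedge 3 fst (one_wedge 2 q3 (\<lambda>ws. ext_deriv 1 (\<lambda>x vs. ?R x (Y x # vs)) x (map q4 ws))) vs)
      - (1 / K\<^sup>2) * (one_wedge 3 q2 (one_wedge 2 q3 ?dw) vs - wedge22 ?dw (\<lambda>ws. Wf t c x (map q4 ws)) vs)"
    unfolding g2_laplacian_def dl(2)[symmetric]
  proof (rule hodge_laplacian_cong[of "cimg k1 \<times> cimg k2 \<times> cimg k3 \<times> cimg c"])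
    show "open (cimg k1 \<times> cimg k2 \<times> cimg k3 \<times> cimg c)" by (intro open_Times circle_chart(1) k atlas_chart(2)[OF atlas c(1)])
  qed (use zx eq in \<open>simp_all add: g2_dual_def c7_def\<close>)
  \<comment> \<open>The factor 2 from differentiating the square cancels the 1/2 in \<psi>. The
    minus sign of the Kaehler derivative then factors out of the bracket and becomes the sign of 1 /
    K^2 in the Laplacian.\<close>
  have "((\<lambda>s. \<psi> s vs) has_real_derivative
      K * (one_wedge 3 fst (one_wedge 2 q2 (\<lambda>ws. ext_deriv 1 (\<lambda>x vs. ?I x (Y x # vs)) x (map q4 ws))) vs
         - one_wedge 3 fst (one_wedge 2 q3 (\<lambda>ws. ext_deriv 1 (\<lambda>x vs. ?R x (Y x # vs)) x (map q4 ws))) vs)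
      + (1 / K\<^sup>2) * (one_wedge 3 q2 (one_wedge 2 q3 (\<lambda>ws. - ?dw ws)) vs - 2 * wedge22 (\<lambda>ws. - ?dw ws) (\<lambda>ws. Wf t c x (map q4 ws)) vs / 2)) (at t within {0..})"
    unfolding \<psi>_def
    by (intro DERIV_add DERIV_diff DERIV_cmult DERIV_cdivide has_real_derivative_one_wedge has_real_derivative_wedge22 W(3)[rule_format])
       (use PI PR n2 in simp_all)
  moreover have "wedge22 (\<lambda>ws. - \<alpha> ws) \<beta> vs = - wedge22 \<alpha> \<beta> vs" for \<alpha> \<beta> :: "((complex^'n) t3) list \<Rightarrow> real" by (simp add: wedge22_def)
  moreover have "one_wedge 3 q2 (one_wedge 2 q3 (\<lambda>ws. - ?dw ws)) vs = - one_wedge 3 q2 (one_wedge 2 q3 ?dw) vs"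
    unfolding one_wedge_uminus[abs_def] one_wedge_uminus ..
  ultimately show ?derivative
    unfolding lap by (simp add: algebra_simps)
qed

lemma T3_chart_cases:
  assumes "c7 \<in> T3_times A" "z \<in> cimg c7"
  obtains k1 k2 k3 c a1 a2 a3 x where "k1 \<in> circle_atlas" "k2 \<in> circle_atlas" "k3 \<in> circle_atlas" "a1 \<in> cimg k1" "a2 \<in> cimg k2" "a3 \<in> cimg k3"
    "c \<in> A" "x \<in> cimg c" "c7 = tchart k1 k2 k3 c" "z = (a1, a2, a3, x)"
proof -
  obtain k1 k2 k3 c where k: "k1 \<in> circle_atlas" "k2 \<in> circle_atlas" "k3 \<in> circle_atlas" "c \<in> A" "c7 = tchart k1 k2 k3 c"
    using assms(1) unfolding T3_times_tchart by blast
  obtain a1 a2 a3 x where z: "z = (a1, a2, a3, x)" by (cases z)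
  have "(a1, a2, a3, x) \<in> cimg k1 \<times> cimg k2 \<times> cimg k3 \<times> cimg c"
    using assms(2) unfolding k(5) z tchart_facts(2)[OF k(1-3) atlas_inj[OF atlas k(4)]] .
  then show thesis using that[OF k(1-3) _ _ _ k(4) _ k(5) z] by simp
qed

lemma T3_coflow:
  assumes n2: "CARD('n) = 2" and K: "\<kappa> > 0" "\<kappa> ^ 3 = 2" "K = \<kappa> * \<kappa>"
  shows "g2_laplacian_coflow (T3_times A) phi2"
  unfolding g2_laplacian_coflow_def
proof (intro conjI allI impI ballI)
  fix t :: real assume t: "0 \<le> t"
  show "g2_structure (T3_times A) (phi2 t)"
    unfolding g2_structure_def
  proof (intro conjI ballI allI impI)
    show "DIM((complex^'n) t3) = 7" using n2 by simp
    show "smooth_form (T3_times A) 3 (phi2 t)"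
      unfolding pullback_fun_times pullback_fun_divide
      by (rule T3_smooth_form[OF atlas Nf_smooth[OF t] moved_smooth(1)[OF t] moved_smooth(3,4)[OF t, unfolded n2]])
    fix c7 z and Z :: "(complex^'n) t3" assume "c7 \<in> T3_times A" "z \<in> cimg c7" and Z: "Z \<noteq> 0"
    then obtain k1 k2 k3 c a1 a2 a3 x where kc: "k1 \<in> circle_atlas" "k2 \<in> circle_atlas" "k3 \<in> circle_atlas" "a1 \<in> cimg k1" "a2 \<in> cimg k2" "a3 \<in> cimg k3"
      "c \<in> A" "x \<in> cimg c" "c7 = tchart k1 k2 k3 c" "z = (a1, a2, a3, x)" by (elim T3_chart_cases)
    show "\<exists>vs. wedge 4 3 (wedge 2 2 (interior_product Z (phi2 t c7 z)) (interior_product Z (phi2 t c7 z))) (phi2 t c7 z) vs \<noteq> 0"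
      unfolding kc(9,10) by (rule T3_coflow_point(2)[OF n2 K t kc(1-8) Z])
  qed
  fix c7 z vs assume "c7 \<in> T3_times A" "z \<in> cimg c7"
  then obtain k1 k2 k3 c a1 a2 a3 x where kc: "k1 \<in> circle_atlas" "k2 \<in> circle_atlas" "k3 \<in> circle_atlas" "a1 \<in> cimg k1" "a2 \<in> cimg k2" "a3 \<in> cimg k3"
    "c \<in> A" "x \<in> cimg c" "c7 = tchart k1 k2 k3 c" "z = (a1, a2, a3, x)" by (elim T3_chart_cases)
  show "((\<lambda>s. g2_dual (phi2 s) c7 z vs) has_real_derivative g2_laplacian 4 (phi2 t) (g2_dual (phi2 t)) c7 z vs) (at t within {0..})"
    unfolding kc(9,10)
    by (rule has_real_derivative_transform[OF _ _ T3_coflow_point(3)[OF n2 K t kc(1-8)]])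
       (use t T3_coflow_point(1)[OF n2 K _ kc(1-8)] in auto)
qed

lemma T3_initial:
  assumes n2: "CARD('n) = 2" and \<omega>: "kaehler_form A \<omega>"
  shows "form_eq (T3_times A) (phi2 0) (T3_form A nrm0 (fun_times nrm0 \<omega>) (fun_divide \<Omega> nrm0))"
  unfolding form_eq_def
proof (intro ballI)
  fix c7 z assume "c7 \<in> T3_times A" "z \<in> cimg c7"
  then obtain k1 k2 k3 c a1 a2 a3 x where kc: "k1 \<in> circle_atlas" "k2 \<in> circle_atlas" "k3 \<in> circle_atlas" "a1 \<in> cimg k1" "a2 \<in> cimg k2" "a3 \<in> cimg k3"
    "c \<in> A" "x \<in> cimg c" "c7 = tchart k1 k2 k3 c" "z = (a1, a2, a3, x)" by (elim T3_chart_cases)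
  have z: "(a1, a2, a3, x) \<in> cimg k1 \<times> cimg k2 \<times> cimg k3 \<times> cimg c" using kc by simp
  note i = initial_values[OF \<omega> kc(7,8)]
  note s = initial_smooth[OF \<omega>]
  have cr: "smooth_form A 2 (Re_form (fun_divide \<Omega> nrm0))" "smooth_form A 2 (Im_form (fun_divide \<Omega> nrm0))"
    unfolding Re_form_def Im_form_def
    using smooth_form_linear[OF atlas bounded_linear_Re s(2)] smooth_form_linear[OF atlas bounded_linear_Im s(2)] n2 by simp_all
  show "phi2 0 c7 z = T3_form A nrm0 (fun_times nrm0 \<omega>) (fun_divide \<Omega> nrm0) c7 z"
    unfolding kc(9,10) T3_form_alg[OF atlas compat_of[OF norm_smooth_form[OF A \<omega> \<Omega> n]] s(1) cr kc(1-3,7) z] phi2_in_chart[OF n2 order_refl kc(1-3,7) z] T3_alg_def[abs_def]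
    by (simp add: i fun_times_def fun_divide_def one_wedge_cmult one_wedge_divide)
qed

end

theorem mainTheorem4:
  fixes n :: nat and K :: real
    and A :: "('x::{t2_space, second_countable_topology}, complex^'n) chart set"
    and \<omega> :: "('x, complex^'n, real) form"
    and \<Omega> :: "('x, complex^'n, complex) form"
    and \<omega>t :: "real \<Rightarrow> ('x, complex^'n, real) form"
    and \<Theta> :: "real \<Rightarrow> 'x \<Rightarrow> 'x"
  assumes "n \<in> {2, 3}" and "CARD('n) = n"
    and "compact (UNIV :: 'x set)" and "complex_atlas A"
    and "kaehler_form A \<omega>" and "holomorphic_volume_form A \<Omega>"
    and "K = 2 powr (real n / 3)"
    and "kaehler_ricci_flow A K \<omega> \<omega>t"
    and "gradient_flow A K \<Omega> \<omega>t \<Theta>"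
  defines "N \<equiv> \<lambda>t. vol_norm \<Omega> (\<omega>t t)"
    and "N0 \<equiv> vol_norm \<Omega> \<omega>"
  defines "\<phi>2 \<equiv> \<lambda>t. T3_form A
                      (pullback A (\<Theta> t) (N t))
                      (pullback A (\<Theta> t) (fun_times (N t) (\<omega>t t)))
                      (pullback A (\<Theta> t) (fun_divide \<Omega> (N t)))"
    and "\<phi>3 \<equiv> \<lambda>t. S1_form A
                      (pullback A (\<Theta> t) (fun_times (N t) (\<omega>t t)))
                      (pullback A (\<Theta> t) (fun_divide \<Omega> (N t)))"
  shows "(n = 2 \<longrightarrow>
            g2_laplacian_coflow (T3_times A) \<phi>2 \<and>
            form_eq (T3_times A) (\<phi>2 0) (T3_form A N0 (fun_times N0 \<omega>) (fun_divide \<Omega> N0))) \<and>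
         (n = 3 \<longrightarrow>
            g2_laplacian_coflow (S1_times A) \<phi>3 \<and>
            form_eq (S1_times A) (\<phi>3 0) (S1_form A (fun_times N0 \<omega>) (fun_divide \<Omega> N0)))"
proof -
  interpret coflow A \<omega> \<Omega> \<omega>t \<Theta> K using assms by unfold_locales auto
  show ?thesis
  proof (intro conjI impI)
    assume n2: "n = 2"
    have c: "CARD('n) = 2" using assms(2) n2 by simp
    \<comment> \<open>The cube root of 2 is the stretching factor of the frame for n = 2, and its
      square is K = 2^(2/3).\<close>
    let ?k = "2 powr (1 / 3) :: real"
    have k: "?k > 0" "?k ^ 3 = 2" "K = ?k * ?k"
      using assms(7) n2 by (simp_all add: powr_power flip: powr_add)
    show "g2_laplacian_coflow (T3_times A) \<phi>2" unfolding \<phi>2_def N_def by (rule T3_coflow[OF c k])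
    show "form_eq (T3_times A) (\<phi>2 0) (T3_form A N0 (fun_times N0 \<omega>) (fun_divide \<Omega> N0))"
      unfolding \<phi>2_def N_def N0_def by (rule T3_initial[OF c assms(5)])
  next
    assume n3: "n = 3"
    have c: "CARD('n) = 3" "K = 2" using assms(2,7) n3 by simp_all
    show "g2_laplacian_coflow (S1_times A) \<phi>3" unfolding \<phi>3_def N_def by (rule S1_coflow[OF c])
    show "form_eq (S1_times A) (\<phi>3 0) (S1_form A (fun_times N0 \<omega>) (fun_divide \<Omega> N0))"
      unfolding \<phi>3_def N_def N0_def by (rule S1_initial[OF c(1) assms(5)])
  qed
qed

end
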